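(* Assume $m_B,m_E>0$ are not integers. Let $$I_1=\int_0^\infty\ln(1+\gamma)f_B(\gamma)F_E(\gamma)\,d\gamma,\qquad I_2=\int_0^\infty\ln(1+\gamma)f_E(\gamma)F_B(\gamma)\,d\gamma .$$ Then $I_1=\sum_{i=1}^2\sum_{j=1}^2R_{i,j}$ and $I_2=\sum_{i=1}^2\sum_{j=1}^2T_{i,j}$, where $$R_{i,j}=Q_{B,i}Q_{E,j}\,\frac{\bar\gamma_B(1+\bar K_E)}{\bar\gamma_E(1+\bar K_B)}\Big(\frac{m_E}{m_E+K_{E,j}}\Big)^{m_E}\Big(\frac{m_B}{m_B+K_{B,i}}\Big)^{m_B-2}\frac{1}{\Gamma(1-m_B)\Gamma(1-m_E)\Gamma(m_E)}\;H^{0,1:1,1;1,1;1,1;1,2}_{1,3:1,1;1,1;1,1;2,1}\big[x_1,x_2,x_3,x_4\big],$$ with arguments $$x_1=\frac{\bar\gamma_B(m_B+K_{B,i})(1+\bar K_E)}{\bar\gamma_E m_B(1+\bar K_B)},\quad x_2=\frac{\bar\gamma_B m_E(m_B+K_{B,i})(1+\bar K_E)}{\bar\gamma_E m_B(m_E+K_{E,j})(1+\bar K_B)},\quad x_3=\frac{K_{B,i}}{m_B},\quad x_4=\frac{\bar\gamma_B(m_B+K_{B,i})}{m_B(1+\bar K_B)},$$ and parameters (in the notation of the context): upper joint list $(-1;1,1,1,1)$; lower joint list $(-1;1,1,0,0),(0;0,0,1,0),(0;0,0,0,1)$; for variable 1: $c=(m_E,1)$, $d=(0,1)$; variable 2: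 $c=(1-m_E,1)$, $d=(0,1)$; variable 3: $c=(m_B,1)$, $d=(0,1)$; variable 4: $c=(1,1),(1,1)$, $d=(1,1)$. Finally $T_{i,j}$ is the expression obtained from $R_{i,j}$ by interchanging the labels $B$ and $E$ everywhere (so $T_{i,j}$ carries the factor $Q_{E,i}Q_{B,j}$, $K_{E,i}$, $K_{B,j}$, etc.).
   Context: Setting. For each $\ell\in\{B,E\}$ (legitimate receiver $B$, eavesdropper $E$) fix parameters $p_\ell\in[0,1]$, $m_\ell>0$, $K_{\ell,1},K_{\ell,2}>0$ and $\bar\gamma_\ell>0$; put $\bar K_\ell=p_\ell K_{\ell,1}+(1-p_\ell)K_{\ell,2}$, $Q_{\ell,1}=p_\ell$, $Q_{\ell,2}=1-p_\ell$. For $r\in\{1,2\}$ and $\gamma\ge0$ let $f_{RS,\ell,r}(\gamma)=\frac{1+\bar K_\ell}{\bar\gamma_\ell}\big(\frac{m_\ell}{m_\ell+K_{\ell,r}}\big)^{m_\ell}\exp\big(-\frac{(1+\bar K_\ell)\gamma}{\bar\gamma_\ell}\big)\,{}_1F_1\big(m_\ell;1;\frac{K_{\ell,r}(1+\bar K_\ell)\gamma}{\bar\gamma_\ell(m_\ell+K_{\ell,r})}\big)$ and $F_{RS,\ell,r}(\gamma)=\int_0^\gamma f_{RS,\ell,r}(t)\,dt$, where ${}_1F_1$ is Kummer's confluent hypergeometric function. The Alternate Rician Shadowed (ARS) SNR $\gamma_\ell$ has density $f_\ell=Q_{\ell,1}f_{RS,\ell,1}+Q_{\ell,2}f_{RS,\ell,2}$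 and CDF $F_\ell=Q_{\ell,1}F_{RS,\ell,1}+Q_{\ell,2}F_{RS,\ell,2}$ on $[0,\infty)$; $\gamma_B,\gamma_E$ are independent. Multivariate Fox H-function: $H^{0,n:m_1,n_1;\dots;m_L,n_L}_{p,q:p_1,q_1;\dots;p_L,q_L}[x_1,\dots,x_L]$ with upper joint list $(a_j;\alpha^{(1)}_j,\dots,\alpha^{(L)}_j)_{j=1}^p$, lower joint list $(b_j;\beta^{(1)}_j,\dots,\beta^{(L)}_j)_{j=1}^q$, and for each variable $i$ upper list $(c^{(i)}_j,\gamma^{(i)}_j)_{j=1}^{p_i}$ and lower list $(d^{(i)}_j,\delta^{(i)}_j)_{j=1}^{q_i}$, is $\frac{1}{(2\pi i)^L}\int_{\mathcal L_1}\cdots\int_{\mathcal L_L}\psi(s_1,\dots,s_L)\prod_{i=1}^L\phi_i(s_i)x_i^{s_i}\,ds_1\cdots ds_L$, where $\psi=\frac{\prod_{j=1}^{n}\Gamma(1-a_j+\sum_i\alpha^{(i)}_js_i)}{\prod_{j=n+1}^{p}\Gamma(a_j-\sum_i\alpha^{(i)}_js_i)\prod_{j=1}^{q}\Gamma(1-b_j+\sum_i\beta^{(i)}_js_i)}$ and $\phi_i=\frac{\prod_{j=1}^{m_i}\Gamma(d^{(i)}_j-\delta^{(i)}_js_i)\prod_{j=1}^{n_i}\Gamma(1-c^{(i)}_j+\gamma^{(i)}_js_i)}{\prod_{j=m_i+1}^{q_i}\Gamma(1-d^{(i)}_j+\delta^{(i)}_js_i)\prod_{j=n_i+1}^{p_i}\Gamma(c^{(i)}_j-\gamma^{(i)}_js_i)}$,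 the $\mathcal L_i$ being Mellin–Barnes contours separating the poles of the $\Gamma(d-\delta s)$ factors from those of the $\Gamma(1-c+\gamma s)$ factors and of the numerator of $\psi$. *)

theory Defs
  imports "HOL-Complex_Analysis.Complex_Analysis"
begin

definition hyp1F1 :: "real \<Rightarrow> real \<Rightarrow> real \<Rightarrow> real" where
  "hyp1F1 a b z = (\<Sum>k. pochhammer a k / pochhammer b k * z ^ k / fact k)"

definition Kbar :: "real \<Rightarrow> real \<Rightarrow> real \<Rightarrow> real" where
  "Kbar p K1 K2 = p * K1 + (1 - p) * K2"

definition Qw :: "real \<Rightarrow> nat \<Rightarrow> real" where
  "Qw p r = (if r = 1 then p else 1 - p)"

definition Kr :: "real \<Rightarrow> real \<Rightarrow> nat \<Rightarrow> real" where
  "Kr K1 K2 r = (if r = 1 then K1 else K2)"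

definition fRS :: "real \<Rightarrow> real \<Rightarrow> real \<Rightarrow> real \<Rightarrow> real \<Rightarrow> nat \<Rightarrow> real \<Rightarrow> real" where
  "fRS p m K1 K2 gb r g =
     (let Kb = Kbar p K1 K2; K = Kr K1 K2 r in
      (1 + Kb) / gb * (m / (m + K)) powr m * exp (- ((1 + Kb) * g / gb))
        * hyp1F1 m 1 (K * (1 + Kb) * g / (gb * (m + K))))"

definition FRS :: "real \<Rightarrow> real \<Rightarrow> real \<Rightarrow> real \<Rightarrow> real \<Rightarrow> nat \<Rightarrow> real \<Rightarrow> real" where
  "FRS p m K1 K2 gb r g = (LINT t:{0..g}|lborel. fRS p m K1 K2 gb r t)"

definition fARS :: "real \<Rightarrow> real \<Rightarrow> real \<Rightarrow> real \<Rightarrow> real \<Rightarrow> real \<Rightarrow> real" where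
  "fARS p m K1 K2 gb g = Qw p 1 * fRS p m K1 K2 gb 1 g + Qw p 2 * fRS p m K1 K2 gb 2 g"

definition FARS :: "real \<Rightarrow> real \<Rightarrow> real \<Rightarrow> real \<Rightarrow> real \<Rightarrow> real \<Rightarrow> real" where
  "FARS p m K1 K2 gb g = Qw p 1 * FRS p m K1 K2 gb 1 g + Qw p 2 * FRS p m K1 K2 gb 2 g"

text \<open>Joint lists: entries (a_j, [alpha_j^(1), ..., alpha_j^(L)]).
  Variable data: (m_i, n_i, [(c_j, gamma_j)], [(d_j, delta_j)]).\<close>

definition lincomb :: "real list \<Rightarrow> (nat \<Rightarrow> complex) \<Rightarrow> complex" where
  "lincomb al s = (\<Sum>i<length al. complex_of_real (al ! i) * s i)"

definition mfox_psi ::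
  "nat \<Rightarrow> (real \<times> real list) list \<Rightarrow> (real \<times> real list) list \<Rightarrow> (nat \<Rightarrow> complex) \<Rightarrow> complex" where
  "mfox_psi n A B s =
     (\<Prod>j<n. Gamma (1 - of_real (fst (A ! j)) + lincomb (snd (A ! j)) s))
   * (\<Prod>j\<in>{n..<length A}. rGamma (of_real (fst (A ! j)) - lincomb (snd (A ! j)) s))
   * (\<Prod>j<length B. rGamma (1 - of_real (fst (B ! j)) + lincomb (snd (B ! j)) s))"

definition mfox_phi ::
  "nat \<times> nat \<times> (real \<times> real) list \<times> (real \<times> real) list \<Rightarrow> complex \<Rightarrow> complex" where
  "mfox_phi v z = (case v of (m, n, C, D) \<Rightarrow>
       (\<Prod>j<m. Gamma (of_real (fst (D ! j)) - of_real (snd (D ! j)) * z))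
     * (\<Prod>j<n. Gamma (1 - of_real (fst (C ! j)) + of_real (snd (C ! j)) * z))
     * (\<Prod>j\<in>{m..<length D}. rGamma (1 - of_real (fst (D ! j)) + of_real (snd (D ! j)) * z))
     * (\<Prod>j\<in>{n..<length C}. rGamma (of_real (fst (C ! j)) - of_real (snd (C ! j)) * z)))"

text \<open>Poles of the Gamma(d - delta s) factors (to lie to the right of the contour)
  and of the Gamma(1 - c + gamma s) factors (to lie to the left).\<close>
definition right_poles :: "nat \<times> nat \<times> (real \<times> real) list \<times> (real \<times> real) list \<Rightarrow> complex set" where
  "right_poles v = (case v of (m, n, C, D) \<Rightarrow>
     {of_real ((fst (D ! j) + real k) / snd (D ! j)) | j k. j < m})"

definition left_poles :: "nat \<times> nat \<times> (real \<times> real) list \<times> (real \<times> real) list \<Rightarrow> complex set" where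
  "left_poles v = (case v of (m, n, C, D) \<Rightarrow>
     {of_real ((fst (C ! j) - 1 - real k) / snd (C ! j)) | j k. j < n})"

definition mb_contour :: "(real \<Rightarrow> complex) \<Rightarrow> bool" where
  "mb_contour g \<longleftrightarrow> g C1_differentiable_on UNIV \<and>
     (\<exists>c T. \<forall>t. \<bar>t\<bar> \<ge> T \<longrightarrow> g t = complex_of_real c + \<i> * complex_of_real t)"

text \<open>Closing the piece g|[-R,R] by the left half circle from g R back to g (-R).\<close>
definition mb_loop :: "(real \<Rightarrow> complex) \<Rightarrow> real \<Rightarrow> real \<Rightarrow> complex" where
  "mb_loop g R = (let ctr = (g R + g (-R)) / 2 in
     (\<lambda>u. g (- R + 2 * R * u)) +++ (\<lambda>u. ctr + (g R - ctr) * exp (\<i> * of_real (pi * u))))"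

definition left_of :: "(real \<Rightarrow> complex) \<Rightarrow> complex \<Rightarrow> bool" where
  "left_of g z \<longleftrightarrow> z \<notin> range g \<and> (\<forall>\<^sub>F R in at_top. winding_number (mb_loop g R) z = 1)"

definition right_of :: "(real \<Rightarrow> complex) \<Rightarrow> complex \<Rightarrow> bool" where
  "right_of g z \<longleftrightarrow> z \<notin> range g \<and> (\<forall>\<^sub>F R in at_top. winding_number (mb_loop g R) z = 0)"

text \<open>Admissible contours: g i separates the poles of the Gamma(d - delta s_i) factors
  (right) from those of the Gamma(1 - c + gamma s_i) factors and of the numerator of psi
  (left; for the latter, with the other variables fixed on their contours).\<close>
definition mfox_admissible ::
  "nat \<Rightarrow> (real \<times> real list) list \<Rightarrow> (nat \<times> nat \<times> (real \<times> real) list \<times> (real \<times> real) list) list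
    \<Rightarrow> (nat \<Rightarrow> real \<Rightarrow> complex) \<Rightarrow> bool" where
  "mfox_admissible n A V g \<longleftrightarrow>
     (\<forall>i<length V. mb_contour (g i)
        \<and> (\<forall>z\<in>right_poles (V ! i). right_of (g i) z)
        \<and> (\<forall>z\<in>left_poles (V ! i). left_of (g i) z))
   \<and> (\<forall>t :: nat \<Rightarrow> real. \<forall>i<length V. \<forall>j<n. \<forall>k :: nat.
        snd (A ! j) ! i \<noteq> 0 \<longrightarrow>
        left_of (g i)
          ((of_real (fst (A ! j)) - 1 - of_nat k
             - (\<Sum>i'\<in>{..<length V} - {i}. of_real (snd (A ! j) ! i') * g i' (t i')))
           / of_real (snd (A ! j) ! i)))"

definition mfoxH ::
  "nat \<Rightarrow> (real \<times> real list) list \<Rightarrow> (real \<times> real list) list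
    \<Rightarrow> (nat \<times> nat \<times> (real \<times> real) list \<times> (real \<times> real) list) list \<Rightarrow> real list \<Rightarrow> complex" where
  "mfoxH n A B V x =
     (let L = length V; g = (SOME g. mfox_admissible n A V g) in
      1 / (2 * pi * \<i>) ^ L *
      (\<integral>t. mfox_psi n A B (\<lambda>i. g i (t i))
            * (\<Prod>i<L. mfox_phi (V ! i) (g i (t i)) * complex_of_real (x ! i) powr (g i (t i))
                      * vector_derivative (g i) (at (t i)))
        \<partial>(PiM {..<L} (\<lambda>_. lborel))))"

text \<open>Rterm with arguments for the first label (B) then the second label (E);
  T_{i,j} is obtained by swapping the two argument blocks.\<close>
definition Rterm :: "real \<Rightarrow> real \<Rightarrow> real \<Rightarrow> real \<Rightarrow> real \<Rightarrow>
                     real \<Rightarrow> real \<Rightarrow> real \<Rightarrow> real \<Rightarrow> real \<Rightarrow> nat \<Rightarrow> nat \<Rightarrow> complex" where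
  "Rterm pB mB KB1 KB2 gB pE mE KE1 KE2 gE i j =
    (let KbB = Kbar pB KB1 KB2; KbE = Kbar pE KE1 KE2;
         KBi = Kr KB1 KB2 i; KEj = Kr KE1 KE2 j;
         x1 = gB * (mB + KBi) * (1 + KbE) / (gE * mB * (1 + KbB));
         x2 = gB * mE * (mB + KBi) * (1 + KbE) / (gE * mB * (mE + KEj) * (1 + KbB));
         x3 = KBi / mB;
         x4 = gB * (mB + KBi) / (mB * (1 + KbB));
         A = [(-1, [1, 1, 1, 1])];
         B = [(-1, [1, 1, 0, 0]), (0, [0, 0, 1, 0]), (0, [0, 0, 0, 1])];
         V = [(1, 1, [(mE, 1)], [(0, 1)]),
              (1, 1, [(1 - mE, 1)], [(0, 1)]),
              (1, 1, [(mB, 1)], [(0, 1)]),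
              (1, 2, [(1, 1), (1, 1)], [(1, 1)])]
     in complex_of_real
          (Qw pB i * Qw pE j * (gB * (1 + KbE)) / (gE * (1 + KbB))
           * (mE / (mE + KEj)) powr mE * (mB / (mB + KBi)) powr (mB - 2)
           / (Gamma (1 - mB) * Gamma (1 - mE) * Gamma mE))
        * mfoxH 1 A B V [x1, x2, x3, x4])"

end

theory Submission
  imports Defs
begin

text \<open>
  The Fox function is defined by an arbitrary admissible family of contours. Each of the contours
  of the first three variables is moved to a line \<open>Re s = N + 1/2\<close>, picking up the residues of
  \<open>\<Gamma>(-s)\<close> at \<open>0, \<dots>, N\<close>, and the fourth one to \<open>Re s = 1/2\<close>. No pole of \<open>\<Gamma>(2 + \<Sum>s\<^sub>i)\<close> is crossed:
  because \<open>0\<close> lies to the right of each of the first three contours, the condition that the sum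
  avoids \<open>-2, -3, \<dots>\<close> passes from a family of contours to its subfamilies. On the new contours
  \<open>Re (2 + \<Sum>s\<^sub>i) > 0\<close>, so that \<open>\<Gamma>(2 + \<Sum>s\<^sub>i)\<close> is an Euler integral over \<open>y > 0\<close>; by Fubini the
  inner integrals separate into \<open>ln (1 + x\<^sub>4 y)\<close>, the Kummer-transformed series of the density, and the
  double series in \<open>x\<^sub>1 y, x\<^sub>2 y\<close> (coupled by \<open>1 / \<Gamma>(2 + s\<^sub>1 + s\<^sub>2)\<close>) of the distribution function.
  Substituting \<open>\<gamma> = x\<^sub>4 y\<close> gives the capacity integral.

  Since the Gamma parameters may be any non-integers, the poles to be separated can interlace.
  Admissible contours are obtained from a vertical line by attaching circles through its real
  point, each changing the winding numbers by \<open>\<plusminus>1\<close> on the interval that it encloses.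
\<close>

section \<open>Bounds for the Gamma function on vertical strips\<close>

text \<open>Two obstacles shape the proof. The contours come from a choice operator and may cross
  themselves, and their sides are defined by winding numbers of closed-up loops. Sides are therefore
  traded for limits of the symmetric integrals of 1 / (s - z), which simply add up along
  concatenated paths. Secondly, all integrability rests on a tight budget: \<open>Gamma\<close> is
  shown to decay like exp (- 5/4 |Im s|) and \<open>rGamma\<close> to grow at most like exp (9/4 |Im
  s|), so that \<open>Gamma (- s) * Gamma (a + s)\<close> beats one \<open>rGamma\<close> by a
  margin of 1/4. The target line must lie far to the right because of the joint Gamma factor. If
  some moved variable is on Re s = N + 1/2, it outweighs the real parts of all contours not yet
  moved. If all moved variables sit at residue points, their sum is a natural number n and only
  translates the pole condition from - 2 - k to - 2 - (n + k). Either way the poles stay left of the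
  contour that is moved next.\<close>

lemma norm_Gamma_ratio_mono:
  fixes x x' y :: real
  assumes "0 < x" "x \<le> x'"
  shows "norm (Gamma (Complex x y)) * Gamma x' \<le> norm (Gamma (Complex x' y)) * Gamma x"
proof -
  have seq: "norm (Gamma_series (Complex x y) n) * Gamma_series x' n
        \<le> norm (Gamma_series (Complex x' y) n) * Gamma_series x n" if "n > 0" for n
  proof -
    define p q P Q where "p = pochhammer x (n+1)" and "q = pochhammer x' (n+1)"
      and "P = norm (pochhammer (Complex x y) (n+1))" and "Q = norm (pochhammer (Complex x' y) (n+1))"
    have pos: "p > 0" "q > 0" using assms by (auto simp: p_def q_def intro!: pochhammer_pos)
    have "P \<noteq> 0" "Q \<noteq> 0"
      using assms unfolding P_def Q_def norm_eq_zero pochhammer_eq_0_iff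
      by (auto simp: complex_eq_iff)
    hence pos': "P > 0" "Q > 0" by (auto simp: P_def Q_def)
    \<comment> \<open>Factor by factor in the Gauss product: (x + k) / |x + k + iy| increases with
      x. The powers of n cancel, since their moduli depend on the real part of the exponent
      only.\<close>
    have "p * Q \<le> q * P"
    proof -
      have "(\<Prod>k=0..<n+1. (x + real k) * norm (Complex x' y + of_nat k)) \<le>
            (\<Prod>k=0..<n+1. (x' + real k) * norm (Complex x y + of_nat k))"
      proof (intro prod_mono conjI)
        fix k
        define u u' where "u = x + real k" and "u' = x' + real k"
        have u: "0 < u" "u \<le> u'" using assms by (auto simp: u_def u'_def)
        have "(u * sqrt (u'\<^sup>2 + y\<^sup>2))\<^sup>2 \<le> (u' * sqrt (u\<^sup>2 + y\<^sup>2))\<^sup>2"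
        proof -
          have "u\<^sup>2 * y\<^sup>2 \<le> u'\<^sup>2 * y\<^sup>2" using u by (intro mult_right_mono power_mono) auto
          thus ?thesis by (simp add: power_mult_distrib algebra_simps)
        qed
        hence "u * sqrt (u'\<^sup>2 + y\<^sup>2) \<le> u' * sqrt (u\<^sup>2 + y\<^sup>2)"
          by (rule power2_le_imp_le) (use u in simp)
        thus "(x + real k) * norm (Complex x' y + of_nat k) \<le> (x' + real k) * norm (Complex x y + of_nat k)"
          by (simp add: cmod_def u_def u'_def)
      qed (use assms in auto)
      thus ?thesis
        by (simp add: p_def q_def P_def Q_def pochhammer_prod prod.distrib norm_mult flip: prod_norm)
    qed
    hence "1 / (P * q) \<le> 1 / (Q * p)" using pos pos' by (simp add: field_simps)
    hence "(fact n * exp (x * ln n)) * (fact n * exp (x' * ln n)) * (1 / (P * q)) \<le>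
           (fact n * exp (x * ln n)) * (fact n * exp (x' * ln n)) * (1 / (Q * p))"
      by (intro mult_left_mono) auto
    moreover have "norm (exp (Complex a y * complex_of_real (ln (real n)))) = exp (a * ln n)" for a
      by simp
    ultimately show ?thesis
      unfolding Gamma_series_def p_def[symmetric] q_def[symmetric] norm_divide norm_mult
        P_def[symmetric] Q_def[symmetric]
      using that by (simp add: field_simps del: norm_exp_eq_Re)
  qed
  show ?thesis
  proof (rule tendsto_le[OF sequentially_bot])
    show "(\<lambda>n. norm (Gamma_series (Complex x' y) n) * Gamma_series x n) \<longlonglongrightarrow> norm (Gamma (Complex x' y)) * Gamma x"
      by (intro tendsto_intros)
    show "(\<lambda>n. norm (Gamma_series (Complex x y) n) * Gamma_series x' n) \<longlonglongrightarrow> norm (Gamma (Complex x y)) * Gamma x'"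
      by (intro tendsto_intros)
    show "\<forall>\<^sub>F n in sequentially. norm (Gamma_series (Complex x y) n) * Gamma_series x' n
        \<le> norm (Gamma_series (Complex x' y) n) * Gamma_series x n"
      using seq by (auto intro: eventually_mono[OF eventually_gt_at_top[of 0]])
  qed
qed

text \<open>On this line the conjugate of z is 1 - z, so the reflection formula gives the modulus
  exactly. This anchors all the strip estimates.\<close>

lemma norm_Gamma_half: "(norm (Gamma (Complex (1/2) y)))\<^sup>2 = pi / cosh (pi * y)"
proof -
  let ?z = "Complex (1/2) y"
  have "cnj ?z = 1 - ?z" by (simp add: complex_eq_iff)
  hence "Gamma ?z * cnj (Gamma ?z) = Gamma ?z * Gamma (1 - ?z)" by (simp add: cnj_Gamma)
  also have "\<dots> = of_real pi / sin (of_real pi * ?z)" by (rule Gamma_reflection_complex)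
  also have "sin (of_real pi * ?z) = cos (\<i> * of_real (pi * y))"
  proof -
    have "of_real pi * ?z = of_real pi / 2 + \<i> * of_real (pi * y)" by (simp add: complex_eq_iff)
    thus ?thesis by (simp add: sin_add cos_of_real sin_of_real flip: of_real_divide)
  qed
  also have "cos (\<i> * of_real (pi * y)) = of_real (cosh (pi * y))"
    by (simp add: cosh_field_def cos_exp_eq exp_minus mult_ac add_ac flip: exp_of_real of_real_mult)
  finally have "complex_of_real ((norm (Gamma ?z))\<^sup>2) = of_real (pi / cosh (pi * y))"
    by (simp add: complex_norm_square del: of_real_power)
  thus ?thesis by (simp only: of_real_eq_iff)
qed

text \<open>The rates 3/2 and 2 are half of 3 < pi and of 4 > pi; rational exponents keep the later
  bookkeeping simple.\<close>

lemma norm_Gamma_half_bounds: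
  "norm (Gamma (Complex (1/2) y)) \<le> 4 * exp (- (3/2) * \<bar>y\<bar>)"
  "norm (rGamma (Complex (1/2) y)) \<le> exp (2 * \<bar>y\<bar>)"
proof -
  have cosh_ge: "cosh (pi * y) \<ge> exp (3 * \<bar>y\<bar>) / 2"
  proof -
    have "exp (3 * \<bar>y\<bar>) / 2 \<le> exp (pi * \<bar>y\<bar>) / 2" using pi_gt3 by (auto intro!: mult_right_mono)
    also have "\<dots> \<le> cosh (pi * \<bar>y\<bar>)" by (simp add: cosh_field_def)
    also have "\<dots> = cosh (pi * y)" by (cases "y \<ge> 0") auto
    finally show ?thesis .
  qed
  have cosh_le: "cosh (pi * y) \<le> exp (4 * \<bar>y\<bar>)"
  proof -
    have "cosh (pi * y) = cosh (pi * \<bar>y\<bar>)" by (cases "y \<ge> 0") auto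
    also have "\<dots> \<le> exp (pi * \<bar>y\<bar>)" by (simp add: cosh_field_def)
    also have "\<dots> \<le> exp (4 * \<bar>y\<bar>)" using pi_less_4 by (auto intro!: mult_right_mono)
    finally show ?thesis .
  qed
  show "norm (Gamma (Complex (1/2) y)) \<le> 4 * exp (- (3/2) * \<bar>y\<bar>)"
  proof (rule power2_le_imp_le)
    have "(norm (Gamma (Complex (1/2) y)))\<^sup>2 \<le> pi / (exp (3 * \<bar>y\<bar>) / 2)"
      unfolding norm_Gamma_half using cosh_ge by (intro divide_left_mono) auto
    also have "\<dots> = 2 * pi * exp (- 3 * \<bar>y\<bar>)" by (simp add: exp_minus field_simps)
    also have "\<dots> \<le> 16 * exp (- 3 * \<bar>y\<bar>)" using pi_less_4 by (intro mult_right_mono) auto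
    also have "\<dots> = (4 * exp (- (3/2) * \<bar>y\<bar>))\<^sup>2"
      by (simp add: power_mult_distrib flip: exp_of_nat_mult)
    finally show "(norm (Gamma (Complex (1/2) y)))\<^sup>2 \<le> (4 * exp (- (3/2) * \<bar>y\<bar>))\<^sup>2" .
  qed auto
  show "norm (rGamma (Complex (1/2) y)) \<le> exp (2 * \<bar>y\<bar>)"
  proof (rule power2_le_imp_le)
    have "(norm (rGamma (Complex (1/2) y)))\<^sup>2 = 1 / (norm (Gamma (Complex (1/2) y)))\<^sup>2"
      by (simp add: Gamma_def norm_inverse norm_divide power_divide inverse_eq_divide)
    also have "\<dots> = cosh (pi * y) / pi" by (simp add: norm_Gamma_half)
    also have "\<dots> \<le> exp (4 * \<bar>y\<bar>) / 1"
      using cosh_le pi_gt3 by (intro frac_le) auto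
    also have "\<dots> = (exp (2 * \<bar>y\<bar>))\<^sup>2" by (simp flip: exp_of_nat_mult)
    finally show "(norm (rGamma (Complex (1/2) y)))\<^sup>2 \<le> (exp (2 * \<bar>y\<bar>))\<^sup>2" .
  qed auto
qed

text \<open>A polynomial factor is absorbed at the price of 1/4 in the exponent: in the two strip
  bounds this turns 3/2 into 5/4 and 2 into 9/4.\<close>

lemma norm_pochhammer_strip_bound:
  fixes M :: real
  assumes "M > 0"
  shows "\<exists>A>0. \<forall>s. \<bar>Re s\<bar> \<le> M \<longrightarrow> norm (pochhammer s n :: complex) \<le> A * exp (\<bar>Im s\<bar> / 4)"
proof (cases "n = 0")
  case True
  thus ?thesis by (auto intro!: exI[of _ 1])
next
  case False
  define D where "D = M + real n"
  define A where "A = (4 * real n) ^ n * exp (D / 4)"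
  have "norm (pochhammer s n) \<le> A * exp (\<bar>Im s\<bar> / 4)" if "\<bar>Re s\<bar> \<le> M" for s :: complex
  proof -
    have "norm (pochhammer s n) = (\<Prod>k=0..<n. norm (s + of_nat k))"
      by (simp add: pochhammer_prod flip: prod_norm)
    also have "\<dots> \<le> (\<Prod>k=0..<n. D + \<bar>Im s\<bar>)"
    proof (intro prod_mono conjI)
      fix k assume k: "k \<in> {0..<n}"
      have "norm (s + of_nat k) \<le> norm s + real k" by (metis norm_of_nat norm_triangle_ineq)
      also have "norm s \<le> \<bar>Re s\<bar> + \<bar>Im s\<bar>" by (rule cmod_le)
      finally show "norm (s + of_nat k) \<le> D + \<bar>Im s\<bar>" using k that by (auto simp: D_def)
    qed auto
    also have "\<dots> = (D + \<bar>Im s\<bar>) ^ n" by simp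
    \<comment> \<open>Dividing by 4 n first makes the n-th power of the exponential cost exactly a
      quarter of |Im s|.\<close>
    also have "\<dots> = (4 * real n) ^ n * ((D + \<bar>Im s\<bar>) / (4 * real n)) ^ n"
      using False by (subst power_mult_distrib[symmetric]) simp
    also have "\<dots> \<le> (4 * real n) ^ n * (exp ((D + \<bar>Im s\<bar>) / (4 * real n))) ^ n"
      using assms False by (intro mult_left_mono power_mono)
        (auto simp: D_def intro: order_trans[OF _ exp_ge_add_one_self])
    also have "(exp ((D + \<bar>Im s\<bar>) / (4 * real n))) ^ n = exp ((D + \<bar>Im s\<bar>) / 4)"
      using False by (simp flip: exp_of_nat_mult)
    also have "\<dots> = exp (D / 4) * exp (\<bar>Im s\<bar> / 4)" by (simp add: exp_add add_divide_distrib)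
    finally show ?thesis by (simp add: A_def mult_ac)
  qed
  moreover have "A > 0" using False by (simp add: A_def)
  ultimately show ?thesis by blast
qed

text \<open>For |Im s| >= 1 every factor of the Pochhammer symbol has modulus at least 1, so a shift
  by n only increases |Gamma|. The monotone ratio then raises the abscissa to m + 1/2, an integer
  distance from the line Re s = 1/2 on which the modulus is known.\<close>

lemma Gamma_strip_bound:
  fixes M :: real
  shows "\<exists>A>0. \<forall>s. \<bar>Re s\<bar> \<le> M \<and> \<bar>Im s\<bar> \<ge> 1 \<longrightarrow> norm (Gamma s :: complex) \<le> A * exp (- (5/4) * \<bar>Im s\<bar>)"
proof -
  define n where "n = nat \<lceil>\<bar>M\<bar>\<rceil> + 1"
  have n: "real n \<ge> \<bar>M\<bar> + 1" unfolding n_def by linarith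
  define m where "m = 2 * n"
  have cont: "continuous_on {1..real m} (Gamma :: real \<Rightarrow> real)"
    by (intro continuous_intros) (auto elim!: nonpos_Ints_cases)
  have "compact (Gamma ` {1..real m})" by (rule compact_continuous_image[OF cont]) auto
  then obtain B where B: "B > 0" "\<And>x. x \<in> {1..real m} \<Longrightarrow> norm (Gamma x) \<le> B"
    using bounded_pos[of "Gamma ` {1..real m}"] compact_imp_bounded by blast
  obtain A where A: "A > 0" "\<And>s. \<bar>Re s\<bar> \<le> 1 \<Longrightarrow> norm (pochhammer s m :: complex) \<le> A * exp (\<bar>Im s\<bar> / 4)"
    using norm_pochhammer_strip_bound[of 1 m] by auto
  define X where "X = real m + 1/2"
  have X: "Gamma X > 0" by (auto simp: X_def intro!: Gamma_real_pos)
  have "norm (Gamma s) \<le> (B / Gamma X * (A * 4)) * exp (- (5/4) * \<bar>Im s\<bar>)"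
    if s: "\<bar>Re s\<bar> \<le> M" "\<bar>Im s\<bar> \<ge> 1" for s :: complex
  proof -
    define x y where "x = Re s" and "y = Im s"
    have "s \<notin> \<int>\<^sub>\<le>\<^sub>0" using s by (auto elim!: nonpos_Ints_cases)
    hence "Gamma (s + of_nat n) = pochhammer s n * Gamma s"
      by (simp add: pochhammer_Gamma Gamma_eq_zero_iff)
    moreover have "norm (pochhammer s n) \<ge> 1"
    proof -
      have "(\<Prod>k=0..<n. norm (s + of_nat k)) \<ge> (\<Prod>k=0..<n. 1)"
      proof (intro prod_mono conjI)
        fix k
        have "\<bar>Im (s + of_nat k)\<bar> \<le> norm (s + of_nat k)" by (rule abs_Im_le_cmod)
        thus "1 \<le> norm (s + of_nat k)" using s by simp
      qed auto
      thus ?thesis by (simp add: pochhammer_prod flip: prod_norm)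
    qed
    ultimately have "norm (Gamma s) \<le> norm (Gamma (s + of_nat n))"
      by (simp add: norm_mult mult_le_cancel_right1)
    also have "s + of_nat n = Complex (x + n) y" by (simp add: x_def y_def complex_eq_iff)
    also have "norm (Gamma (Complex (x + n) y)) \<le> norm (Gamma (Complex X y)) * Gamma (x + n) / Gamma X"
    proof -
      have "norm (Gamma (Complex (x + n) y)) * Gamma X \<le> norm (Gamma (Complex X y)) * Gamma (x + n)"
        using s n by (intro norm_Gamma_ratio_mono) (auto simp: x_def X_def m_def abs_le_iff)
      thus ?thesis using X by (simp add: field_simps)
    qed
    also have "\<dots> \<le> norm (Gamma (Complex X y)) * B / Gamma X"
      using B(2)[of "x + n"] s n X
      by (intro divide_right_mono mult_left_mono) (auto simp: x_def m_def abs_le_iff)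
    also have "norm (Gamma (Complex X y)) = norm (pochhammer (Complex (1/2) y) m) * norm (Gamma (Complex (1/2) y))"
    proof -
      have "Complex (1/2) y \<notin> \<int>\<^sub>\<le>\<^sub>0" using s by (auto elim!: nonpos_Ints_cases simp: complex_eq_iff y_def)
      moreover have "Complex X y = Complex (1/2) y + of_nat m" by (simp add: X_def complex_eq_iff)
      ultimately show ?thesis by (simp add: pochhammer_Gamma Gamma_eq_zero_iff norm_divide)
    qed
    also have "\<dots> \<le> (A * exp (\<bar>y\<bar> / 4)) * (4 * exp (- (3/2) * \<bar>y\<bar>))"
      using A(2)[of "Complex (1/2) y"] by (intro mult_mono norm_Gamma_half_bounds) (use A(1) in auto)
    also have "\<dots> = A * 4 * exp (- (5/4) * \<bar>y\<bar>)" by (simp add: mult_ac flip: exp_add)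
    finally show ?thesis using B(1) X
      by (simp add: y_def divide_right_mono mult_right_mono mult_ac)
  qed
  moreover have "B / Gamma X * (A * 4) > 0" using A(1) B(1) X by simp
  ultimately show ?thesis by blast
qed

text \<open>The monotone ratio is used the other way round, comparing down to Re s = 1/2 after the
  Pochhammer shift. As \<open>rGamma\<close> is entire, the bound reaches the real axis.\<close>

lemma rGamma_strip_bound:
  fixes M :: real
  shows "\<exists>A>0. \<forall>s. \<bar>Re s\<bar> \<le> M \<longrightarrow> norm (rGamma s :: complex) \<le> A * exp (9/4 * \<bar>Im s\<bar>)"
proof -
  define n where "n = nat \<lceil>\<bar>M\<bar>\<rceil> + 1"
  have n: "real n \<ge> \<bar>M\<bar> + 1" unfolding n_def by linarith
  define m where "m = 2 * n"
  have "compact ((rGamma :: real \<Rightarrow> real) ` {1..real m})"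
    by (rule compact_continuous_image) (auto intro!: continuous_intros)
  then obtain B where B: "B > 0" "\<And>x. x \<in> {1..real m} \<Longrightarrow> norm (rGamma x) \<le> B"
    using bounded_pos[of "rGamma ` {1..real m}"] compact_imp_bounded by blast
  obtain A where A: "A > 0" "\<And>s. \<bar>Re s\<bar> \<le> \<bar>M\<bar> + 1 \<Longrightarrow> norm (pochhammer s n :: complex) \<le> A * exp (\<bar>Im s\<bar> / 4)"
    using norm_pochhammer_strip_bound[of "\<bar>M\<bar> + 1" n] by (auto simp: add_nonneg_pos)
  have "norm (rGamma s) \<le> (A * Gamma (1/2) * B) * exp (9/4 * \<bar>Im s\<bar>)"
    if s: "\<bar>Re s\<bar> \<le> M" for s :: complex
  proof -
    define x y where "x = Re s" and "y = Im s"
    have xn: "x + n \<in> {1..real m}" using s n by (auto simp: x_def m_def abs_le_iff)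
    hence gpos: "Gamma (x + n) > 0" by (intro Gamma_real_pos) auto
    have "rGamma s = pochhammer s n * rGamma (s + of_nat n)" by (rule pochhammer_rGamma)
    also have "s + of_nat n = Complex (x + n) y" by (simp add: x_def y_def complex_eq_iff)
    finally have "norm (rGamma s) = norm (pochhammer s n) * norm (rGamma (Complex (x + n) y))"
      by (simp add: norm_mult)
    also have "\<dots> \<le> (A * exp (\<bar>y\<bar> / 4)) * (Gamma (1/2) * B * exp (2 * \<bar>y\<bar>))"
    proof (intro mult_mono)
      show "norm (pochhammer s n) \<le> A * exp (\<bar>y\<bar> / 4)" using A(2)[of s] s by (simp add: y_def)
      have nz: "Gamma (Complex (1/2) y) \<noteq> 0" "Gamma (Complex (x + n) y) \<noteq> 0"
        using xn by (auto simp: Gamma_eq_zero_iff elim!: nonpos_Ints_cases) (auto simp: complex_eq_iff)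
      have "norm (Gamma (Complex (1/2) y)) * Gamma (x + n) \<le> norm (Gamma (Complex (x + n) y)) * Gamma (1/2)"
        using xn by (intro norm_Gamma_ratio_mono) auto
      hence "1 / norm (Gamma (Complex (x + n) y)) \<le> Gamma (1/2) * (1 / Gamma (x + n)) * (1 / norm (Gamma (Complex (1/2) y)))"
        using gpos nz by (simp add: field_simps)
      hence "norm (rGamma (Complex (x + n) y)) \<le> Gamma (1/2) * rGamma (x + n) * norm (rGamma (Complex (1/2) y))"
        by (simp add: rGamma_inverse_Gamma norm_inverse norm_divide inverse_eq_divide)
      also have "\<dots> \<le> Gamma (1/2) * B * exp (2 * \<bar>y\<bar>)"
        using B(2)[OF xn] B(1) Gamma_real_pos[of "1/2"] gpos
        by (intro mult_mono norm_Gamma_half_bounds) (auto simp: rGamma_inverse_Gamma)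
      finally show "norm (rGamma (Complex (x + n) y)) \<le> Gamma (1/2) * B * exp (2 * \<bar>y\<bar>)" .
    qed (use A in auto)
    also have "\<dots> = (A * Gamma (1/2) * B) * exp (9/4 * \<bar>y\<bar>)"
      by (simp add: mult_ac flip: exp_add)
    finally show ?thesis by (simp add: y_def)
  qed
  moreover have "A * Gamma (1/2) * B > 0" using A(1) B(1) Gamma_real_pos[of "1/2"] by simp
  ultimately show ?thesis by blast
qed

section \<open>Contours and their sides\<close>

definition mb_line :: "real \<Rightarrow> real \<Rightarrow> complex" where
  "mb_line C t = Complex C t"

text \<open>The abscissa and the height that \<open>mb_contour\<close> hides under quantifiers
  become parameters, so that several contours can share one \<open>T\<close>.\<close>

definition mb_tail :: "(real \<Rightarrow> complex) \<Rightarrow> real \<Rightarrow> real \<Rightarrow> bool" where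
  "mb_tail g c T \<longleftrightarrow> g C1_differentiable_on UNIV \<and> 0 < T \<and> (\<forall>t. \<bar>t\<bar> \<ge> T \<longrightarrow> g t = Complex c t)"

lemma mb_contour_imp_tail:
  assumes "mb_contour g"
  obtains c T where "mb_tail g c T"
proof -
  from assms obtain c T where "g C1_differentiable_on UNIV"
      "\<forall>t. \<bar>t\<bar> \<ge> T \<longrightarrow> g t = complex_of_real c + \<i> * complex_of_real t"
    by (auto simp: mb_contour_def)
  hence "mb_tail g c (max T 1)" by (auto simp: mb_tail_def complex_eq_iff)
  thus ?thesis using that by blast
qed

lemma mb_tail_imp_contour: "mb_tail g c T \<Longrightarrow> mb_contour g"
  unfolding mb_contour_def mb_tail_def Complex_eq by blast

lemma mb_tail_continuous: "mb_tail g c T \<Longrightarrow> continuous_on A g"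
  by (auto simp: mb_tail_def intro: continuous_on_subset[OF C1_differentiable_imp_continuous_on])

lemma mb_tail_has_vector_derivative:
  "mb_tail g c T \<Longrightarrow> (g has_vector_derivative vector_derivative g (at t)) (at t within A)"
  unfolding mb_tail_def C1_differentiable_on_eq
  by (metis UNIV_I has_vector_derivative_at_within vector_derivative_works)

lemma mb_tail_continuous_deriv: "mb_tail g c T \<Longrightarrow> continuous_on A (\<lambda>t. vector_derivative g (at t))"
  unfolding mb_tail_def C1_differentiable_on_eq using continuous_on_subset by blast

lemma mb_tail_deriv_tail:
  assumes "mb_tail g c T" "\<bar>t\<bar> > T"
  shows "vector_derivative g (at t) = \<i>"
proof (rule vector_derivative_at)
  have "((\<lambda>t. Complex c t) has_vector_derivative \<i>) (at t)"
    unfolding Complex_eq by (auto intro!: derivative_eq_intros)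
  thus "(g has_vector_derivative \<i>) (at t)"
  proof (rule has_vector_derivative_transform_within_open)
    show "open {t. \<bar>t\<bar> > T}" by (intro open_Collect_less continuous_intros)
  qed (use assms in \<open>auto simp: mb_tail_def\<close>)
qed

lemma vector_derivative_mb_line: "vector_derivative (mb_line C) (at t) = \<i>"
  unfolding mb_line_def Complex_eq by (rule vector_derivative_at) (auto intro!: derivative_eq_intros)

lemma mb_tail_line: "mb_tail (mb_line C) C 1"
proof -
  have "mb_line C differentiable at t" for t
    unfolding mb_line_def Complex_eq by (rule differentiableI_vector) (auto intro!: derivative_eq_intros)
  thus ?thesis
    by (auto simp: mb_tail_def C1_differentiable_on_eq vector_derivative_mb_line) (simp add: mb_line_def)
qed

lemma mb_tail_bounded:
  assumes "mb_tail g c T"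
  shows "\<exists>M>0. (\<forall>t. \<bar>Re (g t)\<bar> \<le> M) \<and> (\<forall>t. \<bar>t\<bar> \<le> T \<longrightarrow> \<bar>Im (g t)\<bar> \<le> M) \<and>
    (\<forall>t. norm (vector_derivative g (at t)) \<le> M)"
proof -
  have "compact (g ` {-T..T})" "compact ((\<lambda>t. vector_derivative g (at t)) ` {-T..T})"
    by (rule compact_continuous_image[OF mb_tail_continuous[OF assms]]
             compact_continuous_image[OF mb_tail_continuous_deriv[OF assms]], rule compact_Icc)+
  hence "bounded (g ` {-T..T})" "bounded ((\<lambda>t. vector_derivative g (at t)) ` {-T..T})"
    by (auto intro: compact_imp_bounded)
  then obtain B1 B2 where B1: "\<forall>x\<in>g ` {-T..T}. norm x \<le> B1"
     and B2: "\<forall>x\<in>(\<lambda>t. vector_derivative g (at t)) ` {-T..T}. norm x \<le> B2"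
    unfolding bounded_iff by blast
  have B: "norm (g t) \<le> B1" "norm (vector_derivative g (at t)) \<le> B2" if "\<bar>t\<bar> \<le> T" for t
  proof -
    have "t \<in> {-T..T}" using that by auto
    thus "norm (g t) \<le> B1" "norm (vector_derivative g (at t)) \<le> B2" using B1 B2 by blast+
  qed
  define M where "M = \<bar>B1\<bar> + \<bar>B2\<bar> + \<bar>c\<bar> + 1"
  have "\<bar>Re (g t)\<bar> \<le> M" for t
    using B(1)[of t] abs_Re_le_cmod[of "g t"] assms by (cases "\<bar>t\<bar> \<le> T") (auto simp: M_def mb_tail_def)
  moreover have "\<bar>Im (g t)\<bar> \<le> M" if "\<bar>t\<bar> \<le> T" for t
    using B(1)[of t] abs_Im_le_cmod[of "g t"] that by (auto simp: M_def)
  moreover have "norm (vector_derivative g (at t)) \<le> M" for t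
    using B(2)[of t] mb_tail_deriv_tail[OF assms, of t] by (cases "\<bar>t\<bar> \<le> T") (auto simp: M_def)
  moreover have "M > 0" by (auto simp: M_def)
  ultimately show ?thesis by blast
qed

section \<open>Sides of a contour as limits of symmetric integrals\<close>

definition mb_seg :: "(real \<Rightarrow> complex) \<Rightarrow> real \<Rightarrow> real \<Rightarrow> complex" where
  "mb_seg g R = (\<lambda>u. g (- R + 2 * R * u))"

lemma has_vector_derivative_mb_seg:
  assumes "mb_tail g c T"
  shows "(mb_seg g R has_vector_derivative of_real (2 * R) * vector_derivative g (at (- R + 2 * R * u))) (at u within A)"
proof -
  have "((g \<circ> (\<lambda>u. - R + 2 * R * u)) has_vector_derivative (2 * R) *\<^sub>R vector_derivative g (at (- R + 2 * R * u))) (at u within A)"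
    by (rule vector_diff_chain_within)
      (auto intro!: derivative_eq_intros mb_tail_has_vector_derivative[OF assms])
  thus ?thesis by (simp add: mb_seg_def o_def scaleR_conv_of_real)
qed

lemma valid_path_mb_seg:
  assumes "mb_tail g c T"
  shows "valid_path (mb_seg g R)"
proof -
  have "mb_seg g R C1_differentiable_on {0..1}"
    unfolding C1_differentiable_on_def
    by (rule exI[of _ "\<lambda>u. of_real (2 * R) * vector_derivative g (at (- R + 2 * R * u))"])
      (intro conjI ballI has_vector_derivative_mb_seg[OF assms] continuous_intros
         continuous_on_compose2[OF mb_tail_continuous_deriv[OF assms, of UNIV]] subset_UNIV)
  thus ?thesis by (simp add: valid_path_def C1_differentiable_imp_piecewise)
qed

lemma contour_integral_mb_seg:
  assumes g: "mb_tail g c T" and R: "R > 0" and f: "continuous_on (g ` {-R..R}) f"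
  shows "(f has_contour_integral integral {-R..R} (\<lambda>t. f (g t) * vector_derivative g (at t))) (mb_seg g R)"
proof -
  have cont: "continuous_on {-R..R} (\<lambda>t. f (g t) * vector_derivative g (at t))"
    by (intro continuous_intros mb_tail_continuous_deriv[OF g]
        continuous_on_compose2[OF f mb_tail_continuous[OF g]]) auto
  have "((\<lambda>u. (2 * R) *\<^sub>R (f (g (- R + 2 * R * u)) * vector_derivative g (at (- R + 2 * R * u))))
     has_integral (integral {- R + 2 * R * 0..- R + 2 * R * 1} (\<lambda>t. f (g t) * vector_derivative g (at t)))) {0..1}"
  proof (rule has_integral_substitution[where c = "-R" and d = R])
    show "(\<lambda>u. - R + 2 * R * u) ` {0..1} \<subseteq> {-R..R}"
    proof (intro subsetI, elim imageE)
      fix x u assume "x = - R + 2 * R * u" "u \<in> {0..1}"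
      thus "x \<in> {-R..R}" using R mult_left_mono[of u 1 "2*R"] mult_nonneg_nonneg[of "2*R" u] by auto
    qed
  qed (use R cont in \<open>auto intro!: derivative_eq_intros\<close>)
  moreover have "(2 * R) *\<^sub>R (f (g (- R + 2 * R * u)) * vector_derivative g (at (- R + 2 * R * u))) =
      f (mb_seg g R u) * vector_derivative (mb_seg g R) (at u)" for u
    unfolding vector_derivative_at[OF has_vector_derivative_mb_seg[OF g]]
    by (simp add: mb_seg_def scaleR_conv_of_real)
  ultimately show ?thesis unfolding has_contour_integral by simp
qed

text \<open>The integral of d log (s - z) over the symmetric piece of the contour. Its limit, pi i
  or - pi i, decides the side of z without a closing arc.\<close>

definition mb_pv :: "(real \<Rightarrow> complex) \<Rightarrow> complex \<Rightarrow> real \<Rightarrow> complex" where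
  "mb_pv g z R = integral {-R..R} (\<lambda>t. 1 / (g t - z) * vector_derivative g (at t))"

text \<open>Distinct integers are at distance at least 1. Limits therefore determine winding numbers
  exactly, not only approximately.\<close>

lemma tendsto_Ints_eventually_eq:
  fixes f :: "'a \<Rightarrow> complex"
  assumes "(f \<longlongrightarrow> of_int k) F" "eventually (\<lambda>x. f x \<in> \<int>) F"
  shows "eventually (\<lambda>x. f x = of_int k) F"
proof -
  have "eventually (\<lambda>x. dist (f x) (of_int k) < 1) F" using assms(1) by (rule tendstoD) auto
  thus ?thesis using assms(2)
  proof eventually_elim
    case (elim x)
    then obtain j where j: "f x = of_int j" by (auto elim: Ints_cases)
    have "dist (f x) (of_int k) = of_int \<bar>j - k\<bar>"
      unfolding j dist_norm of_int_diff[symmetric] norm_of_int by simp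
    thus ?case using elim j by simp
  qed
qed

text \<open>The closing half circle of \<open>mb_loop\<close> once R is beyond the bent part: from c
  + iR counterclockwise through the left side to c - iR.\<close>

definition mb_arc :: "real \<Rightarrow> real \<Rightarrow> real \<Rightarrow> complex" where
  "mb_arc c R = (\<lambda>u. of_real c + (\<i> * of_real R) * exp (\<i> * of_real (pi * u)))"

lemma mb_loop_eq:
  assumes "mb_tail g c T" "R \<ge> T"
  shows "mb_loop g R = mb_seg g R +++ mb_arc c R"
proof -
  have "g R = Complex c R" "g (-R) = Complex c (-R)" using assms by (auto simp: mb_tail_def)
  moreover from this have "(g R + g (-R)) / 2 = of_real c" "g R - of_real c = \<i> * of_real R"
    by (auto simp: complex_eq_iff)
  ultimately show ?thesis by (simp add: mb_loop_def mb_seg_def mb_arc_def Let_def)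
qed

lemma has_vector_derivative_mb_arc:
  "(mb_arc c R has_vector_derivative (\<i> * of_real R) * (\<i> * of_real pi) * exp (\<i> * of_real (pi * u))) (at u within A)"
proof -
  have "((\<lambda>w. of_real c + (\<i> * of_real R) * exp (\<i> * (of_real pi * w))) has_field_derivative
      (\<i> * of_real R) * (\<i> * of_real pi) * exp (\<i> * of_real (pi * u))) (at (of_real u))"
    by (auto intro!: derivative_eq_intros simp: mult_ac)
  hence "((\<lambda>x. of_real c + (\<i> * of_real R) * exp (\<i> * (of_real pi * of_real x))) has_vector_derivative
      (\<i> * of_real R) * (\<i> * of_real pi) * exp (\<i> * of_real (pi * u))) (at u within A)"
    by (rule has_vector_derivative_real_field)
  thus ?thesis by (simp add: mb_arc_def)
qed

lemma mb_arc_props: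
  assumes "R > 0"
  shows "valid_path (mb_arc c R)" "path_image (mb_arc c R) \<subseteq> sphere (of_real c) R"
    "pathstart (mb_arc c R) = Complex c R" "pathfinish (mb_arc c R) = Complex c (-R)"
proof -
  have "mb_arc c R C1_differentiable_on {0..1}"
    unfolding C1_differentiable_on_def
    by (rule exI[of _ "\<lambda>u. (\<i> * of_real R) * (\<i> * of_real pi) * exp (\<i> * of_real (pi * u))"])
      (intro conjI ballI has_vector_derivative_mb_arc continuous_intros)
  thus "valid_path (mb_arc c R)" by (simp add: valid_path_def C1_differentiable_imp_piecewise)
  show "path_image (mb_arc c R) \<subseteq> sphere (of_real c) R"
    using assms by (auto simp: path_image_def mb_arc_def dist_norm norm_mult)
  show "pathstart (mb_arc c R) = Complex c R" by (simp add: pathstart_def mb_arc_def complex_eq_iff)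
  show "pathfinish (mb_arc c R) = Complex c (-R)"
    by (simp add: pathfinish_def mb_arc_def complex_eq_iff)
qed

lemma mb_seg_props:
  assumes "mb_tail g c T" "R \<ge> T"
  shows "pathstart (mb_seg g R) = Complex c (-R)" "pathfinish (mb_seg g R) = Complex c R"
    "path_image (mb_seg g R) \<subseteq> range g"
  using assms by (auto simp: pathstart_def pathfinish_def mb_seg_def mb_tail_def path_image_def)

lemma mb_loop_props:
  assumes "mb_tail g c T" "R \<ge> T"
  shows "valid_path (mb_loop g R)" "pathfinish (mb_loop g R) = pathstart (mb_loop g R)"
    "path_image (mb_loop g R) \<subseteq> range g \<union> sphere (of_real c) R"
proof -
  have R: "R > 0" using assms by (auto simp: mb_tail_def)
  note a = mb_arc_props[OF R, of c] and s = mb_seg_props[OF assms] valid_path_mb_seg[OF assms(1)]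
  show "valid_path (mb_loop g R)" "pathfinish (mb_loop g R) = pathstart (mb_loop g R)"
    unfolding mb_loop_eq[OF assms] using a s by auto
  show "path_image (mb_loop g R) \<subseteq> range g \<union> sphere (of_real c) R"
    unfolding mb_loop_eq[OF assms] using a s path_image_join_subset by fastforce
qed

text \<open>Seen from a far half circle, z is almost at its centre, so the arc contributes half a
  turn up to an error of order 1 / R: this is the 1/2.\<close>

lemma mb_winding:
  assumes g: "mb_tail g c T" and z: "z \<notin> range g"
  shows "((\<lambda>R. winding_number (mb_loop g R) z - mb_pv g z R / (2 * pi * \<i>)) \<longlongrightarrow> 1/2) at_top"
    and "\<forall>\<^sub>F R in at_top. winding_number (mb_loop g R) z \<in> \<int>"
proof -
  define d where "d = of_real c - z"
  define err where "err R = (winding_number (mb_loop g R) z - mb_pv g z R / (2 * pi * \<i>)) - 1/2" for R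
  have main: "winding_number (mb_loop g R) z \<in> \<int> \<and> norm (err R) \<le> norm d / (R - norm d)"
    if R: "R > norm d" "R \<ge> T" for R
  proof -
    have R0: "R > 0" using g R by (auto simp: mb_tail_def)
    note a = mb_arc_props[OF R0, of c] and s = mb_seg_props[OF g R(2)] valid_path_mb_seg[OF g]
    note l = mb_loop_props[OF g R(2)]
    have "z \<notin> sphere (of_real c) R" using R by (auto simp: d_def dist_norm)
    hence zl: "z \<notin> path_image (mb_loop g R)" using l z by auto
    have int: "winding_number (mb_loop g R) z \<in> \<int>"
      using l zl by (intro integer_winding_number valid_path_imp_path) auto
    let ?w = "\<lambda>u. \<i> * of_real R * exp (\<i> * of_real (pi * u))"
    have nz: "?w u + d \<noteq> 0" and nw: "norm (?w u + d) \<ge> R - norm d" for u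
    proof -
      have "norm (?w u) = R" using R0 by (simp add: norm_mult)
      moreover have "norm (?w u) \<le> norm (?w u + d) + norm d" by (metis add_diff_cancel_right' norm_triangle_ineq4)
      ultimately show "norm (?w u + d) \<ge> R - norm d" by simp
      thus "?w u + d \<noteq> 0" using R by auto
    qed
    \<comment> \<open>The integrand of d log (s - z) along the arc; it approaches the constant pi i
      because w / (w + d) tends to 1.\<close>
    define F where "F u = (\<i> * of_real pi) * (?w u / (?w u + d))" for u
    have Fcont: "continuous_on {0..1} F" unfolding F_def using nz by (auto intro!: continuous_intros)
    have i1: "((\<lambda>s. 1 / (s - z)) has_contour_integral mb_pv g z R) (mb_seg g R)"
      unfolding mb_pv_def using z
      by (intro contour_integral_mb_seg[OF g R0]) (auto intro!: continuous_intros)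
    have i2: "((\<lambda>s. 1 / (s - z)) has_contour_integral integral {0..1} F) (mb_arc c R)"
    proof -
      have "(F has_integral integral {0..1} F) {0..1}"
        using Fcont by (intro integrable_integral integrable_continuous_real)
      moreover have "F u = 1 / (mb_arc c R u - z) * vector_derivative (mb_arc c R) (at u)" for u
        unfolding vector_derivative_at[OF has_vector_derivative_mb_arc]
        by (simp add: F_def mb_arc_def d_def algebra_simps)
      ultimately show ?thesis unfolding has_contour_integral by (metis (no_types, lifting) has_integral_eq)
    qed
    have "((\<lambda>s. 1 / (s - z)) has_contour_integral (mb_pv g z R + integral {0..1} F)) (mb_loop g R)"
      unfolding mb_loop_eq[OF g R(2)] using i1 i2 s a by (intro has_contour_integral_join)
    hence "winding_number (mb_loop g R) z = (mb_pv g z R + integral {0..1} F) / (2 * pi * \<i>)"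
      using winding_number_valid_path[OF l(1) zl] by (simp add: contour_integral_unique)
    hence "err R = (integral {0..1} F - \<i> * pi) / (2 * pi * \<i>)"
      by (simp add: err_def field_simps)
    also have "integral {0..1} F - \<i> * pi = integral {0..1} (\<lambda>u. F u - \<i> * pi)"
      using Fcont by (subst Henstock_Kurzweil_Integration.integral_diff)
        (auto intro!: integrable_continuous_real)
    also have "norm (integral {0..1} (\<lambda>u. F u - \<i> * pi) / (2 * pi * \<i>)) \<le> norm d / (R - norm d)"
    proof -
      have "norm (integral {0..1} (\<lambda>u. F u - \<i> * pi)) \<le> (pi * (norm d / (R - norm d))) * (1 - 0)"
      proof (rule integral_bound)
        fix u :: real
        have "F u - \<i> * pi = (\<i> * pi) * (- d / (?w u + d))"
          using nz[of u] by (simp add: F_def field_simps)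
        hence "norm (F u - \<i> * pi) = pi * (norm d / norm (?w u + d))"
          by (simp only: norm_mult norm_divide norm_minus_cancel) simp
        also have "\<dots> \<le> pi * (norm d / (R - norm d))"
          using nw[of u] R by (intro mult_left_mono divide_left_mono mult_pos_pos) auto
        finally show "norm (F u - \<i> * pi) \<le> pi * (norm d / (R - norm d))" .
      qed (use Fcont in \<open>auto intro!: continuous_intros\<close>)
      also have "\<dots> \<le> (2 * pi) * (norm d / (R - norm d))" using R by (auto intro!: divide_right_mono mult_right_mono)
      finally show ?thesis by (simp add: norm_divide norm_mult field_simps)
    qed
    finally show ?thesis using int by blast
  qed
  have ev: "\<forall>\<^sub>F R in at_top. R > norm d \<and> R \<ge> T"
    by (intro eventually_conj eventually_gt_at_top eventually_ge_at_top)
  show "\<forall>\<^sub>F R in at_top. winding_number (mb_loop g R) z \<in> \<int>"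
    using ev by eventually_elim (use main in auto)
  have "(err \<longlongrightarrow> 0) at_top"
  proof (rule Lim_null_comparison)
    show "\<forall>\<^sub>F R in at_top. norm (err R) \<le> norm d / (R - norm d)"
      using ev by eventually_elim (use main in auto)
    show "((\<lambda>R. norm d / (R - norm d)) \<longlongrightarrow> 0) at_top"
      by (intro tendsto_divide_0[OF tendsto_const] filterlim_at_top_imp_at_infinity
          filterlim_tendsto_add_at_top[where f = "\<lambda>_. - norm d", simplified] filterlim_ident)
        (auto intro: filterlim_tendsto_add_at_top)
  qed
  hence "((\<lambda>R. err R + 1/2) \<longlongrightarrow> 0 + 1/2) at_top" by (intro tendsto_intros)
  thus "((\<lambda>R. winding_number (mb_loop g R) z - mb_pv g z R / (2 * pi * \<i>)) \<longlongrightarrow> 1/2) at_top"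
    by (simp add: err_def)
qed

text \<open>The arc always supplies half a turn, whence 2 k - 1 instead of 2 k.\<close>

lemma winding_limit_iff:
  assumes g: "mb_tail g c T" and z: "z \<notin> range g"
  shows "(\<forall>\<^sub>F R in at_top. winding_number (mb_loop g R) z = of_int k) \<longleftrightarrow>
         (mb_pv g z \<longlongrightarrow> (2 * of_int k - 1) * pi * \<i>) at_top"
proof
  assume "\<forall>\<^sub>F R in at_top. winding_number (mb_loop g R) z = of_int k"
  hence "((\<lambda>R. winding_number (mb_loop g R) z) \<longlongrightarrow> of_int k) at_top" by (rule tendsto_eventually)
  hence "((\<lambda>R. (winding_number (mb_loop g R) z - (winding_number (mb_loop g R) z - mb_pv g z R / (2 * pi * \<i>))) * (2 * pi * \<i>))
     \<longlongrightarrow> (of_int k - 1/2) * (2 * pi * \<i>)) at_top"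
    by (intro tendsto_intros mb_winding[OF g z])
  thus "(mb_pv g z \<longlongrightarrow> (2 * of_int k - 1) * pi * \<i>) at_top" by (simp add: algebra_simps)
next
  assume "(mb_pv g z \<longlongrightarrow> (2 * of_int k - 1) * pi * \<i>) at_top"
  hence "((\<lambda>R. (winding_number (mb_loop g R) z - mb_pv g z R / (2 * pi * \<i>)) + mb_pv g z R / (2 * pi * \<i>))
     \<longlongrightarrow> 1/2 + (2 * of_int k - 1) * pi * \<i> / (2 * pi * \<i>)) at_top"
    by (intro tendsto_intros mb_winding[OF g z]) auto
  hence "((\<lambda>R. winding_number (mb_loop g R) z) \<longlongrightarrow> of_int k) at_top" by (simp add: field_simps)
  thus "\<forall>\<^sub>F R in at_top. winding_number (mb_loop g R) z = of_int k"
    by (rule tendsto_Ints_eventually_eq[OF _ mb_winding(2)[OF g z]])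
qed

lemma left_of_iff_pv:
  assumes "mb_tail g c T"
  shows "left_of g z \<longleftrightarrow> z \<notin> range g \<and> (mb_pv g z \<longlongrightarrow> pi * \<i>) at_top"
  using winding_limit_iff[OF assms, of z 1] by (auto simp: left_of_def)

lemma right_of_iff_pv:
  assumes "mb_tail g c T"
  shows "right_of g z \<longleftrightarrow> z \<notin> range g \<and> (mb_pv g z \<longlongrightarrow> - (pi * \<i>)) at_top"
  using winding_limit_iff[OF assms, of z 0] by (auto simp: right_of_def)

lemma not_left_and_right: "left_of g z \<Longrightarrow> \<not> right_of g z"
proof
  assume "left_of g z" "right_of g z"
  hence "\<forall>\<^sub>F R in at_top. winding_number (mb_loop g R) z = 1"
    "\<forall>\<^sub>F R in at_top. winding_number (mb_loop g R) z = 0" by (auto simp: left_of_def right_of_def)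
  hence "\<forall>\<^sub>F R in (at_top :: real filter). False" by eventually_elim simp
  thus False by simp
qed

lemma integral_log_deriv:
  fixes h h' :: "real \<Rightarrow> complex"
  assumes "a \<le> b" "\<And>t. t \<in> {a..b} \<Longrightarrow> (h has_vector_derivative h' t) (at t within {a..b})"
    "\<And>t. t \<in> {a..b} \<Longrightarrow> Re (h t) > 0"
  shows "((\<lambda>t. h' t / h t) has_integral (Ln (h b) - Ln (h a))) {a..b}"
proof (rule fundamental_theorem_of_calculus[OF assms(1)])
  fix t assume t: "t \<in> {a..b}"
  hence "h t \<notin> \<real>\<^sub>\<le>\<^sub>0" using assms(3)[OF t] by (auto simp: complex_nonpos_Reals_iff)
  hence "(Ln has_field_derivative inverse (h t)) (at (h t) within h ` {a..b})"
    by (rule has_field_derivative_at_within[OF has_field_derivative_Ln])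
  from field_vector_diff_chain_within[OF assms(2)[OF t] this]
  show "((\<lambda>t. Ln (h t)) has_vector_derivative h' t / h t) (at t within {a..b})"
    by (simp add: o_def divide_inverse)
qed

text \<open>Factoring out R moves both logarithms close to i and - i, where \<open>Ln\<close> is
  continuous; their difference is the half turn swept by a vertical line.\<close>

lemma Ln_vertical_limit:
  shows "((\<lambda>R. Ln (d + \<i> * of_real R) - Ln (d - \<i> * of_real R)) \<longlongrightarrow> pi * \<i>) at_top"
proof -
  have lim: "((\<lambda>R::real. d / of_real R) \<longlongrightarrow> 0) at_top"
    by (rule tendsto_divide_0[OF tendsto_const])
      (rule filterlim_of_real_at_infinity)
  have "((\<lambda>R. Ln (\<i> + d / of_real R) - Ln (-\<i> + d / of_real R)) \<longlongrightarrow> Ln (\<i> + 0) - Ln (-\<i> + 0)) at_top"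
    by (intro tendsto_intros lim) (auto simp: complex_nonpos_Reals_iff)
  moreover have "\<forall>\<^sub>F R::real in at_top. Ln (\<i> + d / of_real R) - Ln (-\<i> + d / of_real R) =
      Ln (d + \<i> * of_real R) - Ln (d - \<i> * of_real R)"
    using eventually_gt_at_top[of "norm d"]
  proof eventually_elim
    case (elim R)
    have R: "R > 0" using elim norm_ge_zero[of d] by linarith
    have nz: "\<i> + d / of_real R \<noteq> 0" "-\<i> + d / of_real R \<noteq> 0"
    proof -
      have "norm (d / of_real R) < 1" using elim R by (simp add: norm_divide)
      thus "\<i> + d / of_real R \<noteq> 0" "-\<i> + d / of_real R \<noteq> 0"
        by (metis add.inverse_unique add_eq_0_iff norm_ii norm_minus_cancel order_less_irrefl)+
    qed
    have "d + \<i> * of_real R = of_real R * (\<i> + d / of_real R)" "d - \<i> * of_real R = of_real R * (-\<i> + d / of_real R)"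
      using R by (auto simp: field_simps)
    thus ?case by (simp only: Ln_times_of_real[OF R nz(1)] Ln_times_of_real[OF R nz(2)]) simp
  qed
  ultimately show ?thesis
    by (auto dest: Lim_transform_eventually simp: mult.commute)
qed

lemma mb_pv_left:
  assumes g: "mb_tail g c T" and z: "\<And>t. Re z < Re (g t)"
  shows "(mb_pv g z \<longlongrightarrow> pi * \<i>) at_top"
proof (rule Lim_transform_eventually[OF Ln_vertical_limit[of "of_real c - z"]])
  show "\<forall>\<^sub>F R in at_top. Ln (of_real c - z + \<i> * of_real R) - Ln (of_real c - z - \<i> * of_real R) = mb_pv g z R"
    using eventually_ge_at_top[of T]
  proof eventually_elim
    case (elim R)
    have R: "R > 0" using elim g by (auto simp: mb_tail_def)
    have "((\<lambda>t. vector_derivative g (at t) / (g t - z)) has_integral (Ln (g R - z) - Ln (g (-R) - z))) {-R..R}"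
      using R z by (intro integral_log_deriv) (auto intro!: derivative_eq_intros mb_tail_has_vector_derivative[OF g])
    hence "mb_pv g z R = Ln (g R - z) - Ln (g (-R) - z)"
      by (simp add: mb_pv_def integral_unique)
    moreover have "g R - z = of_real c - z + \<i> * of_real R" "g (-R) - z = of_real c - z - \<i> * of_real R"
      using g elim R by (auto simp: mb_tail_def complex_eq_iff)
    ultimately show ?case by simp
  qed
qed

lemma mb_pv_right:
  assumes g: "mb_tail g c T" and z: "\<And>t. Re z > Re (g t)"
  shows "(mb_pv g z \<longlongrightarrow> - (pi * \<i>)) at_top"
proof (rule Lim_transform_eventually[OF tendsto_minus[OF Ln_vertical_limit[of "z - of_real c"]]])
  show "\<forall>\<^sub>F R in at_top. - (Ln (z - of_real c + \<i> * of_real R) - Ln (z - of_real c - \<i> * of_real R)) = mb_pv g z R"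
    using eventually_ge_at_top[of T]
  proof eventually_elim
    case (elim R)
    have R: "R > 0" using elim g by (auto simp: mb_tail_def)
    \<comment> \<open>Here g t - z has negative real part, so the logarithm is taken of z - g t,
      which stays off the branch cut.\<close>
    have "((\<lambda>t. (- vector_derivative g (at t)) / (z - g t)) has_integral (Ln (z - g R) - Ln (z - g (-R)))) {-R..R}"
      using R z by (intro integral_log_deriv) (auto intro!: derivative_eq_intros mb_tail_has_vector_derivative[OF g])
    moreover have "(- vector_derivative g (at t)) / (z - g t) = 1 / (g t - z) * vector_derivative g (at t)" for t
      by (metis minus_diff_eq minus_divide_divide mult_1 times_divide_eq_left)
    ultimately have "mb_pv g z R = Ln (z - g R) - Ln (z - g (-R))"
      by (simp add: mb_pv_def integral_unique)
    moreover have "z - g R = z - of_real c - \<i> * of_real R" "z - g (-R) = z - of_real c + \<i> * of_real R"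
      using g elim R by (auto simp: mb_tail_def complex_eq_iff)
    ultimately show ?case by simp
  qed
qed

lemma left_of_base:
  assumes "mb_tail g c T" "\<And>t. Re z < Re (g t)"
  shows "left_of g z"
  unfolding left_of_iff_pv[OF assms(1)] using mb_pv_left[OF assms] assms(2) by force

lemma right_of_base:
  assumes "mb_tail g c T" "\<And>t. Re z > Re (g t)"
  shows "right_of g z"
  unfolding right_of_iff_pv[OF assms(1)] using mb_pv_right[OF assms] assms(2) by force

text \<open>A bounded set eventually lies inside the closing arc. If it also misses the contour it
  misses the whole loop, and on a connected set the winding number is then constant.\<close>

lemma winding_transfer:
  assumes g: "mb_tail g c T" and S: "connected S" "bounded S" "z \<in> S" "z' \<in> S" "S \<inter> range g = {}"
  shows "\<forall>\<^sub>F R in at_top. winding_number (mb_loop g R) z = winding_number (mb_loop g R) z'"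
proof -
  obtain B where B: "\<And>s. s \<in> S \<Longrightarrow> dist (of_real c) s < B"
    using S(2) by (meson bounded_subset_ballD mem_ball subsetD)
  have "\<forall>\<^sub>F R in at_top. R \<ge> T \<and> R \<ge> B" by (intro eventually_conj eventually_ge_at_top)
  thus ?thesis
  proof eventually_elim
    case (elim R)
    have "S \<inter> sphere (of_real c) R = {}" using B elim by fastforce
    hence "S \<inter> path_image (mb_loop g R) = {}" using mb_loop_props(3)[OF g, of R] elim S by blast
    thus ?case using mb_loop_props[OF g, of R] elim S
      by (intro winding_number_eq valid_path_imp_path) auto
  qed
qed

lemma left_of_transfer:
  assumes "mb_tail g c T" "connected S" "bounded S" "z \<in> S" "z' \<in> S" "S \<inter> range g = {}" "left_of g z"
  shows "left_of g z'"
  using winding_transfer[OF assms(1-6)] assms unfolding left_of_def by (auto elim: eventually_elim2)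

lemma right_of_transfer:
  assumes "mb_tail g c T" "connected S" "bounded S" "z \<in> S" "z' \<in> S" "S \<inter> range g = {}" "right_of g z"
  shows "right_of g z'"
  using winding_transfer[OF assms(1-6)] assms unfolding right_of_def by (auto elim: eventually_elim2)

text \<open>Beyond the bent part the contour is just the line Re s = c, so a horizontal segment
  leads from z to a point outside the range of all real parts, where the side is evident.\<close>

lemma high_left_right:
  assumes g: "mb_tail g c T"
  obtains H where "\<And>z. \<bar>Im z\<bar> \<ge> H \<Longrightarrow> Re z < c \<Longrightarrow> left_of g z"
    "\<And>z. \<bar>Im z\<bar> \<ge> H \<Longrightarrow> Re z > c \<Longrightarrow> right_of g z"
proof -
  obtain M where M: "M > 0" "\<And>t. \<bar>Re (g t)\<bar> \<le> M" "\<And>t. \<bar>t\<bar> \<le> T \<Longrightarrow> \<bar>Im (g t)\<bar> \<le> M"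
    using mb_tail_bounded[OF g] by auto
  have c: "Re (g t) = c" if "\<bar>Im (g t)\<bar> > M" for t
  proof -
    have "\<not> \<bar>t\<bar> \<le> T" using M(3)[of t] that by auto
    thus ?thesis using g by (auto simp: mb_tail_def)
  qed
  have "left_of g z" if z: "\<bar>Im z\<bar> \<ge> M + 1" "Re z < c" for z
  proof (rule left_of_transfer[OF g, where S = "closed_segment (Complex (min (Re z) (- M - 1)) (Im z)) z"])
    show "closed_segment (Complex (min (Re z) (- M - 1)) (Im z)) z \<inter> range g = {}"
    proof -
      have "False" if "s = g t" "s \<in> closed_segment (Complex (min (Re z) (- M - 1)) (Im z)) z" for s t
      proof -
        have "Im s = Im z" "Re s \<le> Re z"
          using that(2) closed_segment_same_Im[of "Complex (min (Re z) (- M - 1)) (Im z)" z]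
          by (auto simp: closed_segment_eq_real_ivl split: if_splits)
        thus False using c[of t] z that(1) by auto
      qed
      thus ?thesis by auto
    qed
    show "left_of g (Complex (min (Re z) (- M - 1)) (Im z))"
    proof (rule left_of_base[OF g])
      fix t
      have "- M \<le> Re (g t)" using M(2)[of t] by linarith
      thus "Re (Complex (min (Re z) (- M - 1)) (Im z)) < Re (g t)" by simp
    qed
  qed (auto simp: bounded_closed_segment)
  moreover have "right_of g z" if z: "\<bar>Im z\<bar> \<ge> M + 1" "Re z > c" for z
  proof (rule right_of_transfer[OF g, where S = "closed_segment (Complex (max (Re z) (M + 1)) (Im z)) z"])
    show "closed_segment (Complex (max (Re z) (M + 1)) (Im z)) z \<inter> range g = {}"
    proof -
      have "False" if "s = g t" "s \<in> closed_segment (Complex (max (Re z) (M + 1)) (Im z)) z" for s t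
      proof -
        have "Im s = Im z" "Re s \<ge> Re z"
          using that(2) closed_segment_same_Im[of "Complex (max (Re z) (M + 1)) (Im z)" z]
          by (auto simp: closed_segment_eq_real_ivl split: if_splits)
        thus False using c[of t] z that(1) by auto
      qed
      thus ?thesis by auto
    qed
    show "right_of g (Complex (max (Re z) (M + 1)) (Im z))"
    proof (rule right_of_base[OF g])
      fix t
      have "Re (g t) \<le> M" using M(2)[of t] by linarith
      thus "Re (Complex (max (Re z) (M + 1)) (Im z)) > Re (g t)" by simp
    qed
  qed (auto simp: bounded_closed_segment)
  ultimately show ?thesis using that by blast
qed

section \<open>Shifting a contour\<close>

lemma tendsto_integral_symmetric:
  fixes f :: "real \<Rightarrow> complex"
  assumes f: "integrable lborel f"
  shows "((\<lambda>R. integral {-R..R} f) \<longlongrightarrow> integral\<^sup>L lborel f) at_top"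
proof -
  have "((\<lambda>R. \<integral>x. indicator {-R..R} x *\<^sub>R f x \<partial>lborel) \<longlongrightarrow> (\<integral>x. f x \<partial>lborel)) at_top"
  proof (rule integral_dominated_convergence_at_top)
    show "AE x in lborel. ((\<lambda>R. indicator {-R..R} x *\<^sub>R f x) \<longlongrightarrow> f x) at_top"
    proof (rule AE_I2, rule tendsto_eventually)
      fix x :: real
      show "\<forall>\<^sub>F R in at_top. indicator {-R..R} x *\<^sub>R f x = f x"
        using eventually_ge_at_top[of "\<bar>x\<bar>"] by eventually_elim (auto simp: indicator_def)
    qed
    show "integrable lborel (\<lambda>x. norm (f x))" using f by (rule integrable_norm)
    show "\<forall>\<^sub>F R in at_top. AE x in lborel. norm (indicator {-R..R} x *\<^sub>R f x) \<le> norm (f x)"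
      by (intro always_eventually allI AE_I2) (auto simp: indicator_def)
  qed (use f in measurable)
  moreover have "(\<integral>x. indicator {-R..R} x *\<^sub>R f x \<partial>lborel) = integral {-R..R} f" for R
  proof -
    have "set_integrable lborel {-R..R} f"
      unfolding set_integrable_def using f by (intro integrable_mult_indicator) auto
    from set_borel_integral_eq_integral(2)[OF this] show ?thesis by (simp add: set_lebesgue_integral_def)
  qed
  ultimately show ?thesis by simp
qed

text \<open>\<open>K\<close> collects the poles right of \<open>g\<close> but left of the target
  line, that is, those swept over. Since \<open>g\<close> may wind arbitrarily, the winding numbers
  of the closed path are not read off geometrically: they are integers converging to the difference
  of the two symmetric integrals, as the horizontal sides vanish.\<close>

lemma mb_shift:
  fixes F :: "complex \<Rightarrow> complex"
  assumes g: "mb_tail g c T"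
    and strip: "\<And>t. \<bar>Re (g t)\<bar> < M" "\<bar>C\<bar> < M"
    and P: "finite P" "F holomorphic_on {s. \<bar>Re s\<bar> < M} - P"
    and K: "K \<subseteq> P" "\<And>p. p \<in> K \<Longrightarrow> right_of g p \<and> Re p < C"
    and LR: "\<And>p. p \<in> P - K \<Longrightarrow> left_of g p \<and> Re p < C \<or> right_of g p \<and> Re p > C"
    and decay: "(B \<longlongrightarrow> 0) at_top"
      "\<And>s. \<bar>Re s\<bar> < M \<Longrightarrow> \<bar>Im s\<bar> \<ge> Y \<Longrightarrow> norm (F s) \<le> B \<bar>Im s\<bar>"
    and int: "integrable lborel (\<lambda>t. F (g t) * vector_derivative g (at t))"
      "integrable lborel (\<lambda>t. F (mb_line C t))"
  shows "(\<integral>t. F (g t) * vector_derivative g (at t) \<partial>lborel) =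
     \<i> * (\<integral>t. F (mb_line C t) \<partial>lborel) - 2 * pi * \<i> * (\<Sum>p\<in>K. residue F p)"
proof -
  define S where "S = {s. \<bar>Re s\<bar> < M}"
  have S_box: "S = {s. Re s < M} \<inter> {s. Re s > - M}" by (auto simp: S_def)
  have S: "open S" "convex S" unfolding S_box
    by (auto intro!: open_Int convex_Int open_halfspace_Re_lt open_halfspace_Re_gt
        convex_halfspace_Re_lt convex_halfspace_Re_gt)
  have c: "\<bar>c\<bar> < M" using g strip(1)[of T] by (auto simp: mb_tail_def)
  note l = mb_tail_line[of C]
  define top where "top R = linepath (Complex c R) (Complex C R)" for R
  define bot where "bot R = linepath (Complex C (-R)) (Complex c (-R))" for R
  define vert where "vert R = reversepath (mb_seg (mb_line C) R)" for R
  define \<gamma> where "\<gamma> R = mb_seg g R +++ top R +++ vert R +++ bot R" for R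
  obtain Y0 where Y0: "\<And>p. p \<in> P \<Longrightarrow> \<bar>Im p\<bar> < Y0"
  proof -
    have "bounded (Im ` P)" using P(1) by (intro finite_imp_bounded) auto
    then obtain b where "\<And>x. x \<in> Im ` P \<Longrightarrow> norm x \<le> b" unfolding bounded_iff by blast
    thus ?thesis using that[of "b + 1"] by force
  qed
  define R0 where "R0 = max 1 (max T (max Y Y0))"
  have Pg: "p \<notin> range g" "Re p \<noteq> C" if "p \<in> P" for p
    using K(2)[of p] LR[of p] that by (auto simp: left_of_def right_of_def)
  have seg_top: "Re s \<in> closed_segment c C \<and> Im s = R" if "s \<in> path_image (top R)" for s R
    using that closed_segment_same_Im[of "Complex c R" "Complex C R"] by (auto simp: top_def)
  have seg_bot: "Re s \<in> closed_segment c C \<and> Im s = - R" if "s \<in> path_image (bot R)" for s R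
    using that closed_segment_same_Im[of "Complex C (-R)" "Complex c (-R)"]
    by (auto simp: bot_def closed_segment_commute)
  have seg_vert: "Re s = C" if "s \<in> path_image (vert R)" for s R
    using that by (auto simp: vert_def mb_seg_def path_image_def mb_line_def reversepath_def)
  have segM: "\<bar>x\<bar> < M" if "x \<in> closed_segment c C" for x
    using that c strip(2) by (auto simp: closed_segment_eq_real_ivl split: if_splits)
  have valid: "valid_path (\<gamma> R)" "pathfinish (\<gamma> R) = pathstart (\<gamma> R)"
    and pim: "path_image (\<gamma> R) \<subseteq> range g \<union> path_image (top R) \<union> path_image (vert R) \<union> path_image (bot R)"
    and parts: "valid_path (mb_seg g R)" "valid_path (top R)" "valid_path (vert R)" "valid_path (bot R)"
      "valid_path (vert R +++ bot R)" "valid_path (top R +++ vert R +++ bot R)"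
    if R: "R \<ge> R0" for R
  proof -
    have RT: "R \<ge> T" "R \<ge> 1" using R by (auto simp: R0_def)
    note sg = mb_seg_props[OF g RT(1)] valid_path_mb_seg[OF g, of R]
      and sl = mb_seg_props[OF l RT(2)] valid_path_mb_seg[OF l, of R]
    show p: "valid_path (mb_seg g R)" "valid_path (top R)" "valid_path (vert R)" "valid_path (bot R)"
      using sg sl by (auto simp: top_def vert_def bot_def valid_path_imp_reverse)
    show vb: "valid_path (vert R +++ bot R)"
      by (intro valid_path_join p) (simp add: vert_def bot_def sl)
    show tvb: "valid_path (top R +++ vert R +++ bot R)"
      by (intro valid_path_join p vb) (simp add: vert_def top_def sl)
    show "valid_path (\<gamma> R)" unfolding \<gamma>_def
      by (intro valid_path_join p tvb) (simp add: top_def sg)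
    show "pathfinish (\<gamma> R) = pathstart (\<gamma> R)" by (simp add: \<gamma>_def bot_def sg)
    show "path_image (\<gamma> R) \<subseteq> range g \<union> path_image (top R) \<union> path_image (vert R) \<union> path_image (bot R)"
      unfolding \<gamma>_def using sg path_image_join_subset by blast
  qed
  have pimS: "path_image (\<gamma> R) \<subseteq> S - P" if R: "R \<ge> R0" for R
  proof
    fix s assume "s \<in> path_image (\<gamma> R)"
    with pim[OF R] consider "s \<in> range g" | "s \<in> path_image (top R)" | "s \<in> path_image (vert R)" | "s \<in> path_image (bot R)"
      by blast
    thus "s \<in> S - P"
    proof cases
      case 1 thus ?thesis using strip(1) Pg by (auto simp: S_def)
    next
      case 2 thus ?thesis using seg_top[OF 2] segM Y0[of s] R by (auto simp: S_def R0_def)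
    next
      case 3 thus ?thesis using seg_vert[OF 3] strip(2) Pg[of s] by (auto simp: S_def)
    next
      case 4 thus ?thesis using seg_bot[OF 4] segM Y0[of s] R by (auto simp: S_def R0_def)
    qed
  qed
  have CI: "contour_integral (\<gamma> R) f = integral {-R..R} (\<lambda>t. f (g t) * vector_derivative g (at t))
       - integral {-R..R} (\<lambda>t. f (mb_line C t) * \<i>)
       + (contour_integral (top R) f + contour_integral (bot R) f)"
    if R: "R \<ge> R0" and f: "continuous_on (S - P) f" for R f
  proof -
    have R1: "R > 0" using R by (auto simp: R0_def)
    have sub: "g ` {-R..R} \<subseteq> S - P" using strip(1) Pg(1) by (auto simp: S_def)
    have subC: "mb_line C ` {-R..R} \<subseteq> S - P"
      using strip(2) Pg(2)[of "Complex C t" for t] by (auto simp: S_def mb_line_def)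
    have sub': "path_image (top R) \<subseteq> S - P" "path_image (bot R) \<subseteq> S - P"
      using seg_top segM Y0 seg_bot R by (fastforce simp: S_def R0_def)+
    have 1: "(f has_contour_integral integral {-R..R} (\<lambda>t. f (g t) * vector_derivative g (at t))) (mb_seg g R)"
      by (intro contour_integral_mb_seg[OF g R1] continuous_on_subset[OF f sub])
    have "(f has_contour_integral integral {-R..R} (\<lambda>t. f (mb_line C t) * \<i>)) (mb_seg (mb_line C) R)"
      using contour_integral_mb_seg[OF l R1 continuous_on_subset[OF f subC]]
      by (simp add: vector_derivative_mb_line)
    hence 2: "(f has_contour_integral - integral {-R..R} (\<lambda>t. f (mb_line C t) * \<i>)) (vert R)"
      unfolding vert_def by (intro has_contour_integral_reversepath valid_path_mb_seg[OF l])
    have 3: "(f has_contour_integral contour_integral (top R) f) (top R)"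
      "(f has_contour_integral contour_integral (bot R) f) (bot R)"
      using sub' by (auto simp: top_def bot_def intro!: has_contour_integral_integral contour_integrable_continuous_linepath
          continuous_on_subset[OF f])
    have "(f has_contour_integral (integral {-R..R} (\<lambda>t. f (g t) * vector_derivative g (at t)) +
       (contour_integral (top R) f + (- integral {-R..R} (\<lambda>t. f (mb_line C t) * \<i>) + contour_integral (bot R) f)))) (\<gamma> R)"
      unfolding \<gamma>_def using parts[OF R] 1 2 3 by (intro has_contour_integral_join)
    from contour_integral_unique[OF this] show ?thesis by simp
  qed
  \<comment> \<open>Used twice: for \<open>F\<close> itself and, with the bound 1 / (R - |Im p|),
    for 1 / (s - p).\<close>
  have hor: "((\<lambda>R. contour_integral (top R) f + contour_integral (bot R) f) \<longlongrightarrow> 0) at_top"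
    if f: "continuous_on (S - P) f" and b: "(b \<longlongrightarrow> 0) at_top"
      "\<And>s. s \<in> S \<Longrightarrow> \<bar>Im s\<bar> \<ge> R1 \<Longrightarrow> norm (f s) \<le> b \<bar>Im s\<bar>" for f b R1
  proof (rule Lim_null_comparison)
    show "\<forall>\<^sub>F R in at_top. norm (contour_integral (top R) f + contour_integral (bot R) f) \<le> 2 * (b R * \<bar>C - c\<bar>)"
      using eventually_ge_at_top[of "max R0 R1"]
    proof eventually_elim
      case (elim R)
      hence R: "R \<ge> R0" "R \<ge> R1" "R > 0" by (auto simp: R0_def)
      have sub': "path_image (top R) \<subseteq> S - P" "path_image (bot R) \<subseteq> S - P"
        using seg_top segM Y0 seg_bot R by (fastforce simp: S_def R0_def)+
      have bd: "norm (f s) \<le> b R" if "s \<in> path_image (top R) \<union> path_image (bot R)" for s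
        using b(2)[of s] that sub' seg_top[of s R] seg_bot[of s R] R by auto
      have nn: "0 \<le> b R" using bd[of "pathstart (top R)"] norm_ge_zero order_trans by blast
      have "norm (contour_integral (top R) f) \<le> b R * norm (Complex C R - Complex c R)"
        unfolding top_def using bd nn sub'
        by (intro contour_integral_bound_linepath contour_integrable_continuous_linepath
            continuous_on_subset[OF f]) (auto simp: top_def)
      moreover have "norm (contour_integral (bot R) f) \<le> b R * norm (Complex c (-R) - Complex C (-R))"
        unfolding bot_def using bd nn sub'
        by (intro contour_integral_bound_linepath contour_integrable_continuous_linepath
            continuous_on_subset[OF f]) (auto simp: bot_def)
      moreover have "norm (Complex C R - Complex c R) = \<bar>C - c\<bar>" "norm (Complex c (-R) - Complex C (-R)) = \<bar>C - c\<bar>"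
        by (auto simp: cmod_def)
      ultimately show ?case
        using norm_triangle_ineq[of "contour_integral (top R) f" "contour_integral (bot R) f"] by simp
    qed
    have "((\<lambda>R. 2 * (b R * \<bar>C - c\<bar>)) \<longlongrightarrow> 2 * (0 * \<bar>C - c\<bar>)) at_top" by (intro tendsto_intros b)
    thus "((\<lambda>R. 2 * (b R * \<bar>C - c\<bar>)) \<longlongrightarrow> 0) at_top" by simp
  qed
  have ev0: "\<forall>\<^sub>F R in at_top. R \<ge> R0" by (rule eventually_ge_at_top)
  have wind: "\<forall>\<^sub>F R in at_top. winding_number (\<gamma> R) p = (if p \<in> K then -1 else 0)" if p: "p \<in> P" for p
  proof -
    let ?f = "\<lambda>s. 1 / (s - p)"
    have cont: "continuous_on (S - P) ?f" using p by (auto intro!: continuous_intros)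
    have "((\<lambda>R. contour_integral (top R) ?f + contour_integral (bot R) ?f) \<longlongrightarrow> 0) at_top"
    proof (rule hor[OF cont])
      show "((\<lambda>R. 1 / (R - \<bar>Im p\<bar>)) \<longlongrightarrow> 0) at_top"
        by (rule tendsto_divide_0[OF tendsto_const], rule filterlim_at_top_imp_at_infinity)
          (auto intro: filterlim_tendsto_add_at_top[OF tendsto_const[of "- \<bar>Im p\<bar>"] filterlim_ident, simplified])
      fix s assume s: "\<bar>Im s\<bar> \<ge> \<bar>Im p\<bar> + 1"
      have "\<bar>Im s\<bar> - \<bar>Im p\<bar> \<le> norm (s - p)" using abs_Im_le_cmod[of "s - p"] by auto
      thus "norm (?f s) \<le> 1 / (\<bar>Im s\<bar> - \<bar>Im p\<bar>)" using s
        by (auto simp: norm_divide intro!: divide_left_mono mult_pos_pos)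
    qed
    moreover have "(mb_pv g p \<longlongrightarrow> (if left_of g p then 1 else -1) * pi * \<i>) at_top"
      using K(2)[of p] LR[of p] p left_of_iff_pv[OF g, of p] right_of_iff_pv[OF g, of p] by auto
    moreover have "(mb_pv (mb_line C) p \<longlongrightarrow> (if Re p < C then 1 else -1) * pi * \<i>) at_top"
      using mb_pv_left[OF l, of p] mb_pv_right[OF l, of p] Pg(2)[OF p] by (auto simp: mb_line_def)
    ultimately have "((\<lambda>R. (mb_pv g p R - mb_pv (mb_line C) p R
          + (contour_integral (top R) ?f + contour_integral (bot R) ?f)) / (2 * pi * \<i>))
        \<longlongrightarrow> ((if left_of g p then 1 else -1) * pi * \<i> - (if Re p < C then 1 else -1) * pi * \<i> + 0) / (2 * pi * \<i>)) at_top"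
      by (intro tendsto_intros) auto
    \<comment> \<open>The limits for \<open>g\<close> and for the line agree except at poles in
      \<open>K\<close>, where (- pi i - pi i) / (2 pi i) = -1: the path goes up along
      \<open>g\<close> and down along the line.\<close>
    also have "((if left_of g p then 1 else -1) * pi * \<i> - (if Re p < C then 1 else -1) * pi * \<i> + 0) / (2 * pi * \<i>)
        = of_int (if p \<in> K then -1 else 0)"
      using K(2)[of p] LR[of p] p not_left_and_right[of g p] by (auto simp: field_simps)
    finally have lim: "((\<lambda>R. (mb_pv g p R - mb_pv (mb_line C) p R
          + (contour_integral (top R) ?f + contour_integral (bot R) ?f)) / (2 * pi * \<i>))
        \<longlongrightarrow> of_int (if p \<in> K then -1 else 0)) at_top" .
    have eq: "\<forall>\<^sub>F R in at_top. (mb_pv g p R - mb_pv (mb_line C) p R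
          + (contour_integral (top R) ?f + contour_integral (bot R) ?f)) / (2 * pi * \<i>) = winding_number (\<gamma> R) p"
      using ev0
    proof eventually_elim
      case (elim R)
      have "p \<notin> path_image (\<gamma> R)" using pimS[OF elim] p by auto
      from winding_number_valid_path[OF valid(1)[OF elim] this] CI[OF elim cont]
      show ?case by (simp add: mb_pv_def vector_derivative_mb_line)
    qed
    have "\<forall>\<^sub>F R in at_top. winding_number (\<gamma> R) p = of_int (if p \<in> K then -1 else 0)"
    proof (rule tendsto_Ints_eventually_eq[OF Lim_transform_eventually[OF lim eq]])
      show "\<forall>\<^sub>F R in at_top. winding_number (\<gamma> R) p \<in> \<int>"
        using ev0
      proof eventually_elim
        case (elim R)
        have "p \<notin> path_image (\<gamma> R)" using pimS[OF elim] p by auto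
        thus ?case using valid[OF elim] by (intro integer_winding_number valid_path_imp_path) auto
      qed
    qed
    thus ?thesis by (simp split: if_splits)
  qed
  have "\<forall>\<^sub>F R in at_top. \<forall>p\<in>P. winding_number (\<gamma> R) p = (if p \<in> K then -1 else 0)"
    using P(1) wind by (simp add: eventually_ball_finite)
  hence res: "\<forall>\<^sub>F R in at_top. contour_integral (\<gamma> R) F = - (2 * pi * \<i> * (\<Sum>p\<in>K. residue F p))"
    using ev0
  proof eventually_elim
    case (elim R)
    have "contour_integral (\<gamma> R) F = 2 * pi * \<i> * (\<Sum>p\<in>P. winding_number (\<gamma> R) p * residue F p)"
    proof (rule Residue_theorem[OF S(1) convex_connected[OF S(2)] P(1)])
      show "F holomorphic_on S - P" using P(2) by (simp add: S_def)
      show "\<forall>z. z \<notin> S \<longrightarrow> winding_number (\<gamma> R) z = 0"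
        using pimS[OF elim(2)] valid[OF elim(2)] S(2)
        by (auto intro!: winding_number_zero_outside[of _ S] valid_path_imp_path)
    qed (use valid[OF elim(2)] pimS[OF elim(2)] in auto)
    also have "(\<Sum>p\<in>P. winding_number (\<gamma> R) p * residue F p) = (\<Sum>p\<in>P. if p \<in> K then - residue F p else 0)"
      using elim(1) by (intro sum.cong) auto
    also have "\<dots> = (\<Sum>p\<in>K. - residue F p)"
      using P(1) K(1) by (simp add: sum.If_cases Int_absorb1)
    finally show ?case by (simp add: sum_negf)
  qed
  have Fcont: "continuous_on (S - P) F" using P(2) by (auto simp: S_def intro: holomorphic_on_imp_continuous_on)
  have lim: "((\<lambda>R. integral {-R..R} (\<lambda>t. F (g t) * vector_derivative g (at t))
       - integral {-R..R} (\<lambda>t. F (mb_line C t) * \<i>)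
       + (contour_integral (top R) F + contour_integral (bot R) F)) \<longlongrightarrow>
      (\<integral>t. F (g t) * vector_derivative g (at t) \<partial>lborel) - (\<integral>t. F (mb_line C t) * \<i> \<partial>lborel) + 0) at_top"
    using int by (intro tendsto_intros tendsto_integral_symmetric hor[OF Fcont decay(1)] integrable_mult_left)
      (use decay(2) in \<open>auto simp: S_def\<close>)
  have ev: "\<forall>\<^sub>F R in at_top. integral {-R..R} (\<lambda>t. F (g t) * vector_derivative g (at t))
       - integral {-R..R} (\<lambda>t. F (mb_line C t) * \<i>)
       + (contour_integral (top R) F + contour_integral (bot R) F) = - (2 * pi * \<i> * (\<Sum>p\<in>K. residue F p))"
    using res ev0 by eventually_elim (simp add: CI[OF _ Fcont])
  have "(\<integral>t. F (g t) * vector_derivative g (at t) \<partial>lborel) - (\<integral>t. F (mb_line C t) * \<i> \<partial>lborel) + 0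
      = - (2 * pi * \<i> * (\<Sum>p\<in>K. residue F p))"
    by (rule tendsto_unique[OF _ lim tendsto_eventually[OF ev]]) simp
  thus ?thesis by (simp add: algebra_simps)
qed

section \<open>Exponential decay and the residues of the kernel \<open>Gamma (d - s)\<close>\<close>

lemma integrable_exp_minus_abs:
  fixes b :: real
  assumes "b > 0"
  shows "integrable lborel (\<lambda>t. exp (- b * \<bar>t\<bar>))"
proof -
  have "(\<lambda>x. exp (- b * x)) absolutely_integrable_on {0..}"
    using integrable_on_exp_minus_to_infinity[OF assms, of 0]
    by (intro nonnegative_absolutely_integrable_1) auto
  hence 1: "integrable lborel (\<lambda>x. indicator {0..} x *\<^sub>R exp (- b * x))"
    unfolding set_integrable_def by (subst (asm) integrable_completion) auto
  from lborel_integrable_real_affine[OF 1, of "-1" 0]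
  have 2: "integrable lborel (\<lambda>x. indicator {..0} x *\<^sub>R exp (b * x))"
    by (simp add: indicator_def)
  have "integrable lborel (\<lambda>x. indicator {0..} x *\<^sub>R exp (- b * x) + indicator {..0} x *\<^sub>R exp (b * x))"
    by (rule Bochner_Integration.integrable_add[OF 1 2])
  thus ?thesis by (rule Bochner_Integration.integrable_bound) (auto simp: indicator_def)
qed

lemma exp_decay_bound:
  fixes f :: "real \<Rightarrow> complex"
  assumes "continuous_on UNIV f" "\<And>t. \<bar>t\<bar> \<ge> Y \<Longrightarrow> norm (f t) \<le> A * exp (- b * \<bar>t\<bar>)" "b > 0"
  shows "\<exists>A'>0. \<forall>t. norm (f t) \<le> A' * exp (- b * \<bar>t\<bar>)"
proof -
  have "compact (f ` {-\<bar>Y\<bar>..\<bar>Y\<bar>})"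
    by (rule compact_continuous_image[OF continuous_on_subset[OF assms(1)]]) auto
  from compact_imp_bounded[OF this] obtain B where B: "\<forall>x\<in>f ` {-\<bar>Y\<bar>..\<bar>Y\<bar>}. norm x \<le> B"
    unfolding bounded_iff by blast
  define A' where "A' = \<bar>A\<bar> + \<bar>B\<bar> * exp (b * \<bar>Y\<bar>) + 1"
  have "norm (f t) \<le> A' * exp (- b * \<bar>t\<bar>)" for t
  proof (cases "\<bar>t\<bar> \<ge> \<bar>Y\<bar>")
    case True
    hence "norm (f t) \<le> A * exp (- b * \<bar>t\<bar>)" by (intro assms) auto
    also have "\<dots> \<le> A' * exp (- b * \<bar>t\<bar>)"
    proof (rule mult_right_mono)
      have "\<bar>B\<bar> * exp (b * \<bar>Y\<bar>) \<ge> 0" by simp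
      thus "A \<le> A'" unfolding A'_def by linarith
    qed auto
    finally show ?thesis .
  next
    case False
    have "t \<in> {-\<bar>Y\<bar>..\<bar>Y\<bar>}" using False by auto
    hence "norm (f t) \<le> B" using B by blast
    also have "\<dots> \<le> \<bar>B\<bar> * exp (b * \<bar>Y\<bar> - b * \<bar>t\<bar>)"
    proof -
      have "1 \<le> exp (b * \<bar>Y\<bar> - b * \<bar>t\<bar>)" using False assms(3) by (auto simp: mult_left_mono)
      hence "\<bar>B\<bar> * 1 \<le> \<bar>B\<bar> * exp (b * \<bar>Y\<bar> - b * \<bar>t\<bar>)" by (intro mult_left_mono) auto
      thus ?thesis by simp
    qed
    also have "\<dots> = (\<bar>B\<bar> * exp (b * \<bar>Y\<bar>)) * exp (- b * \<bar>t\<bar>)" by (simp add: exp_diff exp_minus field_simps)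
    also have "\<dots> \<le> A' * exp (- b * \<bar>t\<bar>)" by (intro mult_right_mono) (auto simp: A'_def)
    finally show ?thesis .
  qed
  moreover have "A' > 0" unfolding A'_def by (intro add_nonneg_pos add_nonneg_nonneg) auto
  ultimately show ?thesis by blast
qed

lemma integrable_exp_decay:
  fixes f :: "real \<Rightarrow> complex"
  assumes "continuous_on UNIV f" "\<And>t. \<bar>t\<bar> \<ge> Y \<Longrightarrow> norm (f t) \<le> A * exp (- b * \<bar>t\<bar>)" "b > 0"
  shows "integrable lborel f"
proof -
  obtain A' where A': "\<And>t. norm (f t) \<le> A' * exp (- b * \<bar>t\<bar>)" "A' > 0"
    using exp_decay_bound[OF assms] by blast
  show ?thesis
  proof (rule Bochner_Integration.integrable_bound)
    show "integrable lborel (\<lambda>t. A' * exp (- b * \<bar>t\<bar>))"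
      by (intro integrable_mult_right integrable_exp_minus_abs assms)
    show "f \<in> borel_measurable lborel" using borel_measurable_continuous_onI[OF assms(1)] by simp
    show "AE x in lborel. norm (f x) \<le> norm (A' * exp (- b * \<bar>x\<bar>))"
      using A' by (auto simp: abs_mult)
  qed
qed

text \<open>Gamma has residue (-1)^k / k! at - k, and the reversed variable supplies the minus sign.
  The offset d will be 0 for the first three variables and 1 for the fourth.\<close>

lemma residue_Gamma_kernel:
  fixes d k :: nat
  assumes "open S" "of_nat (d + k) \<in> S" "G holomorphic_on S"
  shows "residue (\<lambda>s. Gamma (of_nat d - s) * G s) (of_nat (d + k)) = - ((-1) ^ k / fact k * G (of_nat (d + k)))"
proof -
  let ?p = "of_nat (d + k) :: complex"
  define S' where "S' = S \<inter> ball ?p 1"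
  show ?thesis
  proof (rule residue_simple')
    show "open S'" "?p \<in> S'" using assms by (auto simp: S'_def)
    show "(\<lambda>s. Gamma (of_nat d - s) * G s) holomorphic_on S' - {?p}"
    proof (intro holomorphic_intros)
      show "G holomorphic_on S' - {?p}" using assms(3) by (rule holomorphic_on_subset) (auto simp: S'_def)
      fix s assume s: "s \<in> S' - {?p}"
      show "of_nat d - s \<notin> \<int>\<^sub>\<le>\<^sub>0"
      proof
        assume "of_nat d - s \<in> \<int>\<^sub>\<le>\<^sub>0"
        then obtain n where n: "of_nat d - s = - of_nat n" by (auto elim!: nonpos_Ints_cases')
        hence seq: "s = of_nat (d + n)" by (simp add: algebra_simps)
        have "?p - s = of_int (int k - int n)" by (simp add: seq)
        hence "dist ?p s = real_of_int \<bar>int k - int n\<bar>" by (simp only: dist_norm norm_of_int)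
        moreover have "dist ?p s < 1" using s by (auto simp: S'_def)
        ultimately have "k = n" by auto
        thus False using s seq by auto
      qed
    qed
    have fl: "filterlim (\<lambda>s. of_nat d - s) (at (- of_nat k)) (at ?p)"
    proof (rule filterlim_atI)
      have "((\<lambda>s. of_nat d - s) \<longlongrightarrow> of_nat d - ?p) (at ?p)" by (intro tendsto_intros)
      thus "((\<lambda>s. of_nat d - s) \<longlongrightarrow> - of_nat k) (at ?p)" by simp
      show "\<forall>\<^sub>F s in at ?p. of_nat d - s \<noteq> - of_nat k"
        by (auto simp: eventually_at_filter algebra_simps)
    qed
    have "((\<lambda>s. Gamma (of_nat d - s) * ((of_nat d - s) + of_nat k)) \<longlongrightarrow> (-1) ^ k / fact k) (at ?p)"
      by (rule filterlim_compose[OF Gamma_residues fl])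
    moreover have "(G \<longlongrightarrow> G ?p) (at ?p)"
      using assms by (meson continuous_on_eq_continuous_at holomorphic_on_imp_continuous_on isContD)
    ultimately have "((\<lambda>s. - (Gamma (of_nat d - s) * ((of_nat d - s) + of_nat k) * G s)) \<longlongrightarrow> - ((-1) ^ k / fact k * G ?p)) (at ?p)"
      by (intro tendsto_intros)
    thus "((\<lambda>s. Gamma (of_nat d - s) * G s * (s - ?p)) \<longlongrightarrow> - ((-1) ^ k / fact k * G ?p)) (at ?p)"
      by (rule Lim_transform_eventually) (auto intro!: always_eventually simp: algebra_simps)
  qed
qed

text \<open>The kernel decays at the rate 5/4, so \<open>G\<close> may grow like exp |Im s|; the
  margin of 1/4 gives integrability and makes the horizontal sides vanish. \<open>L\<close> holds
  the singularities of \<open>G\<close>, which stay left of both contours, and \<open>Kn\<close>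
  indexes the swept poles of the kernel.\<close>

lemma kernel_shift:
  fixes d :: nat and G :: "complex \<Rightarrow> complex" and Kn :: "nat set"
  defines "F \<equiv> (\<lambda>s. Gamma (of_nat d - s) * G s)"
  assumes g: "mb_tail g c T"
    and strip: "\<And>t. \<bar>Re (g t)\<bar> < M" "\<bar>C\<bar> < M"
    and L: "finite L" "G holomorphic_on {s. \<bar>Re s\<bar> < M} - L" "\<And>p. p \<in> L \<Longrightarrow> left_of g p \<and> Re p < C"
    and Kn: "\<And>k. k \<in> Kn \<Longrightarrow> right_of g (of_nat (d + k)) \<and> real (d + k) < C"
      "\<And>k. k \<notin> Kn \<Longrightarrow> left_of g (of_nat (d + k)) \<and> real (d + k) < C \<or> right_of g (of_nat (d + k)) \<and> real (d + k) > C"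
    and G: "\<And>s. \<bar>Re s\<bar> < M \<Longrightarrow> \<bar>Im s\<bar> \<ge> Y \<Longrightarrow> norm (G s) \<le> B * exp \<bar>Im s\<bar>"
  shows "integrable lborel (\<lambda>t. F (g t) * vector_derivative g (at t))"
    and "integrable lborel (\<lambda>t. F (mb_line C t))"
    and "(\<integral>t. F (g t) * vector_derivative g (at t) \<partial>lborel) =
     \<i> * (\<integral>t. F (mb_line C t) \<partial>lborel) + 2 * pi * \<i> * (\<Sum>k\<in>Kn. (-1) ^ k / fact k * G (of_nat (d + k)))"
proof -
  \<comment> \<open>Only finitely many poles of the kernel fall into the strip; this bounds their
    indices.\<close>
  define n where "n = nat \<lceil>M\<rceil>"
  have n: "k \<le> n" if "real (d + k) < M" for k using that unfolding n_def by linarith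
  define q where "q = (\<lambda>k. of_nat (d + k) :: complex)"
  have q: "Re (q k) = real (d + k)" "inj q" for k by (auto simp: q_def inj_def)
  have KnC: "k \<le> n" if "k \<in> Kn" for k using Kn(1)[OF that] strip(2) n[of k] by auto
  hence Kfin: "finite Kn" using finite_subset[of Kn "{..n}"] by auto
  define P where "P = L \<union> q ` {..n}"
  define K where "K = q ` Kn"
  have PK: "left_of g p \<and> Re p < C \<or> right_of g p \<and> Re p > C \<or> p \<in> K \<and> right_of g p \<and> Re p < C" if pP: "p \<in> P" for p
  proof (cases "p \<in> L")
    case False
    then obtain k where k: "p = q k" using pP by (auto simp: P_def)
    show ?thesis using Kn(1)[of k] Kn(2)[of k] q(1)[of k]
      by (cases "k \<in> Kn") (auto simp: k K_def q_def)
  qed (use L(3) in auto)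
  have Lq: "q k \<notin> L" if "k \<in> Kn" for k
    using Kn(1)[OF that] L(3)[of "q k"] not_left_and_right[of g "q k"] by (auto simp: q_def)
  have holF: "F holomorphic_on {s. \<bar>Re s\<bar> < M} - P"
    unfolding F_def
  proof (intro holomorphic_intros)
    show "G holomorphic_on {s. \<bar>Re s\<bar> < M} - P" by (rule holomorphic_on_subset[OF L(2)]) (auto simp: P_def)
    fix s assume s: "s \<in> {s. \<bar>Re s\<bar> < M} - P"
    show "of_nat d - s \<notin> \<int>\<^sub>\<le>\<^sub>0"
    proof
      assume "of_nat d - s \<in> \<int>\<^sub>\<le>\<^sub>0"
      then obtain k where k: "of_nat d - s = - of_nat k" by (auto elim!: nonpos_Ints_cases')
      hence seq: "s = q k" by (simp add: algebra_simps q_def)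
      hence "real (d + k) < M" using s q(1)[of k] by auto
      hence "s \<in> P" using seq n by (auto simp: P_def)
      thus False using s by auto
    qed
  qed
  obtain A where A: "A > 0" "\<And>s. \<bar>Re s\<bar> \<le> \<bar>M\<bar> + real d \<Longrightarrow> \<bar>Im s\<bar> \<ge> 1 \<Longrightarrow> norm (Gamma s :: complex) \<le> A * exp (- (5/4) * \<bar>Im s\<bar>)"
    using Gamma_strip_bound[of "\<bar>M\<bar> + real d"] by auto
  have decay: "norm (F s) \<le> (A * B) * exp (- (1/4) * \<bar>Im s\<bar>)" if "\<bar>Re s\<bar> < M" "\<bar>Im s\<bar> \<ge> max 1 Y" for s
  proof -
    have "norm (F s) \<le> (A * exp (- (5/4) * \<bar>Im (of_nat d - s)\<bar>)) * (B * exp \<bar>Im s\<bar>)"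
      unfolding F_def norm_mult using that by (intro mult_mono A G) (use A(1) in auto)
    also have "\<dots> = (A * B) * (exp (- (5/4) * \<bar>Im s\<bar>) * exp \<bar>Im s\<bar>)" by simp
    also have "exp (- (5/4) * \<bar>Im s\<bar>) * exp \<bar>Im s\<bar> = exp (- (1/4) * \<bar>Im s\<bar>)"
      unfolding exp_add[symmetric] by simp
    finally show ?thesis .
  qed
  have contF: "continuous_on ({s. \<bar>Re s\<bar> < M} - P) F" by (rule holomorphic_on_imp_continuous_on[OF holF])
  have int: "integrable lborel (\<lambda>t. F (h t) * vector_derivative h (at t))"
    if h: "mb_tail h c' T'" "\<And>t. \<bar>Re (h t)\<bar> < M" "\<And>p. p \<in> P \<Longrightarrow> p \<notin> range h" for h c' T'
  proof (rule integrable_exp_decay)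
    show "continuous_on UNIV (\<lambda>t. F (h t) * vector_derivative h (at t))"
      using h by (intro continuous_intros mb_tail_continuous_deriv[OF h(1)]
        continuous_on_compose2[OF contF mb_tail_continuous[OF h(1)]]) auto
    fix t assume t: "\<bar>t\<bar> \<ge> max (T' + 1) (max 1 Y)"
    have "h t = Complex c' t" "vector_derivative h (at t) = \<i>"
      using t h(1) mb_tail_deriv_tail[OF h(1), of t] by (auto simp: mb_tail_def)
    thus "norm (F (h t) * vector_derivative h (at t)) \<le> (A * B) * exp (- (1/4) * \<bar>t\<bar>)"
      using decay[of "h t"] t h(2)[of t] by (auto simp: norm_mult)
  qed auto
  show I1: "integrable lborel (\<lambda>t. F (g t) * vector_derivative g (at t))"
    using PK strip by (intro int[OF g]) (auto simp: left_of_def right_of_def)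
  have "integrable lborel (\<lambda>t. F (mb_line C t) * vector_derivative (mb_line C) (at t))"
    using strip by (intro int[OF mb_tail_line]) (auto simp: mb_line_def dest!: PK)
  hence "integrable lborel (\<lambda>t. (F (mb_line C t) * \<i>) * (- \<i>))"
    unfolding vector_derivative_mb_line by (rule integrable_mult_left)
  thus I2: "integrable lborel (\<lambda>t. F (mb_line C t))" by (simp add: mult.assoc)
  have "(\<integral>t. F (g t) * vector_derivative g (at t) \<partial>lborel) =
     \<i> * (\<integral>t. F (mb_line C t) \<partial>lborel) - 2 * pi * \<i> * (\<Sum>p\<in>K. residue F p)"
  proof (rule mb_shift[OF g strip _ holF _ _ _ _ _ I1 I2])
    show "finite P" using L(1) by (auto simp: P_def)
    show "K \<subseteq> P" using KnC by (auto simp: P_def K_def)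
    show "right_of g p \<and> Re p < C" if "p \<in> K" for p using that Kn(1) q by (auto simp: K_def q_def)
    show "left_of g p \<and> Re p < C \<or> right_of g p \<and> Re p > C" if "p \<in> P - K" for p using PK[of p] that by auto
    have "((\<lambda>y. (A * B) * exp (- (1/4) * y)) \<longlongrightarrow> (A * B) * 0) at_top"
      by (intro tendsto_intros filterlim_compose[OF exp_at_bot] filterlim_tendsto_neg_mult_at_bot[OF tendsto_const])
        (auto simp: filterlim_ident)
    thus "((\<lambda>y. (A * B) * exp (- (1/4) * y)) \<longlongrightarrow> 0) at_top" by simp
    show "norm (F s) \<le> (A * B) * exp (- (1/4) * \<bar>Im s\<bar>)" if "\<bar>Re s\<bar> < M" "\<bar>Im s\<bar> \<ge> max 1 Y" for s
      using decay that by blast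
  qed
  also have "(\<Sum>p\<in>K. residue F p) = (\<Sum>k\<in>Kn. residue F (q k))"
    unfolding K_def using q(2) by (subst sum.reindex) (auto simp: inj_on_def inj_def)
  also have "\<dots> = (\<Sum>k\<in>Kn. - ((-1) ^ k / fact k * G (of_nat (d + k))))"
  proof (rule sum.cong)
    fix k assume k: "k \<in> Kn"
    have "{s. \<bar>Re s\<bar> < M} - L = {s. Re s < M} \<inter> {s. Re s > - M} - L" by auto
    hence "open ({s. \<bar>Re s\<bar> < M} - L)" using L(1)
      by (auto intro!: open_Diff finite_imp_closed open_Int open_halfspace_Re_lt open_halfspace_Re_gt)
    moreover have "of_nat (d + k) \<in> {s. \<bar>Re s\<bar> < M} - L"
      using Lq[OF k] Kn(1)[OF k] strip(2) by (auto simp: q_def)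
    ultimately show "residue F (q k) = - ((-1) ^ k / fact k * G (of_nat (d + k)))"
      unfolding F_def q_def by (rule residue_Gamma_kernel[OF _ _ L(2)])
  qed auto
  finally show "(\<integral>t. F (g t) * vector_derivative g (at t) \<partial>lborel) =
     \<i> * (\<integral>t. F (mb_line C t) \<partial>lborel) + 2 * pi * \<i> * (\<Sum>k\<in>Kn. (-1) ^ k / fact k * G (of_nat (d + k)))"
    by (simp add: sum_negf)
qed

section \<open>Barnes integrals\<close>

text \<open>Together with the kernel \<open>Gamma (- s)\<close> this is the Mellin-Barnes integrand
  of a multiple of the series 1F1(a; b; - x). The parameter b is complex because in the coupled pair
  it becomes 2 plus the other variable.\<close>

definition barnes :: "real \<Rightarrow> complex \<Rightarrow> real \<Rightarrow> complex \<Rightarrow> complex" where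
  "barnes a b x s = Gamma (of_real a + s) * rGamma (b + s) * of_real x powr s"

lemma norm_of_real_powr: "x > 0 \<Longrightarrow> norm (of_real x powr s :: complex) = x powr Re s"
  by (simp add: norm_powr_real_powr)

text \<open>The rates combine to - 5/4 + 9/4 = 1, precisely the growth that the kernel
  tolerates.\<close>

lemma barnes_bound:
  assumes "x > 0"
  shows "\<exists>B\<ge>0. \<forall>s. \<bar>Re s\<bar> < M \<and> \<bar>Im s\<bar> \<ge> 1 \<longrightarrow> norm (barnes a b x s) \<le> B * exp \<bar>Im s\<bar>"
proof -
  obtain A1 where A1: "A1 > 0" "\<And>s. \<bar>Re s\<bar> \<le> \<bar>M\<bar> + \<bar>a\<bar> \<Longrightarrow> \<bar>Im s\<bar> \<ge> 1 \<Longrightarrow> norm (Gamma s :: complex) \<le> A1 * exp (- (5/4) * \<bar>Im s\<bar>)"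
    using Gamma_strip_bound[of "\<bar>M\<bar> + \<bar>a\<bar>"] by auto
  obtain A2 where A2: "A2 > 0" "\<And>s. \<bar>Re s\<bar> \<le> \<bar>M\<bar> + \<bar>Re b\<bar> \<Longrightarrow> norm (rGamma s :: complex) \<le> A2 * exp (9/4 * \<bar>Im s\<bar>)"
    using rGamma_strip_bound[of "\<bar>M\<bar> + \<bar>Re b\<bar>"] by auto
  define B where "B = A1 * (A2 * exp (9/4 * \<bar>Im b\<bar>)) * exp (\<bar>M\<bar> * \<bar>ln x\<bar>)"
  have "norm (barnes a b x s) \<le> B * exp \<bar>Im s\<bar>" if s: "\<bar>Re s\<bar> < M" "\<bar>Im s\<bar> \<ge> 1" for s
  proof -
    have "norm (Gamma (of_real a + s)) \<le> A1 * exp (- (5/4) * \<bar>Im s\<bar>)"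
      using A1(2)[of "of_real a + s"] s by auto
    moreover have "norm (rGamma (b + s)) \<le> (A2 * exp (9/4 * \<bar>Im b\<bar>)) * exp (9/4 * \<bar>Im s\<bar>)"
    proof -
      have "norm (rGamma (b + s)) \<le> A2 * exp (9/4 * \<bar>Im (b + s)\<bar>)" using A2(2)[of "b + s"] s by auto
      also have "\<dots> \<le> A2 * exp (9/4 * (\<bar>Im b\<bar> + \<bar>Im s\<bar>))" using A2(1) abs_triangle_ineq[of "Im b" "Im s"] by simp
      also have "9/4 * (\<bar>Im b\<bar> + \<bar>Im s\<bar>) = 9/4 * \<bar>Im b\<bar> + 9/4 * \<bar>Im s\<bar>" by simp
      finally show ?thesis unfolding exp_add by (simp add: mult_ac)
    qed
    moreover have "norm (of_real x powr s :: complex) \<le> exp (\<bar>M\<bar> * \<bar>ln x\<bar>)"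
    proof -
      have "norm (of_real x powr s :: complex) = exp (Re s * ln x)"
        using assms by (simp add: norm_of_real_powr powr_def)
      also have "Re s * ln x \<le> \<bar>Re s * ln x\<bar>" by (rule abs_ge_self)
      also have "\<dots> = \<bar>Re s\<bar> * \<bar>ln x\<bar>" by (rule abs_mult)
      also have "\<dots> \<le> \<bar>M\<bar> * \<bar>ln x\<bar>" using s by (intro mult_right_mono) auto
      finally show ?thesis by simp
    qed
    ultimately have "norm (barnes a b x s) \<le> (A1 * exp (- (5/4) * \<bar>Im s\<bar>)) *
        ((A2 * exp (9/4 * \<bar>Im b\<bar>)) * exp (9/4 * \<bar>Im s\<bar>)) * exp (\<bar>M\<bar> * \<bar>ln x\<bar>)"
      unfolding barnes_def norm_mult using A1(1) A2(1) by (intro mult_mono) auto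
    also have "\<dots> = B * (exp (- (5/4) * \<bar>Im s\<bar>) * exp (9/4 * \<bar>Im s\<bar>))" by (simp add: B_def)
    also have "exp (- (5/4) * \<bar>Im s\<bar>) * exp (9/4 * \<bar>Im s\<bar>) = exp \<bar>Im s\<bar>"
      unfolding exp_add[symmetric] by simp
    finally show ?thesis .
  qed
  moreover have "B \<ge> 0" using A1(1) A2(1) by (simp add: B_def)
  ultimately show ?thesis by blast
qed

definition gpoles :: "complex \<Rightarrow> nat \<Rightarrow> complex set" where
  "gpoles w n = (\<lambda>k. - w - of_nat k) ` {..n}"

lemma finite_gpoles [simp]: "finite (gpoles w n)"
  by (simp add: gpoles_def)

lemma gpoles_cover:
  assumes "\<bar>Re s\<bar> < M" "w + s \<in> \<int>\<^sub>\<le>\<^sub>0"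
  shows "s \<in> gpoles w (nat \<lceil>M + \<bar>Re w\<bar>\<rceil>)"
proof -
  from assms(2) obtain k where k: "w + s = - of_nat k" by (auto elim!: nonpos_Ints_cases')
  hence s: "s = - w - of_nat k" by (metis add_diff_cancel_left' uminus_add_conv_diff add.commute diff_conv_add_uminus)
  have "real k < M + \<bar>Re w\<bar>" using assms(1) s by (auto simp: abs_less_iff)
  hence "k \<le> nat \<lceil>M + \<bar>Re w\<bar>\<rceil>" by linarith
  thus ?thesis using s by (auto simp: gpoles_def)
qed

text \<open>\<open>H\<close> is the slot for the factors that tie the variable to the others, such
  as \<open>Gamma (w + s)\<close>; being bounded at large heights, they leave the decay budget
  untouched.\<close>

lemma barnes_shift:
  fixes a x :: real and b :: complex and d :: nat and H :: "complex \<Rightarrow> complex" and Kn :: "nat set"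
  defines "F \<equiv> (\<lambda>s. Gamma (of_nat d - s) * (barnes a b x s * H s))"
  assumes x: "x > 0" and g: "mb_tail g c T"
    and strip: "\<And>t. \<bar>Re (g t)\<bar> < M" "\<bar>C\<bar> < M"
    and a: "\<And>k::nat. left_of g (- of_real a - of_nat k)" "- a < C"
    and L: "finite L" "H holomorphic_on {s. \<bar>Re s\<bar> < M} - L" "\<And>p. p \<in> L \<Longrightarrow> left_of g p \<and> Re p < C"
    and Kn: "\<And>k. k \<in> Kn \<Longrightarrow> right_of g (of_nat (d + k)) \<and> real (d + k) < C"
      "\<And>k. k \<notin> Kn \<Longrightarrow> left_of g (of_nat (d + k)) \<and> real (d + k) < C \<or> right_of g (of_nat (d + k)) \<and> real (d + k) > C"
    and H: "\<And>s. \<bar>Re s\<bar> < M \<Longrightarrow> \<bar>Im s\<bar> \<ge> Y \<Longrightarrow> norm (H s) \<le> B"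
  shows "integrable lborel (\<lambda>t. F (g t) * vector_derivative g (at t))"
    and "integrable lborel (\<lambda>t. F (mb_line C t))"
    and "(\<integral>t. F (g t) * vector_derivative g (at t) \<partial>lborel) =
     \<i> * (\<integral>t. F (mb_line C t) \<partial>lborel) +
     2 * pi * \<i> * (\<Sum>k\<in>Kn. (-1) ^ k / fact k * (barnes a b x (of_nat (d + k)) * H (of_nat (d + k))))"
proof -
  define L' where "L' = L \<union> gpoles (of_real a) (nat \<lceil>M + \<bar>a\<bar>\<rceil>)"
  have L': "finite L'" "\<And>p. p \<in> L' \<Longrightarrow> left_of g p \<and> Re p < C"
    using L a by (auto simp: L'_def gpoles_def)
  have hol: "(\<lambda>s. barnes a b x s * H s) holomorphic_on {s. \<bar>Re s\<bar> < M} - L'"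
    unfolding barnes_def
  proof (intro holomorphic_intros)
    show "H holomorphic_on {s. \<bar>Re s\<bar> < M} - L'" by (rule holomorphic_on_subset[OF L(2)]) (auto simp: L'_def)
    fix s assume "s \<in> {s. \<bar>Re s\<bar> < M} - L'"
    thus "of_real a + s \<notin> \<int>\<^sub>\<le>\<^sub>0" using gpoles_cover[of s M "of_real a"] by (auto simp: L'_def)
  qed
  obtain B' where B': "B' \<ge> 0" "\<And>s. \<bar>Re s\<bar> < M \<Longrightarrow> \<bar>Im s\<bar> \<ge> 1 \<Longrightarrow> norm (barnes a b x s) \<le> B' * exp \<bar>Im s\<bar>"
    using barnes_bound[OF x, of M a b] by auto
  have bd: "norm (barnes a b x s * H s) \<le> (B' * B) * exp \<bar>Im s\<bar>" if "\<bar>Re s\<bar> < M" "\<bar>Im s\<bar> \<ge> max 1 Y" for s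
  proof -
    have "norm (barnes a b x s * H s) \<le> (B' * exp \<bar>Im s\<bar>) * B"
      unfolding norm_mult using that B'(1) by (intro mult_mono B' H) auto
    thus ?thesis by (simp add: mult_ac)
  qed
  note ks = kernel_shift[OF g strip L'(1) hol L'(2) Kn bd]
  show "integrable lborel (\<lambda>t. F (g t) * vector_derivative g (at t))" "integrable lborel (\<lambda>t. F (mb_line C t))"
    "(\<integral>t. F (g t) * vector_derivative g (at t) \<partial>lborel) =
     \<i> * (\<integral>t. F (mb_line C t) \<partial>lborel) +
     2 * pi * \<i> * (\<Sum>k\<in>Kn. (-1) ^ k / fact k * (barnes a b x (of_nat (d + k)) * H (of_nat (d + k))))"
    unfolding F_def by (rule ks; assumption)+
qed

lemma barnes_line_step:
  fixes N :: nat and a x :: real and b :: complex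
  assumes x: "x > 0" and a: "- a < real N + 1/2"
  defines "F \<equiv> \<lambda>s. Gamma (- s) * barnes a b x s"
  shows "integrable lborel (\<lambda>t. F (mb_line (real N + 1/2) t))"
    and "(\<integral>t. F (mb_line (real N + 1/2) t) \<partial>lborel) = (\<integral>t. F (mb_line (real (Suc N) + 1/2) t) \<partial>lborel)
          + 2 * pi * ((-1) ^ Suc N / fact (Suc N) * barnes a b x (of_nat (Suc N)))"
proof -
  let ?g = "mb_line (real N + 1/2)"
  note g = mb_tail_line[of "real N + 1/2"]
  have left: "left_of ?g p" if "Re p < real N + 1/2" for p
    using that by (intro left_of_base[OF g]) (auto simp: mb_line_def)
  have right: "right_of ?g p" if "Re p > real N + 1/2" for p
    using that by (intro right_of_base[OF g]) (auto simp: mb_line_def)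
  have 1: "\<And>t. \<bar>Re (?g t)\<bar> < real N + 2" by (auto simp: mb_line_def)
  have 2: "\<bar>real (Suc N) + 1/2\<bar> < real N + 2" by auto
  have 3: "left_of ?g (- of_real a - of_nat k)" for k using a by (intro left) auto
  have 4: "- a < real (Suc N) + 1/2" using a by auto
  have 5: "\<And>k. k \<in> {Suc N} \<Longrightarrow> right_of ?g (of_nat (0 + k)) \<and> real (0 + k) < real (Suc N) + 1/2"
    by (auto intro!: right)
  have 6: "left_of ?g (of_nat (0 + k)) \<and> real (0 + k) < real (Suc N) + 1/2 \<or> right_of ?g (of_nat (0 + k)) \<and> real (0 + k) > real (Suc N) + 1/2"
    if "k \<notin> {Suc N}" for k
  proof (cases "k \<le> N")
    case False
    hence "k \<ge> Suc (Suc N)" using that by auto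
    thus ?thesis by (intro disjI2 conjI right) auto
  qed (auto intro!: left)
  note bs = barnes_shift[where d = 0 and H = "\<lambda>_. 1" and L = "{}" and Y = 1 and B = 1 and b = b and Kn = "{Suc N}", OF x g 1 2 3 4 _ _ _ 5 6]
  have I: "integrable lborel (\<lambda>t. F (?g t) * vector_derivative ?g (at t))"
    unfolding F_def using bs(1) by simp
  hence "integrable lborel (\<lambda>t. (F (?g t) * \<i>) * (- \<i>))"
    unfolding vector_derivative_mb_line by (rule integrable_mult_left)
  thus "integrable lborel (\<lambda>t. F (?g t))" by (simp add: mult.assoc)
  have "(\<integral>t. F (?g t) * \<i> \<partial>lborel) = \<i> * (\<integral>t. F (mb_line (real (Suc N) + 1/2) t) \<partial>lborel)
          + 2 * pi * \<i> * ((-1) ^ Suc N / fact (Suc N) * barnes a b x (of_nat (Suc N)))"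
    unfolding F_def using bs(3) by (simp add: vector_derivative_mb_line del: of_nat_Suc)
  also have "\<dots> = ((\<integral>t. F (mb_line (real (Suc N) + 1/2) t) \<partial>lborel)
          + 2 * pi * ((-1) ^ Suc N / fact (Suc N) * barnes a b x (of_nat (Suc N)))) * \<i>"
    by (simp add: algebra_simps)
  finally show "(\<integral>t. F (?g t) \<partial>lborel) = (\<integral>t. F (mb_line (real (Suc N) + 1/2) t) \<partial>lborel)
          + 2 * pi * ((-1) ^ Suc N / fact (Suc N) * barnes a b x (of_nat (Suc N)))" by simp
qed

text \<open>Passing from s to s + 1 multiplies the integrand by - x (a + s) / ((s + 1) (b + s)), and
  |a + s| <= (1 + |a - 1|) |s + 1|. The modulus is halved as soon as b + s is large enough.\<close>

lemma barnes_kernel_ratio: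
  assumes "x > 0" "Re s > 0" "Re s > - a" "2 * x * (1 + \<bar>a - 1\<bar>) \<le> Re s + Re b"
  shows "norm (Gamma (- (s + 1)) * barnes a b x (s + 1)) \<le> norm (Gamma (- s) * barnes a b x s) / 2"
proof (cases "s \<in> \<nat>")
  case True
  then obtain n where n: "s = of_nat n" by (auto elim: Nats_cases)
  \<comment> \<open>The argument is a pole of Gamma, where the default value is 0.\<close>
  have "- (s + 1) = - of_nat (Suc n)" by (simp add: n)
  hence "Gamma (- (s + 1)) = 0" by (simp only: Gamma_eq_zero_iff minus_of_nat_in_nonpos_Ints)
  thus ?thesis by simp
next
  case False
  have s1: "s + 1 \<noteq> 0" using assms(2) by (auto simp: complex_eq_iff)
  have np: "- (s + 1) \<notin> \<int>\<^sub>\<le>\<^sub>0"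
  proof
    assume "- (s + 1) \<in> \<int>\<^sub>\<le>\<^sub>0"
    then obtain k where k: "- (s + 1) = - of_nat k" by (auto elim!: nonpos_Ints_cases')
    hence "s = of_nat k - 1" by (simp add: algebra_simps)
    moreover have "k \<noteq> 0" using k s1 by (metis neg_equal_0_iff_equal of_nat_0)
    ultimately have "s = of_nat (k - 1)" by (simp add: of_nat_diff)
    thus False using False by simp
  qed
  have "of_real a + s \<notin> \<int>\<^sub>\<le>\<^sub>0" using assms(3) by (auto elim!: nonpos_Ints_cases simp: complex_eq_iff)
  hence e1: "Gamma (of_real a + (s + 1)) = (of_real a + s) * Gamma (of_real a + s)"
    using Gamma_plus1[of "of_real a + s"] by (simp add: add_ac)
  have e2: "Gamma (- s) = - (s + 1) * Gamma (- (s + 1))"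
    using Gamma_plus1[OF np] by simp
  have e3: "rGamma (b + s) = (b + s) * rGamma (b + (s + 1))"
    using rGamma_plus1[of "b + s"] by (simp add: add_ac)
  have e4: "of_real x powr (s + 1) = (of_real x :: complex) * of_real x powr s"
    using assms(1) by (simp add: powr_add)
  have R1: "norm (s + 1) \<ge> 1" using complex_Re_le_cmod[of "s + 1"] assms(2) by simp
  have "norm (of_real a + s) \<le> norm (s + 1) + \<bar>a - 1\<bar>"
    using norm_triangle_ineq[of "s + 1" "of_real (a - 1)"] unfolding norm_of_real by (simp add: algebra_simps)
  also have "\<dots> \<le> norm (s + 1) + \<bar>a - 1\<bar> * norm (s + 1)"
    using R1 mult_left_mono[of 1 "norm (s + 1)" "\<bar>a - 1\<bar>"] by simp
  finally have A: "norm (of_real a + s) \<le> (1 + \<bar>a - 1\<bar>) * norm (s + 1)" by (simp add: algebra_simps)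
  have Bb: "2 * x * (1 + \<bar>a - 1\<bar>) \<le> norm (b + s)" using complex_Re_le_cmod[of "b + s"] assms(4) by simp
  let ?Q = "norm (Gamma (- (s + 1))) * norm (Gamma (of_real a + s)) * norm (rGamma (b + (s + 1))) * norm (of_real x powr s :: complex)"
  have "norm (Gamma (- (s + 1)) * barnes a b x (s + 1)) = (x * norm (of_real a + s)) * ?Q"
    unfolding barnes_def e1 e4 norm_mult using assms(1) by simp
  also have "x * norm (of_real a + s) \<le> norm (b + s) * norm (s + 1) / 2"
  proof -
    have "x * norm (of_real a + s) \<le> x * ((1 + \<bar>a - 1\<bar>) * norm (s + 1))"
      using A assms(1) by (intro mult_left_mono) auto
    also have "\<dots> = (2 * x * (1 + \<bar>a - 1\<bar>)) * norm (s + 1) / 2" by simp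
    also have "\<dots> \<le> norm (b + s) * norm (s + 1) / 2" using Bb by (intro divide_right_mono mult_right_mono) auto
    finally show ?thesis .
  qed
  also have "norm (b + s) * norm (s + 1) / 2 * ?Q = norm (Gamma (- s) * barnes a b x s) / 2"
    unfolding barnes_def e2 e3 norm_mult norm_minus_cancel by simp
  finally show ?thesis by (simp add: mult_right_mono)
qed

text \<open>Each step of the line to the right splits off one term of the series. The remaining
  integral tends to 0 because the integral of its modulus is eventually halved at every
  step.\<close>

lemma barnes_sums:
  fixes N :: nat
  assumes x: "x > 0" and a: "- a < real N + 1/2"
  shows "(\<lambda>k. (-1) ^ k / fact k * barnes a b x (of_nat k)) sums
    ((\<Sum>k\<le>N. (-1) ^ k / fact k * barnes a b x (of_nat k)) +
      (\<integral>t. Gamma (- mb_line (real N + 1/2) t) * barnes a b x (mb_line (real N + 1/2) t) \<partial>lborel) / (2 * pi))"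
proof -
  define F where "F s = Gamma (- s) * barnes a b x s" for s
  define trm where "trm k = (-1) ^ k / fact k * barnes a b x (of_nat k)" for k :: nat
  define J where "J n = (\<integral>t. F (mb_line (real n + 1/2) t) \<partial>lborel)" for n :: nat
  define A where "A n = (\<integral>t. norm (F (mb_line (real n + 1/2) t)) \<partial>lborel)" for n :: nat
  have int: "integrable lborel (\<lambda>t. F (mb_line (real n + 1/2) t))" if "n \<ge> N" for n
    unfolding F_def using barnes_line_step(1)[OF x, of a n b] a that by auto
  have step: "J n = J (Suc n) + 2 * pi * trm (Suc n)" if "n \<ge> N" for n
    unfolding J_def F_def trm_def by (rule barnes_line_step(2)[OF x]) (use a that in linarith)
  have const: "(\<Sum>k\<le>N + n. trm k) + J (N + n) / (2 * pi) = (\<Sum>k\<le>N. trm k) + J N / (2 * pi)" for n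
  proof (induction n)
    case (Suc n)
    thus ?case using step[of "N + n"] by (simp add: add_divide_distrib algebra_simps)
  qed auto
  \<comment> \<open>From this index on, the ratio bound applies on the whole line Re s = n +
    1/2.\<close>
  define N1 where "N1 = N + nat \<lceil>2 * x * (1 + \<bar>a - 1\<bar>) + \<bar>Re b\<bar>\<rceil>"
  have N1: "N1 \<ge> N" "real N1 \<ge> 2 * x * (1 + \<bar>a - 1\<bar>) + \<bar>Re b\<bar>"
    unfolding N1_def by (auto, linarith)
  have half: "A (Suc n) \<le> A n / 2" if n: "n \<ge> N1" for n
  proof -
    have "A (Suc n) \<le> (\<integral>t. norm (F (mb_line (real n + 1/2) t)) / 2 \<partial>lborel)"
      unfolding A_def
    proof (rule integral_mono)
      show "integrable lborel (\<lambda>t. norm (F (mb_line (real (Suc n) + 1/2) t)))"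
        "integrable lborel (\<lambda>t. norm (F (mb_line (real n + 1/2) t)) / 2)"
        by (intro integrable_norm int integrable_divide; use n N1 in linarith)+
      fix t
      have eq: "mb_line (real (Suc n) + 1/2) t = mb_line (real n + 1/2) t + 1"
        by (simp add: mb_line_def complex_eq_iff)
      have "2 * x * (1 + \<bar>a - 1\<bar>) + \<bar>Re b\<bar> \<le> real n" "real N \<le> real n" using n N1 by linarith+
      thus "norm (F (mb_line (real (Suc n) + 1/2) t)) \<le> norm (F (mb_line (real n + 1/2) t)) / 2"
        unfolding F_def eq using a x by (intro barnes_kernel_ratio) (auto simp: mb_line_def)
    qed
    thus ?thesis by (simp add: A_def)
  qed
  have Ab: "A (N1 + n) \<le> A N1 * (1/2) ^ n" for n
  proof (induction n)
    case (Suc n)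
    thus ?case using half[of "N1 + n"] by simp
  qed auto
  have "(\<lambda>n. J (N1 + n)) \<longlonglongrightarrow> 0"
  proof (rule Lim_null_comparison)
    show "\<forall>\<^sub>F n in sequentially. norm (J (N1 + n)) \<le> A N1 * (1/2) ^ n"
    proof (intro always_eventually allI)
      fix n
      have "norm (J (N1 + n)) \<le> A (N1 + n)" unfolding J_def A_def by (rule integral_norm_bound)
      thus "norm (J (N1 + n)) \<le> A N1 * (1/2) ^ n" using Ab[of n] by linarith
    qed
    show "(\<lambda>n. A N1 * (1/2) ^ n) \<longlonglongrightarrow> 0" by (auto intro!: tendsto_eq_intros LIMSEQ_realpow_zero)
  qed
  hence J0: "J \<longlonglongrightarrow> 0" using LIMSEQ_offset[where f = J and k = N1] by (simp add: add.commute)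
  define V where "V = (\<Sum>k\<le>N. trm k) + J N / (2 * pi)"
  have "(\<lambda>n. V - J n / (2 * pi)) \<longlonglongrightarrow> V - 0 / (2 * pi)" by (intro tendsto_intros) (use J0 in auto)
  moreover have "\<forall>\<^sub>F n in sequentially. V - J n / (2 * pi) = (\<Sum>k\<le>n. trm k)"
    using eventually_ge_at_top[of N]
  proof eventually_elim
    case (elim n)
    thus ?case using const[of "n - N"] by (simp add: V_def algebra_simps)
  qed
  ultimately have "(\<lambda>n. \<Sum>k\<le>n. trm k) \<longlonglongrightarrow> V" by (auto dest: Lim_transform_eventually)
  hence "trm sums V" by (simp add: sums_def_le)
  thus ?thesis unfolding V_def J_def F_def trm_def[abs_def] .
qed

text \<open>The line \<open>Re s = N + 1/2\<close> together with the point masses at \<open>0, \<dots>, N\<close> (the residues of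
  \<open>\<Gamma>(-s)\<close> swept over when a contour is moved there), encoded as a single function of a real
  parameter: the masses are spread over the unit intervals between the two halves of the line.\<close>

definition res_point :: "nat \<Rightarrow> real \<Rightarrow> complex" where
  "res_point N t = (if t < 0 then mb_line (real N + 1/2) t
     else if t < real N + 1 then of_nat (nat \<lfloor>t\<rfloor>) else mb_line (real N + 1/2) (t - (real N + 1)))"

definition res_weight :: "nat \<Rightarrow> real \<Rightarrow> complex" where
  "res_weight N t = (if t < 0 \<or> t \<ge> real N + 1 then \<i> * Gamma (- res_point N t)
     else 2 * pi * \<i> * ((-1) ^ nat \<lfloor>t\<rfloor> / fact (nat \<lfloor>t\<rfloor>)))"

text \<open>Turning line and residues into one integral over the reals lets Fubini and product
  measures treat both alike. Translation by N + 1 rejoins the two halves of the line.\<close>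

lemma res_integral:
  fixes G :: "complex \<Rightarrow> complex"
  assumes L: "integrable lborel (\<lambda>t. Gamma (- mb_line (real N + 1/2) t) * G (mb_line (real N + 1/2) t))"
  shows "integrable lborel (\<lambda>t. res_weight N t * G (res_point N t))"
    and "(\<integral>t. res_weight N t * G (res_point N t) \<partial>lborel) =
      \<i> * (\<integral>t. Gamma (- mb_line (real N + 1/2) t) * G (mb_line (real N + 1/2) t) \<partial>lborel)
      + 2 * pi * \<i> * (\<Sum>k\<le>N. (-1) ^ k / fact k * G (of_nat k))"
proof -
  define l where "l t = \<i> * (Gamma (- mb_line (real N + 1/2) t) * G (mb_line (real N + 1/2) t))" for t
  define v where "v k = 2 * pi * \<i> * ((-1) ^ k / fact k * G (of_nat k))" for k
  have l: "integrable lborel l" unfolding l_def using L by (rule integrable_mult_right)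
  have l1: "integrable lborel (\<lambda>t. indicator {..<0} t *\<^sub>R l t)" "integrable lborel (\<lambda>t. indicator {0..} t *\<^sub>R l t)"
    by (intro integrable_mult_indicator l; simp)+
  have eq1: "indicator {0..} (- (real N + 1) + 1 * t) *\<^sub>R l (- (real N + 1) + 1 * t) = indicator {real N + 1..} t *\<^sub>R l (t - (real N + 1))" for t
    by (simp add: indicator_def) (simp add: algebra_simps)
  have l2: "integrable lborel (\<lambda>t. indicator {real N + 1..} t *\<^sub>R l (t - (real N + 1)))"
    using lborel_integrable_real_affine[OF l1(2), of 1 "- (real N + 1)"] unfolding eq1 by simp
  have l2': "(\<integral>t. indicator {real N + 1..} t *\<^sub>R l (t - (real N + 1)) \<partial>lborel) = (\<integral>t. indicator {0..} t *\<^sub>R l t \<partial>lborel)"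
    using lborel_integral_real_affine[of 1 "\<lambda>t. indicator {0..} t *\<^sub>R l t" "- (real N + 1)"] unfolding eq1 by simp
  have hb: "has_bochner_integral lborel (\<lambda>t. indicator {real k..<real k + 1} t *\<^sub>R v k) (v k)" for k
  proof -
    have "has_bochner_integral lborel (\<lambda>t. indicator {real k..<real k + 1} t *\<^sub>R v k) (measure lborel {real k..<real k + 1} *\<^sub>R v k)"
      by (intro has_bochner_integral_scaleR_left has_bochner_integral_real_indicator) auto
    thus ?thesis by simp
  qed
  have l3: "integrable lborel (\<lambda>t. \<Sum>k\<le>N. indicator {real k..<real k + 1} t *\<^sub>R v k)"
    by (intro Bochner_Integration.integrable_sum) (use hb in \<open>auto simp: has_bochner_integral_iff\<close>)
  have l3': "(\<integral>t. (\<Sum>k\<le>N. indicator {real k..<real k + 1} t *\<^sub>R v k) \<partial>lborel) = (\<Sum>k\<le>N. v k)"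
    using hb by (subst Bochner_Integration.integral_sum) (auto simp: has_bochner_integral_iff)
  have pw: "res_weight N t * G (res_point N t) = indicator {..<0} t *\<^sub>R l t + (\<Sum>k\<le>N. indicator {real k..<real k + 1} t *\<^sub>R v k)
      + indicator {real N + 1..} t *\<^sub>R l (t - (real N + 1))" for t
  proof -
    have mid: "(\<Sum>k\<le>N. indicator {real k..<real k + 1} t *\<^sub>R v k) = (if 0 \<le> t \<and> t < real N + 1 then v (nat \<lfloor>t\<rfloor>) else 0)"
    proof (cases "0 \<le> t \<and> t < real N + 1")
      case True
      have "indicator {real k..<real k + 1} t *\<^sub>R v k = (if k = nat \<lfloor>t\<rfloor> then v k else 0)" for k
      proof -
        have "real k \<le> t \<and> t < real k + 1 \<longleftrightarrow> k = nat \<lfloor>t\<rfloor>" using True by linarith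
        thus ?thesis by (auto simp: indicator_def)
      qed
      moreover have "nat \<lfloor>t\<rfloor> \<le> N" using True by linarith
      ultimately show ?thesis using True by simp
    next
      case False
      have "indicator {real k..<real k + 1} t *\<^sub>R v k = 0" if "k \<le> N" for k
        using False that by (auto simp: indicator_def)
      hence "(\<Sum>k\<le>N. indicator {real k..<real k + 1} t *\<^sub>R v k) = 0" by (intro sum.neutral) blast
      thus ?thesis using False by (simp only: if_False)
    qed
    consider "t < 0" | "0 \<le> t" "t < real N + 1" | "t \<ge> real N + 1" by linarith
    thus ?thesis
      by cases (simp_all add: mid, simp_all add: res_weight_def res_point_def l_def v_def indicator_def)
  qed
  show "integrable lborel (\<lambda>t. res_weight N t * G (res_point N t))"
    unfolding pw by (intro Bochner_Integration.integrable_add l1 l2 l3)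
  have "(\<integral>t. res_weight N t * G (res_point N t) \<partial>lborel) = (\<integral>t. indicator {..<0} t *\<^sub>R l t \<partial>lborel) + (\<Sum>k\<le>N. v k)
     + (\<integral>t. indicator {0..} t *\<^sub>R l t \<partial>lborel)"
    unfolding pw Bochner_Integration.integral_add[OF Bochner_Integration.integrable_add[OF l1(1) l3] l2]
      Bochner_Integration.integral_add[OF l1(1) l3] l2' l3' ..
  also have "\<dots> = (\<integral>t. indicator {..<0} t *\<^sub>R l t + indicator {0..} t *\<^sub>R l t \<partial>lborel) + (\<Sum>k\<le>N. v k)"
    using l1 by simp
  also have "(\<lambda>t. indicator {..<0} t *\<^sub>R l t + indicator {0..} t *\<^sub>R l t) = l"
    by (auto simp: indicator_def)
  finally show "(\<integral>t. res_weight N t * G (res_point N t) \<partial>lborel) =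
      \<i> * (\<integral>t. Gamma (- mb_line (real N + 1/2) t) * G (mb_line (real N + 1/2) t) \<partial>lborel)
      + 2 * pi * \<i> * (\<Sum>k\<le>N. (-1) ^ k / fact k * G (of_nat k))"
    by (simp add: l_def v_def sum_distrib_left)
qed

text \<open>The point masses are exactly the terms that the line at N + 1/2 has passed, so together
  they give the full series whatever N is.\<close>

lemma res_barnes:
  assumes x: "x > 0" and a: "- a < real N + 1/2"
  shows "integrable lborel (\<lambda>t. res_weight N t * barnes a b x (res_point N t))"
    and "(\<lambda>k. (-1) ^ k / fact k * barnes a b x (of_nat k)) sums
      ((\<integral>t. res_weight N t * barnes a b x (res_point N t) \<partial>lborel) / (2 * pi * \<i>))"
proof -
  note I = barnes_line_step(1)[OF x a, of b]
  show "integrable lborel (\<lambda>t. res_weight N t * barnes a b x (res_point N t))" by (rule res_integral(1)[OF I])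
  have "(\<integral>t. res_weight N t * barnes a b x (res_point N t) \<partial>lborel) / (2 * pi * \<i>) =
    (\<Sum>k\<le>N. (-1) ^ k / fact k * barnes a b x (of_nat k)) +
      (\<integral>t. Gamma (- mb_line (real N + 1/2) t) * barnes a b x (mb_line (real N + 1/2) t) \<partial>lborel) / (2 * pi)"
    unfolding res_integral(2)[OF I] by (simp add: field_simps)
  thus "(\<lambda>k. (-1) ^ k / fact k * barnes a b x (of_nat k)) sums
      ((\<integral>t. res_weight N t * barnes a b x (res_point N t) \<partial>lborel) / (2 * pi * \<i>))"
    using barnes_sums[OF x a, of b] by simp
qed

section \<open>Fubini with a product majorant, and measurability of the integrands\<close>

lemma (in pair_sigma_finite) Fubini_product_bound:
  fixes f :: "'a \<Rightarrow> 'b \<Rightarrow> complex" and u :: "'a \<Rightarrow> real" and v :: "'b \<Rightarrow> real"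
  assumes f: "case_prod f \<in> borel_measurable (M1 \<Otimes>\<^sub>M M2)"
    and u: "integrable M1 u" and v: "integrable M2 v"
    and bound: "\<And>x y. norm (f x y) \<le> u x * v y"
  shows "integrable (M1 \<Otimes>\<^sub>M M2) (case_prod f)"
    and "(\<integral>x. (\<integral>y. f x y \<partial>M2) \<partial>M1) = (\<integral>y. (\<integral>x. f x y \<partial>M1) \<partial>M2)"
proof -
  have um: "u \<in> borel_measurable M1" and vm: "v \<in> borel_measurable M2" using u v by auto
  have "integrable (M1 \<Otimes>\<^sub>M M2) (\<lambda>(x,y). u x * v y)"
  proof (rule Fubini_integrable)
    show "(\<lambda>(x,y). u x * v y) \<in> borel_measurable (M1 \<Otimes>\<^sub>M M2)" using um vm by measurable
    have "integrable M1 (\<lambda>x. norm (u x) * (\<integral>y. norm (v y) \<partial>M2))" using u by (intro integrable_mult_left) auto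
    thus "integrable M1 (\<lambda>x. \<integral>y. norm (case (x, y) of (x, y) \<Rightarrow> u x * v y) \<partial>M2)"
      by (simp add: abs_mult)
    show "AE x in M1. integrable M2 (\<lambda>y. case (x, y) of (x, y) \<Rightarrow> u x * v y)" using v by auto
  qed
  thus int: "integrable (M1 \<Otimes>\<^sub>M M2) (case_prod f)"
  proof (rule Bochner_Integration.integrable_bound[OF _ f])
    show "AE p in M1 \<Otimes>\<^sub>M M2. norm (case p of (x, y) \<Rightarrow> f x y) \<le> norm (case p of (x, y) \<Rightarrow> u x * v y)"
      using bound by (auto intro!: AE_I2 intro: order_trans[OF _ abs_ge_self])
  qed
  show "(\<integral>x. (\<integral>y. f x y \<partial>M2) \<partial>M1) = (\<integral>y. (\<integral>x. f x y \<partial>M1) \<partial>M2)"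
    using Fubini_integral[OF int] by simp
qed

lemma Gamma_borel_measurable [measurable]: "(Gamma :: complex \<Rightarrow> complex) \<in> borel_measurable borel"
proof -
  have "(rGamma :: complex \<Rightarrow> complex) \<in> borel_measurable borel"
    by (intro borel_measurable_continuous_onI continuous_intros)
  hence "(\<lambda>z::complex. inverse (rGamma z)) \<in> borel_measurable borel" by measurable
  thus ?thesis by (simp add: Gamma_def[abs_def])
qed

lemma rGamma_borel_measurable [measurable]: "(rGamma :: complex \<Rightarrow> complex) \<in> borel_measurable borel"
  by (intro borel_measurable_continuous_onI continuous_intros)

lemma mb_line_borel_measurable [measurable]: "mb_line C \<in> borel_measurable borel"
  unfolding mb_line_def[abs_def] Complex_eq by measurable

text \<open>\<open>Ln\<close> jumps across the negative axis, so measurability is obtained from an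
  explicit formula for each sign of the real base.\<close>

lemma of_real_powr_borel_measurable [measurable (raw)]:
  fixes f :: "'a \<Rightarrow> complex" and y :: "'a \<Rightarrow> real"
  assumes [measurable]: "f \<in> borel_measurable M" "y \<in> borel_measurable M"
  shows "(\<lambda>t. of_real (y t) powr f t) \<in> borel_measurable M"
proof -
  have "(of_real (y t) powr f t) = (if y t = 0 then 0 else if y t > 0 then exp (f t * of_real (ln (y t)))
      else exp (f t * (of_real (ln (- y t)) + \<i> * of_real pi)))" for t
  proof -
    have "Ln (of_real (y t)) = of_real (ln (- y t)) + \<i> * of_real pi" if "y t < 0"
    proof -
      have "Ln (of_real (- y t)) = of_real (ln (- y t))" using that by (subst Ln_of_real) auto
      moreover have "Ln (- of_real (- y t)) = Ln (of_real (- y t)) + \<i> * pi"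
        using that by (subst Ln_minus) auto
      ultimately show ?thesis by simp
    qed
    thus ?thesis by (auto simp: powr_def Ln_of_real)
  qed
  thus ?thesis by simp
qed

section \<open>The logarithm as a Mellin--Barnes integral\<close>

text \<open>Moving the line from 1/2 to 3/2 picks up the residue at 1, while the functional equation
  makes the integrand at s + 1 equal to - z times that at s. Hence (1 + z) J = 2 pi for the integral
  J. On Re s = 1/2 the product of the Gammas is pi / cosh (pi t).\<close>

lemma sech_line_integral:
  fixes z :: real
  assumes z: "z > 0"
  defines "F \<equiv> \<lambda>s. Gamma (1 - s) * (Gamma s * of_real z powr (s - 1))"
  shows "integrable lborel (\<lambda>t. F (mb_line (1/2) t))"
    and "(\<integral>t. F (mb_line (1/2) t) \<partial>lborel) = of_real (2 * pi / (1 + z))"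
proof -
  let ?g = "mb_line (1/2)"
  note g = mb_tail_line[of "1/2"]
  have left: "left_of ?g p" if "Re p < 1/2" for p
    using that by (intro left_of_base[OF g]) (auto simp: mb_line_def)
  have right: "right_of ?g p" if "Re p > 1/2" for p
    using that by (intro right_of_base[OF g]) (auto simp: mb_line_def)
  define L where "L = gpoles 0 (nat \<lceil>2 + \<bar>Re 0\<bar>\<rceil>)"
  have 1: "\<And>t. \<bar>Re (?g t)\<bar> < 2" by (auto simp: mb_line_def)
  have 2: "\<bar>3/2\<bar> < (2::real)" by auto
  have 3: "finite L" by (auto simp: L_def)
  have 4: "(\<lambda>s. Gamma s * of_real z powr (s - 1)) holomorphic_on {s. \<bar>Re s\<bar> < 2} - L"
  proof (intro holomorphic_intros)
    show "({s. \<bar>Re s\<bar> < 2} - L) \<inter> \<int>\<^sub>\<le>\<^sub>0 = {}" using gpoles_cover[of _ 2 0] by (auto simp: L_def)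
  qed
  have 5: "\<And>p. p \<in> L \<Longrightarrow> left_of ?g p \<and> Re p < 3/2" by (auto simp: L_def gpoles_def intro!: left)
  have 6: "\<And>k. k \<in> {0} \<Longrightarrow> right_of ?g (of_nat (1 + k)) \<and> real (1 + k) < 3/2" by (auto intro!: right)
  have 7: "\<And>k. k \<notin> {0} \<Longrightarrow> left_of ?g (of_nat (1 + k)) \<and> real (1 + k) < 3/2 \<or> right_of ?g (of_nat (1 + k)) \<and> real (1 + k) > 3/2"
    by (intro disjI2 conjI right) auto
  obtain A where A: "A > 0" "\<And>s. \<bar>Re s\<bar> \<le> 2 \<Longrightarrow> \<bar>Im s\<bar> \<ge> 1 \<Longrightarrow> norm (Gamma s :: complex) \<le> A * exp (- (5/4) * \<bar>Im s\<bar>)"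
    using Gamma_strip_bound[of 2] by auto
  have 8: "norm (Gamma s * of_real z powr (s - 1)) \<le> (A * exp (3 * \<bar>ln z\<bar>)) * exp \<bar>Im s\<bar>"
    if "\<bar>Re s\<bar> < 2" "\<bar>Im s\<bar> \<ge> 1" for s
  proof -
    have "norm (Gamma s) \<le> A * exp (- (5/4) * \<bar>Im s\<bar>)" using A(2)[of s] that by auto
    also have "\<dots> \<le> A * exp \<bar>Im s\<bar>" using A(1) by auto
    finally have "norm (Gamma s) \<le> A * exp \<bar>Im s\<bar>" .
    moreover have "norm (of_real z powr (s - 1) :: complex) \<le> exp (3 * \<bar>ln z\<bar>)"
    proof -
      have "norm (of_real z powr (s - 1) :: complex) = exp (Re (s - 1) * ln z)"
        using z by (simp add: norm_of_real_powr powr_def)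
      also have "Re (s - 1) * ln z \<le> \<bar>Re (s - 1) * ln z\<bar>" by (rule abs_ge_self)
      also have "\<dots> = \<bar>Re (s - 1)\<bar> * \<bar>ln z\<bar>" by (rule abs_mult)
      also have "\<dots> \<le> 3 * \<bar>ln z\<bar>" using that by (intro mult_right_mono) auto
      finally show ?thesis by simp
    qed
    ultimately have "norm (Gamma s * of_real z powr (s - 1)) \<le> (A * exp \<bar>Im s\<bar>) * exp (3 * \<bar>ln z\<bar>)"
      unfolding norm_mult using A(1) by (intro mult_mono) auto
    thus ?thesis by (simp add: mult_ac)
  qed
  note ks = kernel_shift[where d = 1 and Kn = "{0}" and Y = 1, OF g 1 2 3 4 5 6 7 8]
  have I: "integrable lborel (\<lambda>t. F (?g t) * vector_derivative ?g (at t))"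
    unfolding F_def using ks(1) by simp
  hence "integrable lborel (\<lambda>t. (F (?g t) * \<i>) * (- \<i>))"
    unfolding vector_derivative_mb_line by (rule integrable_mult_left)
  thus I': "integrable lborel (\<lambda>t. F (?g t))" by (simp add: mult.assoc)
  have "(\<integral>t. F (?g t) * \<i> \<partial>lborel) = \<i> * (\<integral>t. F (mb_line (3/2) t) \<partial>lborel) + 2 * pi * \<i>"
    unfolding F_def using ks(3) z by (simp add: vector_derivative_mb_line)
  also have "(\<integral>t. F (mb_line (3/2) t) \<partial>lborel) = (\<integral>t. - of_real z * F (?g t) \<partial>lborel)"
  proof (rule Bochner_Integration.integral_cong[OF refl])
    fix t :: real
    define s where "s = ?g t"
    have s: "mb_line (3/2) t = s + 1" by (simp add: s_def mb_line_def complex_eq_iff)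
    have n1: "s \<notin> \<int>\<^sub>\<le>\<^sub>0" by (auto simp: s_def mb_line_def elim!: nonpos_Ints_cases) (auto simp: complex_eq_iff)
    have "- s \<notin> \<int>\<^sub>\<le>\<^sub>0"
    proof
      assume "- s \<in> \<int>\<^sub>\<le>\<^sub>0"
      then obtain k :: nat where "s = of_nat k" by (auto elim!: nonpos_Ints_cases')
      hence "1/2 = real k" by (auto simp: s_def mb_line_def complex_eq_iff)
      hence "real (2 * k) = real 1" by simp
      hence "2 * k = 1" by (simp only: of_nat_eq_iff)
      thus False by presburger
    qed
    hence "Gamma (1 - s) = - s * Gamma (- s)" using Gamma_plus1[of "- s"] by simp
    moreover have "Gamma (s + 1) = s * Gamma s" using Gamma_plus1[OF n1] by simp
    moreover have "of_real z powr s = (of_real z :: complex) * of_real z powr (s - 1)" using z by (simp add: powr_diff)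
    ultimately show "F (mb_line (3/2) t) = - of_real z * F (?g t)"
      unfolding s unfolding s_def[symmetric] F_def by (simp add: algebra_simps)
  qed
  also have "\<dots> = - of_real z * (\<integral>t. F (?g t) \<partial>lborel)" by simp
  finally have "\<i> * ((1 + of_real z) * (\<integral>t. F (?g t) \<partial>lborel)) = \<i> * (2 * pi)" by (simp add: algebra_simps)
  hence "(1 + of_real z) * (\<integral>t. F (?g t) \<partial>lborel) = 2 * pi"
    by (simp only: mult_cancel_left) simp
  moreover have "1 + complex_of_real z \<noteq> 0" using z by (auto simp: complex_eq_iff)
  ultimately show "(\<integral>t. F (?g t) \<partial>lborel) = of_real (2 * pi / (1 + z))" by (simp add: field_simps)
qed

lemma powr_lebesgue_integral:
  fixes s :: complex and x :: real
  assumes "Re s > 0" "x > 0"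
  shows "(\<integral>y. indicator {0..x} y *\<^sub>R (of_real y powr (s - 1)) \<partial>lborel) = of_real x powr s / s"
    and "integrable lborel (\<lambda>y. indicator {0..x} y *\<^sub>R (y powr (Re s - 1)))"
proof -
  have "((\<lambda>t. complex_of_real t powr (s - 1)) has_integral (of_real x powr s / s - of_real 0 powr s / s)) {0..x}"
    using assms by (intro fundamental_theorem_of_calculus_interior)
      (auto intro!: continuous_intros derivative_eq_intros has_vector_derivative_real_field)
  hence hi: "((\<lambda>t. complex_of_real t powr (s - 1)) has_integral (of_real x powr s / s)) {0..x}" by simp
  have "(\<lambda>y. y powr (Re s - 1)) absolutely_integrable_on {0..x}"
    using assms integrable_on_powr_from_0[of "Re s - 1" x]
    by (intro nonnegative_absolutely_integrable_1) auto
  thus I: "integrable lborel (\<lambda>y. indicator {0..x} y *\<^sub>R (y powr (Re s - 1)))"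
    unfolding set_integrable_def by (subst (asm) integrable_completion) auto
  have "integrable lborel (\<lambda>y. indicator {0..x} y *\<^sub>R (complex_of_real y powr (s - 1)))"
  proof (rule Bochner_Integration.integrable_bound[OF I])
    show "AE y in lborel. norm (indicator {0..x} y *\<^sub>R (complex_of_real y powr (s - 1))) \<le> norm (indicator {0..x} y *\<^sub>R (y powr (Re s - 1)))"
    proof (rule AE_I2)
      fix y
      show "norm (indicator {0..x} y *\<^sub>R (complex_of_real y powr (s - 1))) \<le> norm (indicator {0..x} y *\<^sub>R (y powr (Re s - 1)))"
        by (cases "y = 0") (auto simp: indicator_def norm_of_real_powr)
    qed
  qed measurable
  hence "set_integrable lborel {0..x} (\<lambda>y. complex_of_real y powr (s - 1))" by (simp add: set_integrable_def)
  from set_borel_integral_eq_integral(2)[OF this] integral_unique[OF hi]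
  show "(\<integral>y. indicator {0..x} y *\<^sub>R (of_real y powr (s - 1)) \<partial>lborel) = of_real x powr s / s"
    by (simp add: set_lebesgue_integral_def)
qed

text \<open>As Gamma (s) / Gamma (1 + s) = 1 / s, the integrand is Gamma (1 - s) Gamma (s) x^s / s,
  and x^s / s is the integral of y^(s - 1) over [0, x]. Exchanging the integrals leaves 2 pi / (1 +
  y), whose primitive is the logarithm.\<close>

lemma ln_line_integral:
  assumes x: "x > 0"
  shows "(\<integral>t. Gamma (1 - mb_line (1/2) t) * (barnes 0 1 x (mb_line (1/2) t) * Gamma (mb_line (1/2) t)) \<partial>lborel)
     = of_real (2 * pi * ln (1 + x))"
proof -
  let ?g = "mb_line (1/2)"
  define K where "K t = Gamma (1 - ?g t) * Gamma (?g t)" for t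
  define f where "f t y = indicator {0..x} y *\<^sub>R (K t * of_real y powr (?g t - 1))" for t y
  have "integrable lborel K" using sech_line_integral(1)[of 1] by (simp add: K_def[abs_def])
  hence Kn: "integrable lborel (\<lambda>t. norm (K t))" by (rule integrable_norm)
  note P = powr_lebesgue_integral[of "Complex (1/2) 0" x]
  have V: "integrable lborel (\<lambda>y. indicator {0..x} y *\<^sub>R (y powr (-1/2)))" using P(2) x by simp
  have swap: "(\<integral>t. (\<integral>y. f t y \<partial>lborel) \<partial>lborel) = (\<integral>y. (\<integral>t. f t y \<partial>lborel) \<partial>lborel)"
  proof (rule lborel_pair.Fubini_product_bound(2)[OF _ Kn V])
    show "case_prod f \<in> borel_measurable (lborel \<Otimes>\<^sub>M lborel)"
      unfolding f_def[abs_def] K_def by measurable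
    show "norm (f t y) \<le> norm (K t) * indicator {0..x} y *\<^sub>R y powr (-1/2)" for t y
      by (cases "y = 0") (auto simp: f_def indicator_def norm_mult norm_of_real_powr mb_line_def)
  qed
  have inner: "(\<integral>y. f t y \<partial>lborel) = Gamma (1 - ?g t) * (barnes 0 1 x (?g t) * Gamma (?g t))" for t
  proof -
    have s0: "?g t \<notin> \<int>\<^sub>\<le>\<^sub>0" by (auto simp: mb_line_def elim!: nonpos_Ints_cases) (auto simp: complex_eq_iff)
    hence s1: "?g t \<noteq> 0" by auto
    have "(\<integral>y. f t y \<partial>lborel) = (\<integral>y. K t * (indicator {0..x} y *\<^sub>R of_real y powr (?g t - 1)) \<partial>lborel)"
      by (simp add: f_def mult_ac)
    also have "\<dots> = K t * (\<integral>y. indicator {0..x} y *\<^sub>R of_real y powr (?g t - 1) \<partial>lborel)"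
      by (rule integral_mult_right_zero)
    also have "\<dots> = K t * (of_real x powr ?g t / ?g t)"
      using powr_lebesgue_integral(1)[of "?g t" x] x by (simp add: mb_line_def)
    also have "rGamma (1 + ?g t) = 1 / (?g t * Gamma (?g t))"
      using Gamma_plus1[OF s0] by (simp add: rGamma_inverse_Gamma field_simps add.commute) 
    hence "K t * (of_real x powr ?g t / ?g t) = Gamma (1 - ?g t) * (barnes 0 1 x (?g t) * Gamma (?g t))"
      using s0 s1 by (simp add: K_def barnes_def Gamma_eq_zero_iff)
    finally show ?thesis .
  qed
  have "(\<integral>y. (\<integral>t. f t y \<partial>lborel) \<partial>lborel) = (\<integral>y. indicator {0..x} y *\<^sub>R of_real (2 * pi / (1 + y)) \<partial>lborel)"
  proof (rule integral_cong_AE)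
    show "(\<lambda>y. \<integral>t. f t y \<partial>lborel) \<in> borel_measurable lborel"
      unfolding f_def[abs_def] K_def by measurable
    \<comment> \<open>The point y = 0 is removed as a null set, the line integral being known for y
      > 0.\<close>
    show "AE y in lborel. (\<integral>t. f t y \<partial>lborel) = indicator {0..x} y *\<^sub>R complex_of_real (2 * pi / (1 + y))"
      using AE_lborel_singleton[of 0]
    proof eventually_elim
      case (elim y)
      show ?case
      proof (cases "y \<in> {0..x}")
        case True
        thus ?thesis using sech_line_integral(2)[of y] elim by (simp add: f_def K_def mult_ac)
      qed (auto simp: f_def)
    qed
  qed measurable
  also have "\<dots> = of_real (2 * pi * ln (1 + x))"
  proof -
    have hi: "((\<lambda>y. complex_of_real (2 * pi / (1 + y))) has_integral (of_real (2 * pi * ln (1 + x)) - of_real (2 * pi * ln (1 + 0)))) {0..x}"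
    proof (rule fundamental_theorem_of_calculus)
      fix y assume "y \<in> {0..x}"
      thus "((\<lambda>y. complex_of_real (2 * pi * ln (1 + y))) has_vector_derivative complex_of_real (2 * pi / (1 + y))) (at y within {0..x})"
        by (intro has_vector_derivative_of_real) (auto intro!: derivative_eq_intros simp: has_real_derivative_iff_has_vector_derivative[symmetric])
    qed (use x in auto)
    have "set_integrable lborel {0..x} (\<lambda>y. complex_of_real (2 * pi / (1 + y)))"
      unfolding set_integrable_def by (rule borel_integrable_compact) (auto intro!: continuous_intros simp: complex_eq_iff)
    from set_borel_integral_eq_integral(2)[OF this] integral_unique[OF hi] show ?thesis
      by (simp add: set_lebesgue_integral_def)
  qed
  finally show ?thesis using swap unfolding inner by simp
qed

section \<open>Confluent hypergeometric series\<close>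

lemma binomial_finite_difference:
  fixes b :: "nat \<Rightarrow> real"
  shows "(\<Sum>j\<le>Suc N. real (Suc N choose j) * (-1) ^ j * b j) =
    (\<Sum>j\<le>N. real (N choose j) * (-1) ^ j * b j) - (\<Sum>j\<le>N. real (N choose j) * (-1) ^ j * b (Suc j))"
proof -
  have "(\<Sum>j\<le>Suc N. real (Suc N choose j) * (-1) ^ j * b j) =
     b 0 + (\<Sum>j\<le>N. real (Suc N choose Suc j) * (-1) ^ Suc j * b (Suc j))"
    by (subst sum.atMost_Suc_shift) simp
  also have "\<dots> = b 0 + (\<Sum>j\<le>N. real (N choose Suc j) * (-1) ^ Suc j * b (Suc j)) -
      (\<Sum>j\<le>N. real (N choose j) * (-1) ^ j * b (Suc j))"
    by (simp add: sum_subtractf[symmetric] sum.distrib[symmetric] algebra_simps sum_negf)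
  also have "b 0 + (\<Sum>j\<le>N. real (N choose Suc j) * (-1) ^ Suc j * b (Suc j)) =
     (\<Sum>j\<le>Suc N. real (N choose j) * (-1) ^ j * b j)"
    by (subst sum.atMost_Suc_shift) simp
  also have "\<dots> = (\<Sum>j\<le>N. real (N choose j) * (-1) ^ j * b j)" by simp
  finally show ?thesis .
qed

text \<open>A form of the Chu-Vandermonde identity. The offset l is free because Pascal's rule
  splits the difference of order N + 1 into two of order N, at l and at l + 1.\<close>

lemma pochhammer_finite_difference:
  fixes m :: real
  shows "(\<Sum>j\<le>N. real (N choose j) * (-1) ^ j * (pochhammer m (l + j) / fact (l + j))) =
     pochhammer m l * pochhammer (1 - m) N / fact (l + N)"
proof (induction N arbitrary: l)
  case (Suc N)
  have "(\<Sum>j\<le>Suc N. real (Suc N choose j) * (-1) ^ j * (pochhammer m (l + j) / fact (l + j))) =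
     pochhammer m l * pochhammer (1 - m) N / fact (l + N)
     - pochhammer m (Suc l) * pochhammer (1 - m) N / fact (Suc l + N)"
    using binomial_finite_difference[of N "\<lambda>j. pochhammer m (l + j) / fact (l + j)"]
      Suc.IH[of l] Suc.IH[of "Suc l"] by simp
  also have "\<dots> = pochhammer m l * pochhammer (1 - m) (Suc N) / fact (l + Suc N)"
  proof -
    define p q r :: real where "p = pochhammer m l" and "q = pochhammer (1 - m) N" and "r = fact (l + N)"
    have r: "r > 0" by (simp add: r_def)
    have "real l + real N + 1 \<noteq> 0" by linarith
    hence "p * q / r - (p * (m + real l)) * q / ((real l + real N + 1) * r) =
        p * (q * (1 - m + real N)) / ((real l + real N + 1) * r)"
      using r by (simp add: divide_simps) (simp add: algebra_simps)
    thus ?thesis by (simp add: pochhammer_Suc p_def q_def r_def algebra_simps)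
  qed
  finally show ?case .
qed simp

text \<open>The coefficient of z^n in (1 + \<alpha> z)^(m - 1) (1 + \<delta> z)^(- m). Divided by n!
  it gives the Humbert series Phi2(1 - m, m; 1; - \<alpha> t, - \<delta> t), the origin of the
  parameters 1 - m and m of the first two Fox variables.\<close>

definition hcoeff :: "real \<Rightarrow> real \<Rightarrow> real \<Rightarrow> nat \<Rightarrow> real" where
  "hcoeff m \<alpha> \<delta> n = (\<Sum>k\<le>n. (pochhammer (1 - m) k / fact k * (- \<alpha>) ^ k) * (pochhammer m (n - k) / fact (n - k) * (- \<delta>) ^ (n - k)))"

text \<open>The left side is what multiplying the exponential series by Kummer's series produces.
  After the binomial expansion of (\<alpha> - \<delta>)^k, the sum over the surplus j = k - l is an
  alternating difference and collapses.\<close>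

lemma hcoeff_eq:
  "(\<Sum>k\<le>n. real (n choose k) * (- \<alpha>) ^ (n - k) * (pochhammer m k * (\<alpha> - \<delta>) ^ k / fact k)) = hcoeff m \<alpha> \<delta> n"
proof -
  define T where "T k l = real (n choose k) * (- \<alpha>) ^ (n - k) * (pochhammer m k / fact k) *
     (real (k choose l) * (- \<delta>) ^ l * \<alpha> ^ (k - l))" for k l
  have "(\<Sum>k\<le>n. real (n choose k) * (- \<alpha>) ^ (n - k) * (pochhammer m k * (\<alpha> - \<delta>) ^ k / fact k)) = (\<Sum>k\<le>n. \<Sum>l\<le>k. T k l)"
  proof (rule sum.cong)
    fix k assume "k \<in> {..n}"
    have "(\<alpha> - \<delta>) ^ k = (\<Sum>l\<le>k. real (k choose l) * (- \<delta>) ^ l * \<alpha> ^ (k - l))"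
      using binomial_ring[of "- \<delta>" \<alpha> k] by (simp add: atLeast0AtMost)
    thus "real (n choose k) * (- \<alpha>) ^ (n - k) * (pochhammer m k * (\<alpha> - \<delta>) ^ k / fact k) = (\<Sum>l\<le>k. T k l)"
      by (simp add: T_def sum_distrib_left sum_divide_distrib mult_ac)
  qed simp
  also have "\<dots> = (\<Sum>(k, l)\<in>(SIGMA k:{..n}. {..k}). T k l)" by (simp add: sum.Sigma)
  also have "\<dots> = (\<Sum>(l, j)\<in>(SIGMA l:{..n}. {..n - l}). T (l + j) l)"
    by (rule sum.reindex_bij_witness[of _ "\<lambda>(l, j). (l + j, l)" "\<lambda>(k, l). (l, k - l)"]) auto
  also have "\<dots> = (\<Sum>l\<le>n. \<Sum>j\<le>n - l. T (l + j) l)" by (simp add: sum.Sigma)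
  also have "\<dots> = (\<Sum>l\<le>n. (pochhammer (1 - m) (n - l) / fact (n - l) * (- \<alpha>) ^ (n - l)) * (pochhammer m l / fact l * (- \<delta>) ^ l))"
  proof (rule sum.cong)
    fix l assume "l \<in> {..n}"
    hence l: "l \<le> n" by simp
    have "T (l + j) l = (real (n choose l) * (- \<delta>) ^ l * (- \<alpha>) ^ (n - l)) *
        (real (n - l choose j) * (-1) ^ j * (pochhammer m (l + j) / fact (l + j)))" if j: "j \<le> n - l" for j
    proof -
      have e1: "real (n choose (l + j)) * real ((l + j) choose l) = real (n choose l) * real (n - l choose j)"
        using choose_mult[of l "l + j" n] j l by (simp flip: of_nat_mult)
      have e2: "(- \<alpha>) ^ (n - (l + j)) * \<alpha> ^ j = (-1) ^ j * (- \<alpha>) ^ (n - l)"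
      proof -
        have "\<alpha> ^ j = (-1) ^ j * (- \<alpha>) ^ j" by (simp flip: power_mult_distrib)
        hence "(- \<alpha>) ^ (n - (l + j)) * \<alpha> ^ j = (-1) ^ j * ((- \<alpha>) ^ (n - (l + j)) * (- \<alpha>) ^ j)" by simp
        also have "(- \<alpha>) ^ (n - (l + j)) * (- \<alpha>) ^ j = (- \<alpha>) ^ (n - l)"
          using j l by (simp flip: power_add)
        finally show ?thesis .
      qed
      have "T (l + j) l = (real (n choose (l + j)) * real ((l + j) choose l)) * ((- \<alpha>) ^ (n - (l + j)) * \<alpha> ^ j)
         * (- \<delta>) ^ l * (pochhammer m (l + j) / fact (l + j))"
        by (simp add: T_def)
      thus ?thesis unfolding e1 e2 by simp
    qed
    hence "(\<Sum>j\<le>n - l. T (l + j) l) = (real (n choose l) * (- \<delta>) ^ l * (- \<alpha>) ^ (n - l)) *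
        (\<Sum>j\<le>n - l. real (n - l choose j) * (-1) ^ j * (pochhammer m (l + j) / fact (l + j)))"
      by (simp add: sum_distrib_left)
    also have "(\<Sum>j\<le>n - l. real (n - l choose j) * (-1) ^ j * (pochhammer m (l + j) / fact (l + j))) =
        pochhammer m l * pochhammer (1 - m) (n - l) / fact n"
      unfolding pochhammer_finite_difference using l by simp
    finally show "(\<Sum>j\<le>n - l. T (l + j) l) = (pochhammer (1 - m) (n - l) / fact (n - l) * (- \<alpha>) ^ (n - l)) * (pochhammer m l / fact l * (- \<delta>) ^ l)"
      using l by (simp add: binomial_fact field_simps)
  qed simp
  also have "\<dots> = hcoeff m \<alpha> \<delta> n" unfolding hcoeff_def
    by (rule sum.reindex_bij_witness[of _ "\<lambda>l. n - l" "\<lambda>l. n - l"]) auto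
  finally show ?thesis .
qed

lemma summable_norm_1F1:
  fixes m z :: real
  shows "summable (\<lambda>k. norm (pochhammer m k / (fact k)\<^sup>2 * z ^ k))"
proof (rule summable_ratio_test[of "1/2" "nat \<lceil>2 * \<bar>z\<bar> * (\<bar>m\<bar> + 1)\<rceil>"])
  fix n assume "n \<ge> nat \<lceil>2 * \<bar>z\<bar> * (\<bar>m\<bar> + 1)\<rceil>"
  hence n: "real n \<ge> 2 * \<bar>z\<bar> * (\<bar>m\<bar> + 1)" by linarith
  have "\<bar>m + real n\<bar> * \<bar>z\<bar> \<le> (1/2) * (real n + 1)\<^sup>2"
  proof -
    have "\<bar>m + real n\<bar> \<le> \<bar>m\<bar> + real n" by simp
    also have "\<dots> \<le> (\<bar>m\<bar> + 1) * (real n + 1)" by (simp add: algebra_simps)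
    finally have "\<bar>m + real n\<bar> \<le> (\<bar>m\<bar> + 1) * (real n + 1)" .
    hence "\<bar>m + real n\<bar> * \<bar>z\<bar> \<le> (\<bar>m\<bar> + 1) * (real n + 1) * \<bar>z\<bar>" by (intro mult_right_mono) auto
    also have "\<dots> = (1/2) * (2 * \<bar>z\<bar> * (\<bar>m\<bar> + 1)) * (real n + 1)" by simp
    also have "\<dots> \<le> (1/2) * (real n + 1) * (real n + 1)" using n by (intro mult_right_mono mult_left_mono) auto
    finally show ?thesis by (simp add: power2_eq_square)
  qed
  hence "\<bar>m + real n\<bar> * \<bar>z\<bar> / (real n + 1)\<^sup>2 \<le> 1/2" by (simp add: field_simps)
  hence "(\<bar>m + real n\<bar> * \<bar>z\<bar> / (real n + 1)\<^sup>2) * norm (pochhammer m n / (fact n)\<^sup>2 * z ^ n) \<le> 1/2 * norm (pochhammer m n / (fact n)\<^sup>2 * z ^ n)"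
    by (intro mult_right_mono) auto
  moreover have "norm (pochhammer m (Suc n) / (fact (Suc n))\<^sup>2 * z ^ Suc n) =
      (\<bar>m + real n\<bar> * \<bar>z\<bar> / (real n + 1)\<^sup>2) * norm (pochhammer m n / (fact n)\<^sup>2 * z ^ n)"
    by (simp add: pochhammer_Suc abs_mult power_mult_distrib add.commute mult_ac)
  ultimately show "norm (norm (pochhammer m (Suc n) / (fact (Suc n))\<^sup>2 * z ^ Suc n)) \<le> 1/2 * norm (norm (pochhammer m n / (fact n)\<^sup>2 * z ^ n))"
    by simp
qed simp

lemma hyp1F1_1: "hyp1F1 m 1 z = (\<Sum>k. pochhammer m k / (fact k)\<^sup>2 * z ^ k)"
  unfolding hyp1F1_def by (simp add: pochhammer_fact[symmetric] power2_eq_square mult_ac)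

lemma exp_hyp1F1_sums:
  "(\<lambda>n. hcoeff m \<alpha> \<delta> n / fact n * t ^ n) sums (exp (- \<alpha> * t) * hyp1F1 m 1 ((\<alpha> - \<delta>) * t))"
proof -
  define p where "p k = (- \<alpha> * t) ^ k / fact k" for k
  define q where "q k = pochhammer m k / (fact k)\<^sup>2 * ((\<alpha> - \<delta>) * t) ^ k" for k
  have "summable (\<lambda>k. norm (p k))" unfolding p_def
    using summable_norm_exp[of "- \<alpha> * t"] by (simp add: divide_inverse mult.commute)
  moreover have "summable (\<lambda>k. norm (q k))" unfolding q_def by (rule summable_norm_1F1)
  ultimately have "(\<lambda>n. \<Sum>k\<le>n. q k * p (n - k)) sums ((\<Sum>k. q k) * (\<Sum>k. p k))"
    by (intro Cauchy_product_sums)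
  moreover have "(\<Sum>k. p k) = exp (- \<alpha> * t)" unfolding p_def exp_def by (simp add: divide_inverse mult.commute)
  moreover have "(\<Sum>k. q k) = hyp1F1 m 1 ((\<alpha> - \<delta>) * t)" by (simp add: q_def hyp1F1_1)
  moreover have "(\<Sum>k\<le>n. q k * p (n - k)) = hcoeff m \<alpha> \<delta> n / fact n * t ^ n" for n
  proof -
    have "(\<Sum>k\<le>n. q k * p (n - k)) = (\<Sum>k\<le>n. (t ^ n / fact n) * (real (n choose k) * (- \<alpha>) ^ (n - k) * (pochhammer m k * (\<alpha> - \<delta>) ^ k / fact k)))"
    proof (rule sum.cong)
      fix k assume "k \<in> {..n}"
      hence k: "k \<le> n" by simp
      have "t ^ n = t ^ k * t ^ (n - k)" using k by (simp flip: power_add)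
      thus "q k * p (n - k) = (t ^ n / fact n) * (real (n choose k) * (- \<alpha>) ^ (n - k) * (pochhammer m k * (\<alpha> - \<delta>) ^ k / fact k))"
        unfolding q_def p_def power_mult_distrib binomial_fact[OF k] by (simp add: power2_eq_square field_simps)
    qed simp
    also have "\<dots> = (t ^ n / fact n) * hcoeff m \<alpha> \<delta> n" unfolding hcoeff_eq[symmetric] by (rule sum_distrib_left[symmetric])
    finally show ?thesis by simp
  qed
  ultimately show ?thesis by (simp add: mult.commute)
qed

text \<open>Kummer's transformation is the case \<delta> = 0, in which only the term k = n of
  \<open>hcoeff\<close> survives.\<close>

lemma hyp1F1_Kummer:
  "exp (- \<alpha> * t) * hyp1F1 m 1 (\<alpha> * t) = (\<Sum>n. pochhammer (1 - m) n / (fact n)\<^sup>2 * (- \<alpha> * t) ^ n)"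
proof -
  have "hcoeff m \<alpha> 0 n = pochhammer (1 - m) n / fact n * (- \<alpha>) ^ n" for n
  proof -
    have "hcoeff m \<alpha> 0 n = (\<Sum>k\<le>n. if k = n then pochhammer (1 - m) n / fact n * (- \<alpha>) ^ n else 0)"
      unfolding hcoeff_def by (intro sum.cong) (auto simp: power_0_left)
    thus ?thesis by simp
  qed
  hence "hcoeff m \<alpha> 0 n / fact n * t ^ n = pochhammer (1 - m) n / (fact n)\<^sup>2 * (- \<alpha> * t) ^ n" for n
    unfolding power_mult_distrib by (simp add: power2_eq_square)
  with exp_hyp1F1_sums[of m \<alpha> 0 t] show ?thesis by (simp add: sums_iff)
qed

text \<open>Termwise integration in the form of differentiation: \<open>c\<close> is the series with
  \<open>diffs c\<close> equal to the known expansion, and it converges because integrating only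
  divides coefficients by n + 1.\<close>

lemma exp_hyp1F1_integral:
  fixes m \<alpha> \<delta> x :: real
  assumes "x \<ge> 0"
  shows "((\<lambda>t. exp (- \<alpha> * t) * hyp1F1 m 1 ((\<alpha> - \<delta>) * t)) has_integral (\<Sum>n. hcoeff m \<alpha> \<delta> n / fact (Suc n) * x ^ Suc n)) {0..x}"
    and "summable (\<lambda>n. hcoeff m \<alpha> \<delta> n / fact (Suc n) * x ^ Suc n)"
    and "continuous_on UNIV (\<lambda>t. exp (- \<alpha> * t) * hyp1F1 m 1 ((\<alpha> - \<delta>) * t))"
proof -
  define c where "c n = (case n of 0 \<Rightarrow> 0 | Suc k \<Rightarrow> hcoeff m \<alpha> \<delta> k / fact (Suc k))" for n
  define d where "d n = hcoeff m \<alpha> \<delta> n / fact n" for n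
  have diffs: "diffs c = d" by (auto simp: diffs_def c_def d_def fun_eq_iff)
  have sd: "summable (\<lambda>n. d n * y ^ n)" for y unfolding d_def using exp_hyp1F1_sums by (blast intro: sums_summable)
  have sdn: "summable (\<lambda>n. norm (d n * y ^ n))" for y
    by (rule powser_insidea[OF sd[of "\<bar>y\<bar> + 1"]]) simp
  have sc: "summable (\<lambda>n. c n * y ^ n)" for y
  proof -
    have "summable (\<lambda>n. c (Suc n) * y ^ Suc n)"
    proof (rule summable_comparison_test)
      show "summable (\<lambda>n. norm (d n * y ^ n) * \<bar>y\<bar>)" by (intro summable_mult2 sdn)
      have "norm (c (Suc n) * y ^ Suc n) \<le> norm (d n * y ^ n) * \<bar>y\<bar>" for n
      proof -
        have "norm (c (Suc n) * y ^ Suc n) = (norm (d n * y ^ n) * \<bar>y\<bar>) / real (Suc n)"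
          by (simp add: c_def d_def abs_mult mult_ac)
        also have "\<dots> \<le> (norm (d n * y ^ n) * \<bar>y\<bar>) / 1" by (intro divide_left_mono) auto
        finally show ?thesis by simp
      qed
      thus "\<exists>N. \<forall>n\<ge>N. norm (c (Suc n) * y ^ Suc n) \<le> norm (d n * y ^ n) * \<bar>y\<bar>" by blast
    qed
    thus ?thesis by (subst (asm) summable_Suc_iff)
  qed
  define P where "P y = (\<Sum>n. c n * y ^ n)" for y
  have deriv: "(P has_real_derivative (\<Sum>n. d n * y ^ n)) (at y)" for y
    unfolding P_def[abs_def] diffs[symmetric] by (rule termdiffs_strong_converges_everywhere[OF sc])
  have val: "(\<Sum>n. d n * y ^ n) = exp (- \<alpha> * y) * hyp1F1 m 1 ((\<alpha> - \<delta>) * y)" for y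
    unfolding d_def using exp_hyp1F1_sums[of m \<alpha> \<delta> y] by (simp add: sums_iff)
  have Px: "P y = (\<Sum>n. hcoeff m \<alpha> \<delta> n / fact (Suc n) * y ^ Suc n)" for y
  proof -
    have "P y = c 0 + (\<Sum>n. c (Suc n) * y ^ Suc n)"
      unfolding P_def using suminf_split_head[OF sc[of y]] by simp
    thus ?thesis by (simp add: c_def)
  qed
  have "((\<lambda>y. \<Sum>n. d n * y ^ n) has_integral (P x - P 0)) {0..x}"
    using assms deriv by (intro fundamental_theorem_of_calculus)
      (auto simp: has_real_derivative_iff_has_vector_derivative[symmetric] intro: has_field_derivative_at_within)
  moreover have "P 0 = 0" by (simp add: Px)
  ultimately show "((\<lambda>t. exp (- \<alpha> * t) * hyp1F1 m 1 ((\<alpha> - \<delta>) * t)) has_integral (\<Sum>n. hcoeff m \<alpha> \<delta> n / fact (Suc n) * x ^ Suc n)) {0..x}"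
    by (simp add: val Px)
  have "summable (\<lambda>n. c (Suc n) * x ^ Suc n)" using sc[of x] by (subst summable_Suc_iff)
  thus "summable (\<lambda>n. hcoeff m \<alpha> \<delta> n / fact (Suc n) * x ^ Suc n)" by (simp add: c_def)
  have "isCont (\<lambda>y. \<Sum>n. d n * y ^ n) y" for y
    by (rule isCont_powser[OF sd[of "\<bar>y\<bar> + 1"]]) simp
  thus "continuous_on UNIV (\<lambda>t. exp (- \<alpha> * t) * hyp1F1 m 1 ((\<alpha> - \<delta>) * t))"
    unfolding val by (simp add: continuous_on_eq_continuous_at)
qed

section \<open>Double series and the coupled pair of Barnes integrals\<close>

lemma double_series_diagonal:
  fixes f :: "nat \<Rightarrow> nat \<Rightarrow> complex" and u v :: "nat \<Rightarrow> real"
  assumes u: "summable u" "\<And>k. u k \<ge> 0" and v: "summable v" "\<And>k. v k \<ge> 0"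
    and f: "\<And>k l. norm (f k l) \<le> u k * v l"
  shows "(\<lambda>n. \<Sum>k\<le>n. f k (n - k)) sums (\<Sum>k. \<Sum>l. f k l)"
proof -
  have uS: "u summable_on UNIV" and vS: "v summable_on UNIV"
    using u v by (auto intro!: norm_summable_imp_summable_on)
  have "(\<lambda>p. norm ((\<lambda>(k, l). u k * v l) p)) summable_on (UNIV \<times> UNIV)"
  proof (subst Infinite_Sum.abs_summable_on_Sigma_iff, intro conjI ballI)
    fix k :: nat
    show "(\<lambda>l. norm ((\<lambda>(k, l). u k * v l) (k, l))) summable_on UNIV"
      using u(2) v(2) by (simp add: abs_mult summable_on_cmult_right vS)
  next
    have "(\<lambda>k. norm (infsum (\<lambda>l. norm ((\<lambda>(k, l). u k * v l) (k, l))) UNIV)) = (\<lambda>k. u k * infsum v UNIV)"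
      using u(2) v(2) by (simp add: infsum_cmult_right' abs_mult infsum_nonneg)
    thus "(\<lambda>k. norm (infsum (\<lambda>l. norm ((\<lambda>(k, l). u k * v l) (k, l))) UNIV)) summable_on UNIV"
      using uS by (simp only:) (simp add: summable_on_cmult_left)
  qed
  hence "(\<lambda>p. norm ((\<lambda>(k, l). f k l) p)) summable_on (UNIV \<times> UNIV)"
    by (rule Infinite_Sum.abs_summable_on_comparison_test) (use f u(2) v(2) in \<open>auto simp: abs_mult\<close>)
  hence "(\<lambda>(k, l). f k l) summable_on (UNIV \<times> UNIV)" by (rule Infinite_Sum.abs_summable_summable)
  then obtain S where S: "((\<lambda>(k, l). f k l) has_sum S) (UNIV \<times> UNIV)" by (auto simp: summable_on_def)
  have "((\<lambda>k. \<Sum>l. f k l) has_sum S) UNIV"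
  proof (rule has_sum_SigmaD[OF S])
    fix k :: nat
    have "summable (\<lambda>l. norm (f k l))"
      by (rule summable_comparison_test[OF _ summable_mult[OF v(1), of "u k"]]) (use f in auto)
    thus "((\<lambda>l. case (k, l) of (k, l) \<Rightarrow> f k l) has_sum (\<Sum>l. f k l)) UNIV"
      by (auto intro!: norm_summable_imp_has_sum summable_sums dest: summable_norm_cancel)
  qed
  hence 1: "(\<lambda>k. \<Sum>l. f k l) sums S" by (rule has_sum_imp_sums)
  have "((\<lambda>(n, k). f k (n - k)) has_sum S) (SIGMA n:UNIV. {..n})"
    using S by (subst (asm) has_sum_reindex_bij_witness[of _ "\<lambda>(n, k). (k, n - k)" "\<lambda>(k, l). (k + l, k)"
        "SIGMA n:UNIV. {..n}" "\<lambda>(n, k). f k (n - k)" _ S]) auto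
  hence "((\<lambda>n. \<Sum>k\<le>n. f k (n - k)) has_sum S) UNIV"
    by (rule has_sum_SigmaD) (auto intro!: has_sum_finite)
  hence 2: "(\<lambda>n. \<Sum>k\<le>n. f k (n - k)) sums S" by (rule has_sum_imp_sums)
  from 1 2 show ?thesis by (simp add: sums_iff)
qed

lemma barnes_of_nat:
  assumes "a \<notin> \<int>\<^sub>\<le>\<^sub>0"  "x > 0"
  shows "barnes a b x (of_nat k) = of_real (Gamma a * pochhammer a k * x ^ k) * rGamma (b + of_nat k)"
proof -
  have "Gamma (of_real a + of_nat k :: complex) = of_real (Gamma (a + real k))"
    by (simp add: Gamma_complex_of_real[symmetric] del: Gamma_complex_of_real)
  also have "Gamma (a + real k) = Gamma a * pochhammer a k"
    using assms(1) by (simp add: pochhammer_Gamma Gamma_eq_zero_iff)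
  finally have "Gamma (of_real a + of_nat k :: complex) = of_real (Gamma a * pochhammer a k)" .
  moreover have "(of_real x :: complex) powr (of_nat k) = of_real (x ^ k)"
    using assms(2) by (simp add: powr_nat)
  ultimately show ?thesis by (simp add: barnes_def)
qed

lemma rGamma_of_nat_Suc: "rGamma (1 + of_nat k :: complex) = 1 / fact k"
  by (simp add: rGamma_inverse_Gamma Gamma_fact inverse_eq_divide)

text \<open>With b = 1 the reciprocal Gamma at k is 1 / k!, which supplies the second factorial of
  the series 1F1(a; 1; - x).\<close>

lemma res_1F1:
  assumes a: "a \<notin> \<int>\<^sub>\<le>\<^sub>0" "- a < real N + 1/2" and x: "x > 0"
  shows "(\<integral>t. res_weight N t * barnes a 1 x (res_point N t) \<partial>lborel) =
     2 * pi * \<i> * of_real (Gamma a * (\<Sum>k. pochhammer a k / (fact k)\<^sup>2 * (- x) ^ k))"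
proof -
  have "(-1) ^ k / fact k * barnes a 1 x (of_nat k) = of_real (Gamma a * (pochhammer a k / (fact k)\<^sup>2 * (- x) ^ k))" for k
    unfolding barnes_of_nat[OF a(1) x] rGamma_of_nat_Suc
    by (simp add: power2_eq_square power_minus[of x])
  moreover have "(\<lambda>k. complex_of_real (Gamma a * (pochhammer a k / (fact k)\<^sup>2 * (- x) ^ k))) sums
      of_real (Gamma a * (\<Sum>k. pochhammer a k / (fact k)\<^sup>2 * (- x) ^ k))"
    by (intro sums_of_real sums_mult summable_sums summable_norm_cancel[OF summable_norm_1F1])
  ultimately have "(\<integral>t. res_weight N t * barnes a 1 x (res_point N t) \<partial>lborel) / (2 * pi * \<i>) =
      of_real (Gamma a * (\<Sum>k. pochhammer a k / (fact k)\<^sup>2 * (- x) ^ k))"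
    using res_barnes(2)[OF x a(2), of 1] by (metis (no_types, lifting) sums_unique2 sums_cong)
  thus ?thesis by (simp add: field_simps)
qed

lemma Re_res_point: "0 \<le> Re (res_point N t)" "Re (res_point N t) \<le> real N + 1/2"
proof -
  have "real (nat \<lfloor>t\<rfloor>) \<le> real N" if "0 \<le> t" "t < real N + 1"
  proof -
    have "\<lfloor>t\<rfloor> \<le> int N" using that by linarith
    thus ?thesis using that by simp
  qed
  thus "0 \<le> Re (res_point N t)" "Re (res_point N t) \<le> real N + 1/2"
    by (auto simp: res_point_def mb_line_def)
qed

text \<open>Each factor 2 + s + j has modulus at least 1 + j. The gain of 1 / k! makes the sum over
  k converge against one majorant in the other variable.\<close>

lemma norm_rGamma_shift:
  assumes "Re s \<ge> -1"
  shows "norm (rGamma (2 + s + of_nat k)) \<le> norm (rGamma (2 + s)) / fact k"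
proof -
  have "fact k = (\<Prod>j=0..<k. 1 + real j)" by (simp add: pochhammer_fact pochhammer_prod)
  also have "\<dots> \<le> (\<Prod>j=0..<k. norm (2 + s + of_nat j))"
  proof (intro prod_mono conjI)
    fix j
    show "1 + real j \<le> norm (2 + s + of_nat j)"
      using complex_Re_le_cmod[of "2 + s + of_nat j"] assms by simp
  qed auto
  also have "\<dots> = norm (pochhammer (2 + s) k)" by (simp add: pochhammer_prod prod_norm)
  finally have "fact k * norm (rGamma (2 + s + of_nat k)) \<le> norm (pochhammer (2 + s) k) * norm (rGamma (2 + s + of_nat k))"
    by (intro mult_right_mono) auto
  also have "\<dots> = norm (rGamma (2 + s))"
    using pochhammer_rGamma[of "2 + s" k] by (simp add: norm_mult)
  finally show ?thesis by (simp add: field_simps)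
qed

lemma res_point_measurable [measurable]: "res_point N \<in> borel_measurable borel"
  unfolding res_point_def[abs_def] by measurable

lemma res_weight_measurable [measurable]: "res_weight N \<in> borel_measurable borel"
  unfolding res_weight_def[abs_def] by measurable

text \<open>The variables are coupled only through 1 / Gamma (2 + s0 + s1). Summing the inner
  integral to a series in k turns this into 1 / Gamma (2 + k + s1), again a Barnes integrand, now
  with b = 2 + k. A second summation gives 1 / (k + l + 1)!, and collecting k + l = n yields the
  series of the distribution function.\<close>

lemma res_double:
  assumes a0: "a0 \<notin> \<int>\<^sub>\<le>\<^sub>0" "- a0 < real N + 1/2" and a1: "a1 \<notin> \<int>\<^sub>\<le>\<^sub>0" "- a1 < real N + 1/2"
    and x: "x > 0" and y: "y > 0"
  shows "(\<integral>t1. res_weight N t1 * (Gamma (of_real a1 + res_point N t1) * of_real y powr res_point N t1) *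
       (\<integral>t0. res_weight N t0 * barnes a0 (2 + res_point N t1) x (res_point N t0) \<partial>lborel) \<partial>lborel) =
    (2 * pi * \<i>)\<^sup>2 * of_real (Gamma a0 * Gamma a1 *
      (\<Sum>n. (\<Sum>k\<le>n. (pochhammer a0 k / fact k * (- x) ^ k) * (pochhammer a1 (n - k) / fact (n - k) * (- y) ^ (n - k))) / fact (Suc n)))"
proof -
  define c where "c k = Gamma a0 * (pochhammer a0 k / fact k * (- x) ^ k)" for k
  define d where "d k = Gamma a1 * (pochhammer a1 k / fact k * (- y) ^ k)" for k
  define W where "W t = res_weight N t * (Gamma (of_real a1 + res_point N t) * of_real y powr res_point N t)" for t
  define f where "f k t = W t * (of_real (c k) * rGamma (2 + res_point N t + of_nat k))" for k t
  have sum_c: "summable (\<lambda>k. \<bar>c k\<bar> / fact k)" and sum_d: "summable (\<lambda>k. \<bar>d k\<bar> / fact k)"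
  proof -
    have "\<bar>c k\<bar> / fact k = \<bar>Gamma a0\<bar> * norm (pochhammer a0 k / (fact k)\<^sup>2 * (- x) ^ k)"
      "\<bar>d k\<bar> / fact k = \<bar>Gamma a1\<bar> * norm (pochhammer a1 k / (fact k)\<^sup>2 * (- y) ^ k)" for k
      by (simp_all add: c_def d_def abs_mult power2_eq_square)
    thus "summable (\<lambda>k. \<bar>c k\<bar> / fact k)" "summable (\<lambda>k. \<bar>d k\<bar> / fact k)"
      using summable_mult[OF summable_norm_1F1] by simp_all
  qed
  have inner: "(\<integral>t0. res_weight N t0 * barnes a0 (2 + res_point N t1) x (res_point N t0) \<partial>lborel) =
      2 * pi * \<i> * (\<Sum>k. of_real (c k) * rGamma (2 + res_point N t1 + of_nat k))" for t1
  proof -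
    have eq: "(-1) ^ k / fact k * barnes a0 (2 + res_point N t1) x (of_nat k) = of_real (c k) * rGamma (2 + res_point N t1 + of_nat k)" for k
      unfolding barnes_of_nat[OF a0(1) x] by (simp add: c_def power_minus[of x])
    from res_barnes(2)[OF x a0(2), of "2 + res_point N t1"]
    show ?thesis unfolding eq by (simp add: sums_iff field_simps)
  qed
  have fk: "f k t = of_real (c k) * (res_weight N t * barnes a1 (2 + of_nat k) y (res_point N t))" for k t
    by (simp add: f_def W_def barnes_def add_ac)
  have fint: "integrable lborel (f k)" for k
    unfolding fk[abs_def] by (intro integrable_mult_right res_barnes(1)[OF y a1(2)])
  have fval: "(\<integral>t. f k t \<partial>lborel) = 2 * pi * \<i> * (\<Sum>l. of_real (c k * d l / fact (Suc (k + l))))" for k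
  proof -
    have "(-1) ^ l / fact l * barnes a1 (2 + of_nat k) y (of_nat l) = of_real (d l / fact (Suc (k + l)))" for l
    proof -
      have "rGamma (2 + of_nat k + of_nat l :: complex) = rGamma (1 + of_nat (Suc (k + l)))" by (simp add: add_ac)
      also have "\<dots> = 1 / fact (Suc (k + l))" by (rule rGamma_of_nat_Suc)
      finally show ?thesis unfolding barnes_of_nat[OF a1(1) y] by (simp add: d_def power_minus[of y])
    qed
    with res_barnes(2)[OF y a1(2), of "2 + of_nat k"]
    have s: "(\<lambda>l. of_real (d l / fact (Suc (k + l)))) sums
       ((\<integral>t. res_weight N t * barnes a1 (2 + of_nat k) y (res_point N t) \<partial>lborel) / (2 * pi * \<i>))" by simp
    have "(\<lambda>l. of_real (c k) * of_real (d l / fact (Suc (k + l)))) sums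
       (of_real (c k) * ((\<integral>t. res_weight N t * barnes a1 (2 + of_nat k) y (res_point N t) \<partial>lborel) / (2 * pi * \<i>)))"
      by (rule sums_mult[OF s])
    hence "(\<Sum>l. of_real (c k * d l / fact (Suc (k + l)))) =
       (of_real (c k) * ((\<integral>t. res_weight N t * barnes a1 (2 + of_nat k) y (res_point N t) \<partial>lborel) / (2 * pi * \<i>)))"
      unfolding sums_iff by (simp only: of_real_mult times_divide_eq_right[symmetric])
    moreover have "(\<integral>t. f k t \<partial>lborel) = of_real (c k) * (\<integral>t. res_weight N t * barnes a1 (2 + of_nat k) y (res_point N t) \<partial>lborel)"
      unfolding fk by (rule integral_mult_right_zero)
    ultimately show ?thesis by simp
  qed
  define D where "D t = norm (res_weight N t * barnes a1 2 y (res_point N t))" for t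
  have Dint: "integrable lborel D" unfolding D_def[abs_def] by (intro integrable_norm res_barnes(1)[OF y a1(2)])
  have fnorm: "norm (f k t) \<le> (\<bar>c k\<bar> / fact k) * D t" for k t
  proof -
    have "norm (f k t) = norm (W t) * \<bar>c k\<bar> * norm (rGamma (2 + res_point N t + of_nat k))" by (simp add: f_def norm_mult)
    also have "\<dots> \<le> norm (W t) * \<bar>c k\<bar> * (norm (rGamma (2 + res_point N t)) / fact k)"
      using Re_res_point[of N t] by (intro mult_left_mono norm_rGamma_shift) auto
    also have "\<dots> = (\<bar>c k\<bar> / fact k) * D t" by (simp add: D_def W_def barnes_def norm_mult)
    finally show ?thesis .
  qed
  have "(\<integral>t1. res_weight N t1 * (Gamma (of_real a1 + res_point N t1) * of_real y powr res_point N t1) *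
       (\<integral>t0. res_weight N t0 * barnes a0 (2 + res_point N t1) x (res_point N t0) \<partial>lborel) \<partial>lborel) =
     (\<integral>t. 2 * pi * \<i> * (\<Sum>k. f k t) \<partial>lborel)"
  proof (rule Bochner_Integration.integral_cong[OF refl])
    fix t
    have "summable (\<lambda>k. norm (of_real (c k) * rGamma (2 + res_point N t + of_nat k)))"
    proof (rule summable_comparison_test[OF _ summable_mult2[OF sum_c, of "norm (rGamma (2 + res_point N t))"]], intro exI allI impI)
      fix k
      have "\<bar>c k\<bar> * norm (rGamma (2 + res_point N t + of_nat k)) \<le> \<bar>c k\<bar> * (norm (rGamma (2 + res_point N t)) / fact k)"
        using Re_res_point[of N t] by (intro mult_left_mono norm_rGamma_shift) auto
      thus "norm (norm (of_real (c k) * rGamma (2 + res_point N t + of_nat k))) \<le> \<bar>c k\<bar> / fact k * norm (rGamma (2 + res_point N t))"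
        by (simp add: norm_mult)
    qed
    from suminf_mult[OF summable_norm_cancel[OF this], of "W t"]
    have "(\<Sum>k. f k t) = W t * (\<Sum>k. of_real (c k) * rGamma (2 + res_point N t + of_nat k))"
      unfolding f_def .
    thus "res_weight N t * (Gamma (of_real a1 + res_point N t) * of_real y powr res_point N t) *
       (\<integral>t0. res_weight N t0 * barnes a0 (2 + res_point N t) x (res_point N t0) \<partial>lborel) = 2 * pi * \<i> * (\<Sum>k. f k t)"
      unfolding inner by (simp add: W_def)
  qed
  also have "\<dots> = 2 * pi * \<i> * (\<integral>t. (\<Sum>k. f k t) \<partial>lborel)" by (rule integral_mult_right_zero)
  also have "(\<integral>t. (\<Sum>k. f k t) \<partial>lborel) = (\<Sum>k. \<integral>t. f k t \<partial>lborel)"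
  proof (rule integral_suminf[OF fint])
    show "AE t in lborel. summable (\<lambda>k. norm (f k t))"
    proof (rule AE_I2)
      fix t
      show "summable (\<lambda>k. norm (f k t))"
        by (rule summable_comparison_test[OF _ summable_mult2[OF sum_c, of "D t"]]) (use fnorm in auto)
    qed
    show "summable (\<lambda>k. \<integral>t. norm (f k t) \<partial>lborel)"
    proof (rule summable_comparison_test[OF _ summable_mult2[OF sum_c, of "\<integral>t. D t \<partial>lborel"]], intro exI allI impI)
      fix k
      have "(\<integral>t. norm (f k t) \<partial>lborel) \<le> (\<integral>t. (\<bar>c k\<bar> / fact k) * D t \<partial>lborel)"
        using fnorm by (intro integral_mono integrable_norm fint integrable_mult_right Dint)
      thus "norm (\<integral>t. norm (f k t) \<partial>lborel) \<le> \<bar>c k\<bar> / fact k * (\<integral>t. D t \<partial>lborel)" by simp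
    qed
  qed
  also have "\<dots> = (\<Sum>k. 2 * pi * \<i> * (\<Sum>l. of_real (c k * d l / fact (Suc (k + l)))))" by (simp only: fval)
  also have "\<dots> = 2 * pi * \<i> * (\<Sum>k. \<Sum>l. of_real (c k * d l / fact (Suc (k + l))))"
  proof (rule suminf_mult)
    have "summable (\<lambda>k. \<integral>t. f k t \<partial>lborel)"
    proof (rule summable_comparison_test[OF _ summable_mult2[OF sum_c, of "\<integral>t. D t \<partial>lborel"]], intro exI allI impI)
      fix k
      have "norm (\<integral>t. f k t \<partial>lborel) \<le> (\<integral>t. norm (f k t) \<partial>lborel)" by (rule integral_norm_bound)
      also have "\<dots> \<le> (\<integral>t. (\<bar>c k\<bar> / fact k) * D t \<partial>lborel)"
        using fnorm by (intro integral_mono integrable_norm fint integrable_mult_right Dint)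
      finally show "norm (\<integral>t. f k t \<partial>lborel) \<le> \<bar>c k\<bar> / fact k * (\<integral>t. D t \<partial>lborel)" by simp
    qed
    hence "summable (\<lambda>k. (1 / (2 * pi * \<i>)) * (2 * pi * \<i> * (\<Sum>l. complex_of_real (c k * d l / fact (Suc (k + l))))))"
      unfolding fval by (rule summable_mult)
    thus "summable (\<lambda>k. \<Sum>l. complex_of_real (c k * d l / fact (Suc (k + l))))" by simp
  qed
  finally have total: "(\<integral>t1. res_weight N t1 * (Gamma (of_real a1 + res_point N t1) * of_real y powr res_point N t1) *
       (\<integral>t0. res_weight N t0 * barnes a0 (2 + res_point N t1) x (res_point N t0) \<partial>lborel) \<partial>lborel) =
     (2 * pi * \<i>)\<^sup>2 * (\<Sum>k. \<Sum>l. complex_of_real (c k * d l / fact (Suc (k + l))))"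
    by (simp add: power2_eq_square)
  define h where "h n = (\<Sum>k\<le>n. (pochhammer a0 k / fact k * (- x) ^ k) * (pochhammer a1 (n - k) / fact (n - k) * (- y) ^ (n - k))) / fact (Suc n)" for n
  have "(\<lambda>n. \<Sum>k\<le>n. complex_of_real (c k * d (n - k) / fact (Suc (k + (n - k))))) sums
     (\<Sum>k. \<Sum>l. complex_of_real (c k * d l / fact (Suc (k + l))))"
  proof (rule double_series_diagonal[OF sum_c _ sum_d])
    fix k l
    \<comment> \<open>The product of the factorials divides (k + l)!, so the double series is
      dominated by a product of two convergent ones.\<close>
    have "fact k * fact l \<le> (fact (Suc (k + l)) :: real)"
    proof -
      have "fact k * fact l dvd (fact (k + l) :: nat)" by (rule fact_fact_dvd_fact)
      hence "fact k * fact l \<le> (fact (k + l) :: nat)" by (rule dvd_imp_le) simp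
      also have "\<dots> \<le> fact (Suc (k + l))" by (rule fact_mono_nat) simp
      finally have "real (fact k * fact l) \<le> real (fact (Suc (k + l)))" by (simp only: of_nat_le_iff)
      thus ?thesis by (simp only: of_nat_mult of_nat_fact)
    qed
    hence "\<bar>c k * d l\<bar> / fact (Suc (k + l)) \<le> \<bar>c k * d l\<bar> / (fact k * fact l)"
      by (intro divide_left_mono) auto
    thus "norm (complex_of_real (c k * d l / fact (Suc (k + l)))) \<le> \<bar>c k\<bar> / fact k * (\<bar>d l\<bar> / fact l)"
      unfolding norm_of_real by (simp add: abs_mult)
  qed auto
  also have "(\<lambda>n. \<Sum>k\<le>n. complex_of_real (c k * d (n - k) / fact (Suc (k + (n - k))))) =
     (\<lambda>n. complex_of_real (Gamma a0 * Gamma a1 * h n))"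
  proof
    fix n
    have "(\<Sum>k\<le>n. complex_of_real (c k * d (n - k) / fact (Suc (k + (n - k))))) = (\<Sum>k\<le>n. of_real (c k * d (n - k) / fact (Suc n)))"
      by (intro sum.cong) auto
    also have "\<dots> = of_real (\<Sum>k\<le>n. Gamma a0 * Gamma a1 * ((pochhammer a0 k / fact k * (- x) ^ k) * (pochhammer a1 (n - k) / fact (n - k) * (- y) ^ (n - k)) / fact (Suc n)))"
      unfolding of_real_sum by (intro sum.cong) (auto simp: c_def d_def)
    finally show "(\<Sum>k\<le>n. complex_of_real (c k * d (n - k) / fact (Suc (k + (n - k))))) = of_real (Gamma a0 * Gamma a1 * h n)"
      unfolding h_def by (simp only: sum_distrib_left sum_divide_distrib)
  qed
  finally have hs: "(\<lambda>n. complex_of_real (Gamma a0 * Gamma a1 * h n)) sums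
     (\<Sum>k. \<Sum>l. complex_of_real (c k * d l / fact (Suc (k + l))))" .
  have "Gamma a0 * Gamma a1 \<noteq> 0" using a0 a1 by (simp add: Gamma_eq_zero_iff)
  moreover have "summable (\<lambda>n. Gamma a0 * Gamma a1 * h n)"
    using sums_summable[OF hs] summable_complex_of_real by blast
  ultimately have "summable h" by (simp only: summable_cmult_iff) simp
  hence "(\<lambda>n. complex_of_real (Gamma a0 * Gamma a1 * h n)) sums of_real (Gamma a0 * Gamma a1 * suminf h)"
    by (intro sums_of_real sums_mult summable_sums)
  hence "(\<Sum>k. \<Sum>l. complex_of_real (c k * d l / fact (Suc (k + l)))) = of_real (Gamma a0 * Gamma a1 * suminf h)"
    using hs by (rule sums_unique2[symmetric])
  thus ?thesis unfolding total h_def by (simp only:)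
qed

section \<open>Sums of contours\<close>

lemma mb_tail_mono: "mb_tail g c T \<Longrightarrow> T \<le> T' \<Longrightarrow> mb_tail g c T'"
  by (auto simp: mb_tail_def)

text \<open>The condition on the abscissas records the side on which the poles - 2 - k are avoided:
  with all parameters in the tails, the sum lies on the line whose abscissa is the sum of the c
  i.\<close>

definition sum_avoids :: "(nat \<Rightarrow> real \<Rightarrow> complex) \<Rightarrow> (nat \<Rightarrow> real) \<Rightarrow> nat set \<Rightarrow> bool" where
  "sum_avoids g c I \<longleftrightarrow> (\<forall>t. \<forall>k::nat. (\<Sum>i\<in>I. g i (t i)) \<noteq> - 2 - of_nat k) \<and> (\<Sum>i\<in>I. c i) > - 2"

lemma sum_tail:
  assumes "finite I" "\<And>i. i \<in> I \<Longrightarrow> mb_tail (g i) (c i) T" "\<And>i. i \<in> I \<Longrightarrow> \<bar>t i\<bar> \<ge> T"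
  shows "(\<Sum>i\<in>I. g i (t i)) = Complex (\<Sum>i\<in>I. c i) (\<Sum>i\<in>I. t i)"
proof -
  have "(\<Sum>i\<in>I. g i (t i)) = (\<Sum>i\<in>I. Complex (c i) (t i))"
    using assms(2,3) by (intro sum.cong) (auto simp: mb_tail_def)
  thus ?thesis by (simp add: complex_eq_iff)
qed

text \<open>Two parameters pushed into opposite tails balance each other, so every height y is
  reached with all parameters in their tails.\<close>

lemma sum_vertical_line:
  assumes I: "finite I" "i \<in> I" "j \<in> I" "i \<noteq> j" and g: "\<And>i. i \<in> I \<Longrightarrow> mb_tail (g i) (c i) T"
  shows "\<exists>t. (\<Sum>i\<in>I. g i (t i)) = Complex (\<Sum>i\<in>I. c i) y"
proof -
  have T: "T > 0" using g[OF I(2)] by (auto simp: mb_tail_def)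
  define B where "B = T + \<bar>y\<bar> + real (card I) * T"
  define S where "S = (\<Sum>k\<in>I - {i} - {j}. T)"
  define t where "t = (\<lambda>k. T)(i := B, j := y - B - S)"
  have S: "S \<ge> 0" unfolding S_def using T by (intro sum_nonneg) auto
  have "(\<Sum>k\<in>I. t k) = t i + (t j + (\<Sum>k\<in>I - {i} - {j}. t k))"
    using I by (simp add: sum.remove[of I i] sum.remove[of "I - {i}" j])
  also have "(\<Sum>k\<in>I - {i} - {j}. t k) = S" unfolding S_def by (intro sum.cong) (auto simp: t_def)
  finally have "(\<Sum>k\<in>I. t k) = y" using I by (simp add: t_def)
  moreover have "\<bar>t k\<bar> \<ge> T" for k
  proof -
    have "real (card I) * T \<ge> 0" using T by simp
    hence B: "B \<ge> T" "B \<ge> T + \<bar>y\<bar>" by (auto simp: B_def)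
    thus ?thesis using S T by (auto simp: t_def)
  qed
  ultimately show ?thesis using sum_tail[of I g c T t] I g by auto
qed

text \<open>The other parameters are moved continuously into their upper tails. On the way the point
  never meets \<open>g j\<close>, for that would be a forbidden value of the full sum; at the end it
  is so far from the real axis that comparing abscissas decides its side.\<close>

lemma sum_avoids_left_of:
  assumes I: "finite I" "j \<in> I" "I - {j} \<noteq> {}" and g: "\<And>i. i \<in> I \<Longrightarrow> mb_tail (g i) (c i) T"
    and Q: "sum_avoids g c I"
  shows "left_of (g j) (- 2 - of_nat k - (\<Sum>i\<in>I - {j}. g i (t i)))"
proof -
  define z where "z t = - 2 - of_nat k - (\<Sum>i\<in>I - {j}. g i (t i))" for t
  obtain H where H: "\<And>z. \<bar>Im z\<bar> \<ge> H \<Longrightarrow> Re z < c j \<Longrightarrow> left_of (g j) z"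
    using high_left_right[OF g[OF I(2)]] by metis
  have T: "T > 0" using g[OF I(2)] by (auto simp: mb_tail_def)
  define \<tau> where "\<tau> = max T \<bar>H\<bar>"
  define t' where "t' = (\<lambda>_::nat. \<tau>)"
  have "card (I - {j}) > 0" using I(1,3) unfolding card_gt_0_iff by blast
  hence card: "real (card (I - {j})) \<ge> 1" by linarith
  have sum': "(\<Sum>i\<in>I - {j}. g i (t' i)) = Complex (\<Sum>i\<in>I - {j}. c i) (\<Sum>i\<in>I - {j}. \<tau>)"
    using sum_tail[of "I - {j}" g c T t'] I g T by (auto simp: t'_def \<tau>_def)
  have "left_of (g j) (z t')"
  proof (rule H)
    have "\<tau> > 0" using T by (simp add: \<tau>_def)
    hence "(\<Sum>i\<in>I - {j}. \<tau>) \<ge> \<tau>" using mult_right_mono[OF card, of \<tau>] by (simp only: sum_constant) simp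
    moreover have "Im (z t') = - (\<Sum>i\<in>I - {j}. \<tau>)" unfolding z_def sum' by (simp del: sum_constant)
    moreover have "\<tau> \<ge> H" by (simp add: \<tau>_def)
    ultimately show "\<bar>Im (z t')\<bar> \<ge> H" by linarith
    have "(\<Sum>i\<in>I. c i) = c j + (\<Sum>i\<in>I - {j}. c i)" using I by (simp add: sum.remove)
    thus "Re (z t') < c j" unfolding z_def sum' using Q by (simp add: sum_avoids_def)
  qed
  moreover define S where "S = (\<lambda>u. z (\<lambda>i. (1 - u) * t i + u * t' i)) ` {0..1}"
  have cont: "continuous_on {0..1} (\<lambda>u. z (\<lambda>i. (1 - u) * t i + u * t' i))"
    unfolding z_def
    by (intro continuous_intros continuous_on_compose2[OF mb_tail_continuous[OF g, of _ UNIV]]) auto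
  have "connected S" "bounded S" unfolding S_def
    using connected_continuous_image[OF cont] compact_imp_bounded[OF compact_continuous_image[OF cont]] by auto
  moreover have "z t \<in> S" "z t' \<in> S"
    unfolding S_def by (rule image_eqI[of _ _ 0]; simp) (rule image_eqI[of _ _ 1]; simp)
  moreover have "S \<inter> range (g j) = {}"
  proof -
    have False if "z v = g j u" for v u
    proof -
      have "(\<Sum>i\<in>I. g i ((v(j := u)) i)) = g j u + (\<Sum>i\<in>I - {j}. g i (v i))"
        using I by (simp add: sum.remove[of I j])
      also have "\<dots> = - 2 - of_nat k" using that by (simp add: z_def algebra_simps)
      finally show False using Q unfolding sum_avoids_def by blast
    qed
    thus ?thesis by (auto simp: S_def)
  qed
  ultimately have "left_of (g j) (z t)" using left_of_transfer[OF g[OF I(2)]] by blast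
  thus ?thesis by (simp add: z_def)
qed

text \<open>As \<open>0\<close> lies to the right of \<open>g\<^sub>j\<close>, a point \<open>- 2 - k\<close> hit by the remaining sum would contradict the
  fact that \<open>- 2 - k - \<Sum>\<close> lies to its left.\<close>

lemma sum_avoids_remove:
  assumes I: "finite I" "j \<in> I" "i \<in> I - {j}" "i' \<in> I - {j}" "i \<noteq> i'" and g: "\<And>i. i \<in> I \<Longrightarrow> mb_tail (g i) (c i) T"
    and Q: "sum_avoids g c I" and r: "right_of (g j) 0"
  shows "sum_avoids g c (I - {j})"
  unfolding sum_avoids_def
proof (intro conjI allI notI)
  have ne: "I - {j} \<noteq> {}" using I by auto
  fix t k assume "(\<Sum>i\<in>I - {j}. g i (t i)) = - 2 - of_nat k"
  hence "left_of (g j) 0" using sum_avoids_left_of[OF I(1,2) ne g Q, of k t] by simp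
  thus False using r not_left_and_right by blast
next
  show "(\<Sum>i\<in>I - {j}. c i) > - 2"
  proof (rule ccontr)
    assume neg: "\<not> (\<Sum>i\<in>I - {j}. c i) > - 2"
    \<comment> \<open>If the claim failed, the remaining sums would fill the vertical line at
      abscissa - 2 - x0, so \<open>g j\<close> could not contain a point with real part x0. Its
      tails lie right of x0, hence all of it does, and as x0 >= 0 this puts 0 on its left.\<close>
    define x0 where "x0 = - 2 - (\<Sum>i\<in>I - {j}. c i)"
    have x0: "x0 \<ge> 0" using neg by (simp add: x0_def)
    have ne: "Re (g j u) \<noteq> x0" for u
    proof
      assume u: "Re (g j u) = x0"
      obtain t where t: "(\<Sum>i\<in>I - {j}. g i (t i)) = Complex (\<Sum>i\<in>I - {j}. c i) (- Im (g j u))"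
        using sum_vertical_line[of "I - {j}" i i' g c T] I g by auto
      have "(\<Sum>i\<in>I. g i ((t(j := u)) i)) = g j u + (\<Sum>i\<in>I - {j}. g i (t i))"
        using I by (simp add: sum.remove[of I j])
      also have "\<dots> = - 2 - of_nat 0" unfolding t using u by (simp add: complex_eq_iff x0_def)
      finally show False using Q unfolding sum_avoids_def by blast
    qed
    have "(\<Sum>i\<in>I. c i) = c j + (\<Sum>i\<in>I - {j}. c i)" using I by (simp add: sum.remove)
    hence cj: "c j > x0" using Q by (simp add: sum_avoids_def x0_def)
    have "Re (g j u) > x0" for u
    proof (rule ccontr)
      assume "\<not> Re (g j u) > x0"
      hence u: "Re (g j u) < x0" using ne[of u] by simp
      have "Re (g j T) = c j" using g[OF I(2)] by (auto simp: mb_tail_def)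
      moreover have "connected ((\<lambda>t. Re (g j t)) ` UNIV)"
        by (rule connected_continuous_image[OF continuous_on_Re[OF mb_tail_continuous[OF g[OF I(2)]]]]) (rule connected_UNIV)
      ultimately have "x0 \<in> (\<lambda>t. Re (g j t)) ` UNIV"
        using u cj connectedD_interval[of "(\<lambda>t. Re (g j t)) ` UNIV" "Re (g j u)" "Re (g j T)" x0]
          rangeI[of "\<lambda>t. Re (g j t)" T] by auto
      thus False using ne by auto
    qed
    hence "Re 0 < Re (g j u)" for u using x0 le_less_trans[of 0 x0 "Re (g j u)"] by simp
    hence "left_of (g j) 0" by (rule left_of_base[OF g[OF I(2)]])
    thus False using r not_left_and_right by blast
  qed
qed

section \<open>Boundedness of Gamma along sums of contours\<close>

lemma sum_concentrate:
  assumes I: "finite I" and g: "\<And>i. i \<in> I \<Longrightarrow> mb_tail (g i) (c i) T"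
  shows "\<exists>t'. (\<Sum>i\<in>I. g i (t' i)) = (\<Sum>i\<in>I. g i (t i)) \<and> ((\<forall>i\<in>I. t' i \<ge> - T) \<or> (\<forall>i\<in>I. t' i \<le> T))"
proof (induction "card {i\<in>I. \<bar>t i\<bar> > T}" arbitrary: t rule: less_induct)
  case (less t)
  show ?case
  proof (cases "(\<forall>i\<in>I. t i \<ge> - T) \<or> (\<forall>i\<in>I. t i \<le> T)")
    case True
    thus ?thesis by (intro exI[of _ t]) auto
  next
    case False
    then obtain i j where ij: "i \<in> I" "t i < - T" "j \<in> I" "t j > T" by force
    have T: "T > 0" using g[OF ij(1)] by (auto simp: mb_tail_def)
    have "i \<noteq> j" using ij T by auto
    \<comment> \<open>One parameter in a lower tail and one in an upper tail approach each other by
      the same amount, which leaves the sum unchanged, until one of them reaches the end of its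
      tail. The number of parameters beyond T drops.\<close>
    define \<delta> where "\<delta> = min (t j - T) (- T - t i)"
    define t1 where "t1 = t(i := t i + \<delta>, j := t j - \<delta>)"
    have d: "\<delta> > 0" "t i + \<delta> \<le> - T" "t j - \<delta> \<ge> T" "t i + \<delta> = - T \<or> t j - \<delta> = T" using ij by (auto simp: \<delta>_def)
    have split: "(\<Sum>k\<in>I. g k (s k)) = g i (s i) + (g j (s j) + (\<Sum>k\<in>I - {i} - {j}. g k (s k)))" for s
      using I ij \<open>i \<noteq> j\<close> by (simp add: sum.remove[of I i] sum.remove[of "I - {i}" j])
    have "(\<Sum>k\<in>I - {i} - {j}. g k (t1 k)) = (\<Sum>k\<in>I - {i} - {j}. g k (t k))"
      by (intro sum.cong) (auto simp: t1_def)
    moreover have "g i (t1 i) + g j (t1 j) = g i (t i) + g j (t j)"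
    proof -
      have "g i s = Complex (c i) s" "g j s = Complex (c j) s" if "\<bar>s\<bar> \<ge> T" for s
        using g[OF ij(1)] g[OF ij(3)] that by (auto simp: mb_tail_def)
      thus ?thesis using d ij T \<open>i \<noteq> j\<close> by (simp add: t1_def complex_eq_iff)
    qed
    ultimately have same: "(\<Sum>k\<in>I. g k (t1 k)) = (\<Sum>k\<in>I. g k (t k))"
      unfolding split by (simp add: add.assoc[symmetric])
    have "{k\<in>I. \<bar>t1 k\<bar> > T} \<subset> {k\<in>I. \<bar>t k\<bar> > T}"
    proof
      show "{k\<in>I. \<bar>t1 k\<bar> > T} \<subseteq> {k\<in>I. \<bar>t k\<bar> > T}"
        using ij T d \<open>i \<noteq> j\<close> by (auto simp: t1_def)
      have "i \<in> {k\<in>I. \<bar>t k\<bar> > T}" "j \<in> {k\<in>I. \<bar>t k\<bar> > T}" using ij T by auto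
      moreover have "i \<notin> {k\<in>I. \<bar>t1 k\<bar> > T} \<or> j \<notin> {k\<in>I. \<bar>t1 k\<bar> > T}" using d(4) T \<open>i \<noteq> j\<close> by (auto simp: t1_def)
      ultimately show "{k\<in>I. \<bar>t1 k\<bar> > T} \<noteq> {k\<in>I. \<bar>t k\<bar> > T}" by blast
    qed
    hence "card {k\<in>I. \<bar>t1 k\<bar> > T} < card {k\<in>I. \<bar>t k\<bar> > T}" using I by (intro psubset_card_mono) auto
    from less[OF this] same show ?thesis by simp
  qed
qed

lemma compact_sum_box:
  fixes g :: "'i \<Rightarrow> real \<Rightarrow> complex"
  assumes "finite I" "\<And>i. i \<in> I \<Longrightarrow> continuous_on UNIV (g i)"
  shows "compact {\<Sum>i\<in>I. g i (t i) |t. \<forall>i\<in>I. \<bar>t i\<bar> \<le> B}"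
  using assms
proof (induction I rule: finite_induct)
  case (insert j I)
  have "{\<Sum>i\<in>insert j I. g i (t i) |t. \<forall>i\<in>insert j I. \<bar>t i\<bar> \<le> B} =
     {x + y |x y. x \<in> g j ` {-B..B} \<and> y \<in> {\<Sum>i\<in>I. g i (t i) |t. \<forall>i\<in>I. \<bar>t i\<bar> \<le> B}}" (is "?L = ?R")
  proof
    show "?L \<subseteq> ?R"
    proof
      fix s assume "s \<in> ?L"
      then obtain t where t: "s = (\<Sum>i\<in>insert j I. g i (t i))" "\<forall>i\<in>insert j I. \<bar>t i\<bar> \<le> B" by auto
      have "s = g j (t j) + (\<Sum>i\<in>I. g i (t i))" using t insert by simp
      moreover have "t j \<in> {-B..B}" using t(2) by (auto simp: abs_le_iff)
      ultimately show "s \<in> ?R" using t(2) by blast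
    qed
    show "?R \<subseteq> ?L"
    proof
      fix s assume "s \<in> ?R"
      then obtain u t where s: "s = g j u + (\<Sum>i\<in>I. g i (t i))" "u \<in> {-B..B}" "\<forall>i\<in>I. \<bar>t i\<bar> \<le> B" by auto
      have "(\<Sum>i\<in>I. g i ((t(j := u)) i)) = (\<Sum>i\<in>I. g i (t i))" using insert by (intro sum.cong) auto
      hence "s = (\<Sum>i\<in>insert j I. g i ((t(j := u)) i))" using s insert by simp
      moreover have "\<forall>i\<in>insert j I. \<bar>(t(j := u)) i\<bar> \<le> B" using s by auto
      ultimately show "s \<in> ?L" by blast
    qed
  qed
  moreover have "compact (g j ` {-B..B})"
    using insert.prems by (intro compact_continuous_image) (auto intro: continuous_on_subset)
  moreover have "compact {\<Sum>i\<in>I. g i (t i) |t. \<forall>i\<in>I. \<bar>t i\<bar> \<le> B}" using insert by auto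
  ultimately show ?case using compact_sums by (simp only:)
qed simp

text \<open>Values near the real axis may come from huge parameters that cancel. Once opposite tails
  no longer occur together, a bounded imaginary part of the sum bounds every parameter.\<close>

lemma sum_low_compact:
  assumes I: "finite I" and g: "\<And>i. i \<in> I \<Longrightarrow> mb_tail (g i) (c i) T"
  shows "\<exists>B. \<forall>t. \<bar>Im (\<Sum>i\<in>I. g i (t i))\<bar> \<le> 1 \<longrightarrow>
     (\<Sum>i\<in>I. g i (t i)) \<in> {\<Sum>i\<in>I. g i (t i) |t. \<forall>i\<in>I. \<bar>t i\<bar> \<le> B}"
proof -
  have "\<forall>i\<in>I. \<exists>M>0. \<forall>t. \<bar>t\<bar> \<le> T \<longrightarrow> \<bar>Im (g i t)\<bar> \<le> M"
    using mb_tail_bounded[OF g] by blast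
  then obtain M where M: "\<And>i. i \<in> I \<Longrightarrow> M i > 0" "\<And>i t. i \<in> I \<Longrightarrow> \<bar>t\<bar> \<le> T \<Longrightarrow> \<bar>Im (g i t)\<bar> \<le> M i" by metis
  define B where "B = \<bar>T\<bar> + 1 + (\<Sum>i\<in>I. M i)"
  have Msum: "(\<Sum>k\<in>A. M k) \<le> (\<Sum>k\<in>I. M k)" if "A \<subseteq> I" for A
    using I that M(1) by (intro sum_mono2) (auto intro: less_imp_le)
  have low: "Im (g i t) \<ge> - M i" if "i \<in> I" "t \<ge> - T" for i t
  proof (cases "t \<le> T")
    case True thus ?thesis using M(2)[of i t] that by (auto simp: abs_le_iff)
  next
    case False
    hence "Im (g i t) = t" "T > 0" using g[OF that(1)] by (auto simp: mb_tail_def)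
    thus ?thesis using False M(1)[OF that(1)] by auto
  qed
  have high: "Im (g i t) \<le> M i" if "i \<in> I" "t \<le> T" for i t
  proof (cases "t \<ge> - T")
    case True thus ?thesis using M(2)[of i t] that by (auto simp: abs_le_iff)
  next
    case False
    hence "Im (g i t) = t" "T > 0" using g[OF that(1)] by (auto simp: mb_tail_def)
    thus ?thesis using False M(1)[OF that(1)] by auto
  qed
  have "(\<Sum>i\<in>I. g i (t i)) \<in> {\<Sum>i\<in>I. g i (t i) |t. \<forall>i\<in>I. \<bar>t i\<bar> \<le> B}" if t: "\<bar>Im (\<Sum>i\<in>I. g i (t i))\<bar> \<le> 1" for t
  proof -
    obtain t' where t': "(\<Sum>i\<in>I. g i (t' i)) = (\<Sum>i\<in>I. g i (t i))" "(\<forall>i\<in>I. t' i \<ge> - T) \<or> (\<forall>i\<in>I. t' i \<le> T)"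
      using sum_concentrate[of I g c T t] I g by blast
    have im: "\<bar>Im (g i (t' i)) + (\<Sum>k\<in>I - {i}. Im (g k (t' k)))\<bar> \<le> 1" if "i \<in> I" for i
      using t t'(1)[symmetric] I that by (simp add: sum.remove[of I i])
    have "\<bar>t' i\<bar> \<le> B" if i: "i \<in> I" for i
    proof (cases "\<bar>t' i\<bar> \<le> T")
      case True thus ?thesis using Msum[of "{}"] by (simp add: B_def)
    next
      case False
      have gi: "Im (g i (t' i)) = t' i" using False g[OF i] by (auto simp: mb_tail_def)
      from t'(2) show ?thesis
      proof
        assume a: "\<forall>i\<in>I. t' i \<ge> - T"
        have "(\<Sum>k\<in>I - {i}. Im (g k (t' k))) \<ge> (\<Sum>k\<in>I - {i}. - M k)" using a low by (intro sum_mono) auto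
        hence "(\<Sum>k\<in>I - {i}. Im (g k (t' k))) \<ge> - (\<Sum>k\<in>I. M k)" using Msum[of "I - {i}"] by (simp add: sum_negf)
        hence "t' i \<le> 1 + (\<Sum>k\<in>I. M k)" using im[OF i] gi by linarith
        moreover have "t' i \<ge> - T" using a i by auto
        ultimately show ?thesis using Msum[of "{}"] by (auto simp: B_def)
      next
        assume a: "\<forall>i\<in>I. t' i \<le> T"
        have "(\<Sum>k\<in>I - {i}. Im (g k (t' k))) \<le> (\<Sum>k\<in>I - {i}. M k)" using a high by (intro sum_mono) auto
        hence "(\<Sum>k\<in>I - {i}. Im (g k (t' k))) \<le> (\<Sum>k\<in>I. M k)" using Msum[of "I - {i}"] by simp
        hence "t' i \<ge> - 1 - (\<Sum>k\<in>I. M k)" using im[OF i] gi by linarith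
        moreover have "t' i \<le> T" using a i by auto
        ultimately show ?thesis using Msum[of "{}"] by (auto simp: B_def)
      qed
    qed
    thus ?thesis using t'(1) by (intro CollectI exI[of _ t']) auto
  qed
  thus ?thesis by blast
qed

text \<open>Poles can be approached only near the real axis, where X is confined to a pole-free
  compact set; farther out the strip bound takes over.\<close>

lemma Gamma_bounded_on:
  fixes X :: "complex set"
  assumes "\<And>s. s \<in> X \<Longrightarrow> \<bar>Re s\<bar> \<le> M" "compact Y" "Y \<inter> \<int>\<^sub>\<le>\<^sub>0 = {}" "\<And>s. s \<in> X \<Longrightarrow> \<bar>Im s\<bar> \<le> 1 \<Longrightarrow> s \<in> Y"
  shows "\<exists>K\<ge>0. \<forall>s\<in>X. norm (Gamma s) \<le> K"
proof -
  have "continuous_on Y Gamma"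
    using assms(3) by (intro holomorphic_on_imp_continuous_on holomorphic_Gamma)
  from compact_imp_bounded[OF compact_continuous_image[OF this assms(2)]]
  obtain K1 where K1: "\<forall>x\<in>Gamma ` Y. norm x \<le> K1" unfolding bounded_iff by blast
  obtain A where A: "A > 0" "\<And>s. \<bar>Re s\<bar> \<le> M \<Longrightarrow> \<bar>Im s\<bar> \<ge> 1 \<Longrightarrow> norm (Gamma s :: complex) \<le> A * exp (- (5/4) * \<bar>Im s\<bar>)"
    using Gamma_strip_bound[of M] by auto
  have "norm (Gamma s) \<le> max A \<bar>K1\<bar>" if s: "s \<in> X" for s
  proof (cases "\<bar>Im s\<bar> \<le> 1")
    case True
    hence "Gamma s \<in> Gamma ` Y" using assms(4)[OF s] by blast
    thus ?thesis using K1 by fastforce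
  next
    case False
    hence "norm (Gamma s) \<le> A * exp (- (5/4) * \<bar>Im s\<bar>)" using assms(1)[OF s] by (intro A) auto
    also have "\<dots> \<le> A * 1" using A(1) by (intro mult_left_mono) auto
    finally show ?thesis by simp
  qed
  thus ?thesis using A(1) by (intro exI[of _ "max A \<bar>K1\<bar>"]) auto
qed

text \<open>Compactness near the real axis turns mere avoidance of the poles into a bound. The shift
  n stands for variables already frozen at residue points.\<close>

lemma Gamma_sum_bounded:
  assumes I: "finite I" and g: "\<And>i. i \<in> I \<Longrightarrow> mb_tail (g i) (c i) T"
    and av: "\<And>t k. (\<Sum>i\<in>I. g i (t i)) \<noteq> - 2 - of_nat (k::nat)"
  shows "\<exists>K\<ge>0. \<forall>t. \<forall>n\<le>N. norm (Gamma (2 + of_nat n + (\<Sum>i\<in>I. g i (t i)))) \<le> K"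
proof -
  obtain B where B: "\<And>t. \<bar>Im (\<Sum>i\<in>I. g i (t i))\<bar> \<le> 1 \<Longrightarrow>
     (\<Sum>i\<in>I. g i (t i)) \<in> {\<Sum>i\<in>I. g i (t i) |t. \<forall>i\<in>I. \<bar>t i\<bar> \<le> B}"
    using sum_low_compact[of I g c T] I g by blast
  define Y where "Y = {\<Sum>i\<in>I. g i (t i) |t. \<forall>i\<in>I. \<bar>t i\<bar> \<le> B}"
  have Y: "compact Y" unfolding Y_def using I g mb_tail_continuous by (intro compact_sum_box) blast+
  have "\<forall>i\<in>I. \<exists>M>0. \<forall>t. \<bar>Re (g i t)\<bar> \<le> M" using mb_tail_bounded[OF g] by blast
  then obtain M where M: "\<And>i t. i \<in> I \<Longrightarrow> \<bar>Re (g i t)\<bar> \<le> M i" by metis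
  have one: "\<exists>K\<ge>0. \<forall>s\<in>range (\<lambda>t. 2 + of_nat n + (\<Sum>i\<in>I. g i (t i))). norm (Gamma s) \<le> K" for n :: nat
  proof (rule Gamma_bounded_on)
    show "compact ((\<lambda>s. 2 + of_nat n + s) ` Y)" using Y by (rule compact_translation)
    show "(\<lambda>s. 2 + of_nat n + s) ` Y \<inter> \<int>\<^sub>\<le>\<^sub>0 = {}"
    proof -
      have False if "2 + of_nat n + (\<Sum>i\<in>I. g i (t i)) \<in> \<int>\<^sub>\<le>\<^sub>0" for t
      proof -
        from that obtain k where "2 + of_nat n + (\<Sum>i\<in>I. g i (t i)) = - of_nat k" by (auto elim!: nonpos_Ints_cases')
        hence "(\<Sum>i\<in>I. g i (t i)) = - of_nat k - (2 + of_nat n)" by (metis add_diff_cancel_left')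
        hence "(\<Sum>i\<in>I. g i (t i)) = - 2 - of_nat (n + k)" by simp
        thus False using av by blast
      qed
      thus ?thesis unfolding Y_def by blast
    qed
    fix s assume "s \<in> range (\<lambda>t. 2 + of_nat n + (\<Sum>i\<in>I. g i (t i)))"
    then obtain t where s: "s = 2 + of_nat n + (\<Sum>i\<in>I. g i (t i))" by auto
    have "\<bar>\<Sum>i\<in>I. Re (g i (t i))\<bar> \<le> (\<Sum>i\<in>I. \<bar>Re (g i (t i))\<bar>)" by (rule sum_abs)
    also have "\<dots> \<le> (\<Sum>i\<in>I. M i)" by (intro sum_mono M)
    finally show "\<bar>Re s\<bar> \<le> 2 + real n + (\<Sum>i\<in>I. M i)" by (simp add: s)
    assume "\<bar>Im s\<bar> \<le> 1"
    thus "s \<in> (\<lambda>s. 2 + of_nat n + s) ` Y" using B[of t] by (auto simp: s Y_def)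
  qed
  then obtain K where K: "\<And>n. K n \<ge> 0" "\<And>n t. norm (Gamma (2 + of_nat n + (\<Sum>i\<in>I. g i (t i)))) \<le> K n"
    by (metis rangeI)
  have "norm (Gamma (2 + of_nat n + (\<Sum>i\<in>I. g i (t i)))) \<le> (\<Sum>n\<le>N. K n)" if "n \<le> N" for n t
    using K(2)[of n t] member_le_sum[of n "{..N}" K] K(1) that by fastforce
  thus ?thesis using K(1) by (intro exI[of _ "\<Sum>n\<le>N. K n"]) (auto intro: sum_nonneg)
qed

lemma Gamma_right_bounded: "\<exists>K\<ge>0. \<forall>s. 1 \<le> Re s \<and> Re s \<le> M \<longrightarrow> norm (Gamma s :: complex) \<le> K"
proof -
  have "\<exists>K\<ge>0. \<forall>s\<in>{s. 1 \<le> Re s \<and> Re s \<le> M}. norm (Gamma s) \<le> K"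
  proof (rule Gamma_bounded_on[where Y = "cbox (Complex 1 (-1)) (Complex M 1)"])
    show "cbox (Complex 1 (- 1)) (Complex M 1) \<inter> \<int>\<^sub>\<le>\<^sub>0 = {}"
      by (auto simp: in_cbox_complex_iff elim!: nonpos_Ints_cases)
  qed (auto simp: in_cbox_complex_iff)
  thus ?thesis by auto
qed

lemma contour_kernel_integrable:
  fixes d :: nat
  assumes g: "mb_tail g c T" "\<And>t k. g t \<noteq> of_nat (d + k)" "\<And>t. \<bar>Re (g t)\<bar> < M"
    and G: "continuous_on UNIV (\<lambda>t. G (g t))"
      "\<And>s. \<bar>Re s\<bar> < M \<Longrightarrow> \<bar>Im s\<bar> \<ge> Y \<Longrightarrow> norm (G s) \<le> B * exp \<bar>Im s\<bar>"
  shows "integrable lborel (\<lambda>t. Gamma (of_nat d - g t) * G (g t) * vector_derivative g (at t))"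
proof -
  obtain A where A: "A > 0" "\<And>s. \<bar>Re s\<bar> \<le> \<bar>M\<bar> + real d \<Longrightarrow> \<bar>Im s\<bar> \<ge> 1 \<Longrightarrow> norm (Gamma s :: complex) \<le> A * exp (- (5/4) * \<bar>Im s\<bar>)"
    using Gamma_strip_bound[of "\<bar>M\<bar> + real d"] by auto
  show ?thesis
  proof (rule integrable_exp_decay)
    have "of_nat d - g t \<notin> \<int>\<^sub>\<le>\<^sub>0" for t
    proof
      assume "of_nat d - g t \<in> \<int>\<^sub>\<le>\<^sub>0"
      then obtain k where "of_nat d - g t = - of_nat k" by (auto elim!: nonpos_Ints_cases')
      hence "g t = of_nat (d + k)" by (simp add: algebra_simps)
      thus False using g(2) by blast
    qed
    hence "continuous_on UNIV (\<lambda>t. Gamma (of_nat d - g t))"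
      by (intro continuous_on_compose2[OF holomorphic_on_imp_continuous_on[OF holomorphic_Gamma[of "- \<int>\<^sub>\<le>\<^sub>0"]]]
          continuous_intros mb_tail_continuous[OF g(1)]) auto
    thus "continuous_on UNIV (\<lambda>t. Gamma (of_nat d - g t) * G (g t) * vector_derivative g (at t))"
      by (intro continuous_on_mult G mb_tail_continuous_deriv[OF g(1)])
    fix t assume t: "\<bar>t\<bar> \<ge> max (T + 1) (max 1 Y)"
    have gt: "g t = Complex c t" "vector_derivative g (at t) = \<i>"
      using t g(1) mb_tail_deriv_tail[OF g(1), of t] by (auto simp: mb_tail_def)
    have "norm (Gamma (of_nat d - g t)) \<le> A * exp (- (5/4) * \<bar>t\<bar>)"
      using A(2)[of "of_nat d - g t"] g(3)[of t] t gt by auto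
    moreover have "norm (G (g t)) \<le> B * exp \<bar>t\<bar>" using G(2)[of "g t"] g(3)[of t] t gt by auto
    ultimately have "norm (Gamma (of_nat d - g t)) * norm (G (g t)) \<le> (A * exp (- (5/4) * \<bar>t\<bar>)) * (B * exp \<bar>t\<bar>)"
      using A(1) by (intro mult_mono) auto
    also have "\<dots> = (A * B) * (exp (- (5/4) * \<bar>t\<bar>) * exp \<bar>t\<bar>)" by simp
    also have "exp (- (5/4) * \<bar>t\<bar>) * exp \<bar>t\<bar> = exp (- (1/4) * \<bar>t\<bar>)" unfolding exp_add[symmetric] by simp
    finally show "norm (Gamma (of_nat d - g t) * G (g t) * vector_derivative g (at t)) \<le> (A * B) * exp (- (1/4) * \<bar>t\<bar>)"
      using gt by (simp add: norm_mult)
  qed auto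
qed

text \<open>Here w is 2 plus the other variables. The poles of \<open>Gamma (a + s)\<close> and
  \<open>Gamma (w + s)\<close> lie left of both contours, so just the poles 0, ..., N of the kernel
  are swept; they are the point masses built into \<open>res_weight\<close>.\<close>

lemma residue_step:
  assumes x: "x > 0" and g: "mb_tail g c T" and strip: "\<And>t. \<bar>Re (g t)\<bar> < M" "real N + 1/2 < M"
    and a: "\<And>k::nat. left_of g (- of_real a - of_nat k)" "- a < real N + 1/2"
    and w: "\<And>k::nat. left_of g (- w - of_nat k)" "- Re w < real N + 1/2"
    and r: "\<And>k::nat. right_of g (of_nat k)"
  shows "(\<integral>t. Gamma (- g t) * (barnes a b x (g t) * Gamma (w + g t)) * vector_derivative g (at t) \<partial>lborel) =
     (\<integral>t. res_weight N t * (barnes a b x (res_point N t) * Gamma (w + res_point N t)) \<partial>lborel)"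
proof -
  define L where "L = gpoles w (nat \<lceil>M + \<bar>Re w\<bar>\<rceil>)"
  have 1: "\<bar>real N + 1/2\<bar> < M" using strip(2) by auto
  have 2: "finite L" by (simp add: L_def)
  have 3: "(\<lambda>s. Gamma (w + s)) holomorphic_on {s. \<bar>Re s\<bar> < M} - L"
    by (intro holomorphic_intros) (use gpoles_cover[of _ M w] in \<open>auto simp: L_def\<close>)
  have 4: "\<And>p. p \<in> L \<Longrightarrow> left_of g p \<and> Re p < real N + 1/2" using w by (auto simp: L_def gpoles_def)
  have 5: "\<And>k. k \<in> {..N} \<Longrightarrow> right_of g (of_nat (0 + k)) \<and> real (0 + k) < real N + 1/2" using r by auto
  have 6: "left_of g (of_nat (0 + k)) \<and> real (0 + k) < real N + 1/2 \<or> right_of g (of_nat (0 + k)) \<and> real (0 + k) > real N + 1/2"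
    if "k \<notin> {..N}" for k
  proof -
    have "real k \<ge> real N + 1" using that by auto
    thus ?thesis using r by auto
  qed
  obtain A where A: "A > 0" "\<And>s. \<bar>Re s\<bar> \<le> M + \<bar>Re w\<bar> \<Longrightarrow> \<bar>Im s\<bar> \<ge> 1 \<Longrightarrow> norm (Gamma s :: complex) \<le> A * exp (- (5/4) * \<bar>Im s\<bar>)"
    using Gamma_strip_bound[of "M + \<bar>Re w\<bar>"] by auto
  have 7: "norm (Gamma (w + s)) \<le> A" if "\<bar>Re s\<bar> < M" "\<bar>Im s\<bar> \<ge> \<bar>Im w\<bar> + 1" for s
  proof -
    have "norm (Gamma (w + s)) \<le> A * exp (- (5/4) * \<bar>Im (w + s)\<bar>)" using that by (intro A) auto
    also have "\<dots> \<le> A * 1" using A(1) by (intro mult_left_mono) auto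
    finally show ?thesis by simp
  qed
  note bs = barnes_shift[where d = 0 and Kn = "{..N}" and b = b, OF x g strip(1) 1 a 2 3 4 5 6 7]
  have I: "integrable lborel (\<lambda>t. Gamma (- mb_line (real N + 1/2) t) * (barnes a b x (mb_line (real N + 1/2) t) * Gamma (w + mb_line (real N + 1/2) t)))"
    using bs(2) by simp
  show ?thesis using bs(3) res_integral(2)[where G = "\<lambda>s. barnes a b x s * Gamma (w + s)", OF I] by simp
qed

text \<open>The poles 1, 2, ... of the kernel are right of the old contour and of Re s = 1/2 alike,
  so no residue appears for the fourth variable.\<close>

lemma line_step:
  assumes x: "x > 0" and g: "mb_tail g c T"
    and a: "\<And>k::nat. left_of g (- of_nat k)"
    and w: "\<And>k::nat. left_of g (- w - of_nat k)" "Re w > 0"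
    and r: "\<And>k::nat. right_of g (of_nat (1 + k))"
  shows "(\<integral>t. Gamma (1 - g t) * (barnes 0 1 x (g t) * Gamma (g t) * Gamma (w + g t)) * vector_derivative g (at t) \<partial>lborel) =
     \<i> * (\<integral>t. Gamma (1 - mb_line (1/2) t) * (barnes 0 1 x (mb_line (1/2) t) * Gamma (mb_line (1/2) t) * Gamma (w + mb_line (1/2) t)) \<partial>lborel)"
proof -
  obtain M0 where M0: "M0 > 0" "\<And>t. \<bar>Re (g t)\<bar> \<le> M0" using mb_tail_bounded[OF g] by auto
  define M where "M = M0 + 1"
  have M: "\<bar>Re (g t)\<bar> < M" "\<bar>1/2\<bar> < M" for t using M0(1) M0(2)[of t] by (auto simp: M_def)
  define L where "L = gpoles 0 (nat \<lceil>M + \<bar>Re 0\<bar>\<rceil>) \<union> gpoles w (nat \<lceil>M + \<bar>Re w\<bar>\<rceil>)"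
  have a': "\<And>k::nat. left_of g (- of_real 0 - of_nat k)" "- 0 < (1/2::real)" using a by auto
  have 2: "finite L" by (simp add: L_def)
  have 3: "(\<lambda>s. Gamma s * Gamma (w + s)) holomorphic_on {s. \<bar>Re s\<bar> < M} - L"
  proof (intro holomorphic_intros)
    show "({s. \<bar>Re s\<bar> < M} - L) \<inter> \<int>\<^sub>\<le>\<^sub>0 = {}" using gpoles_cover[of _ M 0] by (auto simp: L_def)
  qed (use gpoles_cover[of _ M w] in \<open>auto simp: L_def\<close>)
  have 4: "\<And>p. p \<in> L \<Longrightarrow> left_of g p \<and> Re p < 1/2" using w a by (auto simp: L_def gpoles_def)
  have 6: "left_of g (of_nat (1 + k)) \<and> real (1 + k) < 1/2 \<or> right_of g (of_nat (1 + k)) \<and> real (1 + k) > 1/2" for k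
    using r by auto
  obtain A where A: "A > 0" "\<And>s. \<bar>Re s\<bar> \<le> M + \<bar>Re w\<bar> \<Longrightarrow> \<bar>Im s\<bar> \<ge> 1 \<Longrightarrow> norm (Gamma s :: complex) \<le> A * exp (- (5/4) * \<bar>Im s\<bar>)"
    using Gamma_strip_bound[of "M + \<bar>Re w\<bar>"] by auto
  have A1: "norm (Gamma s) \<le> A" if "\<bar>Re s\<bar> \<le> M + \<bar>Re w\<bar>" "\<bar>Im s\<bar> \<ge> 1" for s
  proof -
    have "norm (Gamma s) \<le> A * exp (- (5/4) * \<bar>Im s\<bar>)" using that by (intro A) auto
    also have "\<dots> \<le> A * 1" using A(1) by (intro mult_left_mono) auto
    finally show ?thesis by simp
  qed
  have 7: "norm (Gamma s * Gamma (w + s)) \<le> A * A" if "\<bar>Re s\<bar> < M" "\<bar>Im s\<bar> \<ge> \<bar>Im w\<bar> + 1" for s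
    unfolding norm_mult using that A(1) by (intro mult_mono A1) auto
  note bs = barnes_shift[where d = 1 and Kn = "{}" and b = 1, OF x g M a' 2 3 4 _ 6 7]
  show ?thesis using bs(3) by (simp add: mult.assoc)
qed

section \<open>Deforming the four-fold integral\<close>

text \<open>Points and weights are independent functions of the parameter, so one expression serves
  for contours, for lines with residues, and for mixtures of both.\<close>

definition joint_integrand :: "(nat \<Rightarrow> real \<Rightarrow> complex) \<Rightarrow> (nat \<Rightarrow> real \<Rightarrow> complex) \<Rightarrow> (nat \<Rightarrow> real) \<Rightarrow> complex" where
  "joint_integrand \<omega> \<zeta> t = Gamma (2 + (\<Sum>i<4. \<zeta> i (t i))) * rGamma (2 + \<zeta> 0 (t 0) + \<zeta> 1 (t 1)) * (\<Prod>i<4. \<omega> i (t i))"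

text \<open>Bounds the growth of \<open>1 / \<Gamma>(2 + s\<^sub>0 + s\<^sub>1)\<close>, distributed over the two variables it couples;
  \<open>9/4\<close> is affordable because \<open>\<Gamma>(-s) \<Gamma>(a + s)\<close> decays like \<open>exp (- 5/2 * \<bar>Im s\<bar>)\<close> or faster.\<close>

definition joint_weight :: "nat \<Rightarrow> complex \<Rightarrow> real" where
  "joint_weight i s = (if i < 2 then exp (9/4 * \<bar>Im s\<bar>) else 1)"

lemma prod_joint_weight:
  "n \<ge> 2 \<Longrightarrow> (\<Prod>i<n. joint_weight i (s i)) = exp (9/4 * \<bar>Im (s 0)\<bar>) * exp (9/4 * \<bar>Im (s 1)\<bar>)"
proof (induction n rule: dec_induct)
  case base
  thus ?case by (simp add: numeral_2_eq_2 joint_weight_def)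
next
  case (step n)
  thus ?case by (simp add: joint_weight_def)
qed

text \<open>As |Im (s0 + s1)| <= |Im s0| + |Im s1|, the growth of the coupling factor can be shared
  between the two variables; the majorant is then a product of integrable functions of one variable
  each.\<close>

lemma joint_integrable:
  fixes n :: nat and \<omega> \<zeta> :: "nat \<Rightarrow> real \<Rightarrow> complex" and G :: "(nat \<Rightarrow> real) \<Rightarrow> complex"
  assumes n: "n \<ge> 2" and meas: "\<And>i. i < n \<Longrightarrow> \<omega> i \<in> borel_measurable borel" "\<And>i. i < n \<Longrightarrow> \<zeta> i \<in> borel_measurable borel"
    and int: "\<And>i. i < n \<Longrightarrow> integrable lborel (\<lambda>t. \<omega> i t * of_real (joint_weight i (\<zeta> i t)))"
    and M: "\<And>i t. i < n \<Longrightarrow> \<bar>Re (\<zeta> i t)\<bar> \<le> M"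
    and G: "G \<in> borel_measurable (PiM {..<n} (\<lambda>_. lborel))" "\<And>t. norm (G t) \<le> K"
  shows "integrable (PiM {..<n} (\<lambda>_. lborel)) (\<lambda>t. G t * rGamma (2 + \<zeta> 0 (t 0) + \<zeta> 1 (t 1)) * (\<Prod>i<n. \<omega> i (t i)))"
proof -
  interpret product_sigma_finite "\<lambda>_::nat. lborel :: real measure" by standard
  obtain A where A: "A > 0" "\<And>s. \<bar>Re s\<bar> \<le> 2 + 2 * M \<Longrightarrow> norm (rGamma s :: complex) \<le> A * exp (9/4 * \<bar>Im s\<bar>)"
    using rGamma_strip_bound[of "2 + 2 * M"] by auto
  have comp: "(\<lambda>t. f (t i)) \<in> borel_measurable (PiM {..<n} (\<lambda>_. lborel))"
    if "f \<in> borel_measurable borel" "i < n" for f :: "real \<Rightarrow> complex" and i :: nat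
    using that by (intro measurable_compose[OF measurable_component_singleton, of i]) auto
  define b where "b t = (\<Prod>i<n. \<omega> i (t i) * of_real (joint_weight i (\<zeta> i (t i))))" for t
  have bint: "integrable (PiM {..<n} (\<lambda>_. lborel)) b"
    unfolding b_def by (rule product_integrable_prod) (use int in auto)
  show ?thesis
  proof (rule Bochner_Integration.integrable_bound)
    show "integrable (PiM {..<n} (\<lambda>_. lborel)) (\<lambda>t. of_real (K * A) * b t)" using bint by (rule integrable_mult_right)
    have m1: "(\<lambda>t. rGamma (2 + \<zeta> 0 (t 0) + \<zeta> 1 (t 1))) \<in> borel_measurable (PiM {..<n} (\<lambda>_. lborel))"
    proof -
      have [measurable]: "(\<lambda>t. \<zeta> 0 (t 0)) \<in> borel_measurable (PiM {..<n} (\<lambda>_. lborel))"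
        "(\<lambda>t. \<zeta> 1 (t 1)) \<in> borel_measurable (PiM {..<n} (\<lambda>_. lborel))"
        by (rule comp[OF meas(2)]; use n in simp)+
      show ?thesis by measurable
    qed
    have m2: "(\<lambda>t. \<Prod>i<n. \<omega> i (t i)) \<in> borel_measurable (PiM {..<n} (\<lambda>_. lborel))"
      by (intro borel_measurable_prod comp meas) auto
    show "(\<lambda>t. G t * rGamma (2 + \<zeta> 0 (t 0) + \<zeta> 1 (t 1)) * (\<Prod>i<n. \<omega> i (t i))) \<in> borel_measurable (PiM {..<n} (\<lambda>_. lborel))"
      by (intro borel_measurable_times G(1) m1 m2)
    show "AE t in PiM {..<n} (\<lambda>_. lborel). norm (G t * rGamma (2 + \<zeta> 0 (t 0) + \<zeta> 1 (t 1)) * (\<Prod>i<n. \<omega> i (t i))) \<le> norm (of_real (K * A) * b t)"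
    proof (rule AE_I2)
      fix t :: "nat \<Rightarrow> real"
      let ?e = "\<lambda>i. exp (9/4 * \<bar>Im (\<zeta> i (t i))\<bar>)"
      have K0: "K \<ge> 0" using G(2)[of undefined] norm_ge_zero order_trans by blast
      have "norm (rGamma (2 + \<zeta> 0 (t 0) + \<zeta> 1 (t 1))) \<le> A * exp (9/4 * \<bar>Im (2 + \<zeta> 0 (t 0) + \<zeta> 1 (t 1))\<bar>)"
        using n M[of 0 "t 0"] M[of 1 "t 1"] by (intro A(2)) (auto simp: abs_le_iff)
      also have "\<dots> \<le> A * exp (9/4 * (\<bar>Im (\<zeta> 0 (t 0))\<bar> + \<bar>Im (\<zeta> 1 (t 1))\<bar>))"
        using A(1) abs_triangle_ineq[of "Im (\<zeta> 0 (t 0))" "Im (\<zeta> 1 (t 1))"] by simp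
      also have "9/4 * (\<bar>Im (\<zeta> 0 (t 0))\<bar> + \<bar>Im (\<zeta> 1 (t 1))\<bar>) = 9/4 * \<bar>Im (\<zeta> 0 (t 0))\<bar> + 9/4 * \<bar>Im (\<zeta> 1 (t 1))\<bar>" by simp
      finally have r: "norm (rGamma (2 + \<zeta> 0 (t 0) + \<zeta> 1 (t 1))) \<le> A * (?e 0 * ?e 1)" unfolding exp_add by simp
      have "b t = (\<Prod>i<n. \<omega> i (t i)) * of_real (\<Prod>i<n. joint_weight i (\<zeta> i (t i)))"
        unfolding b_def by (simp add: prod.distrib)
      hence nb: "norm (b t) = (?e 0 * ?e 1) * norm (\<Prod>i<n. \<omega> i (t i))"
        unfolding prod_joint_weight[OF n] by (simp add: norm_mult)
      have "norm (G t) * norm (rGamma (2 + \<zeta> 0 (t 0) + \<zeta> 1 (t 1))) * norm (\<Prod>i<n. \<omega> i (t i)) \<le> K * (A * (?e 0 * ?e 1)) * norm (\<Prod>i<n. \<omega> i (t i))"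
        using r G(2)[of t] K0 by (intro mult_right_mono mult_mono) auto
      also have "\<dots> = norm (of_real (K * A) * b t)"
      proof -
        have "norm (complex_of_real (K * A)) = K * A" using K0 A(1) by (simp only: norm_of_real) simp
        thus ?thesis unfolding norm_mult[of "of_real (K * A)"] nb by (simp only: mult_ac)
      qed
      finally show "norm (G t * rGamma (2 + \<zeta> 0 (t 0) + \<zeta> 1 (t 1)) * (\<Prod>i<n. \<omega> i (t i))) \<le> norm (of_real (K * A) * b t)"
        by (simp only: norm_mult)
    qed
  qed
qed

lemma sum_component_measurable:
  assumes "\<And>i. i < 4 \<Longrightarrow> \<zeta> i \<in> borel_measurable borel"
  shows "(\<lambda>t. \<Sum>i<4. \<zeta> i (t i) :: complex) \<in> borel_measurable (PiM {..<4::nat} (\<lambda>_. lborel :: real measure))"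
  using assms by (intro borel_measurable_sum measurable_compose[OF measurable_component_singleton]) auto

text \<open>By Fubini it suffices that the inner integrals over coordinate j agree for every choice
  of the other parameters.\<close>

lemma joint_integral_replace:
  assumes j: "j < 4" and int: "integrable (PiM {..<4} (\<lambda>_. lborel)) (joint_integrand \<omega> \<zeta>)"
      "integrable (PiM {..<4} (\<lambda>_. lborel)) (joint_integrand \<omega>' \<zeta>')"
    and eq: "\<And>t. (\<integral>u. joint_integrand \<omega> \<zeta> (t(j := u)) \<partial>lborel) = (\<integral>u. joint_integrand \<omega>' \<zeta>' (t(j := u)) \<partial>lborel)"
  shows "(\<integral>t. joint_integrand \<omega> \<zeta> t \<partial>PiM {..<4} (\<lambda>_. lborel)) = (\<integral>t. joint_integrand \<omega>' \<zeta>' t \<partial>PiM {..<4} (\<lambda>_. lborel))"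
proof -
  interpret product_sigma_finite "\<lambda>_::nat. lborel :: real measure" by standard
  have ins: "insert j ({..<4} - {j}) = {..<4}" using j by auto
  show ?thesis
    using product_integral_insert[of "{..<4} - {j}" j "joint_integrand \<omega> \<zeta>"]
      product_integral_insert[of "{..<4} - {j}" j "joint_integrand \<omega>' \<zeta>'"] int
    unfolding ins by (simp add: eq)
qed

lemma joint_integrand_upd:
  assumes j: "j < 4"
  shows "joint_integrand \<omega> \<zeta> (t(j := u)) = (\<Prod>i\<in>{..<4} - {j}. \<omega> i (t i)) *
    (Gamma (2 + (\<Sum>i\<in>{..<4} - {j}. \<zeta> i (t i)) + \<zeta> j u) *
     rGamma (2 + (if j = 0 then \<zeta> 0 u else \<zeta> 0 (t 0)) + (if j = 1 then \<zeta> 1 u else \<zeta> 1 (t 1))) * \<omega> j u)"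
proof -
  have "(\<Sum>i<4. \<zeta> i ((t(j := u)) i)) = \<zeta> j u + (\<Sum>i\<in>{..<4} - {j}. \<zeta> i (t i))"
    using j by (simp add: sum.remove[of "{..<4}" j])
  moreover have "(\<Prod>i<4. \<omega> i ((t(j := u)) i)) = \<omega> j u * (\<Prod>i\<in>{..<4} - {j}. \<omega> i (t i))"
    using j by (simp add: prod.remove[of "{..<4}" j])
  ultimately show ?thesis unfolding joint_integrand_def by (simp add: add_ac mult_ac)
qed

section \<open>Moving the contours one variable at a time\<close>

locale mb_four =
  fixes a x :: "nat \<Rightarrow> real"
  assumes x_pos: "\<And>i. x i > 0" and a_nonint: "\<And>i. i < 3 \<Longrightarrow> a i \<notin> \<int>" and a_3: "a 3 = 0"
begin

definition dnum :: "nat \<Rightarrow> nat" where "dnum i = (if i = 3 then 1 else 0)"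

text \<open>What remains of variable i once the kernel \<open>Gamma (d - s)\<close> and the coupling
  factors are split off. The reciprocal Gammas of the lower joint list that involve a single
  variable are included for i = 2 and i = 3.\<close>

definition factor :: "nat \<Rightarrow> complex \<Rightarrow> complex" where
  "factor i s = (if i < 2 then Gamma (of_real (a i) + s) * of_real (x i) powr s
     else if i = 2 then barnes (a 2) 1 (x 2) s else barnes 0 1 (x 3) s * Gamma s)"

definition std_point :: "nat \<Rightarrow> nat \<Rightarrow> real \<Rightarrow> complex" where
  "std_point N i = (if i < 3 then res_point N else mb_line (1/2))"

definition std_weight :: "nat \<Rightarrow> nat \<Rightarrow> real \<Rightarrow> complex" where
  "std_weight N i t = (if i < 3 then res_weight N t * factor i (res_point N t)
     else \<i> * Gamma (1 - mb_line (1/2) t) * factor i (mb_line (1/2) t))"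

definition path_weight :: "(nat \<Rightarrow> real \<Rightarrow> complex) \<Rightarrow> nat \<Rightarrow> real \<Rightarrow> complex" where
  "path_weight g i t = Gamma (of_nat (dnum i) - g i t) * factor i (g i t) * vector_derivative (g i) (at t)"

definition mix_point :: "(nat \<Rightarrow> real \<Rightarrow> complex) \<Rightarrow> nat \<Rightarrow> nat \<Rightarrow> nat \<Rightarrow> real \<Rightarrow> complex" where
  "mix_point g N m i = (if i < m then std_point N i else g i)"

definition mix_weight :: "(nat \<Rightarrow> real \<Rightarrow> complex) \<Rightarrow> nat \<Rightarrow> nat \<Rightarrow> nat \<Rightarrow> real \<Rightarrow> complex" where
  "mix_weight g N m i = (if i < m then std_weight N i else path_weight g i)"

lemma factor_bound:
  assumes "i < 4"
  shows "\<exists>B. \<forall>s. \<bar>Re s\<bar> < M \<and> \<bar>Im s\<bar> \<ge> 1 \<longrightarrow> norm (factor i s * of_real (joint_weight i s)) \<le> B * exp \<bar>Im s\<bar>"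
proof -
  obtain A where A: "A > 0" "\<And>s. \<bar>Re s\<bar> \<le> \<bar>M\<bar> + \<bar>a i\<bar> \<Longrightarrow> \<bar>Im s\<bar> \<ge> 1 \<Longrightarrow> norm (Gamma s :: complex) \<le> A * exp (- (5/4) * \<bar>Im s\<bar>)"
    using Gamma_strip_bound[of "\<bar>M\<bar> + \<bar>a i\<bar>"] by auto
  consider "i < 2" | "i = 2" | "i = 3" using assms by linarith
  thus ?thesis
  proof cases
    case 1
    have "norm (factor i s * of_real (joint_weight i s)) \<le> (A * exp (\<bar>M\<bar> * \<bar>ln (x i)\<bar>)) * exp \<bar>Im s\<bar>"
      if s: "\<bar>Re s\<bar> < M" "\<bar>Im s\<bar> \<ge> 1" for s
    proof -
      have "norm (Gamma (of_real (a i) + s)) \<le> A * exp (- (5/4) * \<bar>Im s\<bar>)"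
        using A(2)[of "of_real (a i) + s"] s by auto
      moreover have "norm (of_real (x i) powr s :: complex) \<le> exp (\<bar>M\<bar> * \<bar>ln (x i)\<bar>)"
      proof -
        have "norm (of_real (x i) powr s :: complex) = exp (Re s * ln (x i))"
          using x_pos[of i] by (simp add: norm_of_real_powr powr_def)
        also have "Re s * ln (x i) \<le> \<bar>Re s * ln (x i)\<bar>" by (rule abs_ge_self)
        also have "\<dots> = \<bar>Re s\<bar> * \<bar>ln (x i)\<bar>" by (rule abs_mult)
        also have "\<dots> \<le> \<bar>M\<bar> * \<bar>ln (x i)\<bar>" using s by (intro mult_right_mono) auto
        finally show ?thesis by simp
      qed
      ultimately have "norm (Gamma (of_real (a i) + s)) * norm (of_real (x i) powr s :: complex) * exp (9/4 * \<bar>Im s\<bar>)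
         \<le> (A * exp (- (5/4) * \<bar>Im s\<bar>)) * exp (\<bar>M\<bar> * \<bar>ln (x i)\<bar>) * exp (9/4 * \<bar>Im s\<bar>)"
        using A(1) by (intro mult_right_mono mult_mono) auto
      also have "\<dots> = (A * exp (\<bar>M\<bar> * \<bar>ln (x i)\<bar>)) * (exp (- (5/4) * \<bar>Im s\<bar>) * exp (9/4 * \<bar>Im s\<bar>))" by simp
      also have "exp (- (5/4) * \<bar>Im s\<bar>) * exp (9/4 * \<bar>Im s\<bar>) = exp \<bar>Im s\<bar>" unfolding exp_add[symmetric] by simp
      finally show ?thesis using 1 by (simp add: factor_def joint_weight_def norm_mult)
    qed
    thus ?thesis by blast
  next
    case 2
    then show ?thesis using barnes_bound[OF x_pos[of 2], of M "a 2" 1] by (auto simp: factor_def joint_weight_def)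
  next
    case 3
    obtain B where B: "B \<ge> 0" "\<And>s. \<bar>Re s\<bar> < M \<Longrightarrow> \<bar>Im s\<bar> \<ge> 1 \<Longrightarrow> norm (barnes 0 1 (x 3) s) \<le> B * exp \<bar>Im s\<bar>"
      using barnes_bound[OF x_pos[of 3], of M 0 1] by auto
    have "norm (factor i s * of_real (joint_weight i s)) \<le> (B * A) * exp \<bar>Im s\<bar>" if s: "\<bar>Re s\<bar> < M" "\<bar>Im s\<bar> \<ge> 1" for s
    proof -
      have "norm (Gamma s) \<le> A * exp (- (5/4) * \<bar>Im s\<bar>)" using s by (intro A) auto
      also have "\<dots> \<le> A * 1" using A(1) by (intro mult_left_mono) auto
      finally have "norm (barnes 0 1 (x 3) s) * norm (Gamma s) \<le> (B * exp \<bar>Im s\<bar>) * A"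
        using B s by (intro mult_mono) auto
      thus ?thesis using 3 by (simp add: factor_def joint_weight_def norm_mult mult_ac)
    qed
    thus ?thesis by blast
  qed
qed

lemma factor_measurable [measurable]: "factor i \<in> borel_measurable borel"
  unfolding factor_def[abs_def] barnes_def by measurable

lemma joint_weight_measurable [measurable]: "joint_weight i \<in> borel_measurable borel"
  unfolding joint_weight_def[abs_def] by measurable

lemma factor_continuous:
  assumes i: "i < 4" and g: "continuous_on UNIV g" "\<And>t k. g t \<noteq> - of_real (a i) - of_nat k"
  shows "continuous_on UNIV (\<lambda>t. factor i (g t) * of_real (joint_weight i (g t)))"
proof -
  have np: "of_real (a i) + g t \<notin> \<int>\<^sub>\<le>\<^sub>0" for t
  proof
    assume "of_real (a i) + g t \<in> \<int>\<^sub>\<le>\<^sub>0"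
    then obtain k where "of_real (a i) + g t = - of_nat k" by (auto elim!: nonpos_Ints_cases')
    hence "g t = - of_nat k - of_real (a i)" by (metis add_diff_cancel_left')
    thus False using g(2)[of t k] by simp
  qed
  have G: "continuous_on UNIV (\<lambda>t. Gamma (of_real (a i) + g t))"
    using np by (intro continuous_on_compose2[OF holomorphic_on_imp_continuous_on[OF holomorphic_Gamma[of "- \<int>\<^sub>\<le>\<^sub>0"]]]
          continuous_intros g) auto
  have P: "continuous_on UNIV (\<lambda>t. (of_real (x j) :: complex) powr g t)" for j
    using x_pos[of j] by (intro continuous_on_powr_complex continuous_intros g) auto
  have R: "continuous_on UNIV (\<lambda>t. rGamma (1 + g t))"
    by (intro continuous_on_compose2[OF continuous_on_rGamma[of UNIV]] continuous_intros g) auto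
  have J: "continuous_on UNIV (\<lambda>t. complex_of_real (joint_weight i (g t)))"
    unfolding joint_weight_def by (cases "i < 2") (auto intro!: continuous_intros g)
  consider "i < 2" | "i = 2" | "i = 3" using i by linarith
  hence "continuous_on UNIV (\<lambda>t. factor i (g t))"
  proof cases
    case 1 thus ?thesis unfolding factor_def using G P by (auto intro!: continuous_on_mult)
  next
    case 2 thus ?thesis unfolding factor_def barnes_def using G P R by (auto intro!: continuous_on_mult)
  next
    case 3 thus ?thesis unfolding factor_def barnes_def using G P R a_3 by (auto intro!: continuous_on_mult)
  qed
  thus ?thesis using J by (rule continuous_on_mult)
qed

lemma path_weight_integrable:
  assumes i: "i < 4" and g: "mb_tail (g i) c T"
    and l: "\<And>t k. g i t \<noteq> - of_real (a i) - of_nat k" and r: "\<And>t k. g i t \<noteq> of_nat (dnum i + k)"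
  shows "integrable lborel (\<lambda>t. path_weight g i t * of_real (joint_weight i (g i t)))"
proof -
  obtain M0 where M0: "M0 > 0" "\<And>t. \<bar>Re (g i t)\<bar> \<le> M0" using mb_tail_bounded[OF g] by auto
  obtain B where B: "\<And>s. \<bar>Re s\<bar> < M0 + 1 \<Longrightarrow> \<bar>Im s\<bar> \<ge> 1 \<Longrightarrow> norm (factor i s * of_real (joint_weight i s)) \<le> B * exp \<bar>Im s\<bar>"
    using factor_bound[OF i, of "M0 + 1"] by blast
  have "\<bar>Re (g i t)\<bar> < M0 + 1" for t using M0(2)[of t] by linarith
  from contour_kernel_integrable[OF g r this factor_continuous[OF i mb_tail_continuous[OF g] l] B]
  show ?thesis by (simp add: path_weight_def mult_ac)
qed

lemma a_line: "- of_real (a i) - of_nat k \<noteq> mb_line C t" if "- a i < C"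
  using that by (auto simp: complex_eq_iff mb_line_def)

lemma std_weight_integrable:
  assumes i: "i < 4" and N: "\<And>i. i < 3 \<Longrightarrow> - a i < real N + 1/2"
  shows "integrable lborel (\<lambda>t. std_weight N i t * of_real (joint_weight i (std_point N i t)))"
proof (cases "i < 3")
  case True
  let ?G = "\<lambda>s. factor i s * of_real (joint_weight i s)"
  let ?C = "real N + 1/2"
  \<comment> \<open>The abscissa is half an odd number, so the line misses all poles of the
    kernel.\<close>
  have half: "real n \<noteq> ?C" for n
  proof
    assume "real n = ?C"
    hence "real (2 * n) = real (2 * N + 1)" by simp
    hence "2 * n = 2 * N + 1" by (simp only: of_nat_eq_iff)
    thus False by presburger
  qed
  have "integrable lborel (\<lambda>t. path_weight (\<lambda>_. mb_line ?C) i t * of_real (joint_weight i (mb_line ?C t)))"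
  proof (rule path_weight_integrable[OF i mb_tail_line])
    show "mb_line ?C t \<noteq> - of_real (a i) - of_nat k" for t k using a_line[OF N[OF True]] by metis
    show "mb_line ?C t \<noteq> of_nat (dnum i + k)" for t k using half[of "dnum i + k"]
      by (auto simp: mb_line_def complex_eq_iff)
  qed
  hence "integrable lborel (\<lambda>t. - \<i> * (path_weight (\<lambda>_. mb_line ?C) i t * of_real (joint_weight i (mb_line ?C t))))"
    by (rule integrable_mult_right)
  hence "integrable lborel (\<lambda>t. Gamma (- mb_line ?C t) * ?G (mb_line ?C t))"
    using True by (simp add: path_weight_def dnum_def vector_derivative_mb_line mult_ac)
  from res_integral(1)[OF this] show ?thesis
    using True by (simp add: std_weight_def std_point_def mult_ac)
next
  case False
  hence i3: "i = 3" using i by auto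
  have "integrable lborel (\<lambda>t. path_weight (\<lambda>_. mb_line (1/2)) i t * of_real (joint_weight i (mb_line (1/2) t)))"
  proof (rule path_weight_integrable[OF i mb_tail_line])
    show "mb_line (1/2) t \<noteq> - of_real (a i) - of_nat k" for t k using a_line[of i "1/2"] a_3 i3 by (metis half_gt_zero_iff neg_0_less_iff_less neg_equal_zero zero_less_one)
    show "mb_line (1/2) t \<noteq> of_nat (dnum i + k)" for t k using i3
      by (auto simp: mb_line_def complex_eq_iff dnum_def)
  qed
  thus ?thesis using i3 by (simp add: path_weight_def std_weight_def std_point_def dnum_def vector_derivative_mb_line mult_ac)
qed

lemma std_point_Re:
  "0 \<le> Re (std_point N i t)" "Re (std_point N i t) \<le> real N + 1/2"
  using Re_res_point[of N t] by (auto simp: std_point_def mb_line_def)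

lemma std_measurable: "std_point N i \<in> borel_measurable borel" "std_weight N i \<in> borel_measurable borel"
proof -
  have "(\<lambda>t. res_weight N t * factor i (res_point N t)) \<in> borel_measurable borel"
    "(\<lambda>t. \<i> * Gamma (1 - mb_line (1/2) t) * factor i (mb_line (1/2) t)) \<in> borel_measurable borel"
    by measurable
  thus "std_weight N i \<in> borel_measurable borel"
    by (cases "i < 3") (simp_all add: std_weight_def[abs_def])
  show "std_point N i \<in> borel_measurable borel"
    by (cases "i < 3") (simp_all add: std_point_def res_point_measurable mb_line_borel_measurable)
qed

lemma res_point_cases: "(\<exists>n\<le>N. res_point N t = of_nat n) \<or> Re (res_point N t) = real N + 1/2"
proof (cases "0 \<le> t \<and> t < real N + 1")
  case True
  have "\<lfloor>t\<rfloor> \<le> int N" using True by linarith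
  hence "nat \<lfloor>t\<rfloor> \<le> N" by simp
  thus ?thesis using True by (auto simp: res_point_def)
qed (auto simp: res_point_def mb_line_def)

text \<open>No standard point has negative real part, so a single one on a line lifts the sum to N +
  1/2; otherwise all are residue points. The joint Gamma is then controlled by size or by
  translation, respectively.\<close>

lemma std_sum_cases:
  assumes "m \<le> 3"
  shows "(\<exists>n\<le>m * N. (\<Sum>i<m. std_point N i (t i)) = of_nat n) \<or> Re (\<Sum>i<m. std_point N i (t i)) \<ge> real N + 1/2"
  using assms
proof (induction m)
  case (Suc m)
  have pt: "std_point N m (t m) = res_point N (t m)" using Suc.prems by (simp add: std_point_def)
  have nn: "Re (\<Sum>i<m. std_point N i (t i)) \<ge> 0" by (auto intro!: sum_nonneg std_point_Re)
  from Suc.IH Suc.prems consider n where "n \<le> m * N" "(\<Sum>i<m. std_point N i (t i)) = of_nat n"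
    | "Re (\<Sum>i<m. std_point N i (t i)) \<ge> real N + 1/2" by auto
  thus ?case
  proof cases
    case 1
    from res_point_cases[of N "t m"] show ?thesis
    proof
      assume "\<exists>n\<le>N. res_point N (t m) = of_nat n"
      then obtain n' where n': "n' \<le> N" "res_point N (t m) = of_nat n'" by blast
      have "(\<Sum>i<Suc m. std_point N i (t i)) = of_nat (n + n')" using 1 n' pt by simp
      moreover have "n + n' \<le> Suc m * N" using 1 n' by simp
      ultimately show ?thesis by blast
    qed (use nn pt in simp)
  next
    case 2
    thus ?thesis using Re_res_point(1)[of N "t m"] pt by simp
  qed
qed simp

lemma joint_integrand_cong:
  assumes "\<And>i. i < 4 \<Longrightarrow> \<omega> i = \<omega>' i" "\<And>i. i < 4 \<Longrightarrow> \<zeta> i = \<zeta>' i"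
  shows "joint_integrand \<omega> \<zeta> = joint_integrand \<omega>' \<zeta>'"
  unfolding joint_integrand_def fun_eq_iff using assms by simp

end

text \<open>N outweighs the contours not yet moved, whose real parts sum to at most 4 M in modulus,
  as well as the contour being moved, with room to spare.\<close>

locale mb_four_paths = mb_four +
  fixes g :: "nat \<Rightarrow> real \<Rightarrow> complex" and c :: "nat \<Rightarrow> real" and T M :: real and N :: nat
  assumes tail: "\<And>i. i < 4 \<Longrightarrow> mb_tail (g i) (c i) T"
    and left: "\<And>i k. i < 4 \<Longrightarrow> left_of (g i) (- of_real (a i) - of_nat k)"
    and right: "\<And>i k. i < 4 \<Longrightarrow> right_of (g i) (of_nat (dnum i + k))"
    and Q: "sum_avoids g c {..<4}"
    and M: "\<And>i t. i < 4 \<Longrightarrow> \<bar>Re (g i t)\<bar> \<le> M"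
    and N: "real N \<ge> 8 * M + 4" "\<And>i. i < 3 \<Longrightarrow> - a i < real N + 1/2"
begin

lemma right_0: "i < 3 \<Longrightarrow> right_of (g i) (of_nat k)"
  using right[of i k] by (simp add: dnum_def)

text \<open>Removing a variable requires two others to remain, so only variables 0 and 1 are
  stripped here. The last variable alone is treated in \<open>tail_avoids\<close>: as
  \<open>a 3 = 0\<close>, the points - 2 - k are among its own left poles.\<close>

lemma sum_avoids_from: "m \<le> 2 \<Longrightarrow> sum_avoids g c {m..<4}"
proof (induction m)
  case 0
  thus ?case using Q by (simp add: atLeast0LessThan)
next
  case (Suc m)
  have "sum_avoids g c ({m..<4} - {m})"
    using Suc right_0[of m 0]
    by (intro sum_avoids_remove[where i = 2 and i' = 3 and T = T]) (auto intro!: tail)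
  moreover have "{m..<4} - {m} = {Suc m..<4}" by auto
  ultimately show ?case by simp
qed

lemma tail_avoids: "m \<le> 3 \<Longrightarrow> (\<Sum>i\<in>{m..<4}. g i (t i)) \<noteq> - 2 - of_nat k"
proof (cases "m = 3")
  case True
  have "{3..<4} = {3::nat}" by auto
  moreover have "- 2 - of_nat k \<notin> range (g 3)" using left[of 3 "k + 2"] a_3 by (simp add: left_of_def)
  hence "g 3 (t 3) \<noteq> - 2 - of_nat k" by (metis rangeI)
  ultimately show ?thesis using True by simp
next
  case False
  assume "m \<le> 3"
  thus ?thesis using False sum_avoids_from[of m] by (simp add: sum_avoids_def)
qed

lemma M_nonneg: "M \<ge> 0" using M[of 0 0] by linarith

lemma Re_tail_sum: "\<bar>Re (\<Sum>i\<in>A. g i (t i))\<bar> \<le> 4 * M" if "A \<subseteq> {..<4}"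
proof -
  have "\<bar>Re (\<Sum>i\<in>A. g i (t i))\<bar> \<le> (\<Sum>i\<in>A. \<bar>Re (g i (t i))\<bar>)" by simp
  also have "\<dots> \<le> (\<Sum>i\<in>A. M)" using that by (intro sum_mono M) auto
  also have "\<dots> \<le> (\<Sum>i\<in>{..<4::nat}. M)" using that M_nonneg by (intro sum_mono2) auto
  finally show ?thesis by simp
qed

lemma mix_sum:
  assumes "m \<le> 4"
  shows "(\<Sum>i<4. mix_point g N m i (t i)) = (\<Sum>i<m. std_point N i (t i)) + (\<Sum>i\<in>{m..<4}. g i (t i))"
proof -
  have "{..<m} \<union> {m..<4} = {..<4}" using assms by auto
  moreover have "(\<Sum>i\<in>{..<m} \<union> {m..<4}. mix_point g N m i (t i)) = (\<Sum>i<m. mix_point g N m i (t i)) + (\<Sum>i\<in>{m..<4}. mix_point g N m i (t i))"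
    by (rule sum.union_disjoint) auto
  ultimately have "(\<Sum>i<4. mix_point g N m i (t i)) = (\<Sum>i<m. mix_point g N m i (t i)) + (\<Sum>i\<in>{m..<4}. mix_point g N m i (t i))"
    by simp
  thus ?thesis by (simp add: mix_point_def)
qed

lemma Re_std_sum: "0 \<le> Re (\<Sum>i<m. std_point N i (t i))" "Re (\<Sum>i<m. std_point N i (t i)) \<le> real m * (real N + 1/2)"
proof -
  show "0 \<le> Re (\<Sum>i<m. std_point N i (t i))" by (auto intro!: sum_nonneg std_point_Re)
  have "Re (\<Sum>i<m. std_point N i (t i)) = (\<Sum>i<m. Re (std_point N i (t i)))" by simp
  also have "\<dots> \<le> (\<Sum>i<m. real N + 1/2)" by (intro sum_mono std_point_Re)
  finally show "Re (\<Sum>i<m. std_point N i (t i)) \<le> real m * (real N + 1/2)" by simp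
qed

text \<open>The dichotomy of \<open>std_sum_cases\<close> is used: natural sums leave finitely many
  translates of the unmoved sum, and in the other case the argument has real part in a bounded range
  right of 1.\<close>

lemma mix_Gamma_bounded:
  assumes m: "m \<le> 4"
  shows "\<exists>K. \<forall>t. norm (Gamma (2 + (\<Sum>i<4. mix_point g N m i (t i)))) \<le> K"
proof -
  obtain K1 where K1: "K1 \<ge> 0" "\<And>s. 1 \<le> Re s \<Longrightarrow> Re s \<le> 2 + 4 * (real N + 1/2) + 4 * M \<Longrightarrow> norm (Gamma s :: complex) \<le> K1"
    using Gamma_right_bounded[of "2 + 4 * (real N + 1/2) + 4 * M"] by blast
  have sub: "{m..<4} \<subseteq> {..<4}" by auto
  have up: "Re (2 + (\<Sum>i<4. mix_point g N m i (t i))) \<le> 2 + 4 * (real N + 1/2) + 4 * M" for t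
  proof -
    have "real m * (real N + 1/2) \<le> 4 * (real N + 1/2)" using m by (intro mult_right_mono) auto
    thus ?thesis unfolding mix_sum[OF m] using Re_std_sum(2)[of t m] Re_tail_sum[of "{m..<4}" t, OF sub] by auto
  qed
  show ?thesis
  proof (cases "m = 4")
    case True
    have "norm (Gamma (2 + (\<Sum>i<4. mix_point g N m i (t i)))) \<le> K1" for t
      using up[of t] Re_std_sum(1)[of t 4] unfolding mix_sum[OF m] by (intro K1) (auto simp: True)
    thus ?thesis by blast
  next
    case False
    hence m3: "m \<le> 3" using m by auto
    have tl: "\<And>i. i \<in> {m..<4} \<Longrightarrow> mb_tail (g i) (c i) T" using tail by auto
    obtain K2 where K2: "\<And>t n. n \<le> 3 * N \<Longrightarrow> norm (Gamma (2 + of_nat n + (\<Sum>i\<in>{m..<4}. g i (t i)))) \<le> K2"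
      using Gamma_sum_bounded[of "{m..<4}" g c T "3 * N"] tl tail_avoids[OF m3] by blast
    have "norm (Gamma (2 + (\<Sum>i<4. mix_point g N m i (t i)))) \<le> max K1 K2" for t
      using std_sum_cases[OF m3, of N t]
    proof
      assume "\<exists>n\<le>m * N. (\<Sum>i<m. std_point N i (t i)) = of_nat n"
      then obtain n where n: "n \<le> m * N" "(\<Sum>i<m. std_point N i (t i)) = of_nat n" by blast
      have "m * N \<le> 3 * N" using m3 by simp
      hence "n \<le> 3 * N" using n by linarith
      from K2[OF this, of t] show ?thesis unfolding mix_sum[OF m] n(2) by (simp add: add_ac)
    next
      assume "Re (\<Sum>i<m. std_point N i (t i)) \<ge> real N + 1/2"
      hence "1 \<le> Re (2 + (\<Sum>i<4. mix_point g N m i (t i)))"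
        unfolding mix_sum[OF m] using Re_tail_sum[of "{m..<4}" t, OF sub] N(1) M_nonneg by auto
      hence "norm (Gamma (2 + (\<Sum>i<4. mix_point g N m i (t i)))) \<le> K1" using up[of t] by (intro K1) auto
      thus ?thesis by simp
    qed
    thus ?thesis by blast
  qed
qed

lemma path_measurable:
  assumes "i < 4"
  shows "g i \<in> borel_measurable borel" "path_weight g i \<in> borel_measurable borel"
proof -
  show m [measurable]: "g i \<in> borel_measurable borel"
    by (rule borel_measurable_continuous_onI[OF mb_tail_continuous[OF tail[OF assms]]])
  have [measurable]: "(\<lambda>t. vector_derivative (g i) (at t)) \<in> borel_measurable borel"
    by (rule borel_measurable_continuous_onI[OF mb_tail_continuous_deriv[OF tail[OF assms]]])
  show "path_weight g i \<in> borel_measurable borel" unfolding path_weight_def[abs_def] by measurable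
qed

lemma mix_measurable:
  assumes "i < 4"
  shows "mix_point g N m i \<in> borel_measurable borel" "mix_weight g N m i \<in> borel_measurable borel"
  using path_measurable[OF assms] std_measurable[of N i] by (auto simp: mix_point_def mix_weight_def)

lemma mix_integrable:
  assumes m: "m \<le> 4"
  shows "integrable (PiM {..<4} (\<lambda>_. lborel)) (joint_integrand (mix_weight g N m) (mix_point g N m))"
proof -
  obtain K where K: "\<And>t. norm (Gamma (2 + (\<Sum>i<4. mix_point g N m i (t i)))) \<le> K"
    using mix_Gamma_bounded[OF m] by blast
  show ?thesis unfolding joint_integrand_def[abs_def]
  proof (rule joint_integrable[where M = "max M (real N + 1/2)"])
    show "2 \<le> (4::nat)" by simp
    fix i :: nat assume i: "i < 4"
    show "mix_weight g N m i \<in> borel_measurable borel" "mix_point g N m i \<in> borel_measurable borel"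
      using mix_measurable[OF i] by auto
    show "integrable lborel (\<lambda>t. mix_weight g N m i t * of_real (joint_weight i (mix_point g N m i t)))"
    proof (cases "i < m")
      case True
      thus ?thesis using std_weight_integrable[OF i N(2)] by (simp add: mix_weight_def mix_point_def)
    next
      case False
      have "integrable lborel (\<lambda>t. path_weight g i t * of_real (joint_weight i (g i t)))"
      proof (rule path_weight_integrable[of i g, OF i tail[OF i]])
        show "g i t \<noteq> - of_real (a i) - of_nat k" for t k using left[OF i, of k] unfolding left_of_def by (metis rangeI)
        show "g i t \<noteq> of_nat (dnum i + k)" for t k using right[OF i, of k] unfolding right_of_def by (metis rangeI)
      qed
      thus ?thesis using False by (simp add: mix_weight_def mix_point_def)
    qed
    fix t
    show "\<bar>Re (mix_point g N m i t)\<bar> \<le> max M (real N + 1/2)"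
      using M[OF i, of t] std_point_Re[of N i t] by (auto simp: mix_point_def)
  next
    have [measurable]: "(\<lambda>t. \<Sum>i<4. mix_point g N m i (t i)) \<in> borel_measurable (PiM {..<4::nat} (\<lambda>_. lborel))"
      by (rule sum_component_measurable) (rule mix_measurable)
    show "(\<lambda>t. Gamma (2 + (\<Sum>i<4. mix_point g N m i (t i)))) \<in> borel_measurable (PiM {..<4::nat} (\<lambda>_. lborel))"
      by measurable
    show "norm (Gamma (2 + (\<Sum>i<4. mix_point g N m i (t i)))) \<le> K" for t by (rule K)
  qed
qed

text \<open>The condition for moving contour j when the earlier variables are standard. If these add
  up to a natural number n, the point is - 2 - (n + k) minus the later contours, covered by
  \<open>sum_avoids_from\<close> or, for j = 3, by the left poles. Otherwise N pushes it left of
  every point of \<open>g j\<close>.\<close>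

lemma mix_left_of:
  assumes j: "j < 4"
  defines "w \<equiv> \<lambda>t. 2 + (\<Sum>i\<in>{..<4} - {j}. mix_point g N j i (t i))"
  shows "left_of (g j) (- w t - of_nat k)" and "- Re (w t) < real N + 1/2" and "j = 3 \<Longrightarrow> Re (w t) > 0"
proof -
  define A where "A = (\<Sum>i<j. std_point N i (t i))"
  define B where "B = (\<Sum>i\<in>{j..<4} - {j}. g i (t i))"
  have "{..<j} \<union> ({j..<4} - {j}) = {..<4} - {j}" using j by auto
  moreover have "(\<Sum>i\<in>{..<j} \<union> ({j..<4} - {j}). mix_point g N j i (t i)) = (\<Sum>i<j. mix_point g N j i (t i)) + (\<Sum>i\<in>{j..<4} - {j}. mix_point g N j i (t i))"
    by (rule sum.union_disjoint) auto
  ultimately have "(\<Sum>i\<in>{..<4} - {j}. mix_point g N j i (t i)) = (\<Sum>i<j. mix_point g N j i (t i)) + (\<Sum>i\<in>{j..<4} - {j}. mix_point g N j i (t i))"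
    by (simp only:)
  hence w: "w t = 2 + (A + B)" by (simp add: w_def A_def B_def mix_point_def)
  have RA: "Re A \<ge> 0" unfolding A_def by (rule Re_std_sum)
  have RB: "\<bar>Re B\<bar> \<le> 4 * M" unfolding B_def by (rule Re_tail_sum) auto
  show "- Re (w t) < real N + 1/2" using RA RB N(1) M_nonneg by (simp add: w)
  show "Re (w t) > 0" if "j = 3"
  proof -
    have "{j..<4} - {j} = {}" using that by auto
    hence "B = 0" by (simp only: B_def sum.empty)
    thus ?thesis using RA by (simp add: w)
  qed
  have "j \<le> 3" using j by auto
  from std_sum_cases[OF this, of N t] show "left_of (g j) (- w t - of_nat k)"
  proof
    assume "\<exists>n\<le>j * N. (\<Sum>i<j. std_point N i (t i)) = of_nat n"
    then obtain n where n: "A = of_nat n" by (auto simp: A_def)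
    have eq: "- w t - of_nat k = - 2 - of_nat (n + k) - B" by (simp add: w n)
    show ?thesis
    proof (cases "j = 3")
      case True
      have "{j..<4} - {j} = {}" using True by auto
      hence "B = 0" by (simp only: B_def sum.empty)
      hence "- w t - of_nat k = - of_real (a j) - of_nat (n + k + 2)" using a_3 True by (simp add: eq)
      thus ?thesis using left[OF j] by metis
    next
      case False
      have "3 \<in> {j..<4} - {j}" using j False by auto
      hence ne: "{j..<4} - {j} \<noteq> {}" by blast
      show ?thesis unfolding eq B_def
        by (rule sum_avoids_left_of[where c = c and T = T])
          (use j False tail sum_avoids_from[of j] ne in auto)
    qed
  next
    assume h: "Re (\<Sum>i<j. std_point N i (t i)) \<ge> real N + 1/2"
    show ?thesis
    proof (rule left_of_base[OF tail[OF j]])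
      fix u
      have "Re (g j u) \<ge> - M" using M[OF j, of u] by linarith
      moreover have "Re (- w t - of_nat k) \<le> - 2 - (real N + 1/2) + 4 * M"
        using h RB by (simp add: w A_def)
      ultimately show "Re (- w t - of_nat k) < Re (g j u)" using N(1) M_nonneg by linarith
    qed
  qed
qed

text \<open>With the other variables fixed, the coupling \<open>rGamma\<close> becomes the parameter
  b of a Barnes integrand for j = 0, 1 and a constant for j = 2, 3, so that the shifts in one
  variable apply.\<close>

lemma mix_step:
  assumes j: "j < 4"
  shows "(\<integral>t. joint_integrand (mix_weight g N j) (mix_point g N j) t \<partial>PiM {..<4} (\<lambda>_. lborel)) =
     (\<integral>t. joint_integrand (mix_weight g N (Suc j)) (mix_point g N (Suc j)) t \<partial>PiM {..<4} (\<lambda>_. lborel))"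
proof (rule joint_integral_replace[OF j mix_integrable mix_integrable])
  fix t
  define w where "w = 2 + (\<Sum>i\<in>{..<4} - {j}. mix_point g N j i (t i))"
  define P where "P = (\<Prod>i\<in>{..<4} - {j}. mix_weight g N j i (t i))"
  define z where "z i = mix_point g N j i (t i)" for i
  define R where "R s = rGamma (2 + (if j = 0 then s else z 0) + (if j = 1 then s else z 1))" for s
  have P': "(\<Prod>i\<in>{..<4} - {j}. mix_weight g N (Suc j) i (t i)) = P"
    unfolding P_def by (intro prod.cong) (auto simp: mix_weight_def)
  have w': "2 + (\<Sum>i\<in>{..<4} - {j}. mix_point g N (Suc j) i (t i)) = w"
    unfolding w_def by (intro arg_cong2[of _ _ _ _ "(+)"] refl sum.cong) (auto simp: mix_point_def)
  have z': "j \<noteq> i \<Longrightarrow> mix_point g N (Suc j) i (t i) = z i" for i by (auto simp: z_def mix_point_def)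
  have lhs: "joint_integrand (mix_weight g N j) (mix_point g N j) (t(j := u)) =
      P * (Gamma (w + g j u) * R (g j u) * path_weight g j u)" for u
    unfolding joint_integrand_upd[OF j] P_def[symmetric] w_def[symmetric] R_def z_def
    by (cases "j = 0"; cases "j = 1") (simp_all add: mix_point_def mix_weight_def)
  have rhs: "joint_integrand (mix_weight g N (Suc j)) (mix_point g N (Suc j)) (t(j := u)) =
      P * (Gamma (w + std_point N j u) * R (std_point N j u) * std_weight N j u)" for u
    unfolding joint_integrand_upd[OF j] P' w' R_def
    using z'[of 0] z'[of 1] by (cases "j = 0"; cases "j = 1") (simp_all add: mix_point_def mix_weight_def)
  have w1: "left_of (g j) (- w - of_nat k)" "- Re w < real N + 1/2" "j = 3 \<Longrightarrow> Re w > 0" for k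
    using mix_left_of(1)[OF j, of t k] mix_left_of(2)[OF j, of t] mix_left_of(3)[OF j, of t] by (simp_all add: w_def)
  have "(\<integral>u. Gamma (w + g j u) * R (g j u) * path_weight g j u \<partial>lborel) =
      (\<integral>u. Gamma (w + std_point N j u) * R (std_point N j u) * std_weight N j u \<partial>lborel)"
  proof (cases "j = 3")
    case False
    hence j3: "j < 3" using j by auto
    define b where "b = (if j = 0 then 2 + z 1 else if j = 1 then 2 + z 0 else 1)"
    define q where "q = (if j = 2 then rGamma (2 + z 0 + z 1) else 1)"
    have fac: "R s * factor j s = q * barnes (a j) b (x j) s" for s
    proof -
      consider "j = 0" | "j = 1" | "j = 2" using j3 by linarith
      thus ?thesis by cases (simp_all add: R_def factor_def q_def b_def barnes_def add_ac mult_ac)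
    qed
    have "(\<integral>u. Gamma (- g j u) * (barnes (a j) b (x j) (g j u) * Gamma (w + g j u)) * vector_derivative (g j) (at u) \<partial>lborel) =
        (\<integral>u. res_weight N u * (barnes (a j) b (x j) (res_point N u) * Gamma (w + res_point N u)) \<partial>lborel)"
    proof (rule residue_step[where M = "M + real N + 1"])
      show "\<bar>Re (g j u)\<bar> < M + real N + 1" for u using M[OF j, of u] by linarith
      show "real N + 1/2 < M + real N + 1" using M_nonneg by linarith
    qed (use x_pos tail[OF j] left[OF j] N(2)[OF j3] w1 right_0[OF j3] in auto)
    moreover have "Gamma (w + g j u) * R (g j u) * path_weight g j u =
       q * (Gamma (- g j u) * (barnes (a j) b (x j) (g j u) * Gamma (w + g j u)) * vector_derivative (g j) (at u))" for u
    proof -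
      have "Gamma (w + g j u) * R (g j u) * path_weight g j u =
          (R (g j u) * factor j (g j u)) * (Gamma (- g j u) * Gamma (w + g j u) * vector_derivative (g j) (at u))"
        using j3 by (simp add: path_weight_def dnum_def)
      thus ?thesis unfolding fac by (simp only: mult_ac)
    qed
    moreover have "Gamma (w + std_point N j u) * R (std_point N j u) * std_weight N j u =
       q * (res_weight N u * (barnes (a j) b (x j) (res_point N u) * Gamma (w + res_point N u)))" for u
    proof -
      have "Gamma (w + std_point N j u) * R (std_point N j u) * std_weight N j u =
          (R (res_point N u) * factor j (res_point N u)) * (res_weight N u * Gamma (w + res_point N u))"
        using j3 by (simp add: std_point_def std_weight_def)
      thus ?thesis unfolding fac by (simp only: mult_ac)
    qed
    ultimately show ?thesis by (simp only: integral_mult_right_zero)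
  next
    case True
    have "(\<integral>u. Gamma (1 - g j u) * (barnes 0 1 (x 3) (g j u) * Gamma (g j u) * Gamma (w + g j u)) * vector_derivative (g j) (at u) \<partial>lborel) =
     \<i> * (\<integral>u. Gamma (1 - mb_line (1/2) u) * (barnes 0 1 (x 3) (mb_line (1/2) u) * Gamma (mb_line (1/2) u) * Gamma (w + mb_line (1/2) u)) \<partial>lborel)"
    proof (rule line_step)
      show "left_of (g j) (- of_nat k)" for k using left[OF j, of k] True a_3 by simp
      show "right_of (g j) (of_nat (1 + k))" for k using right[OF j, of k] True by (simp add: dnum_def)
    qed (use x_pos tail[OF j] w1 True in auto)
    moreover have "Gamma (w + g j u) * R (g j u) * path_weight g j u =
       rGamma (2 + z 0 + z 1) * (Gamma (1 - g j u) * (barnes 0 1 (x 3) (g j u) * Gamma (g j u) * Gamma (w + g j u)) * vector_derivative (g j) (at u))" for u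
      using True by (simp add: path_weight_def dnum_def R_def factor_def mult_ac)
    moreover have "Gamma (w + std_point N j u) * R (std_point N j u) * std_weight N j u =
       (rGamma (2 + z 0 + z 1) * \<i>) * (Gamma (1 - mb_line (1/2) u) * (barnes 0 1 (x 3) (mb_line (1/2) u) * Gamma (mb_line (1/2) u) * Gamma (w + mb_line (1/2) u)))" for u
      using True by (simp add: std_point_def std_weight_def R_def factor_def mult_ac)
    ultimately show ?thesis by (simp only: integral_mult_right_zero mult.assoc)
  qed
  thus "(\<integral>u. joint_integrand (mix_weight g N j) (mix_point g N j) (t(j := u)) \<partial>lborel) =
     (\<integral>u. joint_integrand (mix_weight g N (Suc j)) (mix_point g N (Suc j)) (t(j := u)) \<partial>lborel)"
    unfolding lhs rhs by simp
qed (use j in auto)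

theorem path_integral_eq_std:
  "(\<integral>t. joint_integrand (path_weight g) g t \<partial>PiM {..<4} (\<lambda>_. lborel)) =
   (\<integral>t. joint_integrand (std_weight N) (std_point N) t \<partial>PiM {..<4} (\<lambda>_. lborel))"
proof -
  have "m \<le> 4 \<Longrightarrow> (\<integral>t. joint_integrand (mix_weight g N 0) (mix_point g N 0) t \<partial>PiM {..<4} (\<lambda>_. lborel)) =
     (\<integral>t. joint_integrand (mix_weight g N m) (mix_point g N m) t \<partial>PiM {..<4} (\<lambda>_. lborel))" for m
    by (induction m) (use mix_step in auto)
  from this[of 4] have "(\<integral>t. joint_integrand (mix_weight g N 0) (mix_point g N 0) t \<partial>PiM {..<4} (\<lambda>_. lborel)) =
     (\<integral>t. joint_integrand (mix_weight g N 4) (mix_point g N 4) t \<partial>PiM {..<4} (\<lambda>_. lborel))" by simp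
  moreover have "joint_integrand (mix_weight g N 0) (mix_point g N 0) = joint_integrand (path_weight g) g"
    by (rule joint_integrand_cong) (auto simp: mix_weight_def mix_point_def)
  moreover have "joint_integrand (mix_weight g N 4) (mix_point g N 4) = joint_integrand (std_weight N) (std_point N)"
    by (rule joint_integrand_cong) (auto simp: mix_weight_def mix_point_def)
  ultimately show ?thesis by simp
qed

end

section \<open>Evaluation of the deformed integral\<close>

lemma Gamma_lebesgue_integral:
  assumes z: "Re z > 0"
  shows "(\<integral>y. indicator {0<..} y *\<^sub>R (of_real y powr (z - 1) * of_real (exp (- y))) \<partial>lborel) = Gamma z"
    and "integrable lborel (\<lambda>y. indicator {0<..} y *\<^sub>R (y powr (Re z - 1) * exp (- y)))"
proof -
  let ?f = "\<lambda>y::real. of_real y powr (z - 1) * of_real (exp (- y)) :: complex"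
  have "(\<lambda>y. of_real y powr (z - 1) / of_real (exp y) :: complex) absolutely_integrable_on {0<..}"
    by (rule absolutely_integrable_Gamma_integral'[OF z])
  hence "?f absolutely_integrable_on {0<..}" by (simp add: exp_minus field_simps)
  hence I: "integrable lborel (\<lambda>y. indicator {0<..} y *\<^sub>R ?f y)"
    unfolding set_integrable_def by (subst (asm) integrable_completion) auto
  hence "set_integrable lborel {0<..} ?f" by (simp add: set_integrable_def)
  from set_borel_integral_eq_integral(2)[OF this] integral_unique[OF Gamma_integral_complex'[OF z]]
  show "(\<integral>y. indicator {0<..} y *\<^sub>R ?f y \<partial>lborel) = Gamma z"
    by (simp add: set_lebesgue_integral_def exp_minus field_simps)
  have "norm (indicator {0<..} y *\<^sub>R ?f y) = indicator {0<..} y *\<^sub>R (y powr (Re z - 1) * exp (- y))" for y :: real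
    by (auto simp: indicator_def norm_mult norm_of_real_powr)
  with integrable_norm[OF I] show "integrable lborel (\<lambda>y. indicator {0<..} y *\<^sub>R (y powr (Re z - 1) * exp (- y)))"
    by (simp only:)
qed

text \<open>Variables 2 and 3 do not enter \<open>rGamma\<close> and peel off by Fubini; the pair 0,
  1 stays an iterated integral in the order in which \<open>res_double\<close> evaluates it.\<close>

lemma joint_product_split:
  fixes \<omega> \<zeta> :: "nat \<Rightarrow> real \<Rightarrow> complex"
  assumes meas: "\<And>i. i < 4 \<Longrightarrow> \<omega> i \<in> borel_measurable borel" "\<And>i. i < 4 \<Longrightarrow> \<zeta> i \<in> borel_measurable borel"
    and int: "\<And>i. i < 4 \<Longrightarrow> integrable lborel (\<lambda>t. \<omega> i t * of_real (joint_weight i (\<zeta> i t)))"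
    and M: "\<And>i t. i < 4 \<Longrightarrow> \<bar>Re (\<zeta> i t)\<bar> \<le> M"
  shows "(\<integral>t. rGamma (2 + \<zeta> 0 (t 0) + \<zeta> 1 (t 1)) * (\<Prod>i<4. \<omega> i (t i)) \<partial>PiM {..<4} (\<lambda>_. lborel)) =
    (\<integral>t1. \<omega> 1 t1 * (\<integral>t0. rGamma (2 + \<zeta> 0 t0 + \<zeta> 1 t1) * \<omega> 0 t0 \<partial>lborel) \<partial>lborel) * (\<integral>t. \<omega> 2 t \<partial>lborel) * (\<integral>t. \<omega> 3 t \<partial>lborel)"
proof -
  interpret product_sigma_finite "\<lambda>_::nat. lborel :: real measure" by standard
  define F where "F n t = rGamma (2 + \<zeta> 0 (t 0) + \<zeta> 1 (t 1)) * (\<Prod>i<n. \<omega> i (t i))" for n :: nat and t :: "nat \<Rightarrow> real"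
  have Fint: "integrable (PiM {..<n} (\<lambda>_. lborel)) (F n)" if "2 \<le> n" "n \<le> 4" for n
  proof -
    have "integrable (PiM {..<n} (\<lambda>_. lborel)) (\<lambda>t. 1 * rGamma (2 + \<zeta> 0 (t 0) + \<zeta> 1 (t 1)) * (\<Prod>i<n. \<omega> i (t i)))"
      using that by (intro joint_integrable[where K = 1 and M = M] meas int M) auto
    thus ?thesis by (simp add: F_def[abs_def])
  qed
  have step: "(\<integral>t. F (Suc n) t \<partial>PiM {..<Suc n} (\<lambda>_. lborel)) = (\<integral>t. F n t \<partial>PiM {..<n} (\<lambda>_. lborel)) * (\<integral>t. \<omega> n t \<partial>lborel)"
    if n: "2 \<le> n" "n < 4" for n
  proof -
    have ins: "{..<Suc n} = insert n {..<n}" by auto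
    have "(\<integral>t. F (Suc n) t \<partial>PiM {..<Suc n} (\<lambda>_. lborel)) = (\<integral>t. (\<integral>u. F (Suc n) (t(n := u)) \<partial>lborel) \<partial>PiM {..<n} (\<lambda>_. lborel))"
      using product_integral_insert[of "{..<n}" n "F (Suc n)"] Fint[of "Suc n"] n unfolding ins by simp
    also have "\<dots> = (\<integral>t. F n t * (\<integral>u. \<omega> n u \<partial>lborel) \<partial>PiM {..<n} (\<lambda>_. lborel))"
    proof (rule Bochner_Integration.integral_cong[OF refl])
      fix t
      have "F (Suc n) (t(n := u)) = F n t * \<omega> n u" for u
      proof -
        have "(\<Prod>i<n. \<omega> i ((t(n := u)) i)) = (\<Prod>i<n. \<omega> i (t i))" by (intro prod.cong) auto
        thus ?thesis using n by (simp add: F_def)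
      qed
      thus "(\<integral>u. F (Suc n) (t(n := u)) \<partial>lborel) = F n t * (\<integral>u. \<omega> n u \<partial>lborel)" by simp
    qed
    finally show ?thesis by simp
  qed
  have base: "(\<integral>t. F 2 t \<partial>PiM {..<2} (\<lambda>_. lborel)) = (\<integral>t1. \<omega> 1 t1 * (\<integral>t0. rGamma (2 + \<zeta> 0 t0 + \<zeta> 1 t1) * \<omega> 0 t0 \<partial>lborel) \<partial>lborel)"
  proof -
    have ins: "{..<2} = insert 0 {1::nat}" by auto
    have "(\<integral>t. F 2 t \<partial>PiM {..<2} (\<lambda>_. lborel)) = (\<integral>t. (\<integral>u. F 2 (t(0 := u)) \<partial>lborel) \<partial>PiM {1} (\<lambda>_. lborel))"
      using product_integral_insert[of "{1}" 0 "F 2"] Fint[of 2] unfolding ins by simp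
    also have "\<dots> = (\<integral>t. (\<lambda>t1. \<omega> 1 t1 * (\<integral>t0. rGamma (2 + \<zeta> 0 t0 + \<zeta> 1 t1) * \<omega> 0 t0 \<partial>lborel)) (t 1) \<partial>PiM {1::nat} (\<lambda>_. lborel))"
    proof (rule Bochner_Integration.integral_cong[OF refl])
      fix t :: "nat \<Rightarrow> real"
      have "F 2 (t(0 := u)) = \<omega> 1 (t 1) * (rGamma (2 + \<zeta> 0 u + \<zeta> 1 (t 1)) * \<omega> 0 u)" for u
        by (simp add: F_def numeral_2_eq_2)
      thus "(\<integral>u. F 2 (t(0 := u)) \<partial>lborel) = (\<lambda>t1. \<omega> 1 t1 * (\<integral>t0. rGamma (2 + \<zeta> 0 t0 + \<zeta> 1 t1) * \<omega> 0 t0 \<partial>lborel)) (t 1)" by simp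
    qed
    also have "\<dots> = (\<integral>t1. \<omega> 1 t1 * (\<integral>t0. rGamma (2 + \<zeta> 0 t0 + \<zeta> 1 t1) * \<omega> 0 t0 \<partial>lborel) \<partial>lborel)"
    proof (rule product_integral_singleton)
      have [measurable]: "\<omega> 0 \<in> borel_measurable borel" "\<omega> 1 \<in> borel_measurable borel"
        "\<zeta> 0 \<in> borel_measurable borel" "\<zeta> 1 \<in> borel_measurable borel" using meas by auto
      show "(\<lambda>t1. \<omega> 1 t1 * (\<integral>t0. rGamma (2 + \<zeta> 0 t0 + \<zeta> 1 t1) * \<omega> 0 t0 \<partial>lborel)) \<in> borel_measurable lborel"
        by measurable
    qed
    finally show ?thesis .
  qed
  have "(\<integral>t. F 4 t \<partial>PiM {..<4} (\<lambda>_. lborel)) = (\<integral>t. F 2 t \<partial>PiM {..<2} (\<lambda>_. lborel)) * (\<integral>t. \<omega> 2 t \<partial>lborel) * (\<integral>t. \<omega> 3 t \<partial>lborel)"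
    using step[of 3] step[of 2] by (simp add: eval_nat_numeral)
  thus ?thesis unfolding base by (simp add: F_def)
qed

lemma of_real_mult_powr:
  assumes "x > 0" "y > 0"
  shows "(of_real (x * y) :: complex) powr s = of_real x powr s * of_real y powr s"
proof -
  have "Ln (of_real (x * y)) = Ln (of_real x) + Ln (of_real y)"
    using assms by (simp only: Ln_of_real mult_pos_pos ln_mult) simp
  moreover have "(of_real (x * y) :: complex) \<noteq> 0" "(of_real x :: complex) \<noteq> 0" "(of_real y :: complex) \<noteq> 0" using assms by auto
  ultimately show ?thesis by (simp only: powr_def if_False) (simp add: distrib_left exp_add)
qed

context mb_four
begin

text \<open>y is the variable of Euler's integral for the joint Gamma, whence the weight y exp (-
  y). The last sum is the Humbert series Phi2(a 0, a 1; 2; - x 0 y, - x 1 y), as (n + 1)! is the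
  Pochhammer symbol of 2.\<close>

definition euler_density :: "real \<Rightarrow> real" where
  "euler_density y = indicator {0<..} y * (y * exp (- y) * ln (1 + x 3 * y) *
     (\<Sum>k. pochhammer (a 2) k / (fact k)\<^sup>2 * (- (x 2 * y)) ^ k) *
     (\<Sum>n. (\<Sum>k\<le>n. (pochhammer (a 0) k / fact k * (- (x 0 * y)) ^ k) *
        (pochhammer (a 1) (n - k) / fact (n - k) * (- (x 1 * y)) ^ (n - k))) / fact (Suc n)))"

lemma a_nonpos: "i < 3 \<Longrightarrow> a i \<notin> \<int>\<^sub>\<le>\<^sub>0"
  using a_nonint nonpos_Ints_subset_Ints by blast

text \<open>The power of y with exponent the sum of the variables is a product over the variables,
  so it merely replaces each x i by x i y.\<close>

lemma std_scaled_integral: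
  assumes N: "\<And>i. i < 3 \<Longrightarrow> - a i < real N + 1/2" and y: "y > 0"
  shows "(\<integral>t. rGamma (2 + std_point N 0 (t 0) + std_point N 1 (t 1)) *
      (\<Prod>i<4. std_weight N i (t i) * of_real y powr std_point N i (t i)) \<partial>PiM {..<4} (\<lambda>_. lborel)) * of_real (y * exp (- y)) =
    (2 * pi * \<i>) ^ 4 * of_real (Gamma (a 0) * Gamma (a 1) * Gamma (a 2) * euler_density y)"
proof -
  define \<omega> where "\<omega> i t = std_weight N i t * of_real y powr std_point N i t" for i t
  have xy: "x i * y > 0" for i using x_pos[of i] y by simp
  have pw: "of_real (x i) powr s * of_real y powr s = (of_real (x i * y) :: complex) powr s" for i s
    using of_real_mult_powr[OF x_pos y] by simp
  \<comment> \<open>Bounds |y^s| for 0 <= Re s <= N + 1/2, whether y is below or above 1.\<close>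
  define C where "C = max 1 (y powr (real N + 1/2))"
  have pb: "norm (of_real y powr std_point N i t :: complex) \<le> C" for i t
  proof -
    have "y powr Re (std_point N i t) \<le> C"
    proof (cases "y \<le> 1")
      case True
      have "y powr Re (std_point N i t) \<le> 1" using True y std_point_Re(1)[of N i t] by (simp add: powr_le_one_le powr_le1)
      thus ?thesis by (simp add: C_def)
    next
      case False
      hence "y powr Re (std_point N i t) \<le> y powr (real N + 1/2)" using std_point_Re(2)[of N i t] by (intro powr_mono) auto
      thus ?thesis by (simp add: C_def)
    qed
    thus ?thesis using y by (simp add: norm_of_real_powr)
  qed
  note m = std_measurable[of N, measurable]
  have om: "\<omega> i \<in> borel_measurable borel" for i unfolding \<omega>_def[abs_def] by measurable
  have oi: "integrable lborel (\<lambda>t. \<omega> i t * of_real (joint_weight i (std_point N i t)))" if "i < 4" for i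
  proof (rule Bochner_Integration.integrable_bound)
    show "integrable lborel (\<lambda>t. of_real C * (std_weight N i t * of_real (joint_weight i (std_point N i t))))"
      by (intro integrable_mult_right std_weight_integrable[OF that N])
    show "(\<lambda>t. \<omega> i t * of_real (joint_weight i (std_point N i t))) \<in> borel_measurable lborel"
      using om by measurable
    have "C \<ge> 0" by (simp add: C_def)
    thus "AE t in lborel. norm (\<omega> i t * of_real (joint_weight i (std_point N i t))) \<le> norm (of_real C * (std_weight N i t * of_real (joint_weight i (std_point N i t))))"
      using mult_right_mono[OF pb norm_ge_zero, of i _ "std_weight N i _ * of_real (joint_weight i (std_point N i _))"]
      by (intro AE_I2) (simp add: \<omega>_def norm_mult mult_ac)
  qed
  have "(\<integral>t. rGamma (2 + std_point N 0 (t 0) + std_point N 1 (t 1)) * (\<Prod>i<4. \<omega> i (t i)) \<partial>PiM {..<4} (\<lambda>_. lborel)) =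
     (\<integral>t1. \<omega> 1 t1 * (\<integral>t0. rGamma (2 + std_point N 0 t0 + std_point N 1 t1) * \<omega> 0 t0 \<partial>lborel) \<partial>lborel) * (\<integral>t. \<omega> 2 t \<partial>lborel) * (\<integral>t. \<omega> 3 t \<partial>lborel)"
  proof (rule joint_product_split[where M = "real N + 1/2"])
    show "\<bar>Re (std_point N i t)\<bar> \<le> real N + 1/2" for i t using std_point_Re[of N i t] by linarith
  qed (use om m oi in blast)+
  also have "(\<integral>t1. \<omega> 1 t1 * (\<integral>t0. rGamma (2 + std_point N 0 t0 + std_point N 1 t1) * \<omega> 0 t0 \<partial>lborel) \<partial>lborel) =
     (\<integral>t1. res_weight N t1 * (Gamma (of_real (a 1) + res_point N t1) * of_real (x 1 * y) powr res_point N t1) *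
       (\<integral>t0. res_weight N t0 * barnes (a 0) (2 + res_point N t1) (x 0 * y) (res_point N t0) \<partial>lborel) \<partial>lborel)"
  proof -
    have "\<omega> 1 t1 = res_weight N t1 * (Gamma (of_real (a 1) + res_point N t1) * of_real (x 1 * y) powr res_point N t1)" for t1
      unfolding pw[symmetric] by (simp add: \<omega>_def std_weight_def std_point_def factor_def)
    moreover have "rGamma (2 + std_point N 0 t0 + std_point N 1 t1) * \<omega> 0 t0 = res_weight N t0 * barnes (a 0) (2 + res_point N t1) (x 0 * y) (res_point N t0)" for t0 t1
      unfolding barnes_def pw[symmetric] by (simp add: \<omega>_def std_weight_def std_point_def factor_def add_ac mult_ac)
    ultimately show ?thesis by simp
  qed
  also have "\<dots> = (2 * pi * \<i>)\<^sup>2 * of_real (Gamma (a 0) * Gamma (a 1) *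
      (\<Sum>n. (\<Sum>k\<le>n. (pochhammer (a 0) k / fact k * (- (x 0 * y)) ^ k) * (pochhammer (a 1) (n - k) / fact (n - k) * (- (x 1 * y)) ^ (n - k))) / fact (Suc n)))"
    by (rule res_double) (use a_nonpos N xy in auto)
  also have "(\<integral>t. \<omega> 2 t \<partial>lborel) = (\<integral>t. res_weight N t * barnes (a 2) 1 (x 2 * y) (res_point N t) \<partial>lborel)"
    unfolding barnes_def pw[symmetric] by (simp add: \<omega>_def std_weight_def std_point_def factor_def barnes_def mult_ac)
  also have "\<dots> = 2 * pi * \<i> * of_real (Gamma (a 2) * (\<Sum>k. pochhammer (a 2) k / (fact k)\<^sup>2 * (- (x 2 * y)) ^ k))"
    by (rule res_1F1) (use a_nonpos N xy in auto)
  also have "(\<integral>t. \<omega> 3 t \<partial>lborel) = (\<integral>t. \<i> * (Gamma (1 - mb_line (1/2) t) * (barnes 0 1 (x 3 * y) (mb_line (1/2) t) * Gamma (mb_line (1/2) t))) \<partial>lborel)"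
    unfolding barnes_def pw[symmetric] by (simp add: \<omega>_def std_weight_def std_point_def factor_def barnes_def mult_ac)
  also have "\<dots> = \<i> * of_real (2 * pi * ln (1 + x 3 * y))"
    unfolding integral_mult_right_zero ln_line_integral[OF xy] ..
  finally have "(\<integral>t. rGamma (2 + std_point N 0 (t 0) + std_point N 1 (t 1)) * (\<Prod>i<4. \<omega> i (t i)) \<partial>PiM {..<4} (\<lambda>_. lborel)) * of_real (y * exp (- y)) =
     (2 * pi * \<i>)\<^sup>2 * of_real (Gamma (a 0) * Gamma (a 1) *
      (\<Sum>n. (\<Sum>k\<le>n. (pochhammer (a 0) k / fact k * (- (x 0 * y)) ^ k) * (pochhammer (a 1) (n - k) / fact (n - k) * (- (x 1 * y)) ^ (n - k))) / fact (Suc n))) *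
     (2 * pi * \<i> * of_real (Gamma (a 2) * (\<Sum>k. pochhammer (a 2) k / (fact k)\<^sup>2 * (- (x 2 * y)) ^ k))) *
     (\<i> * of_real (2 * pi * ln (1 + x 3 * y))) * of_real (y * exp (- y))" by (simp only:)
  also have "\<dots> = (2 * pi * \<i>) ^ 4 * of_real (Gamma (a 0) * Gamma (a 1) * Gamma (a 2) * euler_density y)"
  proof -
    \<comment> \<open>The fourth factor 2 pi i is made up of the i of the last line and the 2 pi of
      the logarithm.\<close>
    have *: "(2 * pi * \<i>)\<^sup>2 * of_real (A * h) * (2 * pi * \<i> * of_real (B * p)) * (\<i> * of_real (2 * pi * l)) * of_real q =
       (2 * pi * \<i>) ^ 4 * of_real (A * B * (q * l * p * h))" for A h B p l q :: real
      by (simp add: eval_nat_numeral)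
    show ?thesis unfolding * using y by (simp add: euler_density_def)
  qed
  finally show ?thesis by (simp add: \<omega>_def)
qed

theorem std_integral:
  assumes N: "\<And>i. i < 3 \<Longrightarrow> - a i < real N + 1/2"
  shows "integrable lborel euler_density"
    and "(\<integral>t. joint_integrand (std_weight N) (std_point N) t \<partial>PiM {..<4} (\<lambda>_. lborel)) =
      (2 * pi * \<i>) ^ 4 * of_real (Gamma (a 0) * Gamma (a 1) * Gamma (a 2) * (\<integral>y. euler_density y \<partial>lborel))"
proof -
  interpret product_sigma_finite "\<lambda>_::nat. lborel :: real measure" by standard
  interpret P: finite_product_sigma_finite "\<lambda>_::nat. lborel :: real measure" "{..<4::nat}" by standard auto
  interpret Q: pair_sigma_finite "PiM {..<4::nat} (\<lambda>_. lborel :: real measure)" "lborel :: real measure"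
    by (intro pair_sigma_finite.intro P.sigma_finite_measure_axioms sigma_finite_lborel)
  define A where "A t = rGamma (2 + std_point N 0 (t 0) + std_point N 1 (t 1)) * (\<Prod>i<4. std_weight N i (t i))" for t
  define S where "S t = (\<Sum>i<4. std_point N i (t i))" for t
  define R where "R = 4 * (real N + 1/2)"
  define f where "f t y = A t * (indicator {0<..} y *\<^sub>R (of_real y powr (1 + S t) * of_real (exp (- y))))" for t and y :: real
  \<comment> \<open>The power y^(1 + Re S) with 0 <= Re S <= R is at most y for y <= 1 and at most
    y^(1 + R) for y >= 1; the sum of both dominates it everywhere.\<close>
  define v where "v y = indicator {0<..} y *\<^sub>R (y powr 1 * exp (- y)) + indicator {0<..} y *\<^sub>R (y powr (1 + R) * exp (- y))" for y :: real
  have m: "std_point N i \<in> borel_measurable borel" "std_weight N i \<in> borel_measurable borel" for i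
    by (rule std_measurable)+
  have Mb: "\<bar>Re (std_point N i t)\<bar> \<le> real N + 1/2" for i t using std_point_Re[of N i t] by auto
  have "integrable (PiM {..<4} (\<lambda>_. lborel)) (\<lambda>t. 1 * rGamma (2 + std_point N 0 (t 0) + std_point N 1 (t 1)) * (\<Prod>i<4. std_weight N i (t i)))"
    by (intro joint_integrable[where K = 1 and M = "real N + 1/2"] m Mb std_weight_integrable N) auto
  hence Ai: "integrable (PiM {..<4} (\<lambda>_. lborel)) A" by (simp add: A_def[abs_def])
  have RN: "R \<ge> 0" by (simp add: R_def)
  have vi: "integrable lborel v" unfolding v_def[abs_def]
    using Gamma_lebesgue_integral(2)[of 2] Gamma_lebesgue_integral(2)[of "of_real (2 + R)"] RN
    by (intro Bochner_Integration.integrable_add) auto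
  have SR: "0 \<le> Re (S t)" "Re (S t) \<le> R" for t
  proof -
    show "0 \<le> Re (S t)" unfolding S_def by (auto intro!: sum_nonneg std_point_Re)
    have "Re (S t) = (\<Sum>i<4. Re (std_point N i (t i)))" by (simp add: S_def)
    also have "\<dots> \<le> (\<Sum>i<4::nat. real N + 1/2)" by (intro sum_mono std_point_Re)
    finally show "Re (S t) \<le> R" by (simp add: R_def)
  qed
  have fb: "norm (f t y) \<le> norm (A t) * v y" for t y
  proof (cases "y > 0")
    case True
    have "y powr (1 + Re (S t)) \<le> y powr 1 + y powr (1 + R)"
    proof (cases "y \<le> 1")
      case y1: True
      have "y powr (1 + Re (S t)) \<le> y powr 1" using y1 True SR(1)[of t] by (intro powr_mono') auto
      thus ?thesis using powr_ge_zero[of y "1 + R"] by linarith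
    next
      case False
      hence "y powr (1 + Re (S t)) \<le> y powr (1 + R)" using SR(2)[of t] by (intro powr_mono) auto
      thus ?thesis using powr_ge_zero[of y 1] by linarith
    qed
    hence "y powr (1 + Re (S t)) * exp (- y) \<le> v y"
      using True by (simp add: v_def distrib_right[symmetric])
    thus ?thesis using True by (simp add: f_def norm_mult norm_of_real_powr mult_left_mono)
  qed (auto simp: f_def v_def)
  have fm: "case_prod f \<in> borel_measurable (PiM {..<4} (\<lambda>_. lborel) \<Otimes>\<^sub>M lborel)"
  proof -
    have [measurable]: "A \<in> borel_measurable (PiM {..<4} (\<lambda>_. lborel))" using Ai by auto
    have [measurable]: "S \<in> borel_measurable (PiM {..<4} (\<lambda>_. lborel))"
      unfolding S_def[abs_def] by (rule sum_component_measurable) (rule m)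
    show ?thesis unfolding f_def[abs_def] by measurable
  qed
  note Fub = Q.Fubini_product_bound[OF fm integrable_norm[OF Ai] vi fb]
  have inner: "(\<integral>y. f t y \<partial>lborel) = joint_integrand (std_weight N) (std_point N) t" for t
  proof -
    have "(\<integral>y. f t y \<partial>lborel) = A t * (\<integral>y. indicator {0<..} y *\<^sub>R (of_real y powr ((2 + S t) - 1) * of_real (exp (- y))) \<partial>lborel)"
    proof -
      have "(2 + S t) - 1 = 1 + S t" by simp
      thus ?thesis unfolding f_def by (simp only: integral_mult_right_zero)
    qed
    also have "\<dots> = A t * Gamma (2 + S t)" using SR(1)[of t] by (subst Gamma_lebesgue_integral(1)) auto
    finally show ?thesis by (simp add: A_def S_def joint_integrand_def mult_ac)
  qed
  have outer: "(\<integral>t. f t y \<partial>PiM {..<4} (\<lambda>_. lborel)) = (2 * pi * \<i>) ^ 4 * of_real (Gamma (a 0) * Gamma (a 1) * Gamma (a 2) * euler_density y)" for y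
  proof (cases "y > 0")
    case True
    have "f t y = rGamma (2 + std_point N 0 (t 0) + std_point N 1 (t 1)) *
      (\<Prod>i<4. std_weight N i (t i) * of_real y powr std_point N i (t i)) * of_real (y * exp (- y))" for t
    proof -
      have "(of_real y :: complex) powr (1 + S t) = of_real y * (\<Prod>i<4. of_real y powr std_point N i (t i))"
        using True by (simp add: S_def powr_add powr_sum)
      thus ?thesis using True by (simp add: f_def A_def prod.distrib mult_ac)
    qed
    thus ?thesis using std_scaled_integral[OF N True] by simp
  qed (simp add: f_def euler_density_def)
  define c where "c = Gamma (a 0) * Gamma (a 1) * Gamma (a 2)"
  \<comment> \<open>Nonintegral parameters keep the Gamma constant away from 0, so integrability can
    be divided back to \<open>euler_density\<close>.\<close>
  have c: "c \<noteq> 0" using a_nonpos by (simp add: c_def Gamma_eq_zero_iff)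
  have "integrable lborel (\<lambda>y. \<integral>t. f t y \<partial>PiM {..<4} (\<lambda>_. lborel))" by (rule Q.integrable_snd[OF Fub(1)])
  hence "integrable lborel (\<lambda>y. (1 / (2 * pi * \<i>) ^ 4) * ((2 * pi * \<i>) ^ 4 * complex_of_real (c * euler_density y)))"
    unfolding outer c_def[symmetric] by (rule integrable_mult_right)
  hence "integrable lborel (\<lambda>y. complex_of_real (c * euler_density y))" by simp
  from integrable_Re[OF this] have "integrable lborel (\<lambda>y. c * euler_density y)" by simp
  hence "integrable lborel (\<lambda>y. (1 / c) * (c * euler_density y))" by (rule integrable_mult_right)
  thus "integrable lborel euler_density" using c by simp
  have "(\<integral>t. joint_integrand (std_weight N) (std_point N) t \<partial>PiM {..<4} (\<lambda>_. lborel)) =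
     (\<integral>y. (2 * pi * \<i>) ^ 4 * complex_of_real (c * euler_density y) \<partial>lborel)"
    using Fub(2) unfolding inner outer c_def[symmetric] .
  also have "\<dots> = (2 * pi * \<i>) ^ 4 * complex_of_real (\<integral>y. c * euler_density y \<partial>lborel)"
    unfolding integral_mult_right_zero integral_complex_of_real ..
  finally show "(\<integral>t. joint_integrand (std_weight N) (std_point N) t \<partial>PiM {..<4} (\<lambda>_. lborel)) =
      (2 * pi * \<i>) ^ 4 * of_real (Gamma (a 0) * Gamma (a 1) * Gamma (a 2) * (\<integral>y. euler_density y \<partial>lborel))"
    by (simp add: c_def)
qed

end

section \<open>Existence of separating contours\<close>

lemma DERIV_max_0_squared: "((\<lambda>u::real. (max 0 u)\<^sup>2) has_real_derivative 2 * max 0 u) (at u)"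
proof -
  consider "u < 0" | "u = 0" | "u > 0" by linarith
  thus ?thesis
  proof cases
    case 1
    have "((\<lambda>_. 0) has_real_derivative 0) (at u)" by simp
    hence "((\<lambda>u::real. (max 0 u)\<^sup>2) has_real_derivative 0) (at u)"
      by (rule has_field_derivative_transform_within_open[of _ _ _ "{..<0}"]) (use 1 in auto)
    thus ?thesis using 1 by simp
  next
    case 3
    have "((\<lambda>u. u\<^sup>2) has_real_derivative 2 * u) (at u)" by (auto intro!: derivative_eq_intros)
    hence "((\<lambda>u::real. (max 0 u)\<^sup>2) has_real_derivative 2 * u) (at u)"
      by (rule has_field_derivative_transform_within_open[of _ _ _ "{0<..}"]) (use 3 in auto)
    thus ?thesis using 3 by simp
  next
    case 2
    have "((\<lambda>h::real. ((max 0 (0 + h))\<^sup>2 - (max 0 0)\<^sup>2) / h) \<longlongrightarrow> 0) (at 0)"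
    proof (rule Lim_null_comparison)
      have "norm (((max 0 (0 + h))\<^sup>2 - (max 0 0)\<^sup>2) / h) \<le> \<bar>h\<bar>" for h :: real
        by (cases "h = 0") (auto simp: max_def power2_eq_square)
      thus "\<forall>\<^sub>F h::real in at 0. norm (((max 0 (0 + h))\<^sup>2 - (max 0 0)\<^sup>2) / h) \<le> \<bar>h\<bar>" by (simp add: always_eventually)
      show "((\<lambda>h::real. \<bar>h\<bar>) \<longlongrightarrow> 0) (at 0)" by (auto intro!: tendsto_eq_intros)
    qed
    thus ?thesis using 2 by (simp add: DERIV_def)
  qed
qed

text \<open>A continuously differentiable step from 0 to 1, glued from the parabolas 2 u^2 on
  [0, 1/2] and 1 - 2 (1 - u)^2 on [1/2, 1]. Truncated squares give one formula for all
  pieces.\<close>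

definition ramp :: "real \<Rightarrow> real" where
  "ramp u = 2 * ((max 0 u)\<^sup>2 - 2 * (max 0 (u - 1/2))\<^sup>2 + (max 0 (u - 1))\<^sup>2)"

definition ramp' :: "real \<Rightarrow> real" where
  "ramp' u = 4 * (max 0 u - 2 * max 0 (u - 1/2) + max 0 (u - 1))"

lemma DERIV_ramp: "(ramp has_real_derivative ramp' u) (at u)"
proof -
  have d: "((\<lambda>u::real. (max 0 (u - b))\<^sup>2) has_real_derivative 2 * max 0 (u - b)) (at u)" for b
    using DERIV_max_0_squared[of "u - b"] DERIV_shift[of "\<lambda>u. (max 0 u)\<^sup>2" "2 * max 0 (u - b)" u "- b"] by simp
  have "((\<lambda>u. 2 * ((max 0 (u - 0))\<^sup>2 - 2 * (max 0 (u - 1/2))\<^sup>2 + (max 0 (u - 1))\<^sup>2)) has_real_derivative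
      2 * (2 * max 0 (u - 0) - 2 * (2 * max 0 (u - 1/2)) + 2 * max 0 (u - 1))) (at u)"
    by (intro DERIV_cmult DERIV_add DERIV_diff d)
  thus ?thesis unfolding ramp_def[abs_def] ramp'_def by (simp add: algebra_simps)
qed

lemma DERIV_ramp_diff: "((\<lambda>t. ramp (t - b)) has_real_derivative ramp' (t - b)) (at t)"
  using DERIV_ramp[of "t - b"] DERIV_shift[of ramp "ramp' (t - b)" t "- b"] by simp

lemma DERIV_ramp_minus: "((\<lambda>t. ramp (- t)) has_real_derivative - ramp' (- t)) (at t)"
  using DERIV_ramp[of "- t"] DERIV_mirror[of ramp "ramp' (- t)" t] by simp

lemma ramp_values: "u \<le> 0 \<Longrightarrow> ramp u = 0" "u \<ge> 1 \<Longrightarrow> ramp u = 1" "0 \<le> ramp u" "ramp u \<le> 1"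
proof -
  show "u \<le> 0 \<Longrightarrow> ramp u = 0" "u \<ge> 1 \<Longrightarrow> ramp u = 1"
    by (auto simp: ramp_def max_def power2_eq_square algebra_simps)
  consider "u \<le> 0" | "0 \<le> u" "u \<le> 1/2" | "1/2 \<le> u" "u \<le> 1" | "u \<ge> 1" by linarith
  hence "0 \<le> ramp u \<and> ramp u \<le> 1"
  proof cases
    case 2
    have "u\<^sup>2 \<le> (1/2)\<^sup>2" using 2 by (intro power_mono) auto
    moreover have "max 0 u = u" "max 0 (u - 1/2) = 0" "max 0 (u - 1) = 0" using 2 by auto
    ultimately show ?thesis by (simp add: ramp_def power2_eq_square)
  next
    case 3
    have "max 0 u = u" "max 0 (u - 1/2) = u - 1/2" "max 0 (u - 1) = 0" using 3 by auto
    hence e: "ramp u = 1 - 2 * (1 - u)\<^sup>2" by (simp add: ramp_def power2_eq_square algebra_simps)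
    have "(1 - u)\<^sup>2 \<le> (1/2)\<^sup>2" using 3 by (intro power_mono) auto
    thus ?thesis unfolding e using zero_le_power2[of "1 - u"] by (simp add: power2_eq_square)
  qed (auto simp: ramp_def max_def power2_eq_square algebra_simps)
  thus "0 \<le> ramp u" "ramp u \<le> 1" by auto
qed

lemma ramp'_outside: "u \<le> 0 \<or> u \<ge> 1 \<Longrightarrow> ramp' u = 0"
  by (auto simp: ramp'_def max_def)

lemma continuous_ramp': "continuous_on A ramp'"
  unfolding ramp'_def[abs_def] by (intro continuous_intros)

lemma continuous_ramp: "continuous_on A ramp"
  unfolding ramp_def[abs_def] by (intro continuous_intros)

text \<open>The circle with diameter from \<open>0\<close> to \<open>2 r\<close>, run through once while \<open>t\<close> goes from \<open>j\<close> to
  \<open>j + 1\<close>; the velocity vanishes at both ends, so that loops can be chained without losing \<open>C\<^sup>1\<close>.\<close>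

definition loop :: "real \<Rightarrow> real \<Rightarrow> nat \<Rightarrow> real \<Rightarrow> complex" where
  "loop r e j t = of_real r * (1 - exp (2 * pi * \<i> * of_real e * of_real (ramp (t - real j))))"

definition loop' :: "real \<Rightarrow> real \<Rightarrow> nat \<Rightarrow> real \<Rightarrow> complex" where
  "loop' r e j t = - of_real r * (2 * pi * \<i> * of_real e * of_real (ramp' (t - real j)) *
      exp (2 * pi * \<i> * of_real e * of_real (ramp (t - real j))))"

lemma loop_deriv: "(loop r e j has_vector_derivative loop' r e j t) (at t)"
proof -
  have "((\<lambda>t. ramp (t - real j)) has_real_derivative ramp' (t - real j)) (at t)"
    by (rule DERIV_ramp_diff)
  hence 1: "((\<lambda>t. complex_of_real (ramp (t - real j))) has_vector_derivative of_real (ramp' (t - real j))) (at t)"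
    by (intro has_vector_derivative_of_real) (simp add: has_real_derivative_iff_has_vector_derivative)
  have 2: "((\<lambda>w. of_real r * (1 - exp (2 * pi * \<i> * of_real e * w))) has_field_derivative
      - of_real r * (2 * pi * \<i> * of_real e * exp (2 * pi * \<i> * of_real e * w0))) (at w0)" for w0
    by (auto intro!: derivative_eq_intros)
  have "of_real (ramp' (t - real j)) * (- of_real r * (2 * pi * \<i> * of_real e * exp (2 * pi * \<i> * of_real e * of_real (ramp (t - real j))))) = loop' r e j t"
    by (simp add: loop'_def)
  thus ?thesis using field_vector_diff_chain_at[OF 1 2] unfolding loop_def[abs_def] o_def by (simp only:)
qed

lemma continuous_loop': "continuous_on A (loop' r e j)"
  unfolding loop'_def[abs_def]
  by (intro continuous_intros continuous_on_compose2[OF continuous_ramp'[of UNIV]] continuous_on_compose2[OF continuous_ramp[of UNIV]]) auto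

lemma loop_outside:
  assumes "e = 1 \<or> e = -1" "t \<le> real j \<or> t \<ge> real j + 1"
  shows "loop r e j t = 0" "loop' r e j t = 0"
proof -
  have "ramp (t - real j) = 0 \<or> ramp (t - real j) = 1" using assms(2) ramp_values[of "t - real j"] by auto
  moreover have "exp (2 * pi * \<i>) = 1" "exp (- (2 * pi * \<i>)) = 1" by (simp_all add: exp_minus)
  ultimately show "loop r e j t = 0" using assms(1) by (auto simp: loop_def)
  have "t - real j \<le> 0 \<or> t - real j \<ge> 1" using assms(2) by linarith
  hence "ramp' (t - real j) = 0" by (rule ramp'_outside)
  thus "loop' r e j t = 0" by (simp add: loop'_def)
qed

lemma loop_on_circle: "norm (loop r e j t - of_real r) = \<bar>r\<bar>"
proof -
  have "loop r e j t - of_real r = - of_real r * exp (\<i> * of_real (2 * pi * e * ramp (t - real j)))"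
    by (simp add: loop_def algebra_simps)
  thus ?thesis by (simp add: norm_mult)
qed

text \<open>For e = 1 the value is the winding number of \<open>circlepath\<close>; the opposite
  orientation follows by complex conjugation, d being real.\<close>

lemma circle_log_integral:
  fixes r d :: real
  assumes r: "r > 0" "\<bar>d\<bar> \<noteq> r" and e: "e = 1 \<or> e = -1"
  defines "k \<equiv> \<lambda>u. - of_real r * (2 * pi * \<i> * of_real e * exp (2 * pi * \<i> * of_real e * of_real u)) /
     (of_real d - of_real r * exp (2 * pi * \<i> * of_real e * of_real u))"
  shows "(k has_integral (if \<bar>d\<bar> < r then 2 * pi * \<i> * of_real e else 0)) {0..1}" and "continuous_on {0..1} k"
proof -
  have nz: "of_real d - of_real r * exp (2 * pi * \<i> * of_real e * of_real u) \<noteq> 0" for u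
  proof
    assume "of_real d - of_real r * exp (2 * pi * \<i> * of_real e * of_real u) = 0"
    hence "norm (complex_of_real d) = norm (of_real r * exp (2 * pi * \<i> * of_real e * of_real u))" by simp
    also have "\<dots> = r" using r by (simp add: norm_mult)
    finally show False using r by simp
  qed
  show "continuous_on {0..1} k" unfolding k_def using nz by (intro continuous_intros) auto
  define w where "w = (if \<bar>d\<bar> < r then 1 else 0 :: real)"
  define k1 where "k1 u = - of_real r * (2 * pi * \<i> * exp (2 * pi * \<i> * of_real u)) / (of_real d - of_real r * exp (2 * pi * \<i> * of_real u))" for u
  have pi: "of_real d \<notin> path_image (circlepath 0 r)" using r by (auto simp: dist_norm)
  have wn: "winding_number (circlepath 0 r) (of_real d) = of_real w"
  proof (cases "\<bar>d\<bar> < r")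
    case True
    thus ?thesis by (simp add: winding_number_circlepath w_def)
  next
    case False
    have "winding_number (circlepath 0 r) (of_real d) = 0"
      by (rule winding_number_zero_outside[of _ "cball 0 r"]) (use False r in auto)
    thus ?thesis using False by (simp add: w_def)
  qed
  have "((\<lambda>s. 1 / (s - of_real d)) has_contour_integral (2 * pi * \<i> * winding_number (circlepath 0 r) (of_real d))) (circlepath 0 r)"
    using pi by (intro has_contour_integral_winding_number) auto
  hence "((\<lambda>u. 1 / (circlepath 0 r u - of_real d) * vector_derivative (circlepath 0 r) (at u)) has_integral (2 * pi * \<i> * of_real w)) {0..1}"
    unfolding has_contour_integral wn .
  moreover have "1 / (circlepath 0 r u - of_real d) * vector_derivative (circlepath 0 r) (at u) = k1 u" for u
  proof -
    have "circlepath 0 r u = of_real r * exp (2 * pi * \<i> * of_real u)" by (simp add: circlepath)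
    moreover have "vector_derivative (circlepath 0 r) (at u) = 2 * pi * \<i> * r * exp (2 * pi * \<i> * of_real u)"
      by (simp add: vector_derivative_circlepath)
    ultimately show ?thesis unfolding k1_def
      by (simp only:) (simp add: divide_simps, simp add: algebra_simps)
  qed
  ultimately have 1: "(k1 has_integral (2 * pi * \<i> * of_real w)) {0..1}" by simp
  show "(k has_integral (if \<bar>d\<bar> < r then 2 * pi * \<i> * of_real e else 0)) {0..1}"
    using e
  proof
    assume e1: "e = 1"
    hence "k = k1" by (simp add: k_def k1_def fun_eq_iff)
    thus ?thesis using 1 e1 by (simp add: w_def split: if_splits)
  next
    assume e1: "e = -1"
    have "k = (\<lambda>u. cnj (k1 u))" by (simp add: fun_eq_iff k_def k1_def e1 exp_cnj)
    moreover have "((\<lambda>u. cnj (k1 u)) has_integral cnj (2 * pi * \<i> * of_real w)) {0..1}"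
      using has_integral_linear[OF 1 bounded_linear_cnj] by (simp add: o_def)
    ultimately show ?thesis using e1 by (simp add: w_def split: if_splits)
  qed
qed

text \<open>The substitution u = ramp (t - j) reduces this to the uniformly traversed
  circle.\<close>

lemma loop_log_integral:
  assumes r: "r > 0" "\<bar>z - r\<bar> \<noteq> r" and e: "e = 1 \<or> e = -1" and R: "R \<ge> real j + 1"
  shows "((\<lambda>t. loop' r e j t / (loop r e j t - of_real z)) has_integral (if \<bar>z - r\<bar> < r then 2 * pi * \<i> * of_real e else 0)) {-R..R}"
proof -
  define k where "k u = - of_real r * (2 * pi * \<i> * of_real e * exp (2 * pi * \<i> * of_real e * of_real u)) /
     (of_real (r - z) - of_real r * exp (2 * pi * \<i> * of_real e * of_real u))" for u
  have abs: "\<bar>r - z\<bar> = \<bar>z - r\<bar>" by simp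
  note ci = circle_log_integral[where d = "r - z" and r = r and e = e, folded k_def, unfolded abs, OF r e]
  have "((\<lambda>t. ramp' (t - real j) *\<^sub>R k (ramp (t - real j))) has_integral integral {ramp (-R - real j)..ramp (R - real j)} k) {-R..R}"
  proof (rule has_integral_substitution[where c = 0 and d = 1])
    show "continuous_on {0..1} k" by (rule ci(2))
    show "((\<lambda>t. ramp (t - real j)) has_real_derivative ramp' (t - real j)) (at t within {-R..R})" for t
      by (rule has_field_derivative_at_within[OF DERIV_ramp_diff])
    show "ramp (- R - real j) \<le> ramp (R - real j)" using R ramp_values by auto
  qed (use R ramp_values in auto)
  moreover have "ramp (-R - real j) = 0" "ramp (R - real j) = 1" using R by (auto intro!: ramp_values)
  moreover have "ramp' (t - real j) *\<^sub>R k (ramp (t - real j)) = loop' r e j t / (loop r e j t - of_real z)" for t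
    unfolding k_def loop_def loop'_def by (simp add: scaleR_conv_of_real algebra_simps)
  ultimately show ?thesis using integral_unique[OF ci(1)] by simp
qed

text \<open>The line waits at its real point c during [0, n] while loop j runs in [j, j + 1]. Each
  loop returns to c, so logarithmic derivatives add up. The circle through c and q j encloses z > c
  just when z < q j, and then changes its winding number by e j.\<close>

lemma exists_looped_contour:
  fixes c :: real and q e :: "nat \<Rightarrow> real" and n :: nat
  assumes q: "\<And>j. j < n \<Longrightarrow> q j > c" and e: "\<And>j. e j = 1 \<or> e j = -1"
  shows "\<exists>g T. mb_tail g c T \<and> (\<forall>t. Re (g t) \<ge> c) \<and>
    (\<forall>z>c. (\<forall>j<n. z \<noteq> q j) \<longrightarrow> of_real z \<notin> range g \<and>
       (mb_pv g (of_real z) \<longlongrightarrow> (2 * of_real (\<Sum>j<n. if z < q j then e j else 0) - 1) * pi * \<i>) at_top)"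
proof -
  \<comment> \<open>The diameter runs from c to q j; the value 1 for j >= n keeps every radius
    positive.\<close>
  define r where "r j = (if j < n then (q j - c) / 2 else 1)" for j
  have r: "r j > 0" for j using q[of j] by (simp add: r_def)
  define L where "L j = loop (r j) (e j) j" for j
  define L' where "L' j = loop' (r j) (e j) j" for j
  \<comment> \<open>Equal to t for t <= -1 and t >= n + 1, and at rest at 0 on [0, n].\<close>
  define \<tau> where "\<tau> t = t * ramp (t - real n) + t * ramp (- t)" for t
  define \<tau>' where "\<tau>' t = (ramp (t - real n) + t * ramp' (t - real n)) + (ramp (- t) - t * ramp' (- t))" for t
  define g0 where "g0 t = Complex c (\<tau> t)" for t
  define g where "g t = g0 t + (\<Sum>j<n. L j t)" for t
  have dtau: "(\<tau> has_real_derivative \<tau>' t) (at t)" for t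
  proof -
    note d = DERIV_ramp_diff[of "real n" t] DERIV_ramp_minus[of t]
    show ?thesis using d unfolding \<tau>_def[abs_def] \<tau>'_def by (auto intro!: derivative_eq_intros)
  qed
  have ctau: "continuous_on UNIV \<tau>'" unfolding \<tau>'_def[abs_def]
    by (intro continuous_intros continuous_on_compose2[OF continuous_ramp'[of UNIV]] continuous_on_compose2[OF continuous_ramp[of UNIV]]) auto
  have dg0: "(g0 has_vector_derivative \<i> * of_real (\<tau>' t)) (at t)" for t
  proof -
    have "((\<lambda>t. complex_of_real (\<tau> t)) has_vector_derivative of_real (\<tau>' t)) (at t)"
      by (rule has_vector_derivative_of_real[OF dtau])
    from has_vector_derivative_add[OF has_vector_derivative_const[of "of_real c"] has_vector_derivative_mult_right[OF this, of \<i>]]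
    show ?thesis unfolding g0_def[abs_def] Complex_eq by simp
  qed
  have dg: "(g has_vector_derivative \<i> * of_real (\<tau>' t) + (\<Sum>j<n. L' j t)) (at t)" for t
    unfolding g_def[abs_def] L_def L'_def by (intro has_vector_derivative_add dg0 has_vector_derivative_sum loop_deriv)
  have tau_tail: "\<tau> t = t" if "\<bar>t\<bar> \<ge> real n + 1" for t
    using that ramp_values[of "t - real n"] ramp_values[of "- t"] by (cases "t \<ge> 0") (auto simp: \<tau>_def)
  have Lout: "L j t = 0" "L' j t = 0" if "t \<le> real j \<or> t \<ge> real j + 1" for j t
    unfolding L_def L'_def using loop_outside[OF e that] by auto
  have tail0: "mb_tail g0 c (real n + 1)"
    unfolding mb_tail_def C1_differentiable_on_def
    by (auto intro!: exI[of _ "\<lambda>t. \<i> * of_real (\<tau>' t)"] dg0 continuous_intros ctau simp: g0_def tau_tail)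
  have tail: "mb_tail g c (real n + 1)"
    unfolding mb_tail_def
  proof (intro conjI allI impI)
    show "g C1_differentiable_on UNIV" unfolding C1_differentiable_on_def
      by (intro exI[of _ "\<lambda>t. \<i> * of_real (\<tau>' t) + (\<Sum>j<n. L' j t)"] conjI ballI dg continuous_intros ctau)
        (auto simp: L'_def intro!: continuous_loop')
    fix t assume t: "real n + 1 \<le> \<bar>t\<bar>"
    have "(\<Sum>j<n. L j t) = 0" using t by (intro sum.neutral ballI Lout) auto
    thus "g t = Complex c t" using t by (simp add: g_def g0_def tau_tail)
  qed simp
  \<comment> \<open>At each time only one of the summands moves; the others rest at the base point.\<close>
  have cases: "(\<exists>j<n. g t = of_real c + L j t \<and> g0 t = of_real c \<and> \<tau>' t = 0 \<and> (\<forall>i. i \<noteq> j \<longrightarrow> L i t = 0 \<and> L' i t = 0))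
     \<or> (g t = g0 t \<and> (\<forall>i<n. L i t = 0 \<and> L' i t = 0))" for t
  proof (cases "0 \<le> t \<and> t < real n")
    case True
    define j where "j = nat \<lfloor>t\<rfloor>"
    have j: "real j \<le> t" "t < real j + 1" using True by (auto simp: j_def)
    have jn: "j < n" using j True by (auto)
    have others: "L i t = 0 \<and> L' i t = 0" if "i \<noteq> j" for i
    proof -
      have "i < j \<or> i > j" using that by auto
      hence "t \<le> real i \<or> t \<ge> real i + 1" using j by auto
      thus ?thesis using Lout by auto
    qed
    have "ramp (t - real n) = 0" "ramp (- t) = 0" "ramp' (t - real n) = 0" "ramp' (- t) = 0"
      using True by (auto intro!: ramp_values ramp'_outside)
    hence t0: "\<tau> t = 0" "\<tau>' t = 0" by (auto simp: \<tau>_def \<tau>'_def)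
    have "(\<Sum>i<n. L i t) = (\<Sum>i\<in>{j}. L i t)" using jn others by (intro sum.mono_neutral_right) auto
    hence "g t = of_real c + L j t" by (simp add: g_def g0_def t0 complex_eq_iff)
    thus ?thesis using jn others t0 by (auto simp: g0_def complex_eq_iff)
  next
    case False
    have "L i t = 0 \<and> L' i t = 0" if "i < n" for i using False that by (intro conjI Lout) auto
    thus ?thesis by (auto simp: g_def)
  qed
  have Re0: "Re (g0 t) = c" for t by (simp add: g0_def)
  have ReL: "Re (L j t) \<ge> 0" for j t
  proof -
    have "norm (L j t - of_real (r j)) = r j" unfolding L_def loop_on_circle using r[of j] by simp
    thus ?thesis using abs_Re_le_cmod[of "L j t - of_real (r j)"] by auto
  qed
  have Reg: "Re (g t) \<ge> c" for t using cases[of t] Re0[of t] ReL by auto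
  have main: "of_real z \<notin> range g \<and>
       (mb_pv g (of_real z) \<longlongrightarrow> (2 * of_real (\<Sum>j<n. if z < q j then e j else 0) - 1) * pi * \<i>) at_top"
    if z: "z > c" "\<forall>j<n. z \<noteq> q j" for z
  proof
    have zr: "\<bar>(z - c) - r j\<bar> \<noteq> r j" "\<bar>(z - c) - r j\<bar> < r j \<longleftrightarrow> z < q j" if "j < n" for j
      using z that q[OF that] by (auto simp: r_def abs_if field_simps)
    have nL: "L j t \<noteq> of_real (z - c)" if "j < n" for j t
    proof
      assume "L j t = of_real (z - c)"
      hence "norm (of_real (z - c) - of_real (r j) :: complex) = r j"
        using loop_on_circle[of "r j" "e j" j t] r[of j] by (simp add: L_def)
      hence "\<bar>(z - c) - r j\<bar> = r j" by (simp only: norm_of_real flip: of_real_diff)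
      thus False using zr(1)[OF that] by simp
    qed
    have ng: "g t \<noteq> of_real z" for t
      using cases[of t]
    proof
      assume "\<exists>j<n. g t = of_real c + L j t \<and> g0 t = of_real c \<and> \<tau>' t = 0 \<and> (\<forall>i. i \<noteq> j \<longrightarrow> L i t = 0 \<and> L' i t = 0)"
      then obtain j where "j < n" "g t = of_real c + L j t" by blast
      thus ?thesis using nL[of j t] by (metis add_diff_cancel_left' of_real_diff)
    next
      assume "g t = g0 t \<and> (\<forall>i<n. L i t = 0 \<and> L' i t = 0)"
      thus ?thesis using z(1) by (auto simp: g0_def complex_eq_iff)
    qed
    show "of_real z \<notin> range g" using ng by force
    have vd: "vector_derivative g (at t) = \<i> * of_real (\<tau>' t) + (\<Sum>j<n. L' j t)"
       "vector_derivative g0 (at t) = \<i> * of_real (\<tau>' t)" for t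
      using dg dg0 by (auto intro: vector_derivative_at)
    \<comment> \<open>A resting loop has velocity 0, so its quotient vanishes; at each time at most
      one summand on the right is nonzero.\<close>
    have pw: "1 / (g t - of_real z) * vector_derivative g (at t) =
       1 / (g0 t - of_real z) * vector_derivative g0 (at t) + (\<Sum>j<n. L' j t / (L j t - of_real (z - c)))" for t
      using cases[of t]
    proof
      assume "\<exists>j<n. g t = of_real c + L j t \<and> g0 t = of_real c \<and> \<tau>' t = 0 \<and> (\<forall>i. i \<noteq> j \<longrightarrow> L i t = 0 \<and> L' i t = 0)"
      then obtain j where j: "j < n" "g t = of_real c + L j t" "g0 t = of_real c" "\<tau>' t = 0" "\<And>i. i \<noteq> j \<Longrightarrow> L i t = 0 \<and> L' i t = 0" by blast
      have "(\<Sum>i<n. L' i t) = (\<Sum>i\<in>{j}. L' i t)" using j by (intro sum.mono_neutral_right) auto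
      moreover have "(\<Sum>i<n. L' i t / (L i t - of_real (z - c))) = (\<Sum>i\<in>{j}. L' i t / (L i t - of_real (z - c)))"
        using j by (intro sum.mono_neutral_right) auto
      moreover have "of_real c + L j t - of_real z = L j t - of_real (z - c)" by simp
      ultimately show ?thesis unfolding vd by (simp only: j) simp
    next
      assume "g t = g0 t \<and> (\<forall>i<n. L i t = 0 \<and> L' i t = 0)"
      thus ?thesis unfolding vd by simp
    qed
    have "\<forall>\<^sub>F R in at_top. mb_pv g0 (of_real z) R + (\<Sum>j<n. if z < q j then 2 * pi * \<i> * of_real (e j) else 0) = mb_pv g (of_real z) R"
      using eventually_ge_at_top[of "real n + 1"]
    proof eventually_elim
      case (elim R)
      have "((\<lambda>t. 1 / (g0 t - of_real z) * vector_derivative g0 (at t)) has_integral mb_pv g0 (of_real z) R) {-R..R}"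
        unfolding mb_pv_def
      proof (rule integrable_integral, rule integrable_continuous_real)
        have "g0 t - of_real z \<noteq> 0" for t using z(1) by (auto simp: g0_def complex_eq_iff)
        thus "continuous_on {-R..R} (\<lambda>t. 1 / (g0 t - of_real z) * vector_derivative g0 (at t))"
          by (intro continuous_intros mb_tail_continuous[OF tail0] mb_tail_continuous_deriv[OF tail0]) auto
      qed
      moreover have "((\<lambda>t. L' j t / (L j t - of_real (z - c))) has_integral (if z < q j then 2 * pi * \<i> * of_real (e j) else 0)) {-R..R}" if "j < n" for j
        using loop_log_integral[of "r j" "z - c" "e j" j R] r zr[OF that] e elim that by (auto simp: L_def L'_def)
      ultimately have "((\<lambda>t. 1 / (g t - of_real z) * vector_derivative g (at t)) has_integral
         (mb_pv g0 (of_real z) R + (\<Sum>j<n. if z < q j then 2 * pi * \<i> * of_real (e j) else 0))) {-R..R}"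
        unfolding pw by (intro has_integral_add has_integral_sum) auto
      thus ?case unfolding mb_pv_def[of g] by (rule integral_unique[symmetric])
    qed
    moreover have "((\<lambda>R. mb_pv g0 (of_real z) R + (\<Sum>j<n. if z < q j then 2 * pi * \<i> * of_real (e j) else 0)) \<longlongrightarrow>
        - (pi * \<i>) + (\<Sum>j<n. if z < q j then 2 * pi * \<i> * of_real (e j) else 0)) at_top"
      by (intro tendsto_intros mb_pv_right[OF tail0]) (use z(1) in \<open>simp add: g0_def\<close>)
    ultimately have "(mb_pv g (of_real z) \<longlongrightarrow> - (pi * \<i>) + (\<Sum>j<n. if z < q j then 2 * pi * \<i> * of_real (e j) else 0)) at_top"
      by (rule Lim_transform_eventually[rotated])
    moreover have "(\<Sum>j<n. if z < q j then 2 * pi * \<i> * of_real (e j) else 0) = 2 * pi * \<i> * of_real (\<Sum>j<n. if z < q j then e j else 0)"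
      unfolding of_real_sum sum_distrib_left by (intro sum.cong) auto
    ultimately show "(mb_pv g (of_real z) \<longlongrightarrow> (2 * of_real (\<Sum>j<n. if z < q j then e j else 0) - 1) * pi * \<i>) at_top"
      by (simp add: algebra_simps)
  qed
  show ?thesis using tail Reg main by blast
qed

text \<open>A positive circle reaching i + h1 and a negative one reaching i + h2 leave winding
  number 1 only between these points: an island around the left pole i + \<delta> that contains no
  integer. One island is made for each left pole to the right of the base line.\<close>

lemma exists_separating_contour:
  fixes a :: real
  assumes a: "a \<notin> \<int>"
  shows "\<exists>g c T. mb_tail g c T \<and> (\<forall>t. Re (g t) > - (1/2)) \<and>
     (\<forall>k::nat. left_of g (- of_real a - of_nat k)) \<and> (\<forall>k::nat. right_of g (of_nat k))"
proof -
  define \<delta> where "\<delta> = frac (- a)"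
  have "- a \<notin> \<int>" using a by simp
  hence \<delta>: "0 < \<delta>" "\<delta> < 1" by (auto simp: \<delta>_def frac_gt_0_iff frac_lt_1)
  \<comment> \<open>h2 is midway between 0 and \<delta>, h1 midway between \<delta> and 1.\<close>
  define h1 h2 where "h1 = (1 + \<delta>) / 2" and "h2 = \<delta> / 2"
  have h: "0 < h2" "h2 < \<delta>" "\<delta> < h1" "h2 < h1" "h1 < 1" using \<delta> by (auto simp: h1_def h2_def)
  \<comment> \<open>The number of left poles - a - k that are positive, namely 0 if - a is
    negative.\<close>
  define m where "m = nat (\<lfloor>- a\<rfloor> + 1)"
  \<comment> \<open>Left of 0, but right of \<delta> - 1, which bounds the negative left poles, and
    right of - 1/2, which will make the joint condition hold for any such contours.\<close>
  define c where "c = max (\<delta> - 1) (- (1/2)) / 2"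
  have c: "c < 0" "c > - (1/2)" "c > \<delta> - 1" using \<delta> by (auto simp: c_def)
  define q where "q j = (if even j then real (j div 2) + h1 else real (j div 2) + h2)" for j
  define e where "e j = (if even j then 1 else -1 :: real)" for j :: nat
  have q0: "q j > 0" for j using h by (auto simp: q_def add_nonneg_pos)
  have "q j > c" for j using q0[of j] c(1) by linarith
  moreover have "e j = 1 \<or> e j = -1" for j by (simp add: e_def)
  ultimately obtain g T where g: "mb_tail g c T" "\<And>t. Re (g t) \<ge> c"
    and pv: "\<And>z. z > c \<Longrightarrow> (\<forall>j<2 * m. z \<noteq> q j) \<Longrightarrow> of_real z \<notin> range g \<and>
       (mb_pv g (of_real z) \<longlongrightarrow> (2 * of_real (\<Sum>j<2 * m. if z < q j then e j else 0) - 1) * pi * \<i>) at_top"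
    using exists_looped_contour[of "2 * m" c q e] by blast
  have sum: "(\<Sum>j<2 * m. if z < q j then e j else 0) =
      (\<Sum>j<m. (if z < real j + h1 then 1 else 0) - (if z < real j + h2 then 1 else 0))" for z m
    by (induction m) (auto simp: q_def e_def)
  have right: "right_of g (of_nat k)" for k
  proof -
    have ne: "real k \<noteq> q j" for j
    proof
      assume eq: "real k = q j"
      have "real (j div 2) < real k" "real k < real (j div 2 + 1)" using eq \<delta> h by (auto simp: q_def split: if_splits)
      thus False by (simp only: of_nat_less_iff)
    qed
    have "(\<Sum>j<2 * m. if real k < q j then e j else 0) = 0" unfolding sum
    proof (rule sum.neutral, rule ballI)
      fix j
      show "(if real k < real j + h1 then 1 else 0) - (if real k < real j + h2 then 1 else 0) = (0::real)"
      proof (cases "k \<le> j")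
        case True
        hence "real k \<le> real j" by simp
        hence "real k < real j + h1" "real k < real j + h2" using h by linarith+
        thus ?thesis by simp
      next
        case False
        hence "real k \<ge> real j + 1" by linarith
        hence "\<not> real k < real j + h1" "\<not> real k < real j + h2" using h by linarith+
        thus ?thesis by simp
      qed
    qed
    thus ?thesis using pv[of "real k"] c(1) ne right_of_iff_pv[OF g(1), of "of_nat k"] by simp
  qed
  have left: "left_of g (- of_real a - of_nat k)" for k
  proof (cases "int k \<le> \<lfloor>- a\<rfloor>")
    case True
    define i where "i = nat (\<lfloor>- a\<rfloor> - int k)"
    have z: "- a - real k = real i + \<delta>" using True by (simp add: i_def \<delta>_def frac_def)
    have im: "i < m" unfolding i_def m_def using True by linarith
    have ne: "real i + \<delta> \<noteq> q j" for j
    proof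
      assume eq: "real i + \<delta> = q j"
      have "real (j div 2) < real (i + 1)" "real i < real (j div 2 + 1)" "real i + \<delta> \<noteq> real i + h2" "real i + \<delta> \<noteq> real i + h1"
        using eq \<delta> h by (auto simp: q_def split: if_splits)
      moreover from this(1,2) have "j div 2 = i" by linarith
      ultimately show False using eq by (auto simp: q_def split: if_splits)
    qed
    have "(\<Sum>j<2 * m. if real i + \<delta> < q j then e j else 0) = (\<Sum>j<m. if j = i then 1 else 0)" unfolding sum
    proof (rule sum.cong[OF refl])
      fix j
      consider "i < j" | "i = j" | "i > j" by linarith
      thus "(if real i + \<delta> < real j + h1 then 1 else 0) - (if real i + \<delta> < real j + h2 then 1 else 0) = (if j = i then 1 else (0::real))"
      proof cases
        case 1
        hence "real i + 1 \<le> real j" by linarith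
        hence "real i + \<delta> < real j + h1" "real i + \<delta> < real j + h2" using h by linarith+
        thus ?thesis using 1 by simp
      next
        case 3
        hence "real j + 1 \<le> real i" by linarith
        hence "\<not> real i + \<delta> < real j + h1" "\<not> real i + \<delta> < real j + h2" using h by linarith+
        thus ?thesis using 3 by simp
      qed (use h in auto)
    qed
    hence "(\<Sum>j<2 * m. if real i + \<delta> < q j then e j else 0) = 1" using im by simp
    moreover have "real i + \<delta> > c" using c \<delta> by auto
    ultimately have "left_of g (of_real (real i + \<delta>))"
      using pv[of "real i + \<delta>"] ne left_of_iff_pv[OF g(1), of "of_real (real i + \<delta>)"] by simp
    moreover have "of_real (real i + \<delta>) = - complex_of_real a - of_nat k" unfolding z[symmetric] by simp
    ultimately show ?thesis by simp
  next
    case False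
    have "- a = of_int \<lfloor>- a\<rfloor> + \<delta>" by (simp add: \<delta>_def frac_def)
    moreover have "real_of_int \<lfloor>- a\<rfloor> + 1 \<le> real k" using False by linarith
    ultimately have "- a - real k < c" using c(3) by linarith
    thus ?thesis using g(2) by (intro left_of_base[OF g(1)]) (simp, meson less_le_trans)
  qed
  have "\<forall>t. Re (g t) > - (1/2)" using g(2) c(2) less_le_trans by blast
  thus ?thesis using g(1) left right by blast
qed

section \<open>The Fox H-function of the capacity integrals\<close>

definition foxA :: "(real \<times> real list) list" where
  "foxA = [(-1, [1, 1, 1, 1])]"

definition foxB :: "(real \<times> real list) list" where
  "foxB = [(-1, [1, 1, 0, 0]), (0, [0, 0, 1, 0]), (0, [0, 0, 0, 1])]"

definition foxV :: "real \<Rightarrow> real \<Rightarrow> (nat \<times> nat \<times> (real \<times> real) list \<times> (real \<times> real) list) list" where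
  "foxV mB mE = [(1, 1, [(mE, 1)], [(0, 1)]), (1, 1, [(1 - mE, 1)], [(0, 1)]), (1, 1, [(mB, 1)], [(0, 1)]),
     (1, 2, [(1, 1), (1, 1)], [(1, 1)])]"

text \<open>Each value is 1 - c for an upper entry (c, 1), so the left poles of variable i are -
  \<open>fox_a\<close> - k.\<close>

definition fox_a :: "real \<Rightarrow> real \<Rightarrow> nat \<Rightarrow> real" where
  "fox_a mB mE i = (if i = 0 then 1 - mE else if i = 1 then mE else if i = 2 then 1 - mB else 0)"

lemma less_4_cases: "i < 4 \<Longrightarrow> i = 0 \<or> i = 1 \<or> i = 2 \<or> i = (3::nat)"
  by linarith

lemma right_poles_single: "right_poles (1, n, C, [(d, 1)]) = {of_real (d + real k) | k. True}"
proof -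
  have "z \<in> right_poles (1, n, C, [(d, 1)])" if "z = of_real (d + real k)" for z k
    unfolding right_poles_def using that by (auto intro!: exI[of _ "0::nat"] exI[of _ k])
  thus ?thesis by (auto simp: right_poles_def)
qed

lemma left_poles_const:
  assumes "n > 0" "\<And>j. j < n \<Longrightarrow> C ! j = (c, 1)"
  shows "left_poles (m, n, C, D) = {of_real (c - 1 - real k) | k. True}"
proof -
  have "z \<in> left_poles (m, n, C, D)" if "z = of_real (c - 1 - real k)" for z k
    unfolding left_poles_def prod.case using that assms(1) assms(2)[OF assms(1)]
    by (intro CollectI exI[of _ "0::nat"] exI[of _ k] conjI) auto
  thus ?thesis using assms(2) by (auto simp: left_poles_def)
qed

lemma fox_right_poles:
  assumes "i < 4"
  shows "right_poles (foxV mB mE ! i) = {of_nat ((if i = 3 then 1 else 0) + k) | k. True}"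
  using less_4_cases[OF assms]
  by (elim disjE) (simp_all add: foxV_def right_poles_single[unfolded One_nat_def] eval_nat_numeral)

lemma fox_left_poles:
  assumes "i < 4"
  shows "left_poles (foxV mB mE ! i) = {- of_real (fox_a mB mE i) - of_nat k | k. True}"
proof -
  have "left_poles (m, 1, [(c, 1)], D) = {of_real (c - 1 - real k) | k. True}" for m c D
    by (rule left_poles_const) auto
  moreover have "left_poles (m, 2, [(1, 1), (1, 1)], D) = {of_real (1 - 1 - real k) | k. True}" for m D
    by (rule left_poles_const) (auto simp: nth_Cons split: nat.splits)
  ultimately show ?thesis using less_4_cases[OF assms]
    by (elim disjE) (simp_all add: foxV_def fox_a_def eval_nat_numeral)
qed

lemma fox_admissible_iff:
  "mfox_admissible 1 foxA (foxV mB mE) g \<longleftrightarrow>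
     (\<forall>i<4. mb_contour (g i) \<and> (\<forall>k::nat. right_of (g i) (of_nat ((if i = 3 then 1 else 0) + k))) \<and>
        (\<forall>k::nat. left_of (g i) (- of_real (fox_a mB mE i) - of_nat k))) \<and>
     (\<forall>t. \<forall>i<4. \<forall>k::nat. left_of (g i) (- 2 - of_nat k - (\<Sum>i'\<in>{..<4} - {i}. g i' (t i'))))"
proof -
  have len: "length (foxV mB mE) = 4" by (simp add: foxV_def)
  have one: "snd (foxA ! 0) ! i = 1" if "i < 4" for i using less_4_cases[OF that] by (auto simp: foxA_def numeral_2_eq_2 numeral_3_eq_3)
  have sum: "(\<Sum>i'\<in>{..<4} - {i}. of_real (snd (foxA ! 0) ! i') * g i' (t i')) = (\<Sum>i'\<in>{..<4} - {i}. g i' (t i'))" for i t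
    by (intro sum.cong) (auto simp: one)
  have joint: "(\<forall>t :: nat \<Rightarrow> real. \<forall>i<4. \<forall>j<1::nat. \<forall>k :: nat.
        snd (foxA ! j) ! i \<noteq> 0 \<longrightarrow>
        left_of (g i)
          ((of_real (fst (foxA ! j)) - 1 - of_nat k
             - (\<Sum>i'\<in>{..<4} - {i}. of_real (snd (foxA ! j) ! i') * g i' (t i')))
           / of_real (snd (foxA ! j) ! i))) \<longleftrightarrow>
     (\<forall>t. \<forall>i<4. \<forall>k::nat. left_of (g i) (- 2 - of_nat k - (\<Sum>i'\<in>{..<4} - {i}. g i' (t i'))))"
  proof -
    have "complex_of_real (fst (foxA ! 0)) = - 1" by (simp add: foxA_def)
    thus ?thesis by (simp add: sum one)
  qed
  have poles: "(\<forall>z\<in>right_poles (foxV mB mE ! i). right_of (g i) z) \<longleftrightarrow> (\<forall>k::nat. right_of (g i) (of_nat ((if i = 3 then 1 else 0) + k)))"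
     "(\<forall>z\<in>left_poles (foxV mB mE ! i). left_of (g i) z) \<longleftrightarrow> (\<forall>k::nat. left_of (g i) (- of_real (fox_a mB mE i) - of_nat k))" if "i < 4" for i
    unfolding fox_right_poles[OF that] fox_left_poles[OF that] by auto
  show ?thesis unfolding mfox_admissible_def len joint using poles by auto
qed

text \<open>The contours can be chosen separately: all stay right of - 1/2, so three of them sum to
  real part at least - 3/2. The joint poles for the fourth then have real part at most - 1/2 and
  fall on its left.\<close>

lemma fox_admissible_exists:
  assumes "mB \<notin> \<int>" "mE \<notin> \<int>"
  shows "\<exists>g. mfox_admissible 1 foxA (foxV mB mE) g"
proof -
  have ni: "fox_a mB mE i \<notin> \<int>" if "i < 3" for i
  proof -
    have "1 - mB \<notin> \<int>" "1 - mE \<notin> \<int>" using assms Ints_diff[OF Ints_1, of "1 - mB"] Ints_diff[OF Ints_1, of "1 - mE"] by auto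
    thus ?thesis using that assms by (auto simp: fox_a_def)
  qed
  have "\<exists>g. mb_contour g \<and> (\<forall>t. Re (g t) > - (1/2)) \<and> (\<forall>k::nat. right_of g (of_nat ((if i = 3 then 1 else 0) + k))) \<and>
      (\<forall>k::nat. left_of g (- of_real (fox_a mB mE i) - of_nat k)) \<and> (\<exists>c T. mb_tail g c T)" if "i < 4" for i
  proof (cases "i = 3")
    case True
    note l = mb_tail_line[of "1/2"]
    have "right_of (mb_line (1/2)) (of_nat (1 + k))" "left_of (mb_line (1/2)) (- of_nat k)" for k :: nat
      by (rule right_of_base[OF l], simp add: mb_line_def) (rule left_of_base[OF l], simp add: mb_line_def)
    moreover have "\<forall>t. Re (mb_line (1/2) t) > - (1/2)" by (simp add: mb_line_def)
    ultimately show ?thesis using True l mb_tail_imp_contour[OF l]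
      by (intro exI[of _ "mb_line (1/2)"]) (auto simp: fox_a_def)
  next
    case False
    hence "i < 3" using that by auto
    from exists_separating_contour[OF ni[OF this]] show ?thesis using False mb_tail_imp_contour by auto
  qed
  then obtain g where g: "\<And>i. i < 4 \<Longrightarrow> mb_contour (g i) \<and> (\<forall>t. Re (g i t) > - (1/2)) \<and> (\<forall>k::nat. right_of (g i) (of_nat ((if i = 3 then 1 else 0) + k))) \<and>
      (\<forall>k::nat. left_of (g i) (- of_real (fox_a mB mE i) - of_nat k)) \<and> (\<exists>c T. mb_tail (g i) c T)" by metis
  have joint: "left_of (g i) (- 2 - of_nat k - (\<Sum>i'\<in>{..<4} - {i}. g i' (t i')))" if i: "i < 4" for t i and k :: nat
  proof -
    obtain c T where tl: "mb_tail (g i) c T" using g[OF i] by blast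
    have "(\<Sum>i'\<in>{..<4} - {i}. - (1/2)) \<le> (\<Sum>i'\<in>{..<4} - {i}. Re (g i' (t i')))"
      using g by (intro sum_mono) (auto intro: less_imp_le)
    moreover have "card ({..<4} - {i}) = 3" using i by simp
    ultimately have "Re (\<Sum>i'\<in>{..<4} - {i}. g i' (t i')) \<ge> - (3/2)" by simp
    hence "Re (- 2 - of_nat k - (\<Sum>i'\<in>{..<4} - {i}. g i' (t i'))) \<le> - (1/2)" by simp
    thus ?thesis using g[OF i] by (intro left_of_base[OF tl]) (meson le_less_trans)
  qed
  show ?thesis unfolding fox_admissible_iff using g joint by blast
qed

context mb_four
begin

lemma fox_integrand_eq:
  assumes a: "\<And>i. i < 4 \<Longrightarrow> a i = fox_a mB mE i"
  shows "mfox_psi 1 foxA foxB (\<lambda>i. g i (t i)) *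
     (\<Prod>i<4. mfox_phi (foxV mB mE ! i) (g i (t i)) * complex_of_real ([x 0, x 1, x 2, x 3] ! i) powr (g i (t i))
        * vector_derivative (g i) (at (t i))) = joint_integrand (path_weight g) g t"
proof -
  define s where "s i = g i (t i)" for i
  have psi: "mfox_psi 1 foxA foxB s = Gamma (2 + (\<Sum>i<4. s i)) * (rGamma (2 + s 0 + s 1) * rGamma (1 + s 2) * rGamma (1 + s 3))"
    by (simp add: mfox_psi_def foxA_def foxB_def lincomb_def eval_nat_numeral add_ac)
  have phi: "mfox_phi (foxV mB mE ! 0) z = Gamma (- z) * Gamma (of_real (a 0) + z)"
    "mfox_phi (foxV mB mE ! 1) z = Gamma (- z) * Gamma (of_real (a 1) + z)"
    "mfox_phi (foxV mB mE ! 2) z = Gamma (- z) * Gamma (of_real (a 2) + z)"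
    "mfox_phi (foxV mB mE ! 3) z = Gamma (1 - z) * (Gamma z * Gamma z)" for z
    by (simp_all add: mfox_phi_def foxV_def a fox_a_def eval_nat_numeral)
  have four: "(\<Prod>i<4. f i) = f 0 * f 1 * f 2 * f 3" for f :: "nat \<Rightarrow> complex" by (simp add: numeral_eq_Suc)
  have nth: "[x 0, x 1, x 2, x 3] ! 0 = x 0" "[x 0, x 1, x 2, x 3] ! 1 = x 1" "[x 0, x 1, x 2, x 3] ! 2 = x 2" "[x 0, x 1, x 2, x 3] ! 3 = x 3"
    by (simp_all add: eval_nat_numeral)
  have pw: "path_weight g 0 (t 0) = Gamma (- s 0) * (Gamma (of_real (a 0) + s 0) * of_real (x 0) powr s 0) * vector_derivative (g 0) (at (t 0))"
    "path_weight g 1 (t 1) = Gamma (- s 1) * (Gamma (of_real (a 1) + s 1) * of_real (x 1) powr s 1) * vector_derivative (g 1) (at (t 1))"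
    "path_weight g 2 (t 2) = Gamma (- s 2) * (Gamma (of_real (a 2) + s 2) * rGamma (1 + s 2) * of_real (x 2) powr s 2) * vector_derivative (g 2) (at (t 2))"
    "path_weight g 3 (t 3) = Gamma (1 - s 3) * (Gamma (s 3) * rGamma (1 + s 3) * of_real (x 3) powr s 3 * Gamma (s 3)) * vector_derivative (g 3) (at (t 3))"
    by (simp_all add: path_weight_def factor_def dnum_def barnes_def s_def)
  show ?thesis
    unfolding s_def[symmetric] psi four phi nth joint_integrand_def pw by (simp only: mult_ac)
qed

theorem fox_value:
  assumes a: "\<And>i. i < 4 \<Longrightarrow> a i = fox_a mB mE i" and m: "mB \<notin> \<int>" "mE \<notin> \<int>"
  shows "mfoxH 1 foxA foxB (foxV mB mE) [x 0, x 1, x 2, x 3] =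
    of_real (Gamma (a 0) * Gamma (a 1) * Gamma (a 2) * (\<integral>y. euler_density y \<partial>lborel))"
    and "integrable lborel euler_density"
proof -
  define g where "g = (SOME g. mfox_admissible 1 foxA (foxV mB mE) g)"
  have "mfox_admissible 1 foxA (foxV mB mE) g"
    unfolding g_def using fox_admissible_exists[OF m] by (rule someI_ex)
  hence adm: "\<And>i. i < 4 \<Longrightarrow> mb_contour (g i)"
     "\<And>i k. i < 4 \<Longrightarrow> right_of (g i) (of_nat ((if i = 3 then 1 else 0) + k))"
     "\<And>i k. i < 4 \<Longrightarrow> left_of (g i) (- of_real (fox_a mB mE i) - of_nat k)"
     "\<And>t i k. i < 4 \<Longrightarrow> left_of (g i) (- 2 - of_nat k - (\<Sum>i'\<in>{..<4} - {i}. g i' (t i')))"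
    unfolding fox_admissible_iff by blast+
  have "\<forall>i. \<exists>c T. i < 4 \<longrightarrow> mb_tail (g i) c T" using adm(1) mb_contour_imp_tail by metis
  then obtain c T0 where cT: "\<And>i. i < 4 \<Longrightarrow> mb_tail (g i) (c i) (T0 i)" by metis
  define T where "T = max (max (T0 0) (T0 1)) (max (T0 2) (T0 3))"
  have tail: "mb_tail (g i) (c i) T" if "i < 4" for i
    using mb_tail_mono[OF cT[OF that], of T] less_4_cases[OF that] by (auto simp: T_def)
  have "\<forall>i. \<exists>M. i < 4 \<longrightarrow> (\<forall>t. \<bar>Re (g i t)\<bar> \<le> M)" using mb_tail_bounded[OF tail] by blast
  then obtain M0 where M0: "\<And>i t. i < 4 \<Longrightarrow> \<bar>Re (g i t)\<bar> \<le> M0 i" by metis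
  define M where "M = max (max (M0 0) (M0 1)) (max (M0 2) (M0 3))"
  have M: "\<bar>Re (g i t)\<bar> \<le> M" if "i < 4" for i t
    using M0[OF that, of t] less_4_cases[OF that] by (auto simp: M_def)
  \<comment> \<open>Meets both demands: outweighing the contours and passing every pole - a
    i.\<close>
  define N where "N = nat \<lceil>8 * M + 4 + \<bar>a 0\<bar> + \<bar>a 1\<bar> + \<bar>a 2\<bar>\<rceil>"
  have "M \<ge> 0" using M[of 0 0] by linarith
  have N0: "real N \<ge> 8 * M + 4 + \<bar>a 0\<bar> + \<bar>a 1\<bar> + \<bar>a 2\<bar>" unfolding N_def by linarith
  have N: "real N \<ge> 8 * M + 4" "\<And>i. i < 3 \<Longrightarrow> - a i < real N + 1/2"
  proof -
    show "real N \<ge> 8 * M + 4" using N0 by linarith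
    fix i :: nat assume "i < 3"
    hence "i = 0 \<or> i = 1 \<or> i = 2" by linarith
    thus "- a i < real N + 1/2" using N0 \<open>M \<ge> 0\<close> by auto
  qed
  have avoid: "sum_avoids g c {..<4}"
    unfolding sum_avoids_def
  proof (intro conjI allI notI)
    fix t k assume eq: "(\<Sum>i\<in>{..<4}. g i (t i)) = - 2 - of_nat k"
    have "(\<Sum>i\<in>{..<4}. g i (t i)) = g 0 (t 0) + (\<Sum>i\<in>{..<4} - {0}. g i (t i))"
      by (rule sum.remove) auto
    hence "g 0 (t 0) = - 2 - of_nat k - (\<Sum>i\<in>{..<4} - {0}. g i (t i))" using eq by (simp add: algebra_simps)
    moreover have "- 2 - of_nat k - (\<Sum>i\<in>{..<4} - {0}. g i (t i)) \<notin> range (g 0)" using adm(4)[of 0 k t] by (simp add: left_of_def)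
    ultimately show False by (metis rangeI)
  next
    \<comment> \<open>With the other three parameters at a common large height, the joint pole z is
      known to be left of \<open>g 0\<close>. So far from the real axis this forces Re z < c 0,
      which is the inequality for the abscissas.\<close>
    obtain H where H: "\<And>z. \<bar>Im z\<bar> \<ge> H \<Longrightarrow> Re z > c 0 \<Longrightarrow> right_of (g 0) z"
      using high_left_right[OF tail[of 0]] by (metis zero_less_numeral)
    define \<tau> where "\<tau> = max T \<bar>H\<bar>"
    define z where "z = - 2 - of_nat 0 - (\<Sum>i\<in>{..<4} - {0}. g i \<tau>)"
    have T: "T > 0" using tail[of 0] by (simp add: mb_tail_def)
    have "(\<Sum>i\<in>{..<4} - {0}. g i ((\<lambda>_. \<tau>) i)) = Complex (\<Sum>i\<in>{..<4} - {0}. c i) (\<Sum>i\<in>{..<4} - {0::nat}. \<tau>)"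
      by (rule sum_tail[where T = T]) (use tail T in \<open>auto simp: \<tau>_def\<close>)
    hence z: "z = Complex (- 2 - (\<Sum>i\<in>{..<4} - {0}. c i)) (- 3 * \<tau>)" by (simp add: z_def complex_eq_iff)
    have left: "left_of (g 0) z" unfolding z_def using adm(4)[of 0 0 "\<lambda>_. \<tau>"] by simp
    have "\<tau> \<ge> \<bar>H\<bar>" "\<tau> \<ge> T" by (auto simp: \<tau>_def)
    hence big: "\<bar>Im z\<bar> \<ge> H" "\<bar>- 3 * \<tau>\<bar> \<ge> T" using T by (auto simp: z)
    have "\<not> Re z > c 0" using H[OF big(1)] left not_left_and_right by blast
    moreover have "Re z \<noteq> c 0"
    proof
      assume "Re z = c 0"
      hence "z = g 0 (- 3 * \<tau>)" using tail[of 0] big(2) unfolding mb_tail_def z by simp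
      thus False using left unfolding left_of_def by (metis rangeI)
    qed
    ultimately have "Re z < c 0" by linarith
    moreover have "(\<Sum>i\<in>{..<4}. c i) = c 0 + (\<Sum>i\<in>{..<4} - {0}. c i)" by (rule sum.remove) auto
    ultimately show "(\<Sum>i\<in>{..<4}. c i) > - 2" by (simp add: z)
  qed
  interpret P: mb_four_paths a x g c T M N
    by unfold_locales (use tail adm a avoid M N in \<open>auto simp: dnum_def\<close>)
  have len: "length (foxV mB mE) = 4" by (simp add: foxV_def)
  have "mfoxH 1 foxA foxB (foxV mB mE) [x 0, x 1, x 2, x 3] =
     1 / (2 * pi * \<i>) ^ 4 * (\<integral>t. joint_integrand (path_weight g) g t \<partial>PiM {..<4} (\<lambda>_. lborel))"
    unfolding mfoxH_def Let_def len g_def[symmetric]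
    by (rule arg_cong2[of _ _ _ _ "(*)", OF refl Bochner_Integration.integral_cong[OF refl fox_integrand_eq[OF a]]])
  also have "\<dots> = of_real (Gamma (a 0) * Gamma (a 1) * Gamma (a 2) * (\<integral>y. euler_density y \<partial>lborel))"
    unfolding P.path_integral_eq_std by (subst std_integral(2)) (use N(2) in auto)
  finally show "mfoxH 1 foxA foxB (foxV mB mE) [x 0, x 1, x 2, x 3] =
    of_real (Gamma (a 0) * Gamma (a 1) * Gamma (a 2) * (\<integral>y. euler_density y \<partial>lborel))" .
  show "integrable lborel euler_density" by (rule std_integral(1)[OF N(2)])
qed

end

section \<open>Density and distribution function in the Euler variable\<close>

lemma FRS_series:
  fixes p m K1 K2 gb :: real and r :: nat
  assumes "g \<ge> 0"
  defines "\<alpha> \<equiv> (1 + Kbar p K1 K2) / gb" and "\<delta> \<equiv> (1 + Kbar p K1 K2) * m / (gb * (m + Kr K1 K2 r))"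
  assumes "m > 0" "Kr K1 K2 r > 0" "gb > 0"
  shows "FRS p m K1 K2 gb r g = \<alpha> * (m / (m + Kr K1 K2 r)) powr m * (\<Sum>n. hcoeff m \<alpha> \<delta> n / fact (Suc n) * g ^ Suc n)"
proof -
  define C where "C = \<alpha> * (m / (m + Kr K1 K2 r)) powr m"
  \<comment> \<open>\<delta> is \<alpha> m / (m + K), so the rate K / (m + K) in Kummer's argument
    is the difference of the two.\<close>
  have ab: "Kr K1 K2 r * (1 + Kbar p K1 K2) * t / (gb * (m + Kr K1 K2 r)) = (\<alpha> - \<delta>) * t" for t
    using assms by (simp add: \<alpha>_def \<delta>_def divide_simps) (simp add: algebra_simps)
  have f: "fRS p m K1 K2 gb r t = C * (exp (- \<alpha> * t) * hyp1F1 m 1 ((\<alpha> - \<delta>) * t))" for t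
    unfolding fRS_def Let_def ab C_def by (simp add: \<alpha>_def mult_ac)
  note I = exp_hyp1F1_integral[OF assms(1), of \<alpha> m \<delta>]
  have "set_integrable lborel {0..g} (\<lambda>t. exp (- \<alpha> * t) * hyp1F1 m 1 ((\<alpha> - \<delta>) * t))"
    unfolding set_integrable_def by (rule borel_integrable_compact[OF compact_Icc continuous_on_subset[OF I(3)]]) simp
  from set_borel_integral_eq_integral(2)[OF this] integral_unique[OF I(1)]
  have "(LINT t:{0..g}|lborel. exp (- \<alpha> * t) * hyp1F1 m 1 ((\<alpha> - \<delta>) * t)) = (\<Sum>n. hcoeff m \<alpha> \<delta> n / fact (Suc n) * g ^ Suc n)"
    by simp
  thus ?thesis unfolding FRS_def f set_integral_mult_right C_def by simp
qed


text \<open>The scale of y makes the rate of the exponential, (m + K) / m, exceed that of Kummer's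
  argument, K / m, by exactly 1. The surplus is the exp (- y) of Euler's integral; the rest is
  absorbed by Kummer's transformation.\<close>

lemma fRS_Kummer:
  fixes p m K1 K2 gb :: real and r :: nat
  defines "K \<equiv> Kr K1 K2 r" and "Kb \<equiv> Kbar p K1 K2"
  assumes "m > 0" "K > 0" "gb > 0" "1 + Kb > 0"
  shows "fRS p m K1 K2 gb r (gb * (m + K) / (m * (1 + Kb)) * y) =
    (1 + Kb) / gb * (m / (m + K)) powr m * exp (- y) * (\<Sum>k. pochhammer (1 - m) k / (fact k)\<^sup>2 * (- (K / m * y)) ^ k)"
proof -
  define g where "g = gb * (m + K) / (m * (1 + Kb)) * y"
  have e1: "K * (1 + Kb) * g / (gb * (m + K)) = K / m * y"
  proof -
    define A B where "A = m + K" and "B = 1 + Kb"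
    have "A \<noteq> 0" "B \<noteq> 0" using assms(3-6) by (auto simp: A_def B_def)
    thus ?thesis using assms(3,5) unfolding g_def A_def[symmetric] B_def[symmetric] by simp
  qed
  have "(1 + Kb) * g / gb = (m + K) / m * y"
  proof -
    define B where "B = 1 + Kb"
    have "B \<noteq> 0" using assms(6) by (auto simp: B_def)
    thus ?thesis using assms(3,5) unfolding g_def B_def[symmetric] by simp
  qed
  also have "\<dots> = y + K / m * y" using assms(3) by (simp add: add_divide_distrib distrib_right)
  finally have e2: "- ((1 + Kb) * g / gb) = - y + - (K / m) * y" by simp
  have "fRS p m K1 K2 gb r g = (1 + Kb) / gb * (m / (m + K)) powr m * exp (- y) * (exp (- (K / m) * y) * hyp1F1 m 1 (K / m * y))"
    unfolding fRS_def Let_def K_def[symmetric] Kb_def[symmetric] e1 e2 exp_add by (simp only: mult_ac)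
  thus ?thesis unfolding hyp1F1_Kummer g_def by simp
qed

lemma hcoeff_scaled:
  "hcoeff m \<alpha> \<delta> n * g ^ n = (\<Sum>k\<le>n. (pochhammer (1 - m) k / fact k * (- (\<alpha> * g)) ^ k) * (pochhammer m (n - k) / fact (n - k) * (- (\<delta> * g)) ^ (n - k)))"
  unfolding hcoeff_def sum_distrib_right
proof (rule sum.cong[OF refl])
  fix k assume "k \<in> {..n}"
  hence "g ^ n = g ^ k * g ^ (n - k)" by (simp flip: power_add)
  moreover have "(- (\<alpha> * g)) ^ k = (- \<alpha>) ^ k * g ^ k" "(- (\<delta> * g)) ^ (n - k) = (- \<delta>) ^ (n - k) * g ^ (n - k)"
    by (simp_all flip: power_mult_distrib)
  ultimately show "pochhammer (1 - m) k / fact k * (- \<alpha>) ^ k * (pochhammer m (n - k) / fact (n - k) * (- \<delta>) ^ (n - k)) * g ^ n =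
     pochhammer (1 - m) k / fact k * (- (\<alpha> * g)) ^ k * (pochhammer m (n - k) / fact (n - k) * (- (\<delta> * g)) ^ (n - k))" by simp
qed

text \<open>The substitution g = x4 y, with x4 the fourth Fox argument, turns the integrand into a
  constant times \<open>euler_density\<close>, whose integral the Fox function computes.\<close>

lemma Rterm_integral:
  fixes pB mB KB1 KB2 gB pE mE KE1 KE2 gE :: real and i j :: nat
  assumes B: "0 \<le> pB" "pB \<le> 1" "0 < mB" "0 < KB1" "0 < KB2" "0 < gB"
      and E: "0 \<le> pE" "pE \<le> 1" "0 < mE" "0 < KE1" "0 < KE2" "0 < gE"
      and m: "mB \<notin> \<int>" "mE \<notin> \<int>"
  defines "F \<equiv> \<lambda>g. indicator {0..} g *\<^sub>R (ln (1 + g) * fRS pB mB KB1 KB2 gB i g * FRS pE mE KE1 KE2 gE j g)"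
  shows "integrable lborel F"
    and "complex_of_real (Qw pB i * Qw pE j * (\<integral>g. F g \<partial>lborel)) = Rterm pB mB KB1 KB2 gB pE mE KE1 KE2 gE i j"
proof -
  define KbB KbE KB KE where "KbB = Kbar pB KB1 KB2" and "KbE = Kbar pE KE1 KE2" and "KB = Kr KB1 KB2 i" and "KE = Kr KE1 KE2 j"
  have pos: "1 + KbB > 0" "1 + KbE > 0" "KB > 0" "KE > 0"
    using B E by (auto simp: KbB_def KbE_def KB_def KE_def Kbar_def Kr_def intro!: add_pos_nonneg add_nonneg_nonneg mult_nonneg_nonneg)
  define x4 where "x4 = gB * (mB + KB) / (mB * (1 + KbB))"
  define xx where "xx k = (if k = 0 then gB * (mB + KB) * (1 + KbE) / (gE * mB * (1 + KbB))
     else if k = 1 then gB * mE * (mB + KB) * (1 + KbE) / (gE * mB * (mE + KE) * (1 + KbB))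
     else if k = 2 then KB / mB else x4)" for k :: nat
  have x4: "x4 > 0" using B pos by (simp add: x4_def)
  have xpos: "xx k > 0" for k using B E pos x4 by (simp add: xx_def)
  have nonint: "1 - mB \<notin> \<int>" "1 - mE \<notin> \<int>"
    using m Ints_diff[OF Ints_1, of "1 - mB"] Ints_diff[OF Ints_1, of "1 - mE"] by auto
  interpret mb_four "fox_a mB mE" xx
    by unfold_locales (use xpos m nonint in \<open>auto simp: fox_a_def\<close>)
  define CB where "CB = (1 + KbB) / gB * (mB / (mB + KB)) powr mB"
  define CE where "CE = (1 + KbE) / gE * (mE / (mE + KE)) powr mE"
  have density: "F (0 + x4 * y) = CB * CE * x4 * euler_density y" for y
  proof (cases "y > 0")
    case True
    define g where "g = x4 * y"
    have g: "g > 0" using True x4 by (simp add: g_def)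
    define \<alpha> \<delta> where "\<alpha> = (1 + KbE) / gE" and "\<delta> = (1 + KbE) * mE / (gE * (mE + KE))"
    \<comment> \<open>The two Humbert arguments become the first two Fox arguments times y.\<close>
    have ag: "\<alpha> * g = xx 0 * y" "\<delta> * g = xx 1 * y"
      by (simp_all add: \<alpha>_def \<delta>_def g_def xx_def x4_def field_simps)
    define h where "h n = (\<Sum>k\<le>n. (pochhammer (1 - mE) k / fact k * (- (xx 0 * y)) ^ k) * (pochhammer mE (n - k) / fact (n - k) * (- (xx 1 * y)) ^ (n - k))) / fact (Suc n)" for n
    have hn: "hcoeff mE \<alpha> \<delta> n / fact (Suc n) * g ^ Suc n = g * h n" for n
      using hcoeff_scaled[of mE \<alpha> \<delta> n g] unfolding ag h_def by (simp add: mult_ac)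
    have "summable (\<lambda>n. g * h n)" using exp_hyp1F1_integral(2)[of g mE \<alpha> \<delta>] g unfolding hn by simp
    hence "summable h" using g by (simp add: summable_cmult_iff)
    hence sum: "(\<Sum>n. hcoeff mE \<alpha> \<delta> n / fact (Suc n) * g ^ Suc n) = g * suminf h" unfolding hn by (rule suminf_mult)
    have FE: "FRS pE mE KE1 KE2 gE j g = CE * (g * suminf h)"
      using FRS_series[of g mE KE1 KE2 j gE pE] g E pos
      unfolding KbE_def[symmetric] KE_def[symmetric] \<alpha>_def[symmetric] \<delta>_def[symmetric] sum by (simp add: CE_def \<alpha>_def)
    have fB: "fRS pB mB KB1 KB2 gB i g = CB * exp (- y) * (\<Sum>k. pochhammer (1 - mB) k / (fact k)\<^sup>2 * (- (xx 2 * y)) ^ k)"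
      using fRS_Kummer[of mB KB1 KB2 i gB pB y] B pos
      unfolding KbB_def[symmetric] KB_def[symmetric] x4_def[symmetric] g_def[symmetric] by (simp add: CB_def xx_def)
    have "euler_density y = y * exp (- y) * ln (1 + g) * (\<Sum>k. pochhammer (1 - mB) k / (fact k)\<^sup>2 * (- (xx 2 * y)) ^ k) * suminf h"
      using True by (simp add: euler_density_def h_def[abs_def] fox_a_def g_def xx_def)
    moreover have "F (0 + x4 * y) = ln (1 + g) * fRS pB mB KB1 KB2 gB i g * FRS pE mE KE1 KE2 gE j g"
      using g unfolding F_def by (simp add: g_def)
    ultimately show ?thesis unfolding FE fB by (simp add: g_def)
  next
    case False
    hence "x4 * y < 0 \<or> x4 * y = 0" using x4 by (auto simp: not_less mult_less_0_iff)
    thus ?thesis using False by (auto simp: F_def euler_density_def)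
  qed
  note val = fox_value[of mB mE, OF refl m]
  have "integrable lborel (\<lambda>y. F (0 + x4 * y))" unfolding density using val(2) by (rule integrable_mult_right)
  thus "integrable lborel F" using x4 by (subst (asm) lborel_integrable_real_affine_iff) auto
  have int: "(\<integral>g. F g \<partial>lborel) = x4 * (CB * CE * x4 * (\<integral>y. euler_density y \<partial>lborel))"
    using lborel_integral_real_affine[of x4 F 0] x4 unfolding density by simp
  \<comment> \<open>One x4 comes from the substitution, the other from the leading factor g of the
    distribution function. Their square lowers the exponent of mB / (mB + KB) from mB to mB -
    2.\<close>
  have const: "x4 * (CB * CE * x4) = (gB * (1 + KbE)) / (gE * (1 + KbB)) * (mE / (mE + KE)) powr mE * (mB / (mB + KB)) powr (mB - 2)"
  proof -
    define u where "u = mB / (mB + KB)"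
    have u: "u > 0" using B pos by (simp add: u_def)
    have x4u: "x4 = gB / (u * (1 + KbB))" using B pos by (simp add: x4_def u_def field_simps)
    have "u powr (mB - 2) = u powr mB / u\<^sup>2" using u by (simp add: powr_diff powr_numeral)
    moreover define v w where "v = 1 + KbB" and "w = 1 + KbE"
    moreover from this have "v \<noteq> 0" using pos by simp
    ultimately show ?thesis using B u
      unfolding CB_def CE_def u_def[symmetric] x4u v_def[symmetric] w_def[symmetric]
      by (simp add: divide_simps power2_eq_square)
  qed
  \<comment> \<open>The Gamma factors in the value of the Fox function cancel against the
    normalising constant of \<open>Rterm\<close>.\<close>
  have G: "Gamma (1 - mB) \<noteq> 0" "Gamma (1 - mE) \<noteq> 0" "Gamma mE \<noteq> 0"
    using nonint m nonpos_Ints_subset_Ints by (auto simp: Gamma_eq_zero_iff)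
  define I where "I = (\<integral>y. euler_density y \<partial>lborel)"
  have fox: "mfoxH 1 foxA foxB (foxV mB mE) [xx 0, xx 1, xx 2, xx 3] = of_real (Gamma (1 - mE) * Gamma mE * Gamma (1 - mB) * I)"
    unfolding val(1) I_def by (simp add: fox_a_def)
  have xs: "xx 0 = gB * (mB + KB) * (1 + KbE) / (gE * mB * (1 + KbB))"
    "xx 1 = gB * mE * (mB + KB) * (1 + KbE) / (gE * mB * (mE + KE) * (1 + KbB))" "xx 2 = KB / mB" "xx 3 = gB * (mB + KB) / (mB * (1 + KbB))"
    by (simp_all add: xx_def x4_def)
  have "Rterm pB mB KB1 KB2 gB pE mE KE1 KE2 gE i j = complex_of_real
          (Qw pB i * Qw pE j * (gB * (1 + KbE)) / (gE * (1 + KbB))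
           * (mE / (mE + KE)) powr mE * (mB / (mB + KB)) powr (mB - 2)
           / (Gamma (1 - mB) * Gamma (1 - mE) * Gamma mE)) *
        mfoxH 1 foxA foxB (foxV mB mE) [xx 0, xx 1, xx 2, xx 3]"
    unfolding Rterm_def Let_def foxA_def foxB_def foxV_def xs KbB_def KbE_def KB_def KE_def ..
  also have "\<dots> = complex_of_real (Qw pB i * Qw pE j * ((gB * (1 + KbE)) / (gE * (1 + KbB)) * (mE / (mE + KE)) powr mE * (mB / (mB + KB)) powr (mB - 2) * I))"
    unfolding fox of_real_mult[symmetric] using G by (intro arg_cong[of _ _ complex_of_real]) simp
  also have "\<dots> = complex_of_real (Qw pB i * Qw pE j * (\<integral>g. F g \<partial>lborel))"
    unfolding int I_def[symmetric] const[symmetric] by (simp only: mult.assoc)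
  finally show "complex_of_real (Qw pB i * Qw pE j * (\<integral>g. F g \<partial>lborel)) = Rterm pB mB KB1 KB2 gB pE mE KE1 KE2 gE i j" by simp
qed

lemma capacity_integral:
  fixes pB mB KB1 KB2 gB pE mE KE1 KE2 gE :: real
  assumes "0 \<le> pB" "pB \<le> 1" "0 < mB" "0 < KB1" "0 < KB2" "0 < gB"
      and "0 \<le> pE" "pE \<le> 1" "0 < mE" "0 < KE1" "0 < KE2" "0 < gE"
      and "mB \<notin> \<int>" "mE \<notin> \<int>"
  shows "complex_of_real
           (LINT g:{0..}|lborel. ln (1 + g) * fARS pB mB KB1 KB2 gB g * FARS pE mE KE1 KE2 gE g)
           = (\<Sum>i\<in>{1,2}. \<Sum>j\<in>{1,2}. Rterm pB mB KB1 KB2 gB pE mE KE1 KE2 gE i j)"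
proof -
  define F where "F i j g = indicator {0..} g *\<^sub>R (ln (1 + g) * fRS pB mB KB1 KB2 gB i g * FRS pE mE KE1 KE2 gE j g)" for i j g
  note R = Rterm_integral[OF assms, folded F_def]
  have "(LINT g:{0..}|lborel. ln (1 + g) * fARS pB mB KB1 KB2 gB g * FARS pE mE KE1 KE2 gE g) =
      (\<integral>g. (\<Sum>i\<in>{1,2}. \<Sum>j\<in>{1,2}. Qw pB i * Qw pE j * F i j g) \<partial>lborel)"
    unfolding set_lebesgue_integral_def
    by (rule Bochner_Integration.integral_cong[OF refl]) (simp add: F_def fARS_def FARS_def algebra_simps)
  also have "\<dots> = (\<Sum>i\<in>{1,2}. \<Sum>j\<in>{1,2}. Qw pB i * Qw pE j * (\<integral>g. F i j g \<partial>lborel))"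
    using R(1) by (simp add: Bochner_Integration.integral_add)
  finally show ?thesis by (simp only: of_real_sum R(2))
qed

theorem theorem1:
  fixes pB mB KB1 KB2 gB pE mE KE1 KE2 gE :: real
  assumes "0 \<le> pB" "pB \<le> 1" "0 < mB" "0 < KB1" "0 < KB2" "0 < gB"
      and "0 \<le> pE" "pE \<le> 1" "0 < mE" "0 < KE1" "0 < KE2" "0 < gE"
      and "mB \<notin> \<int>" "mE \<notin> \<int>"
  shows "complex_of_real
           (LINT g:{0..}|lborel. ln (1 + g) * fARS pB mB KB1 KB2 gB g * FARS pE mE KE1 KE2 gE g)
           = (\<Sum>i\<in>{1,2}. \<Sum>j\<in>{1,2}. Rterm pB mB KB1 KB2 gB pE mE KE1 KE2 gE i j)
         \<and> complex_of_real
           (LINT g:{0..}|lborel. ln (1 + g) * fARS pE mE KE1 KE2 gE g * FARS pB mB KB1 KB2 gB g)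
           = (\<Sum>i\<in>{1,2}. \<Sum>j\<in>{1,2}. Rterm pE mE KE1 KE2 gE pB mB KB1 KB2 gB i j)"
  using capacity_integral[OF assms] capacity_integral[OF assms(7-12) assms(1-6) assms(14,13)] by blast

end
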